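(* Let $\mathbf{A}$ be an additive track category with strict products, let $n\ge2$, and let $X\mapsto F_X$ be a choice of weak $\mathsf{nil}_n$ group structure on every object $X$ of $\mathbf{A}$. The assignment $X\mapsto F_X$ extends uniquely to a track functor $T:\mathbf{A}\to\mathbf{Pseudo}^{\Pi}(\mathsf{nil}_n,\mathbf{A})$ such that $\mathrm{ev}\circ T=\mathrm{id}_{\mathbf{A}}$, where $\mathrm{ev}(G)=G(\mathbb{Z})$ is the evaluation of a pseudofunctor $G:\mathsf{nil}_n^{op}\rightsquigarrow\mathbf{A}$ on the group $\mathbb{Z}$. This $T$ is an equivalence of 2-categories, with inverse $\mathrm{ev}$.
   Context: **Track categories.** A track category $\mathbf{A}$ is a category enriched in groupoids (a 2-category in which all 2-morphisms are invertible). Its 2-morphisms $\eta:f\Rightarrow g$ are called tracks and form the set $\mathrm{Track}(f,g)$; vertical composition is $\varphi\,\square\,\eta$ ($\eta$ first), the identity track is $0^{\square}$, the inverse is $\eta^{\boxminus}$; whiskering is $g_*\eta$ (postcomposition) and $h^*\eta$ (precomposition). $\mathrm{ho}(\mathbf{A})$ is obtained from the underlying category by identifying maps related by a track. A track functor is a functor enriched in groupoids. A strict zero object is an object $*$ such that the hom-groupoids $[[X,*]]$ and $[[*,X]]$ have one object and one morphism for all $X$. Strict products: for all $X,Y$ there are $X\times Y$ and projections inducing an isomorphism of groupoids $[[Z,X\times Y]]\to[[Z,X]]\times[[Z,Y]]$ for all $Z$. We write $(a,b)$ for the map or track into $X\times Y$ with components $a,b$, and $a\times b$ for the product. **Additive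 track category:** a track category $\mathbf{A}$ with a strict zero object such that $\mathrm{ho}(\mathbf{A})$ is additive, together with a biadditive bifunctor $D:\mathrm{ho}(\mathbf{A})^{op}\times\mathrm{ho}(\mathbf{A})\to\mathrm{Ab}$ and, for each $f:X\to Y$, a group isomorphism $\sigma_f:D(X,Y)\to\mathrm{Track}(f,f)$ with $\sigma_g(a)\,\square\,H=H\,\square\,\sigma_f(a)$ for $H:f\Rightarrow g$, and $h^*\sigma_f(a)=\sigma_{fh}(h^*a)$, $g_*\sigma_f(a)=\sigma_{gf}(g_*a)$. **The theories $\mathsf{nil}_n$.** For a group $G$, $\Gamma_0G=G$, $\Gamma_{k+1}G=[G,\Gamma_kG]$. $\mathsf{nil}_n$ is the full subcategory of groups on $\mathbf{F}_p^{\mathsf{nil}_n}=\mathbf{F}_p/\Gamma_n\mathbf{F}_p$, $p\ge 0$, where $\mathbf{F}_p$ is free on $\{1,\dots,p\}$; the category $\mathsf{gr}$ of free groups $\mathbf{F}_p$ is regarded as $\mathsf{nil}_n$ with $n=+\infty$. In $\mathsf{nil}_n^{op}$, $\mathbf{F}_p^{\mathsf{nil}_n}$ is the $p$-fold product of $\mathbb{Z}$. $\mathsf{nil}_n^{op}$ is regarded as a track category with only identity tracks. **Product preserving pseudofunctors.** A pseudofunctor $\varphi:\mathsf{nil}_n^{op}\rightsquigarrow\mathbf{A}$ assigns objects and maps, together with tracks $\varphi_{f,g}:\varphi(f)\varphi(g)\Rightarrow\varphi(fg)$ and $\varphi_X:\varphi(1_X)\Rightarrow 1_{\varphi(X)}$,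 such that $\varphi_{f,gh}\square\varphi(f)_*\varphi_{g,h}=\varphi_{fg,h}\square\varphi(h)^*\varphi_{f,g}$, $\varphi_{f,1_X}=\varphi(f)_*\varphi_X$, $\varphi_{1_Y,f}=\varphi(f)^*\varphi_Y$. It is product preserving if: $\varphi(1_X)=1_{\varphi(X)}$ with $\varphi_X$ the identity track; $\varphi( * )=*$, $\varphi$ sends zero maps to zero maps, and $\varphi_{f,*},\varphi_{*,f}$ are identity tracks of zero maps; the map $\pi_{X,Y}:\varphi(X\times Y)\to\varphi(X)\times\varphi(Y)$ with components $\varphi$ of the two projections is an isomorphism; $(\pi_{X,Y})_*\varphi_{(h,k),g}=(\varphi_{h,g},\varphi_{k,g})$ for $g:T\to Z$, $h:Z\to X$, $k:Z\to Y$; and $\varphi_{X\times X}$ corresponds to $(\varphi_X,\varphi_X)$ under $\pi$. A pseudo natural transformation $\alpha:\varphi\to\psi$ consists of maps $\alpha_X:\varphi(X)\to\psi(X)$ and tracks $\alpha_f:\alpha_Y\varphi(f)\Rightarrow\psi(f)\alpha_X$ for $f:X\to Y$ in $\mathsf{nil}_n^{op}$, with $\alpha_{gf}\square(\alpha_Z)_*\varphi_{g,f}=(\alpha_X)^*\psi_{g,f}\square\psi(g)_*\alpha_f\square\varphi(f)^*\alpha_g$ and $(\alpha_X)^*\psi_X\square\alpha_{1_X}=(\alpha_X)_*\varphi_X$. Composition: $(\beta\alpha)_X=\beta_X\alpha_X$, $(\beta\alpha)_f=(\alpha_X)^*\beta_f\square(\beta_Y)_*\alpha_f$. It is product preserving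 if $\pi_{X,Y}\alpha_{X\times Y}=(\alpha_X\times\alpha_Y)\pi_{X,Y}$ and $(\pi_{X,Y})_*\alpha_{(f,g)}=(\alpha_f,\alpha_g)$ for $f:Z\to X$, $g:Z\to Y$. A homotopy $H:\alpha\Rightarrow\beta$ is a family $H_X:\alpha_X\Rightarrow\beta_X$ with $\beta_f=\psi(f)_*H_X\square\alpha_f\square\varphi(f)^*H_Y^{\boxminus}$; it is product preserving if $(\pi_{X,Y})_*H_{X\times Y}=(\pi_{X,Y})^*(H_X\times H_Y)$. These form the track category $\mathbf{Pseudo}^{\Pi}(\mathsf{nil}_n,\mathbf{A})$ (objects are pseudofunctors on $\mathsf{nil}_n^{op}$). **Weak groups.** A weak $\mathsf{nil}_n$ group structure on $X$ is an object $F_X$ of $\mathbf{Pseudo}^{\Pi}(\mathsf{nil}_n,\mathbf{A})$ with $F_X(\mathbb{Z})=X$. *)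

theory Defs
  imports "HOL-Algebra.Generated_Groups" "HOL-Library.Extended_Nat"
begin

section \<open>Categories\<close>

text \<open>Composition is written in diagram-reversed order: \<open>g \<cdot> f\<close> is defined when
  the domain of \<open>g\<close> is the codomain of \<open>f\<close>.\<close>

record ('o, 'm) cat =
  Obj :: "'o set"
  Arr :: "'m set"
  Dom :: "'m \<Rightarrow> 'o"
  Cod :: "'m \<Rightarrow> 'o"
  Ident :: "'o \<Rightarrow> 'm"
  Comp :: "'m \<Rightarrow> 'm \<Rightarrow> 'm"  (infixl "\<cdot>\<index>" 70)

definition Hom :: "('o, 'm, 'z) cat_scheme \<Rightarrow> 'o \<Rightarrow> 'o \<Rightarrow> 'm set" where
  "Hom C X Y = {f \<in> Arr C. Dom C f = X \<and> Cod C f = Y}"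

locale category =
  fixes C (structure)
  assumes Dom_Obj: "f \<in> Arr C \<Longrightarrow> Dom C f \<in> Obj C"
    and Cod_Obj: "f \<in> Arr C \<Longrightarrow> Cod C f \<in> Obj C"
    and Ident_Hom: "X \<in> Obj C \<Longrightarrow> Ident C X \<in> Hom C X X"
    and Comp_Hom: "\<lbrakk>f \<in> Hom C X Y; g \<in> Hom C Y Z\<rbrakk> \<Longrightarrow> g \<cdot> f \<in> Hom C X Z"
    and Comp_Ident: "f \<in> Hom C X Y \<Longrightarrow> f \<cdot> Ident C X = f"
    and Ident_Comp: "f \<in> Hom C X Y \<Longrightarrow> Ident C Y \<cdot> f = f"
    and Comp_assoc: "\<lbrakk>f \<in> Hom C W X; g \<in> Hom C X Y; h \<in> Hom C Y Z\<rbrakk>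
                      \<Longrightarrow> (h \<cdot> g) \<cdot> f = h \<cdot> (g \<cdot> f)"

definition is_isomorphism :: "('o, 'm, 'z) cat_scheme \<Rightarrow> 'm \<Rightarrow> bool" where
  "is_isomorphism C f \<longleftrightarrow> f \<in> Arr C \<and>
     (\<exists>g \<in> Hom C (Cod C f) (Dom C f).
        g \<cdot>\<^bsub>C\<^esub> f = Ident C (Dom C f) \<and> f \<cdot>\<^bsub>C\<^esub> g = Ident C (Cod C f))"

definition zero_map :: "('o, 'm, 'z) cat_scheme \<Rightarrow> 'o \<Rightarrow> 'o \<Rightarrow> 'o \<Rightarrow> 'm" where
  "zero_map C z X Y = (THE f. \<exists>u \<in> Hom C X z. \<exists>v \<in> Hom C z Y. f = v \<cdot>\<^bsub>C\<^esub> u)"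

definition op_cat :: "('o, 'm) cat \<Rightarrow> ('o, 'm) cat" where
  "op_cat C = \<lparr>Obj = Obj C, Arr = Arr C, Dom = Cod C, Cod = Dom C, Ident = Ident C,
               Comp = (\<lambda>g f. f \<cdot>\<^bsub>C\<^esub> g)\<rparr>"

text \<open>The abelian group structure on the set of maps from \<open>X\<close> to \<open>Y\<close> is the
  (multiplicatively written) group \<open>HG X Y\<close>. It is determined by the category.\<close>

locale additive_category = category C for C (structure) +
  fixes HG :: "'o \<Rightarrow> 'o \<Rightarrow> 'm monoid"
  assumes HG_group: "\<lbrakk>X \<in> Obj C; Y \<in> Obj C\<rbrakk> \<Longrightarrow> comm_group (HG X Y)"
    and HG_carrier: "\<lbrakk>X \<in> Obj C; Y \<in> Obj C\<rbrakk> \<Longrightarrow> carrier (HG X Y) = Hom C X Y"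
    and Comp_add_right: "\<lbrakk>f \<in> Hom C X Y; f' \<in> Hom C X Y; g \<in> Hom C Y Z\<rbrakk>
          \<Longrightarrow> g \<cdot> (f \<otimes>\<^bsub>HG X Y\<^esub> f') = (g \<cdot> f) \<otimes>\<^bsub>HG X Z\<^esub> (g \<cdot> f')"
    and Comp_add_left: "\<lbrakk>f \<in> Hom C X Y; g \<in> Hom C Y Z; g' \<in> Hom C Y Z\<rbrakk>
          \<Longrightarrow> (g \<otimes>\<^bsub>HG Y Z\<^esub> g') \<cdot> f = (g \<cdot> f) \<otimes>\<^bsub>HG X Z\<^esub> (g' \<cdot> f)"
    and zero_object: "\<exists>z \<in> Obj C. \<forall>X \<in> Obj C. (\<exists>!f. f \<in> Hom C X z) \<and> (\<exists>!f. f \<in> Hom C z X)"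
    and biproducts: "\<lbrakk>X \<in> Obj C; Y \<in> Obj C\<rbrakk> \<Longrightarrow>
          \<exists>B \<in> Obj C. \<exists>i \<in> Hom C X B. \<exists>j \<in> Hom C Y B. \<exists>p \<in> Hom C B X. \<exists>q \<in> Hom C B Y.
            p \<cdot> i = Ident C X \<and> q \<cdot> j = Ident C Y \<and>
            p \<cdot> j = \<one>\<^bsub>HG Y X\<^esub> \<and> q \<cdot> i = \<one>\<^bsub>HG X Y\<^esub> \<and>
            (i \<cdot> p) \<otimes>\<^bsub>HG B B\<^esub> (j \<cdot> q) = Ident C B"

section \<open>Track categories\<close>

text \<open>\<open>Post A g \<eta>\<close> is \<open>g\<^sub>*\<eta>\<close> and \<open>Pre A h \<eta>\<close> is \<open>h\<^sup>*\<eta>\<close>. Every track has a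
  well-defined source and target, so an equation between tracks entails that their sources and
  their targets are equal maps.\<close>

record ('o, 'm, 't) track_cat = "('o, 'm) cat" +
  Trk :: "'t set"
  Src :: "'t \<Rightarrow> 'm"
  Trg :: "'t \<Rightarrow> 'm"
  IdT :: "'m \<Rightarrow> 't"
  VComp :: "'t \<Rightarrow> 't \<Rightarrow> 't"  (infixl "\<box>\<index>" 65)
  InvT :: "'t \<Rightarrow> 't"
  Post :: "'m \<Rightarrow> 't \<Rightarrow> 't"
  Pre :: "'m \<Rightarrow> 't \<Rightarrow> 't"

definition Track :: "('o, 'm, 't, 'z) track_cat_scheme \<Rightarrow> 'm \<Rightarrow> 'm \<Rightarrow> 't set" where
  "Track A f g = {\<eta> \<in> Trk A. Src A \<eta> = f \<and> Trg A \<eta> = g}"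

text \<open>The set of all morphisms of the groupoid of maps from \<open>X\<close> to \<open>Y\<close>.\<close>
definition HomTrk :: "('o, 'm, 't, 'z) track_cat_scheme \<Rightarrow> 'o \<Rightarrow> 'o \<Rightarrow> 't set" where
  "HomTrk A X Y = {\<eta> \<in> Trk A. Src A \<eta> \<in> Hom A X Y}"

text \<open>Enrichment in groupoids, presented by vertical composition, whiskering and the interchange
  law.\<close>
locale track_category = category A for A :: "('o, 'm, 't, 'z) track_cat_scheme" (structure) +
  assumes Src_Arr: "\<eta> \<in> Trk A \<Longrightarrow> Src A \<eta> \<in> Arr A"
    and Trg_Hom: "\<eta> \<in> HomTrk A X Y \<Longrightarrow> Trg A \<eta> \<in> Hom A X Y"
    and IdT_Track: "f \<in> Arr A \<Longrightarrow> IdT A f \<in> Track A f f"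
    and VComp_Track: "\<lbrakk>\<eta> \<in> Track A f g; \<phi> \<in> Track A g h\<rbrakk> \<Longrightarrow> \<phi> \<box> \<eta> \<in> Track A f h"
    and InvT_Track: "\<eta> \<in> Track A f g \<Longrightarrow> InvT A \<eta> \<in> Track A g f"
    and VComp_IdT: "\<eta> \<in> Track A f g \<Longrightarrow> \<eta> \<box> IdT A f = \<eta>"
    and IdT_VComp: "\<eta> \<in> Track A f g \<Longrightarrow> IdT A g \<box> \<eta> = \<eta>"
    and VComp_assoc: "\<lbrakk>\<eta> \<in> Track A f g; \<phi> \<in> Track A g h; \<psi> \<in> Track A h k\<rbrakk>
          \<Longrightarrow> (\<psi> \<box> \<phi>) \<box> \<eta> = \<psi> \<box> (\<phi> \<box> \<eta>)"
    and InvT_VComp: "\<eta> \<in> Track A f g \<Longrightarrow> InvT A \<eta> \<box> \<eta> = IdT A f"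
    and VComp_InvT: "\<eta> \<in> Track A f g \<Longrightarrow> \<eta> \<box> InvT A \<eta> = IdT A g"
    and Post_Track: "\<lbrakk>f \<in> Hom A X Y; g \<in> Hom A Y Z; \<eta> \<in> Track A f f'\<rbrakk>
          \<Longrightarrow> Post A g \<eta> \<in> Track A (g \<cdot> f) (g \<cdot> f')"
    and Pre_Track: "\<lbrakk>h \<in> Hom A W X; f \<in> Hom A X Y; \<eta> \<in> Track A f f'\<rbrakk>
          \<Longrightarrow> Pre A h \<eta> \<in> Track A (f \<cdot> h) (f' \<cdot> h)"
    and Post_IdT: "\<lbrakk>f \<in> Hom A X Y; g \<in> Hom A Y Z\<rbrakk> \<Longrightarrow> Post A g (IdT A f) = IdT A (g \<cdot> f)"
    and Pre_IdT: "\<lbrakk>h \<in> Hom A W X; f \<in> Hom A X Y\<rbrakk> \<Longrightarrow> Pre A h (IdT A f) = IdT A (f \<cdot> h)"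
    and Post_VComp: "\<lbrakk>f \<in> Hom A X Y; \<eta> \<in> Track A f f'; \<phi> \<in> Track A f' f''; g \<in> Hom A Y Z\<rbrakk>
          \<Longrightarrow> Post A g (\<phi> \<box> \<eta>) = Post A g \<phi> \<box> Post A g \<eta>"
    and Pre_VComp: "\<lbrakk>h \<in> Hom A W X; f \<in> Hom A X Y; \<eta> \<in> Track A f f'; \<phi> \<in> Track A f' f''\<rbrakk>
          \<Longrightarrow> Pre A h (\<phi> \<box> \<eta>) = Pre A h \<phi> \<box> Pre A h \<eta>"
    and Post_Ident: "\<eta> \<in> HomTrk A X Y \<Longrightarrow> Post A (Ident A Y) \<eta> = \<eta>"
    and Pre_Ident: "\<eta> \<in> HomTrk A X Y \<Longrightarrow> Pre A (Ident A X) \<eta> = \<eta>"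
    and Post_Comp: "\<lbrakk>\<eta> \<in> HomTrk A W X; g \<in> Hom A X Y; g' \<in> Hom A Y Z\<rbrakk>
          \<Longrightarrow> Post A (g' \<cdot> g) \<eta> = Post A g' (Post A g \<eta>)"
    and Pre_Comp: "\<lbrakk>h' \<in> Hom A W X; h \<in> Hom A X Y; \<eta> \<in> HomTrk A Y Z\<rbrakk>
          \<Longrightarrow> Pre A (h \<cdot> h') \<eta> = Pre A h' (Pre A h \<eta>)"
    and Post_Pre: "\<lbrakk>h \<in> Hom A W X; \<eta> \<in> HomTrk A X Y; g \<in> Hom A Y Z\<rbrakk>
          \<Longrightarrow> Post A g (Pre A h \<eta>) = Pre A h (Post A g \<eta>)"
    and interchange: "\<lbrakk>f \<in> Hom A X Y; \<eta> \<in> Track A f f'; g \<in> Hom A Y Z; \<theta> \<in> Track A g g'\<rbrakk>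
          \<Longrightarrow> Post A g' \<eta> \<box> Pre A f \<theta> = Pre A f' \<theta> \<box> Post A g \<eta>"

definition homotopy_class :: "('o, 'm, 't, 'z) track_cat_scheme \<Rightarrow> 'm \<Rightarrow> 'm set" where
  "homotopy_class A f = {g. Track A f g \<noteq> {}}"

definition ho :: "('o, 'm, 't, 'z) track_cat_scheme \<Rightarrow> ('o, 'm set) cat" where
  "ho A = \<lparr>Obj = Obj A, Arr = homotopy_class A ` Arr A,
           Dom = (\<lambda>c. the_elem (Dom A ` c)), Cod = (\<lambda>c. the_elem (Cod A ` c)),
           Ident = (\<lambda>X. homotopy_class A (Ident A X)),
           Comp = (\<lambda>c d. \<Union>g \<in> c. \<Union>f \<in> d. homotopy_class A (g \<cdot>\<^bsub>A\<^esub> f))\<rparr>"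

text \<open>A track category together with a chosen zero object and chosen binary products.\<close>
record ('o, 'm, 't) track_cat_prod = "('o, 'm, 't) track_cat" +
  Zero :: "'o"
  Prod :: "'o \<Rightarrow> 'o \<Rightarrow> 'o"
  Pr1 :: "'o \<Rightarrow> 'o \<Rightarrow> 'm"
  Pr2 :: "'o \<Rightarrow> 'o \<Rightarrow> 'm"

definition strict_zero_object :: "('o, 'm, 't, 'z) track_cat_scheme \<Rightarrow> 'o \<Rightarrow> bool" where
  "strict_zero_object A z \<longleftrightarrow> z \<in> Obj A \<and>
     (\<forall>X \<in> Obj A. (\<exists>!f. f \<in> Hom A X z) \<and> (\<exists>!\<eta>. \<eta> \<in> HomTrk A X z) \<and>
                  (\<exists>!f. f \<in> Hom A z X) \<and> (\<exists>!\<eta>. \<eta> \<in> HomTrk A z X))"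

definition strict_products :: "('o, 'm, 't, 'z) track_cat_prod_scheme \<Rightarrow> bool" where
  "strict_products A \<longleftrightarrow> (\<forall>X \<in> Obj A. \<forall>Y \<in> Obj A.
     Prod A X Y \<in> Obj A \<and>
     Pr1 A X Y \<in> Hom A (Prod A X Y) X \<and> Pr2 A X Y \<in> Hom A (Prod A X Y) Y \<and>
     (\<forall>Z \<in> Obj A.
        bij_betw (\<lambda>u. (Pr1 A X Y \<cdot>\<^bsub>A\<^esub> u, Pr2 A X Y \<cdot>\<^bsub>A\<^esub> u))
          (Hom A Z (Prod A X Y)) (Hom A Z X \<times> Hom A Z Y) \<and>
        bij_betw (\<lambda>\<theta>. (Post A (Pr1 A X Y) \<theta>, Post A (Pr2 A X Y) \<theta>))
          (HomTrk A Z (Prod A X Y)) (HomTrk A Z X \<times> HomTrk A Z Y)))"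

text \<open>\<open>(f, g)\<close> and \<open>a \<times> b\<close> for maps, then for tracks.\<close>

definition pairA :: "('o, 'm, 't, 'z) track_cat_prod_scheme \<Rightarrow> 'm \<Rightarrow> 'm \<Rightarrow> 'm" where
  "pairA A f g = (THE u. u \<in> Hom A (Dom A f) (Prod A (Cod A f) (Cod A g)) \<and>
     Pr1 A (Cod A f) (Cod A g) \<cdot>\<^bsub>A\<^esub> u = f \<and> Pr2 A (Cod A f) (Cod A g) \<cdot>\<^bsub>A\<^esub> u = g)"

definition prodA :: "('o, 'm, 't, 'z) track_cat_prod_scheme \<Rightarrow> 'm \<Rightarrow> 'm \<Rightarrow> 'm" where
  "prodA A a b = pairA A (a \<cdot>\<^bsub>A\<^esub> Pr1 A (Dom A a) (Dom A b)) (b \<cdot>\<^bsub>A\<^esub> Pr2 A (Dom A a) (Dom A b))"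

definition pairT :: "('o, 'm, 't, 'z) track_cat_prod_scheme \<Rightarrow> 't \<Rightarrow> 't \<Rightarrow> 't" where
  "pairT A \<xi> \<eta> = (let X = Cod A (Src A \<xi>); Y = Cod A (Src A \<eta>) in
     THE \<theta>. \<theta> \<in> HomTrk A (Dom A (Src A \<xi>)) (Prod A X Y) \<and>
       Post A (Pr1 A X Y) \<theta> = \<xi> \<and> Post A (Pr2 A X Y) \<theta> = \<eta>)"

definition prodT :: "('o, 'm, 't, 'z) track_cat_prod_scheme \<Rightarrow> 't \<Rightarrow> 't \<Rightarrow> 't" where
  "prodT A \<xi> \<eta> = (let X = Dom A (Src A \<xi>); Y = Dom A (Src A \<eta>) in
     pairT A (Pre A (Pr1 A X Y) \<xi>) (Pre A (Pr2 A X Y) \<eta>))"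

definition loop_group :: "('o, 'm, 't, 'z) track_cat_scheme \<Rightarrow> 'm \<Rightarrow> 't monoid" where
  "loop_group A f = \<lparr>carrier = Track A f f, mult = VComp A, one = IdT A f\<rparr>"

text \<open>\<open>D\<close> and \<open>Dmap\<close> are the values on objects and on morphisms of the bifunctor on the
  homotopy category; \<open>Dmap c e\<close> is contravariant in \<open>c\<close> and covariant in \<open>e\<close>. All abelian
  groups are written multiplicatively.\<close>

locale additive_track_category = track_category A
    for A :: "('o, 'm, 't, 'z) track_cat_prod_scheme" (structure) +
  fixes HG :: "'o \<Rightarrow> 'o \<Rightarrow> 'm set monoid"
    and D :: "'o \<Rightarrow> 'o \<Rightarrow> 'd monoid"
    and Dmap :: "'m set \<Rightarrow> 'm set \<Rightarrow> 'd \<Rightarrow> 'd"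
    and \<sigma> :: "'m \<Rightarrow> 'd \<Rightarrow> 't"
  assumes zero: "strict_zero_object A (Zero A)"
    and ho_additive: "additive_category (ho A) HG"
    and D_group: "\<lbrakk>X \<in> Obj A; Y \<in> Obj A\<rbrakk> \<Longrightarrow> comm_group (D X Y)"
    and Dmap_hom: "\<lbrakk>c \<in> Hom (ho A) X' X; e \<in> Hom (ho A) Y Y'\<rbrakk>
          \<Longrightarrow> Dmap c e \<in> hom (D X Y) (D X' Y')"
    and Dmap_Ident: "\<lbrakk>X \<in> Obj A; Y \<in> Obj A; a \<in> carrier (D X Y)\<rbrakk>
          \<Longrightarrow> Dmap (Ident (ho A) X) (Ident (ho A) Y) a = a"
    and Dmap_Comp: "\<lbrakk>c \<in> Hom (ho A) X' X; c' \<in> Hom (ho A) X'' X';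
           e \<in> Hom (ho A) Y Y'; e' \<in> Hom (ho A) Y' Y''; a \<in> carrier (D X Y)\<rbrakk>
          \<Longrightarrow> Dmap (c \<cdot>\<^bsub>ho A\<^esub> c') (e' \<cdot>\<^bsub>ho A\<^esub> e) a = Dmap c' e' (Dmap c e a)"
    and Dmap_add_left: "\<lbrakk>c \<in> Hom (ho A) X' X; c' \<in> Hom (ho A) X' X; e \<in> Hom (ho A) Y Y';
           a \<in> carrier (D X Y)\<rbrakk>
          \<Longrightarrow> Dmap (c \<otimes>\<^bsub>HG X' X\<^esub> c') e a = Dmap c e a \<otimes>\<^bsub>D X' Y'\<^esub> Dmap c' e a"
    and Dmap_add_right: "\<lbrakk>c \<in> Hom (ho A) X' X; e \<in> Hom (ho A) Y Y'; e' \<in> Hom (ho A) Y Y';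
           a \<in> carrier (D X Y)\<rbrakk>
          \<Longrightarrow> Dmap c (e \<otimes>\<^bsub>HG Y Y'\<^esub> e') a = Dmap c e a \<otimes>\<^bsub>D X' Y'\<^esub> Dmap c e' a"
    and \<sigma>_iso: "f \<in> Hom A X Y \<Longrightarrow> \<sigma> f \<in> iso (D X Y) (loop_group A f)"
    and \<sigma>_VComp: "\<lbrakk>f \<in> Hom A X Y; H \<in> Track A f g; a \<in> carrier (D X Y)\<rbrakk>
          \<Longrightarrow> \<sigma> g a \<box> H = H \<box> \<sigma> f a"
    and \<sigma>_Pre: "\<lbrakk>h \<in> Hom A W X; f \<in> Hom A X Y; a \<in> carrier (D X Y)\<rbrakk>
          \<Longrightarrow> Pre A h (\<sigma> f a) = \<sigma> (f \<cdot> h) (Dmap (homotopy_class A h) (Ident (ho A) Y) a)"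
    and \<sigma>_Post: "\<lbrakk>f \<in> Hom A X Y; g \<in> Hom A Y Z; a \<in> carrier (D X Y)\<rbrakk>
          \<Longrightarrow> Post A g (\<sigma> f a) = \<sigma> (g \<cdot> f) (Dmap (Ident (ho A) X) (homotopy_class A g) a)"

section \<open>Track functors\<close>

record ('o, 'm, 't, 'p, 'n, 's) tfun =
  FObj :: "'o \<Rightarrow> 'p"
  FArr :: "'m \<Rightarrow> 'n"
  FTrk :: "'t \<Rightarrow> 's"

text \<open>The extensionality conditions make equality of records the equality of track functors.\<close>
locale track_functor = A: track_category A + B: track_category B
    for A :: "('o, 'm, 't, 'y) track_cat_scheme" and B :: "('p, 'n, 's, 'z) track_cat_scheme" +
  fixes T :: "('o, 'm, 't, 'p, 'n, 's) tfun"
  assumes ext: "FObj T \<in> extensional (Obj A)" "FArr T \<in> extensional (Arr A)"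
               "FTrk T \<in> extensional (Trk A)"
    and on_Obj: "X \<in> Obj A \<Longrightarrow> FObj T X \<in> Obj B"
    and on_Hom: "f \<in> Hom A X Y \<Longrightarrow> FArr T f \<in> Hom B (FObj T X) (FObj T Y)"
    and on_Track: "\<eta> \<in> Track A f g \<Longrightarrow> FTrk T \<eta> \<in> Track B (FArr T f) (FArr T g)"
    and on_Ident: "X \<in> Obj A \<Longrightarrow> FArr T (Ident A X) = Ident B (FObj T X)"
    and on_Comp: "\<lbrakk>f \<in> Hom A X Y; g \<in> Hom A Y Z\<rbrakk>
          \<Longrightarrow> FArr T (g \<cdot>\<^bsub>A\<^esub> f) = FArr T g \<cdot>\<^bsub>B\<^esub> FArr T f"
    and on_IdT: "f \<in> Arr A \<Longrightarrow> FTrk T (IdT A f) = IdT B (FArr T f)"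
    and on_VComp: "\<lbrakk>\<eta> \<in> Track A f g; \<phi> \<in> Track A g h\<rbrakk>
          \<Longrightarrow> FTrk T (\<phi> \<box>\<^bsub>A\<^esub> \<eta>) = FTrk T \<phi> \<box>\<^bsub>B\<^esub> FTrk T \<eta>"
    and on_Post: "\<lbrakk>\<eta> \<in> HomTrk A X Y; g \<in> Hom A Y Z\<rbrakk>
          \<Longrightarrow> FTrk T (Post A g \<eta>) = Post B (FArr T g) (FTrk T \<eta>)"
    and on_Pre: "\<lbrakk>h \<in> Hom A W X; \<eta> \<in> HomTrk A X Y\<rbrakk>
          \<Longrightarrow> FTrk T (Pre A h \<eta>) = Pre B (FArr T h) (FTrk T \<eta>)"

definition tfun_id :: "('o, 'm, 't, 'z) track_cat_scheme \<Rightarrow> ('o, 'm, 't, 'o, 'm, 't) tfun" where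
  "tfun_id A = \<lparr>FObj = (\<lambda>X \<in> Obj A. X), FArr = (\<lambda>f \<in> Arr A. f), FTrk = (\<lambda>\<eta> \<in> Trk A. \<eta>)\<rparr>"

text \<open>The composite \<open>S \<circ> T\<close>, where \<open>A\<close> is the source of \<open>T\<close>.\<close>
definition tfun_comp :: "('o, 'm, 't, 'z) track_cat_scheme \<Rightarrow> ('p, 'n, 's, 'q, 'k, 'r) tfun
    \<Rightarrow> ('o, 'm, 't, 'p, 'n, 's) tfun \<Rightarrow> ('o, 'm, 't, 'q, 'k, 'r) tfun" where
  "tfun_comp A S T = \<lparr>FObj = compose (Obj A) (FObj S) (FObj T),
                      FArr = compose (Arr A) (FArr S) (FArr T),
                      FTrk = compose (Trk A) (FTrk S) (FTrk T)\<rparr>"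

text \<open>Equivalence in the sense of groupoid-enriched categories: both composites are isomorphic to
  the identity by isomorphisms that are natural for maps and for tracks.\<close>

definition two_natural_iso :: "('o, 'm, 't, 'y) track_cat_scheme
    \<Rightarrow> ('p, 'n, 's, 'z) track_cat_scheme \<Rightarrow> ('o, 'm, 't, 'p, 'n, 's) tfun
    \<Rightarrow> ('o, 'm, 't, 'p, 'n, 's) tfun \<Rightarrow> ('o \<Rightarrow> 'n) \<Rightarrow> bool" where
  "two_natural_iso A B S T c \<longleftrightarrow>
     (\<forall>X \<in> Obj A. c X \<in> Hom B (FObj S X) (FObj T X) \<and> is_isomorphism B (c X)) \<and>
     (\<forall>X \<in> Obj A. \<forall>Y \<in> Obj A. \<forall>f \<in> Hom A X Y.
        FArr T f \<cdot>\<^bsub>B\<^esub> c X = c Y \<cdot>\<^bsub>B\<^esub> FArr S f) \<and>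
     (\<forall>X \<in> Obj A. \<forall>Y \<in> Obj A. \<forall>\<eta> \<in> HomTrk A X Y.
        Pre B (c X) (FTrk T \<eta>) = Post B (c Y) (FTrk S \<eta>))"

definition two_equivalence :: "('o, 'm, 't, 'y) track_cat_scheme
    \<Rightarrow> ('p, 'n, 's, 'z) track_cat_scheme \<Rightarrow> ('o, 'm, 't, 'p, 'n, 's) tfun
    \<Rightarrow> ('p, 'n, 's, 'o, 'm, 't) tfun \<Rightarrow> bool" where
  "two_equivalence A B T S \<longleftrightarrow> track_functor A B T \<and> track_functor B A S \<and>
     (\<exists>c. two_natural_iso A A (tfun_comp A S T) (tfun_id A) c) \<and>
     (\<exists>d. two_natural_iso B B (tfun_comp B T S) (tfun_id B) d)"

section \<open>The theories of free nilpotent groups\<close>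

text \<open>The free group on \<open>{1..p}\<close> as the group of reduced words; the letter \<open>(i, True)\<close> is the
  generator \<open>i\<close> and \<open>(i, False)\<close> its inverse. The product \<open>foldr cancel_cons u v\<close>
  concatenates and cancels.\<close>

type_synonym word = "(nat \<times> bool) list"

fun cancel_cons :: "nat \<times> bool \<Rightarrow> word \<Rightarrow> word" where
  "cancel_cons x [] = [x]"
| "cancel_cons x (y # w) = (if fst x = fst y \<and> snd x \<noteq> snd y then w else x # y # w)"

definition free_group :: "nat \<Rightarrow> word monoid" where
  "free_group p = \<lparr>carrier = {w. fst ` set w \<subseteq> {1..p} \<and>
                      (\<forall>i. Suc i < length w \<longrightarrow>
                         \<not> (fst (w ! i) = fst (w ! Suc i) \<and> snd (w ! i) \<noteq> snd (w ! Suc i)))},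
                    mult = foldr cancel_cons, one = []\<rparr>"

primrec lower_central :: "('a, 'z) monoid_scheme \<Rightarrow> nat \<Rightarrow> 'a set" where
  "lower_central G 0 = carrier G"
| "lower_central G (Suc k) = generate G
     {a \<otimes>\<^bsub>G\<^esub> b \<otimes>\<^bsub>G\<^esub> inv\<^bsub>G\<^esub> a \<otimes>\<^bsub>G\<^esub> inv\<^bsub>G\<^esub> b | a b. a \<in> carrier G \<and> b \<in> lower_central G k}"

text \<open>For \<open>n = \<infinity>\<close> nothing is divided out: the free group appears as its quotient by the
  trivial subgroup, so that \<open>nil_group n p\<close> has the same type for all \<open>n\<close>.\<close>

definition nil_kernel :: "enat \<Rightarrow> nat \<Rightarrow> word set" where
  "nil_kernel n p = (case n of enat k \<Rightarrow> lower_central (free_group p) k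
                             | \<infinity> \<Rightarrow> {\<one>\<^bsub>free_group p\<^esub>})"

definition nil_group :: "enat \<Rightarrow> nat \<Rightarrow> word set monoid" where
  "nil_group n p = free_group p Mod nil_kernel n p"

text \<open>An arrow \<open>(p, q, f)\<close> is a homomorphism \<open>f\<close> from \<open>nil_group n p\<close> to \<open>nil_group n q\<close>.\<close>

type_synonym nil_arr = "nat \<times> nat \<times> (word set \<Rightarrow> word set)"

definition nil_cat :: "enat \<Rightarrow> (nat, nil_arr) cat" where
  "nil_cat n = \<lparr>Obj = UNIV,
     Arr = {(p, q, f). f \<in> hom (nil_group n p) (nil_group n q) \<inter>
                            extensional (carrier (nil_group n p))},
     Dom = (\<lambda>(p, q, f). p), Cod = (\<lambda>(p, q, f). q),
     Ident = (\<lambda>p. (p, p, \<lambda>x \<in> carrier (nil_group n p). x)),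
     Comp = (\<lambda>(q', r, g) (p, q, f). (p, r, compose (carrier (nil_group n p)) g f))\<rparr>"

abbreviation nil_op :: "enat \<Rightarrow> (nat, nil_arr) cat" where
  "nil_op n \<equiv> op_cat (nil_cat n)"

text \<open>The homomorphism from \<open>nil_group n p\<close> to \<open>nil_group n r\<close> sending the generator \<open>i\<close> to
  the generator \<open>s + i\<close>, for \<open>s + p \<le> r\<close>.\<close>
definition nil_shift :: "enat \<Rightarrow> nat \<Rightarrow> nat \<Rightarrow> nat \<Rightarrow> nil_arr" where
  "nil_shift n s p r = (p, r, \<lambda>c \<in> carrier (nil_group n p).
     nil_kernel n r <#>\<^bsub>free_group r\<^esub> (map (\<lambda>(i, e). (s + i, e)) ` c))"

text \<open>In \<open>nil_op n\<close> the product of \<open>p\<close> and \<open>q\<close> is \<open>p + q\<close>, the zero object is \<open>0\<close>, and the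
  projections are the inclusions of the first \<open>p\<close> and of the last \<open>q\<close> generators.\<close>

definition nil_pr1 :: "enat \<Rightarrow> nat \<Rightarrow> nat \<Rightarrow> nil_arr" where
  "nil_pr1 n p q = nil_shift n 0 p (p + q)"

definition nil_pr2 :: "enat \<Rightarrow> nat \<Rightarrow> nat \<Rightarrow> nil_arr" where
  "nil_pr2 n p q = nil_shift n p q (p + q)"

section \<open>Pseudofunctors, pseudo natural transformations, homotopies\<close>

text \<open>As for track functors, all families are undefined outside their index sets.\<close>

record ('x, 'a, 'o, 'm, 't) pseudofun =
  PObj :: "'x \<Rightarrow> 'o"
  PArr :: "'a \<Rightarrow> 'm"
  PComp :: "'a \<Rightarrow> 'a \<Rightarrow> 't"
  PUnit :: "'x \<Rightarrow> 't"

locale pseudofunctor =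
  fixes C :: "('x, 'a) cat" and A :: "('o, 'm, 't, 'z) track_cat_scheme"
    and \<phi> :: "('x, 'a, 'o, 'm, 't) pseudofun"
  assumes P_ext: "PObj \<phi> \<in> extensional (Obj C)" "PArr \<phi> \<in> extensional (Arr C)"
                 "PUnit \<phi> \<in> extensional (Obj C)"
                 "\<not> (f \<in> Arr C \<and> g \<in> Arr C \<and> Dom C f = Cod C g) \<Longrightarrow> PComp \<phi> f g = undefined"
    and PObj_Obj: "X \<in> Obj C \<Longrightarrow> PObj \<phi> X \<in> Obj A"
    and PArr_Hom: "f \<in> Hom C X Y \<Longrightarrow> PArr \<phi> f \<in> Hom A (PObj \<phi> X) (PObj \<phi> Y)"
    and PComp_Track: "\<lbrakk>g \<in> Hom C X Y; f \<in> Hom C Y Z\<rbrakk>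
          \<Longrightarrow> PComp \<phi> f g \<in> Track A (PArr \<phi> f \<cdot>\<^bsub>A\<^esub> PArr \<phi> g) (PArr \<phi> (f \<cdot>\<^bsub>C\<^esub> g))"
    and PUnit_Track: "X \<in> Obj C
          \<Longrightarrow> PUnit \<phi> X \<in> Track A (PArr \<phi> (Ident C X)) (Ident A (PObj \<phi> X))"
    and PComp_assoc: "\<lbrakk>h \<in> Hom C W X; g \<in> Hom C X Y; f \<in> Hom C Y Z\<rbrakk>
          \<Longrightarrow> PComp \<phi> f (g \<cdot>\<^bsub>C\<^esub> h) \<box>\<^bsub>A\<^esub> Post A (PArr \<phi> f) (PComp \<phi> g h)
             = PComp \<phi> (f \<cdot>\<^bsub>C\<^esub> g) h \<box>\<^bsub>A\<^esub> Pre A (PArr \<phi> h) (PComp \<phi> f g)"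
    and PComp_Ident: "f \<in> Hom C X Y
          \<Longrightarrow> PComp \<phi> f (Ident C X) = Post A (PArr \<phi> f) (PUnit \<phi> X)"
    and Ident_PComp: "f \<in> Hom C X Y
          \<Longrightarrow> PComp \<phi> (Ident C Y) f = Pre A (PArr \<phi> f) (PUnit \<phi> Y)"

record ('x, 'a, 'o, 'm, 't) pseudonat =
  NDom :: "('x, 'a, 'o, 'm, 't) pseudofun"
  NCod :: "('x, 'a, 'o, 'm, 't) pseudofun"
  NObj :: "'x \<Rightarrow> 'm"
  NArr :: "'a \<Rightarrow> 't"

locale pseudo_natural =
  fixes C :: "('x, 'a) cat" and A :: "('o, 'm, 't, 'z) track_cat_scheme"
    and \<alpha> :: "('x, 'a, 'o, 'm, 't) pseudonat"
    and \<phi> \<psi> :: "('x, 'a, 'o, 'm, 't) pseudofun"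
  defines "\<phi> \<equiv> NDom \<alpha>" and "\<psi> \<equiv> NCod \<alpha>"
  assumes NDom_pseudo: "pseudofunctor C A \<phi>" and NCod_pseudo: "pseudofunctor C A \<psi>"
    and N_ext: "NObj \<alpha> \<in> extensional (Obj C)" "NArr \<alpha> \<in> extensional (Arr C)"
    and NObj_Hom: "X \<in> Obj C \<Longrightarrow> NObj \<alpha> X \<in> Hom A (PObj \<phi> X) (PObj \<psi> X)"
    and NArr_Track: "f \<in> Hom C X Y
          \<Longrightarrow> NArr \<alpha> f \<in> Track A (NObj \<alpha> Y \<cdot>\<^bsub>A\<^esub> PArr \<phi> f) (PArr \<psi> f \<cdot>\<^bsub>A\<^esub> NObj \<alpha> X)"
    and NArr_Comp: "\<lbrakk>f \<in> Hom C X Y; g \<in> Hom C Y Z\<rbrakk>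
          \<Longrightarrow> NArr \<alpha> (g \<cdot>\<^bsub>C\<^esub> f) \<box>\<^bsub>A\<^esub> Post A (NObj \<alpha> Z) (PComp \<phi> g f)
             = Pre A (NObj \<alpha> X) (PComp \<psi> g f) \<box>\<^bsub>A\<^esub> Post A (PArr \<psi> g) (NArr \<alpha> f)
                 \<box>\<^bsub>A\<^esub> Pre A (PArr \<phi> f) (NArr \<alpha> g)"
    and NArr_Ident: "X \<in> Obj C
          \<Longrightarrow> Pre A (NObj \<alpha> X) (PUnit \<psi> X) \<box>\<^bsub>A\<^esub> NArr \<alpha> (Ident C X)
             = Post A (NObj \<alpha> X) (PUnit \<phi> X)"

record ('x, 'a, 'o, 'm, 't) homotopy =
  HSrc :: "('x, 'a, 'o, 'm, 't) pseudonat"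
  HTrg :: "('x, 'a, 'o, 'm, 't) pseudonat"
  HObj :: "'x \<Rightarrow> 't"

locale pseudo_homotopy =
  fixes C :: "('x, 'a) cat" and A :: "('o, 'm, 't, 'z) track_cat_scheme"
    and H :: "('x, 'a, 'o, 'm, 't) homotopy"
    and \<alpha> \<beta> :: "('x, 'a, 'o, 'm, 't) pseudonat"
    and \<phi> \<psi> :: "('x, 'a, 'o, 'm, 't) pseudofun"
  defines "\<alpha> \<equiv> HSrc H" and "\<beta> \<equiv> HTrg H" and "\<phi> \<equiv> NDom \<alpha>" and "\<psi> \<equiv> NCod \<alpha>"
  assumes HSrc_nat: "pseudo_natural C A \<alpha>" and HTrg_nat: "pseudo_natural C A \<beta>"
    and H_parallel: "NDom \<beta> = \<phi>" "NCod \<beta> = \<psi>"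
    and H_ext: "HObj H \<in> extensional (Obj C)"
    and HObj_Track: "X \<in> Obj C \<Longrightarrow> HObj H X \<in> Track A (NObj \<alpha> X) (NObj \<beta> X)"
    and HObj_natural: "f \<in> Hom C X Y
          \<Longrightarrow> NArr \<beta> f = Post A (PArr \<psi> f) (HObj H X) \<box>\<^bsub>A\<^esub> NArr \<alpha> f
                          \<box>\<^bsub>A\<^esub> Pre A (PArr \<phi> f) (InvT A (HObj H Y))"

subsection \<open>Preservation of products\<close>

definition pi_map :: "enat \<Rightarrow> ('o, 'm, 't, 'z) track_cat_prod_scheme
    \<Rightarrow> (nat, nil_arr, 'o, 'm, 't) pseudofun \<Rightarrow> nat \<Rightarrow> nat \<Rightarrow> 'm" where
  "pi_map n A \<phi> p q = pairA A (PArr \<phi> (nil_pr1 n p q)) (PArr \<phi> (nil_pr2 n p q))"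

text \<open>A map \<open>u\<close> into the product \<open>p + q\<close> in \<open>nil_op n\<close> is the pair \<open>(h, k)\<close> of its
  composites \<open>h\<close>, \<open>k\<close> with the projections.\<close>

locale pp_pseudofunctor = pseudofunctor "nil_op n" A \<phi>
    for n :: enat and A :: "('o, 'm, 't, 'z) track_cat_prod_scheme"
    and \<phi> :: "(nat, nil_arr, 'o, 'm, 't) pseudofun" +
  assumes pp_Ident: "PArr \<phi> (Ident (nil_op n) p) = Ident A (PObj \<phi> p)"
    and pp_PUnit: "PUnit \<phi> p = IdT A (Ident A (PObj \<phi> p))"
    and pp_Zero: "PObj \<phi> 0 = Zero A"
    and pp_zero_map: "PArr \<phi> (zero_map (nil_op n) 0 p q)
          = zero_map A (Zero A) (PObj \<phi> p) (PObj \<phi> q)"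
    and pp_PComp_zero: "f \<in> Hom (nil_op n) q r \<Longrightarrow> PComp \<phi> f (zero_map (nil_op n) 0 p q)
          = IdT A (zero_map A (Zero A) (PObj \<phi> p) (PObj \<phi> r))"
    and pp_zero_PComp: "f \<in> Hom (nil_op n) p q \<Longrightarrow> PComp \<phi> (zero_map (nil_op n) 0 q r) f
          = IdT A (zero_map A (Zero A) (PObj \<phi> p) (PObj \<phi> r))"
    and pp_pi_iso: "is_isomorphism A (pi_map n A \<phi> p q)"
    and pp_PComp: "\<lbrakk>g \<in> Hom (nil_op n) t r; u \<in> Hom (nil_op n) r (p + q)\<rbrakk>
          \<Longrightarrow> Post A (pi_map n A \<phi> p q) (PComp \<phi> u g)
             = pairT A (PComp \<phi> (nil_pr1 n p q \<cdot>\<^bsub>nil_op n\<^esub> u) g)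
                       (PComp \<phi> (nil_pr2 n p q \<cdot>\<^bsub>nil_op n\<^esub> u) g)"
    and pp_PUnit_prod: "Post A (pi_map n A \<phi> p p) (PUnit \<phi> (p + p))
          = Pre A (pi_map n A \<phi> p p) (prodT A (PUnit \<phi> p) (PUnit \<phi> p))"

definition pp_pseudonat :: "enat \<Rightarrow> ('o, 'm, 't, 'z) track_cat_prod_scheme
    \<Rightarrow> (nat, nil_arr, 'o, 'm, 't) pseudonat \<Rightarrow> bool" where
  "pp_pseudonat n A \<alpha> \<longleftrightarrow> pseudo_natural (nil_op n) A \<alpha> \<and>
     pp_pseudofunctor n A (NDom \<alpha>) \<and> pp_pseudofunctor n A (NCod \<alpha>) \<and>
     (\<forall>p q. pi_map n A (NCod \<alpha>) p q \<cdot>\<^bsub>A\<^esub> NObj \<alpha> (p + q)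
            = prodA A (NObj \<alpha> p) (NObj \<alpha> q) \<cdot>\<^bsub>A\<^esub> pi_map n A (NDom \<alpha>) p q) \<and>
     (\<forall>p q r. \<forall>u \<in> Hom (nil_op n) r (p + q).
        Post A (pi_map n A (NCod \<alpha>) p q) (NArr \<alpha> u)
        = pairT A (NArr \<alpha> (nil_pr1 n p q \<cdot>\<^bsub>nil_op n\<^esub> u)) (NArr \<alpha> (nil_pr2 n p q \<cdot>\<^bsub>nil_op n\<^esub> u)))"

definition pp_homotopy :: "enat \<Rightarrow> ('o, 'm, 't, 'z) track_cat_prod_scheme
    \<Rightarrow> (nat, nil_arr, 'o, 'm, 't) homotopy \<Rightarrow> bool" where
  "pp_homotopy n A H \<longleftrightarrow> pseudo_homotopy (nil_op n) A H \<and>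
     pp_pseudonat n A (HSrc H) \<and> pp_pseudonat n A (HTrg H) \<and>
     (\<forall>p q. Post A (pi_map n A (NCod (HSrc H)) p q) (HObj H (p + q))
            = Pre A (pi_map n A (NDom (HSrc H)) p q) (prodT A (HObj H p) (HObj H q)))"

section \<open>The track category of product preserving pseudofunctors\<close>

definition nat_id :: "('x, 'a) cat \<Rightarrow> ('o, 'm, 't, 'z) track_cat_scheme
    \<Rightarrow> ('x, 'a, 'o, 'm, 't) pseudofun \<Rightarrow> ('x, 'a, 'o, 'm, 't) pseudonat" where
  "nat_id C A \<phi> = \<lparr>NDom = \<phi>, NCod = \<phi>,
     NObj = (\<lambda>X \<in> Obj C. Ident A (PObj \<phi> X)), NArr = (\<lambda>f \<in> Arr C. IdT A (PArr \<phi> f))\<rparr>"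

definition nat_comp :: "('x, 'a) cat \<Rightarrow> ('o, 'm, 't, 'z) track_cat_scheme
    \<Rightarrow> ('x, 'a, 'o, 'm, 't) pseudonat \<Rightarrow> ('x, 'a, 'o, 'm, 't) pseudonat
    \<Rightarrow> ('x, 'a, 'o, 'm, 't) pseudonat" where
  "nat_comp C A \<beta> \<alpha> = \<lparr>NDom = NDom \<alpha>, NCod = NCod \<beta>,
     NObj = (\<lambda>X \<in> Obj C. NObj \<beta> X \<cdot>\<^bsub>A\<^esub> NObj \<alpha> X),
     NArr = (\<lambda>f \<in> Arr C. Pre A (NObj \<alpha> (Dom C f)) (NArr \<beta> f)
                            \<box>\<^bsub>A\<^esub> Post A (NObj \<beta> (Cod C f)) (NArr \<alpha> f))\<rparr>"

definition PseudoPi :: "enat \<Rightarrow> ('o, 'm, 't, 'z) track_cat_prod_scheme \<Rightarrow>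
    ((nat, nil_arr, 'o, 'm, 't) pseudofun, (nat, nil_arr, 'o, 'm, 't) pseudonat,
     (nat, nil_arr, 'o, 'm, 't) homotopy) track_cat" where
  "PseudoPi n A = (let C = nil_op n in
     \<lparr>Obj = {\<phi>. pp_pseudofunctor n A \<phi>},
      Arr = {\<alpha>. pp_pseudonat n A \<alpha>},
      Dom = NDom, Cod = NCod,
      Ident = nat_id C A,
      Comp = nat_comp C A,
      Trk = {H. pp_homotopy n A H},
      Src = HSrc, Trg = HTrg,
      IdT = (\<lambda>\<alpha>. \<lparr>HSrc = \<alpha>, HTrg = \<alpha>, HObj = (\<lambda>X \<in> Obj C. IdT A (NObj \<alpha> X))\<rparr>),
      VComp = (\<lambda>K H. \<lparr>HSrc = HSrc H, HTrg = HTrg K,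
                        HObj = (\<lambda>X \<in> Obj C. HObj K X \<box>\<^bsub>A\<^esub> HObj H X)\<rparr>),
      InvT = (\<lambda>H. \<lparr>HSrc = HTrg H, HTrg = HSrc H,
                     HObj = (\<lambda>X \<in> Obj C. InvT A (HObj H X))\<rparr>),
      Post = (\<lambda>\<beta> H. \<lparr>HSrc = nat_comp C A \<beta> (HSrc H), HTrg = nat_comp C A \<beta> (HTrg H),
                       HObj = (\<lambda>X \<in> Obj C. Post A (NObj \<beta> X) (HObj H X))\<rparr>),
      Pre = (\<lambda>\<beta> H. \<lparr>HSrc = nat_comp C A (HSrc H) \<beta>, HTrg = nat_comp C A (HTrg H) \<beta>,
                      HObj = (\<lambda>X \<in> Obj C. Pre A (NObj \<beta> X) (HObj H X))\<rparr>)\<rparr>)"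

text \<open>Evaluation on the object \<open>1\<close> of \<open>nil_op n\<close>, which is the infinite cyclic group.\<close>
definition ev :: "enat \<Rightarrow> ('o, 'm, 't, 'z) track_cat_prod_scheme \<Rightarrow>
    ((nat, nil_arr, 'o, 'm, 't) pseudofun, (nat, nil_arr, 'o, 'm, 't) pseudonat,
     (nat, nil_arr, 'o, 'm, 't) homotopy, 'o, 'm, 't) tfun" where
  "ev n A = \<lparr>FObj = (\<lambda>G \<in> Obj (PseudoPi n A). PObj G 1),
             FArr = (\<lambda>\<alpha> \<in> Arr (PseudoPi n A). NObj \<alpha> 1),
             FTrk = (\<lambda>H \<in> Trk (PseudoPi n A). HObj H 1)\<rparr>"

definition weak_nil_group :: "enat \<Rightarrow> ('o, 'm, 't, 'z) track_cat_prod_scheme \<Rightarrow> 'o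
    \<Rightarrow> (nat, nil_arr, 'o, 'm, 't) pseudofun \<Rightarrow> bool" where
  "weak_nil_group n A X G \<longleftrightarrow> G \<in> Obj (PseudoPi n A) \<and> PObj G 1 = X"

text \<open>\<open>T\<close> is a track functor which is given by \<open>F\<close> on objects and is a section of evaluation.\<close>
definition extends_to :: "enat \<Rightarrow> ('o, 'm, 't, 'z) track_cat_prod_scheme
    \<Rightarrow> ('o \<Rightarrow> (nat, nil_arr, 'o, 'm, 't) pseudofun)
    \<Rightarrow> ('o, 'm, 't, (nat, nil_arr, 'o, 'm, 't) pseudofun, (nat, nil_arr, 'o, 'm, 't) pseudonat,
        (nat, nil_arr, 'o, 'm, 't) homotopy) tfun \<Rightarrow> bool" where
  "extends_to n A F T \<longleftrightarrow> track_functor A (PseudoPi n A) T \<and>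
     (\<forall>X \<in> Obj A. FObj T X = F X) \<and> tfun_comp A (ev n A) T = tfun_id A"

end

theory Submission
  imports Defs "HOL-Algebra.Elementary_Groups"
begin

text \<open>
  Let \<open>\<phi>\<close>, \<open>\<psi>\<close> be product preserving pseudofunctors. A map \<open>f\<close> from \<open>\<phi> 1\<close> to \<open>\<psi> 1\<close> underlies exactly
  one product preserving pseudo natural transformation, and a track between two such maps exactly one
  homotopy; so evaluation is bijective on maps and on tracks, and everything else is formal.

  On objects, the transformation is forced to be \<open>f\<close> to the power \<open>p\<close>. Any two unital operations on an
  object of an additive category coincide with the sum, so \<open>f\<close> commutes up to homotopy with all
  operations, and the tracks realizing this form torsors under \<open>D\<close>. The failure of a choice of tracks
  to be coherent is a 2-cocycle \<open>c(g, w)\<close> with values in \<open>D\<close>. Since \<open>D\<close> is additive in the first variable,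
  the track at an operation \<open>w\<close> of \<open>p\<close> variables can be chosen, in exactly one way, with
  \<open>c(w, i) = 0\<close> for the \<open>p\<close> injections \<open>i\<close>. This fixes the track at the multiplication \<open>\<mu>\<close>; the tracks at
  the endomorphisms of \<open>1\<close>, which are the integers, are then found by recursion such that
  \<open>c(\<mu>, (e, 1)) = 0\<close>. Associativity of \<open>\<mu>\<close> gives \<open>c(\<mu>, (e, f)) = c(\<mu>, (e, f + 1))\<close>, so \<open>c(\<mu>, -)\<close>
  vanishes; hence \<open>c(g, w)\<close> is additive in the group element \<open>g\<close>, and it is zero on generators.
\<close>

section \<open>Free nilpotent groups\<close>

text \<open>Two parallel tracks differ by a unique element of some \<open>D X Y\<close>, so each
  failure of an equation between tracks is one element of an abelian group. Up to homotopy \<phi> p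
  is a biproduct of copies of \<phi> 1. In the first variable of \<open>D\<close> this allows a
  track out of \<phi> p to be prescribed along the injections; in the second, as \<mu> is homotopic
  to the sum of the projections, it makes \<mu> act as addition. The cocycle identity reduces
  c(\<mu>, w) to the values c(\<mu>, w i) at injections i, where w i is a pair of integers; hence
  the special treatment of the endomorphisms of 1. The recursion over them has to run in both
  directions. Downwards the earlier track is hidden inside a pair, but shifting it by d shifts the
  later one by d, because \<mu> acts as addition. The normalizations must also fit together: from
  the identity track of the zero map at 0 the recursion has to return the identity track at 1, which
  it does since the pair (0, 1) is an injection. Inverses need no choice of their own: an additive
  quantity that vanishes on x and on the neutral product x y vanishes on y.\<close>

definition reduced :: "word \<Rightarrow> bool" where
  "reduced = successively (\<lambda>x y. \<not> (fst x = fst y \<and> snd x \<noteq> snd y))"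

definition flip :: "nat \<times> bool \<Rightarrow> nat \<times> bool" where
  "flip x = (fst x, \<not> snd x)"

lemma fst_flip [simp]: "fst (flip x) = fst x" and snd_flip [simp]: "snd (flip x) = (\<not> snd x)"
  and flip_flip [simp]: "flip (flip x) = x"
  by (auto simp: flip_def)

lemma mem_carrier_free_group:
  "w \<in> carrier (free_group p) \<longleftrightarrow> fst ` set w \<subseteq> {1..p} \<and> reduced w"
  by (auto simp: free_group_def reduced_def successively_conv_nth)

lemma mult_free_group: "u \<otimes>\<^bsub>free_group p\<^esub> v = foldr cancel_cons u v"
  and one_free_group: "\<one>\<^bsub>free_group p\<^esub> = []"
  by (auto simp: free_group_def)

lemma reduced_Nil [simp]: "reduced []" and reduced_single [simp]: "reduced [x]"
  by (auto simp: reduced_def)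

lemma reduced_ConsD: "reduced (x # w) \<Longrightarrow> reduced w"
  by (auto simp: reduced_def successively_Cons)

lemma reduced_cancel_cons: "reduced w \<Longrightarrow> reduced (cancel_cons x w)"
  by (cases w) (auto simp: reduced_def successively_Cons)

lemma reduced_foldr: "reduced v \<Longrightarrow> reduced (foldr cancel_cons u v)"
  by (induction u) (auto simp: reduced_cancel_cons)

lemma cancel_cons_reduced: "reduced (x # w) \<Longrightarrow> cancel_cons x w = x # w"
  by (cases w) (auto simp: reduced_def)

text \<open>The delicate case is that \<open>w\<close> begins with \<open>x\<close>: then
  \<open>flip x\<close> cancels it, and reducedness of \<open>w\<close> prevents the restored
  \<open>x\<close> from cancelling the next letter.\<close>

lemma cancel_cons_flip:
  assumes "reduced w" shows "cancel_cons x (cancel_cons (flip x) w) = w"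
proof (cases w)
  case (Cons y w')
  show ?thesis
  proof (cases "y = x")
    case True
    with Cons assms show ?thesis by (simp add: cancel_cons_reduced)
  next
    case False
    with Cons show ?thesis by (auto simp: prod_eq_iff)
  qed
qed auto

text \<open>Associativity for a single letter. The only case with content is that \<open>x\<close>
  cancels against the head of \<open>u\<close>, and then \<open>cancel_cons_flip\<close> removes the
  same pair on the right.\<close>

lemma foldr_cancel_cons:
  assumes "reduced v"
  shows "foldr cancel_cons (cancel_cons x u) v = cancel_cons x (foldr cancel_cons u v)"
proof (cases u)
  case (Cons y u')
  show ?thesis
  proof (cases "y = flip x")
    case True
    with Cons show ?thesis by (simp add: cancel_cons_flip reduced_foldr assms)
  next
    case False
    with Cons show ?thesis by (auto simp: prod_eq_iff)
  qed
qed auto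

lemma foldr_cancel_cons_assoc:
  assumes "reduced v" "reduced w"
  shows "foldr cancel_cons (foldr cancel_cons u v) w = foldr cancel_cons u (foldr cancel_cons v w)"
  using assms by (induction u) (auto simp: foldr_cancel_cons)

lemma foldr_cancel_cons_inverse:
  "reduced u \<Longrightarrow> foldr cancel_cons (rev (map flip u)) u = []"
  by (induction u) (auto dest: reduced_ConsD)

lemma set_cancel_cons: "set (cancel_cons x w) \<subseteq> insert x (set w)"
  by (cases w) auto

lemma set_foldr_cancel_cons: "set (foldr cancel_cons u v) \<subseteq> set u \<union> set v"
proof (induction u)
  case (Cons x u)
  thus ?case using set_cancel_cons[of x "foldr cancel_cons u v"] by auto
qed simp

lemma reduced_flip_rev: "reduced u \<Longrightarrow> reduced (rev (map flip u))"
  unfolding reduced_def by (auto simp: successively_map elim: successively_mono)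

lemma free_group_group: "group (free_group p)"
proof (rule groupI)
  fix x y assume x: "x \<in> carrier (free_group p)" and y: "y \<in> carrier (free_group p)"
  have "fst ` set (foldr cancel_cons x y) \<subseteq> {1..p}"
    using image_mono[OF set_foldr_cancel_cons[of x y], of fst] x y
    by (fastforce simp: mem_carrier_free_group)
  with y show "x \<otimes>\<^bsub>free_group p\<^esub> y \<in> carrier (free_group p)"
    by (simp add: mem_carrier_free_group mult_free_group reduced_foldr)
next
  fix x assume x: "x \<in> carrier (free_group p)"
  hence "rev (map flip x) \<in> carrier (free_group p)"
    by (auto simp: mem_carrier_free_group reduced_flip_rev image_subset_iff)
  thus "\<exists>y\<in>carrier (free_group p). y \<otimes>\<^bsub>free_group p\<^esub> x = \<one>\<^bsub>free_group p\<^esub>"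
    using x by (auto simp: mult_free_group one_free_group mem_carrier_free_group
        foldr_cancel_cons_inverse intro!: bexI[of _ "rev (map flip x)"])
qed (auto simp: mult_free_group one_free_group mem_carrier_free_group foldr_cancel_cons_assoc)

definition gen :: "nat \<Rightarrow> word" where "gen i = [(i, True)]"

lemma gen_closed: "i \<in> {1..p} \<Longrightarrow> gen i \<in> carrier (free_group p)"
  by (auto simp: mem_carrier_free_group gen_def)

lemma inv_gen: "i \<in> {1..p} \<Longrightarrow> inv\<^bsub>free_group p\<^esub> (gen i) = [(i, False)]"
  by (rule group.inv_equality[OF free_group_group])
    (auto simp: mem_carrier_free_group gen_def mult_free_group one_free_group)

text \<open>Translates the list structure of a reduced word into the group structure, so that list
  induction becomes induction over products of generators and their inverses.\<close>

lemma Cons_free_group: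
  assumes "x # w \<in> carrier (free_group p)"
  shows "w \<in> carrier (free_group p)" "fst x \<in> {1..p}"
    "x # w = (if snd x then gen (fst x) else inv\<^bsub>free_group p\<^esub> gen (fst x)) \<otimes>\<^bsub>free_group p\<^esub> w"
proof -
  show "w \<in> carrier (free_group p)" and x: "fst x \<in> {1..p}"
    using assms by (auto simp: mem_carrier_free_group dest: reduced_ConsD)
  show "x # w = (if snd x then gen (fst x) else inv\<^bsub>free_group p\<^esub> gen (fst x)) \<otimes>\<^bsub>free_group p\<^esub> w"
    using assms x
    by (cases x) (auto simp: inv_gen, auto simp: gen_def mult_free_group mem_carrier_free_group cancel_cons_reduced)
qed

section \<open>The universal property of the free group\<close>

definition lift :: "('a, 'z) monoid_scheme \<Rightarrow> (nat \<Rightarrow> 'a) \<Rightarrow> word \<Rightarrow> 'a" where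
  "lift H y w = foldr (\<lambda>x a. (if snd x then y (fst x) else inv\<^bsub>H\<^esub> (y (fst x))) \<otimes>\<^bsub>H\<^esub> a) w \<one>\<^bsub>H\<^esub>"

context
  fixes H (structure) and y :: "nat \<Rightarrow> 'a" and p :: nat
  assumes H: "group H" and y: "\<And>i. i \<in> {1..p} \<Longrightarrow> y i \<in> carrier H"
begin

interpretation H: group H by (rule H)

lemma lift_closed: "fst ` set w \<subseteq> {1..p} \<Longrightarrow> lift H y w \<in> carrier H"
  by (induction w) (auto simp: lift_def y)

text \<open>Evaluation does not see a cancellation, since the two cancelling letters have inverse
  values.\<close>

lemma lift_cancel_cons:
  assumes "fst ` set (x # w) \<subseteq> {1..p}"
  shows "lift H y (cancel_cons x w)
    = (if snd x then y (fst x) else inv (y (fst x))) \<otimes> lift H y w"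
proof (cases w)
  case (Cons z w')
  have "lift H y w' \<in> carrier H" "y (fst x) \<in> carrier H"
    using assms Cons lift_closed[of w'] by (auto intro: y)
  thus ?thesis using Cons
    by (auto simp: lift_def H.m_assoc[symmetric])
qed (auto simp: lift_def)

lemma lift_mult:
  assumes "fst ` set u \<subseteq> {1..p}" "fst ` set v \<subseteq> {1..p}"
  shows "lift H y (foldr cancel_cons u v) = lift H y u \<otimes> lift H y v"
  using assms(1)
proof (induction u)
  case Nil show ?case using assms(2) by (simp add: lift_closed) (simp add: lift_def lift_closed)
next
  case (Cons x u)
  have "fst ` set (x # foldr cancel_cons u v) \<subseteq> {1..p}"
    using image_mono[OF set_foldr_cancel_cons[of u v], of fst] Cons.prems assms(2) by fastforce
  hence "lift H y (foldr cancel_cons (x # u) v)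
    = (if snd x then y (fst x) else inv (y (fst x))) \<otimes> (lift H y u \<otimes> lift H y v)"
    using Cons by (simp add: lift_cancel_cons)
  moreover have "lift H y u \<in> carrier H" "lift H y v \<in> carrier H" "y (fst x) \<in> carrier H"
    using Cons.prems assms(2) lift_closed[of u] lift_closed[of v] by (auto intro: y)
  ultimately show ?case by (auto simp: lift_def H.m_assoc)
qed

lemma lift_hom: "lift H y \<in> hom (free_group p) H"
  by (rule homI) (auto simp: mult_free_group mem_carrier_free_group lift_mult intro!: lift_closed)

lemma lift_gen: "i \<in> {1..p} \<Longrightarrow> lift H y (gen i) = y i"
  using y by (simp add: lift_def gen_def)

end

text \<open>Formulated with group operations instead of letters, so that it passes along the
  quotient map to \<open>nil_group\<close>.\<close>

lemma free_group_induct [consumes 1, case_names one gen mult inv]: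
  assumes w: "w \<in> carrier (free_group p)"
    and one: "P \<one>\<^bsub>free_group p\<^esub>" and gen: "\<And>i. i \<in> {1..p} \<Longrightarrow> P (gen i)"
    and mult: "\<And>u v. u \<in> carrier (free_group p) \<Longrightarrow> v \<in> carrier (free_group p) \<Longrightarrow> P u \<Longrightarrow> P v
      \<Longrightarrow> P (u \<otimes>\<^bsub>free_group p\<^esub> v)"
    and inv: "\<And>u. u \<in> carrier (free_group p) \<Longrightarrow> P u \<Longrightarrow> P (inv\<^bsub>free_group p\<^esub> u)"
  shows "P w"
  using w
proof (induction w)
  case Nil then show ?case using one by (simp add: one_free_group)
next
  case (Cons x w)
  note C = Cons_free_group[OF Cons.prems]
  have "(if snd x then gen (fst x) else inv\<^bsub>free_group p\<^esub> gen (fst x)) \<in> carrier (free_group p)"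
    "P (if snd x then gen (fst x) else inv\<^bsub>free_group p\<^esub> gen (fst x))"
    using C(2) gen inv by (auto simp: gen_closed group.inv_closed[OF free_group_group])
  thus ?case using mult C Cons.IH by metis
qed

section \<open>Functoriality and normality of the lower central series\<close>

lemma lower_central_subgroup:
  assumes "group G" shows "subgroup (lower_central G k) G"
proof (induction k)
  case 0 show ?case using group.subgroup_self[OF assms] by simp
next
  case (Suc k)
  interpret group G by fact
  have "lower_central G k \<subseteq> carrier G" using Suc subgroup.subset by blast
  thus ?case by (auto intro!: generate_is_subgroup)
qed

text \<open>A homomorphism carries commutators to commutators, so the claim passes from one stage to
  the generators of the next and then to the subgroup they generate.\<close>

lemma lower_central_hom:
  assumes "group G" "group H" "h \<in> hom G H" "x \<in> lower_central G k"
  shows "h x \<in> lower_central H k"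
  using assms(4)
proof (induction k arbitrary: x)
  case 0 thus ?case using assms(3) by (auto simp: hom_def)
next
  case (Suc k)
  interpret h: group_hom G H h using assms by (simp add: group_hom_def group_hom_axioms_def)
  have sub: "lower_central G k \<subseteq> carrier G"
    using lower_central_subgroup[OF assms(1)] subgroup.subset by blast
  have subH: "subgroup (lower_central H (Suc k)) H" by (rule lower_central_subgroup[OF assms(2)])
  let ?S = "{a \<otimes>\<^bsub>G\<^esub> b \<otimes>\<^bsub>G\<^esub> inv\<^bsub>G\<^esub> a \<otimes>\<^bsub>G\<^esub> inv\<^bsub>G\<^esub> b | a b. a \<in> carrier G \<and> b \<in> lower_central G k}"
  have S: "h s \<in> lower_central H (Suc k)" if "s \<in> ?S" for s
  proof -
    from that obtain a b where ab: "s = a \<otimes>\<^bsub>G\<^esub> b \<otimes>\<^bsub>G\<^esub> inv\<^bsub>G\<^esub> a \<otimes>\<^bsub>G\<^esub> inv\<^bsub>G\<^esub> b"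
      "a \<in> carrier G" "b \<in> lower_central G k" by blast
    have "h s = h a \<otimes>\<^bsub>H\<^esub> h b \<otimes>\<^bsub>H\<^esub> inv\<^bsub>H\<^esub> h a \<otimes>\<^bsub>H\<^esub> inv\<^bsub>H\<^esub> h b"
      using ab sub by (simp add: subset_iff)
    moreover have "h a \<in> carrier H" "h b \<in> lower_central H k" using ab Suc.IH[of b] by auto
    ultimately show ?thesis by (auto intro!: generate.incl)
  qed
  have SG: "?S \<subseteq> carrier G" using sub by (auto simp: subset_iff)
  from Suc.prems have "x \<in> generate G ?S" by simp
  thus ?case
  proof (induction rule: generate.induct)
    case one thus ?case using subgroup.one_closed[OF subH] by simp
  next
    case (incl s) thus ?case by (rule S)
  next
    case (inv s)
    hence "s \<in> carrier G" using SG by blast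
    thus ?case using subgroup.m_inv_closed[OF subH S[OF inv]] by simp
  next
    case (eng a b)
    have "a \<in> carrier G" "b \<in> carrier G"
      using eng(1,2) h.G.generate_in_carrier[OF SG] by auto
    thus ?case using subgroup.m_closed[OF subH eng(3,4)] by simp
  qed
qed

text \<open>Conjugation is an endomorphism, so normality is a case of
  \<open>lower_central_hom\<close>.\<close>

lemma lower_central_normal:
  assumes "group G" shows "lower_central G k \<lhd> G"
proof -
  interpret group G by fact
  show ?thesis unfolding normal_inv_iff
  proof (intro conjI ballI lower_central_subgroup[OF assms])
    fix x h assume x: "x \<in> carrier G" and h: "h \<in> lower_central G k"
    have "(\<lambda>h. x \<otimes>\<^bsub>G\<^esub> h \<otimes>\<^bsub>G\<^esub> inv\<^bsub>G\<^esub> x) \<in> hom G G"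
    proof (rule homI)
      fix a b assume ab: "a \<in> carrier G" "b \<in> carrier G"
      have "inv\<^bsub>G\<^esub> x \<otimes>\<^bsub>G\<^esub> (x \<otimes>\<^bsub>G\<^esub> (b \<otimes>\<^bsub>G\<^esub> inv\<^bsub>G\<^esub> x)) = b \<otimes>\<^bsub>G\<^esub> inv\<^bsub>G\<^esub> x"
        using x ab by (simp add: m_assoc[symmetric])
      thus "x \<otimes>\<^bsub>G\<^esub> (a \<otimes>\<^bsub>G\<^esub> b) \<otimes>\<^bsub>G\<^esub> inv\<^bsub>G\<^esub> x
        = x \<otimes>\<^bsub>G\<^esub> a \<otimes>\<^bsub>G\<^esub> inv\<^bsub>G\<^esub> x \<otimes>\<^bsub>G\<^esub> (x \<otimes>\<^bsub>G\<^esub> b \<otimes>\<^bsub>G\<^esub> inv\<^bsub>G\<^esub> x)"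
        using x ab by (simp add: m_assoc)
    qed (use x in simp)
    from lower_central_hom[OF assms assms this h]
    show "x \<otimes>\<^bsub>G\<^esub> h \<otimes>\<^bsub>G\<^esub> inv\<^bsub>G\<^esub> x \<in> lower_central G k" .
  qed
qed

section \<open>The quotients as relatively free groups\<close>

lemma nil_kernel_normal: "nil_kernel n p \<lhd> free_group p"
proof -
  interpret group "free_group p" by (rule free_group_group)
  show ?thesis
    by (cases n) (auto simp: nil_kernel_def lower_central_normal is_group one_is_normal)
qed

text \<open>Full invariance of the subgroup that is divided out; this is what lets homomorphisms of
  free groups descend.\<close>

lemma nil_kernel_hom:
  assumes "h \<in> hom (free_group p) (free_group q)" "x \<in> nil_kernel n p"
  shows "h x \<in> nil_kernel n q"
  using assms hom_one[OF assms(1) free_group_group free_group_group]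
  by (cases n) (auto simp: nil_kernel_def intro: lower_central_hom[OF free_group_group free_group_group])

lemma nil_group_group: "group (nil_group n p)"
  unfolding nil_group_def by (rule normal.factorgroup_is_group[OF nil_kernel_normal])

definition cls :: "enat \<Rightarrow> nat \<Rightarrow> word \<Rightarrow> word set" where
  "cls n p w = nil_kernel n p #>\<^bsub>free_group p\<^esub> w"

lemma cls_hom: "cls n p \<in> hom (free_group p) (nil_group n p)"
  unfolding cls_def[abs_def] nil_group_def by (rule normal.r_coset_hom_Mod[OF nil_kernel_normal])

lemma carrier_nil_group: "carrier (nil_group n p) = cls n p ` carrier (free_group p)"
  by (auto simp: nil_group_def FactGroup_def RCOSETS_def cls_def)

lemma cls_group_hom: "group_hom (free_group p) (nil_group n p) (cls n p)"
  by (simp add: group_hom_def group_hom_axioms_def free_group_group nil_group_group cls_hom)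

lemma cls_eqD:
  assumes "x \<in> carrier (free_group p)" "y \<in> carrier (free_group p)" "cls n p x = cls n p y"
  shows "x \<otimes>\<^bsub>free_group p\<^esub> inv\<^bsub>free_group p\<^esub> y \<in> nil_kernel n p"
proof -
  interpret N: normal "nil_kernel n p" "free_group p" by (rule nil_kernel_normal)
  have "x \<in> nil_kernel n p #>\<^bsub>free_group p\<^esub> y"
    using assms N.rcos_self[OF assms(1) N.is_subgroup] by (simp add: cls_def)
  then obtain k where "k \<in> nil_kernel n p" "x = k \<otimes>\<^bsub>free_group p\<^esub> y"
    by (auto simp: r_coset_def)
  thus ?thesis using assms(2) N.subset by (auto simp: N.m_assoc subset_iff)
qed

lemma cls_eqI:
  assumes "x \<in> carrier (free_group p)" "y \<in> carrier (free_group p)"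
    "x \<otimes>\<^bsub>free_group p\<^esub> inv\<^bsub>free_group p\<^esub> y \<in> nil_kernel n p"
  shows "cls n p x = cls n p y"
proof -
  interpret N: normal "nil_kernel n p" "free_group p" by (rule nil_kernel_normal)
  have "x = (x \<otimes>\<^bsub>free_group p\<^esub> inv\<^bsub>free_group p\<^esub> y) \<otimes>\<^bsub>free_group p\<^esub> y"
    using assms by (simp add: N.m_assoc)
  hence "x \<in> nil_kernel n p #>\<^bsub>free_group p\<^esub> y" using assms(3) by (auto simp: r_coset_def)
  thus ?thesis unfolding cls_def
    using N.repr_independence[OF _ assms(2) N.is_subgroup] by metis
qed

text \<open>Two representatives of a class differ by an element of the kernel, which
  \<open>h\<close> sends into the kernel of the target; so \<open>cls n q\<close> after
  \<open>h\<close> factors through the quotient.\<close>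

lemma nil_group_universal:
  assumes "h \<in> hom (free_group p) (free_group q)"
  obtains g where "g \<in> hom (nil_group n p) (nil_group n q)"
    "\<And>w. w \<in> carrier (free_group p) \<Longrightarrow> g (cls n p w) = cls n q (h w)"
proof -
  interpret h: group_hom "free_group p" "free_group q" h
    by (simp add: group_hom_def group_hom_axioms_def free_group_group assms)
  have "(\<lambda>w. cls n q (h w)) \<in> hom (free_group p) (nil_group n q)"
    using hom_compose[OF assms cls_hom, of n] by (simp add: o_def)
  moreover have "cls n q (h x) = cls n q (h y)"
    if "x \<in> carrier (free_group p)" "y \<in> carrier (free_group p)"
      "nil_kernel n p #>\<^bsub>free_group p\<^esub> x = nil_kernel n p #>\<^bsub>free_group p\<^esub> y" for x y
    using cls_eqD[of x p y n] that nil_kernel_hom[OF assms, of _ n]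
    by (intro cls_eqI) (auto simp: cls_def simp flip: h.hom_inv h.hom_mult)
  ultimately show ?thesis
    using FactGroup_universal[OF _ nil_kernel_normal, of "\<lambda>w. cls n q (h w)" p "nil_group n q" n] that
    unfolding nil_group_def cls_def by metis
qed

lemma nil_group_induct [consumes 1, case_names one gen mult inv]:
  assumes "x \<in> carrier (nil_group n p)"
    and "P \<one>\<^bsub>nil_group n p\<^esub>" and "\<And>i. i \<in> {1..p} \<Longrightarrow> P (cls n p (gen i))"
    and "\<And>u v. u \<in> carrier (nil_group n p) \<Longrightarrow> v \<in> carrier (nil_group n p) \<Longrightarrow> P u \<Longrightarrow> P v
      \<Longrightarrow> P (u \<otimes>\<^bsub>nil_group n p\<^esub> v)"
    and "\<And>u. u \<in> carrier (nil_group n p) \<Longrightarrow> P u \<Longrightarrow> P (inv\<^bsub>nil_group n p\<^esub> u)"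
  shows "P x"
proof -
  interpret cls: group_hom "free_group p" "nil_group n p" "cls n p" by (rule cls_group_hom)
  from assms(1) obtain w where "w \<in> carrier (free_group p)" "x = cls n p w"
    by (auto simp: carrier_nil_group)
  moreover from this(1) have "P (cls n p w)"
    by (induction rule: free_group_induct) (use assms(2-5) in auto)
  ultimately show ?thesis by simp
qed

lemma nil_hom_eqI:
  assumes "g \<in> hom (nil_group n p) H" "h \<in> hom (nil_group n p) H" "group H"
    and eq: "\<And>i. i \<in> {1..p} \<Longrightarrow> g (cls n p (gen i)) = h (cls n p (gen i))"
    and x: "x \<in> carrier (nil_group n p)"
  shows "g x = h x"
proof -
  interpret g: group_hom "nil_group n p" H g
    by (simp add: group_hom_def group_hom_axioms_def assms nil_group_group)
  interpret h: group_hom "nil_group n p" H h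
    by (simp add: group_hom_def group_hom_axioms_def assms nil_group_group)
  show ?thesis using x by (induction rule: nil_group_induct) (auto simp: eq)
qed

text \<open>The prescribed values are lifted to words in the free group of the target,
  \<open>lift\<close> extends them there, and the resulting homomorphism descends to the
  quotients.\<close>

lemma nil_hom_exists:
  assumes y: "\<And>i. i \<in> {1..p} \<Longrightarrow> y i \<in> carrier (nil_group n q)"
  obtains g where "g \<in> hom (nil_group n p) (nil_group n q)"
    "\<And>i. i \<in> {1..p} \<Longrightarrow> g (cls n p (gen i)) = y i"
proof -
  have "\<forall>i. \<exists>z. i \<in> {1..p} \<longrightarrow> z \<in> carrier (free_group q) \<and> cls n q z = y i"
    using y by (auto simp: carrier_nil_group) (metis imageE)
  then obtain z where z: "\<And>i. i \<in> {1..p} \<Longrightarrow> z i \<in> carrier (free_group q) \<and> cls n q (z i) = y i"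
    by metis
  have "lift (free_group q) z \<in> hom (free_group p) (free_group q)"
    by (rule lift_hom) (use z in \<open>auto simp: free_group_group\<close>)
  from nil_group_universal[OF this, of n] obtain g where "g \<in> hom (nil_group n p) (nil_group n q)"
    "\<And>w. w \<in> carrier (free_group p) \<Longrightarrow> g (cls n p w) = cls n q (lift (free_group q) z w)"
    by blast
  moreover have "lift (free_group q) z (gen i) = z i" if "i \<in> {1..p}" for i
    by (rule lift_gen[OF free_group_group, where p = p]) (use z that in auto)
  ultimately show ?thesis using z gen_closed by (intro that[of g]) auto
qed

section \<open>The infinite cyclic group\<close>

text \<open>Lifting the constant 1 to the integers gives the exponent sum, which kills commutators.
  These begin at stage \<open>Suc k\<close>, stage 0 being the whole group.\<close>

lemma lift_int_lower_central:
  assumes "x \<in> lower_central (free_group p) (Suc k)"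
  shows "lift integer_group (\<lambda>i. 1) x = 0"
proof -
  have l: "lift integer_group (\<lambda>i. 1) \<in> hom (free_group p) integer_group"
    by (rule lift_hom) auto
  interpret group_hom "free_group p" integer_group "lift integer_group (\<lambda>i. 1)"
    by (simp add: group_hom_def group_hom_axioms_def free_group_group l)
  let ?S = "{a \<otimes>\<^bsub>free_group p\<^esub> b \<otimes>\<^bsub>free_group p\<^esub> inv\<^bsub>free_group p\<^esub> a \<otimes>\<^bsub>free_group p\<^esub> inv\<^bsub>free_group p\<^esub> b
    | a b. a \<in> carrier (free_group p) \<and> b \<in> lower_central (free_group p) k}"
  have sub: "lower_central (free_group p) k \<subseteq> carrier (free_group p)"
    using lower_central_subgroup[OF free_group_group] subgroup.subset by blast
  hence SG: "?S \<subseteq> carrier (free_group p)" by (auto simp: subset_iff)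
  have S: "lift integer_group (\<lambda>i. 1) s = 0" if "s \<in> ?S" for s
    using that sub by (auto simp: subset_iff)
  from assms have "x \<in> generate (free_group p) ?S" by simp
  thus ?thesis
  proof (induction rule: generate.induct)
    case one
    then show ?case using hom_one by simp
  next
    case (incl s) thus ?case by (rule S)
  next
    case (inv s)
    hence "s \<in> carrier (free_group p)" using SG by blast
    then show ?case using S[OF inv] by simp
  next
    case (eng a b)
    have "a \<in> carrier (free_group p)" "b \<in> carrier (free_group p)"
      using eng(1,2) G.generate_in_carrier[OF SG] by auto
    thus ?case using eng by simp
  qed
qed

text \<open>The object \<open>1\<close> is an argument of most constants below; rewriting it to \<open>Suc 0\<close> would block
  the lemmas about them.\<close>
declare One_nat_def [simp del]

definition zgen :: "enat \<Rightarrow> word set" where "zgen n = cls n 1 (gen 1)"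

lemma zgen_closed: "zgen n \<in> carrier (nil_group n 1)"
  using gen_closed[of 1 1] hom_in_carrier[OF cls_hom] by (auto simp: zgen_def)

text \<open>Injectivity comes from the exponent sum, which vanishes on \<open>nil_kernel\<close>.
  Here \<open>1 \<le> n\<close> enters: stage 0 would divide out the whole group.\<close>

lemma zgen_pow_bij:
  assumes "1 \<le> n"
  shows "bij_betw (\<lambda>e::int. zgen n [^]\<^bsub>nil_group n 1\<^esub> e) UNIV (carrier (nil_group n 1))"
proof -
  interpret N: group "nil_group n 1" by (rule nil_group_group)
  interpret cls: group_hom "free_group 1" "nil_group n 1" "cls n 1" by (rule cls_group_hom)
  have l: "lift integer_group (\<lambda>i. 1) \<in> hom (free_group 1) integer_group"
    by (rule lift_hom) simp_all
  interpret l: group_hom "free_group 1" integer_group "lift integer_group (\<lambda>i. 1)"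
    by (intro group_hom.intro group_hom_axioms.intro free_group_group group_integer_group l)
  have g: "gen 1 \<in> carrier (free_group 1)" by (simp add: gen_closed)
  have k: "lift integer_group (\<lambda>i. 1) x = 0" if "x \<in> nil_kernel n 1" for x
  proof (cases n)
    case (enat m)
    then obtain k where "m = Suc k" using assms by (cases m) (auto simp: zero_enat_def[symmetric])
    thus ?thesis using that enat lift_int_lower_central[of x 1 k] by (simp add: nil_kernel_def)
  next
    case infinity
    thus ?thesis using that l.hom_one by (simp add: nil_kernel_def)
  qed
  have lg: "lift integer_group (\<lambda>i. 1) (gen 1) = 1"
    by (subst lift_gen[of _ 1]) auto
  have pow: "zgen n [^]\<^bsub>nil_group n 1\<^esub> (e::int) = cls n 1 (gen 1 [^]\<^bsub>free_group 1\<^esub> e)" for e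
    unfolding zgen_def by (rule cls.hom_int_pow[OF g, symmetric])
  show ?thesis unfolding bij_betw_def
  proof
    show "inj (\<lambda>e::int. zgen n [^]\<^bsub>nil_group n 1\<^esub> e)"
    proof (rule injI)
      fix e f :: int assume "zgen n [^]\<^bsub>nil_group n 1\<^esub> e = zgen n [^]\<^bsub>nil_group n 1\<^esub> f"
      hence "gen 1 [^]\<^bsub>free_group 1\<^esub> e \<otimes>\<^bsub>free_group 1\<^esub> inv\<^bsub>free_group 1\<^esub> (gen 1 [^]\<^bsub>free_group 1\<^esub> f) \<in> nil_kernel n 1"
        using g by (intro cls_eqD) (auto simp: pow)
      from k[OF this] have "lift integer_group (\<lambda>i. 1) (gen 1 [^]\<^bsub>free_group 1\<^esub> e)
         = lift integer_group (\<lambda>i. 1) (gen 1 [^]\<^bsub>free_group 1\<^esub> f)"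
        using g by simp
      thus "e = f" using g lg by (simp add: l.hom_int_pow group_int_pow_integer_group)
    qed
    show "range (\<lambda>e::int. zgen n [^]\<^bsub>nil_group n 1\<^esub> e) = carrier (nil_group n 1)"
    proof (intro equalityI subsetI)
      fix x assume "x \<in> carrier (nil_group n 1)"
      thus "x \<in> range (\<lambda>e::int. zgen n [^]\<^bsub>nil_group n 1\<^esub> e)"
      proof (induction rule: nil_group_induct)
        case one
        then show ?case by (metis int_pow_0 rangeI)
      next
        case (gen i)
        hence "cls n 1 (gen i) = zgen n [^]\<^bsub>nil_group n 1\<^esub> (1::int)"
          using N.int_pow_1[OF zgen_closed] by (simp add: zgen_def)
        thus ?case by blast
      next
        case (mult u v)
        then show ?case using zgen_closed[of n] by (auto simp flip: N.int_pow_mult)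
      next
        case (inv u)
        then show ?case using zgen_closed[of n] by (auto simp flip: N.int_pow_neg)
      qed
    qed (use zgen_closed in auto)
  qed
qed

section \<open>The category opposite to free nilpotent groups\<close>

definition act :: "nil_arr \<Rightarrow> word set \<Rightarrow> word set" where "act u = snd (snd u)"

text \<open>A homomorphism from the cyclic group is determined by its value on the generator;
  \<open>el\<close> identifies the operations of p variables, that is the maps from p to 1, with the
  elements of \<open>nil_group n p\<close>.\<close>

definition el :: "enat \<Rightarrow> nil_arr \<Rightarrow> word set" where "el n w = act w (zgen n)"

text \<open>Projections are indexed from \<open>0\<close>, generators from \<open>1\<close>.\<close>

definition pr :: "enat \<Rightarrow> nat \<Rightarrow> nat \<Rightarrow> nil_arr" where "pr n p k = nil_shift n k 1 p"

lemma Obj_nil_op [simp]: "Obj (nil_op n) = UNIV"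
  by (simp add: op_cat_def nil_cat_def)

lemma Ident_nil_op: "Ident (nil_op n) p = (p, p, \<lambda>x \<in> carrier (nil_group n p). x)"
  by (simp add: op_cat_def nil_cat_def)

lemma Hom_nil_op:
  "u \<in> Hom (nil_op n) p q \<longleftrightarrow> fst u = q \<and> fst (snd u) = p \<and>
    act u \<in> hom (nil_group n q) (nil_group n p) \<and> act u \<in> extensional (carrier (nil_group n q))"
  by (auto simp: Hom_def op_cat_def nil_cat_def act_def split: prod.splits)

lemma act_hom: "u \<in> Hom (nil_op n) p q \<Longrightarrow> act u \<in> hom (nil_group n q) (nil_group n p)"
  by (simp add: Hom_nil_op)

lemma act_closed:
  "u \<in> Hom (nil_op n) p q \<Longrightarrow> x \<in> carrier (nil_group n q) \<Longrightarrow> act u x \<in> carrier (nil_group n p)"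
  using act_hom hom_in_carrier by metis

lemma comp_nil_op:
  assumes "u \<in> Hom (nil_op n) p q" "w \<in> Hom (nil_op n) q r"
  shows "w \<cdot>\<^bsub>nil_op n\<^esub> u = (r, p, compose (carrier (nil_group n r)) (act u) (act w))"
  using assms[unfolded Hom_nil_op]
  by (cases u; cases w) (auto simp: act_def op_cat_def nil_cat_def)

lemma act_comp:
  assumes "u \<in> Hom (nil_op n) p q" "w \<in> Hom (nil_op n) q r" "x \<in> carrier (nil_group n r)"
  shows "act (w \<cdot>\<^bsub>nil_op n\<^esub> u) x = act u (act w x)"
  using assms(3) by (simp add: comp_nil_op[OF assms(1,2)]) (simp add: act_def compose_def)

lemma nil_op_eqI:
  assumes "u \<in> Hom (nil_op n) p q" "v \<in> Hom (nil_op n) p q"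
    "\<And>x. x \<in> carrier (nil_group n q) \<Longrightarrow> act u x = act v x"
  shows "u = v"
proof -
  have "act u = act v" using assms by (auto simp: Hom_nil_op intro: extensionalityI)
  thus ?thesis using assms by (auto simp: Hom_nil_op act_def prod_eq_iff)
qed

lemma restrict_hom:
  assumes "group G" "h \<in> hom G H" shows "restrict h (carrier G) \<in> hom G H"
proof -
  interpret group G by fact
  show ?thesis using assms(2) by (auto simp: hom_def)
qed

lemma Ident_nil_op_Hom: "Ident (nil_op n) p \<in> Hom (nil_op n) p p"
  using restrict_hom[OF nil_group_group, of "\<lambda>x. x" n p "nil_group n p"]
  by (simp add: Hom_nil_op Ident_nil_op act_def hom_def)

lemma comp_nil_op_Hom:
  assumes "u \<in> Hom (nil_op n) p q" "w \<in> Hom (nil_op n) q r"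
  shows "w \<cdot>\<^bsub>nil_op n\<^esub> u \<in> Hom (nil_op n) p r"
proof -
  have "compose (carrier (nil_group n r)) (act u) (act w) \<in> hom (nil_group n r) (nil_group n p)"
    using restrict_hom[OF nil_group_group hom_compose[OF act_hom[OF assms(2)] act_hom[OF assms(1)]]]
    by (simp add: compose_def o_def)
  thus ?thesis by (simp add: comp_nil_op[OF assms] Hom_nil_op) (simp add: act_def)
qed

lemma nil_op_category: "category (nil_op n)"
proof
  fix f X Y assume f: "f \<in> Hom (nil_op n) X Y"
  show "f \<cdot>\<^bsub>nil_op n\<^esub> Ident (nil_op n) X = f"
    by (rule nil_op_eqI[OF comp_nil_op_Hom[OF Ident_nil_op_Hom f] f], subst act_comp[OF Ident_nil_op_Hom f])
      (use act_closed[OF f] in \<open>auto simp: Ident_nil_op act_def\<close>)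
  show "Ident (nil_op n) Y \<cdot>\<^bsub>nil_op n\<^esub> f = f"
    by (rule nil_op_eqI[OF comp_nil_op_Hom[OF f Ident_nil_op_Hom] f], subst act_comp[OF f Ident_nil_op_Hom])
      (auto simp: Ident_nil_op act_def)
next
  fix f W X g Y h Z
  assume fgh: "f \<in> Hom (nil_op n) W X" "g \<in> Hom (nil_op n) X Y" "h \<in> Hom (nil_op n) Y Z"
  note hg = comp_nil_op_Hom[OF fgh(2,3)] and gf = comp_nil_op_Hom[OF fgh(1,2)]
  show "h \<cdot>\<^bsub>nil_op n\<^esub> g \<cdot>\<^bsub>nil_op n\<^esub> f = h \<cdot>\<^bsub>nil_op n\<^esub> (g \<cdot>\<^bsub>nil_op n\<^esub> f)"
    by (rule nil_op_eqI[OF comp_nil_op_Hom[OF fgh(1) hg] comp_nil_op_Hom[OF gf fgh(3)]])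
      (simp add: act_comp[OF fgh(1) hg] act_comp[OF gf fgh(3)] act_comp[OF fgh(2,3)]
         act_comp[OF fgh(1,2)] act_closed[OF fgh(3)])
qed (use Ident_nil_op_Hom comp_nil_op_Hom in auto)

interpretation nil_op: category "nil_op n" for n by (rule nil_op_category)

lemma map_shift_hom:
  assumes "s + p \<le> r"
  shows "map (\<lambda>(i, e). (s + i, e)) \<in> hom (free_group p) (free_group r)"
proof -
  let ?sh = "\<lambda>(i, e). (s + i, e) :: nat \<times> bool"
  have c: "map ?sh (cancel_cons x w) = cancel_cons (?sh x) (map ?sh w)" for x w
    by (cases w; cases x) auto
  have "map ?sh (foldr cancel_cons u v) = foldr cancel_cons (map ?sh u) (map ?sh v)" for u v
    by (induction u) (simp_all add: c)
  moreover have "map ?sh w \<in> carrier (free_group r)" if "w \<in> carrier (free_group p)" for w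
    using that assms unfolding mem_carrier_free_group reduced_def successively_map
    by (auto elim!: successively_mono simp: split_beta image_subset_iff)
  ultimately show ?thesis by (auto simp: hom_def mult_free_group)
qed

text \<open>\<open>nil_shift\<close> is given on classes as the product of the kernel with an image
  set. That set is one coset because shifting maps kernel into kernel.\<close>

lemma nil_shift_cls:
  assumes "s + p \<le> r" "w \<in> carrier (free_group p)"
  shows "act (nil_shift n s p r) (cls n p w) = cls n r (map (\<lambda>(i, e). (s + i, e)) w)"
proof -
  let ?m = "map (\<lambda>(i, e). (s + i, e) :: nat \<times> bool)"
  interpret m: group_hom "free_group p" "free_group r" ?m
    by (simp add: group_hom_def group_hom_axioms_def free_group_group map_shift_hom assms(1))
  interpret N: normal "nil_kernel n r" "free_group r" by (rule nil_kernel_normal)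
  interpret M: normal "nil_kernel n p" "free_group p" by (rule nil_kernel_normal)
  note N_assoc = monoid.m_assoc[OF group.is_monoid[OF free_group_group]]
  have "nil_kernel n r <#>\<^bsub>free_group r\<^esub> (?m ` cls n p w) = cls n r (?m w)"
  proof (intro equalityI subsetI)
    fix x assume "x \<in> nil_kernel n r <#>\<^bsub>free_group r\<^esub> (?m ` cls n p w)"
    then obtain a b where ab: "a \<in> nil_kernel n r" "b \<in> nil_kernel n p"
      "x = a \<otimes>\<^bsub>free_group r\<^esub> ?m (b \<otimes>\<^bsub>free_group p\<^esub> w)"
      by (auto simp: set_mult_def cls_def r_coset_def)
    have "x = (a \<otimes>\<^bsub>free_group r\<^esub> ?m b) \<otimes>\<^bsub>free_group r\<^esub> ?m w"
      using ab assms(2) M.subset N.subset m.hom_mult[of b w] m.hom_closed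
      by (simp add: subset_iff N_assoc)
    moreover have "a \<otimes>\<^bsub>free_group r\<^esub> ?m b \<in> nil_kernel n r"
      using ab nil_kernel_hom[OF map_shift_hom[OF assms(1)]] by (auto intro: N.m_closed)
    ultimately show "x \<in> cls n r (?m w)" by (auto simp: cls_def r_coset_def)
  next
    fix x assume "x \<in> cls n r (?m w)"
    then obtain a where "a \<in> nil_kernel n r" "x = a \<otimes>\<^bsub>free_group r\<^esub> ?m w"
      by (auto simp: cls_def r_coset_def)
    moreover have "w \<in> cls n p w" unfolding cls_def
      using group.rcos_self[OF free_group_group assms(2) M.is_subgroup] .
    ultimately show "x \<in> nil_kernel n r <#>\<^bsub>free_group r\<^esub> (?m ` cls n p w)"
      by (auto simp: set_mult_def)
  qed
  moreover have "cls n p w \<in> carrier (nil_group n p)" using assms(2) by (auto simp: carrier_nil_group)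
  ultimately show ?thesis by (simp add: nil_shift_def act_def)
qed

lemma nil_shift_Hom:
  assumes "s + p \<le> r" shows "nil_shift n s p r \<in> Hom (nil_op n) r p"
proof -
  obtain g where g: "g \<in> hom (nil_group n p) (nil_group n r)"
    "\<And>w. w \<in> carrier (free_group p) \<Longrightarrow> g (cls n p w) = cls n r (map (\<lambda>(i, e). (s + i, e)) w)"
    using nil_group_universal[OF map_shift_hom[OF assms]] by blast
  have eq: "act (nil_shift n s p r) x = g x" if "x \<in> carrier (nil_group n p)" for x
    using that g(2) nil_shift_cls[OF assms] by (auto simp: carrier_nil_group)
  have "restrict (act (nil_shift n s p r)) (carrier (nil_group n p))
      = restrict g (carrier (nil_group n p))"
    by (rule restrict_ext) (rule eq)
  hence "act (nil_shift n s p r) = restrict g (carrier (nil_group n p))"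
    by (simp add: nil_shift_def act_def)
  hence "act (nil_shift n s p r) \<in> hom (nil_group n p) (nil_group n r)"
    using restrict_hom[OF nil_group_group g(1)] by simp
  thus ?thesis by (simp add: Hom_nil_op) (simp add: nil_shift_def act_def)
qed

lemma nil_shift_gen:
  assumes "s + p \<le> r" "i \<in> {1..p}"
  shows "act (nil_shift n s p r) (cls n p (gen i)) = cls n r (gen (s + i))"
  using nil_shift_cls[OF assms(1) gen_closed[OF assms(2)], of n] by (simp add: gen_def)

lemma pr_Hom: "k < p \<Longrightarrow> pr n p k \<in> Hom (nil_op n) p 1"
  by (simp add: pr_def nil_shift_Hom)

lemma el_pr: "k < p \<Longrightarrow> el n (pr n p k) = cls n p (gen (Suc k))"
  using nil_shift_gen[of k 1 p 1 n] by (simp add: pr_def el_def zgen_def One_nat_def)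

lemma nil_op_gen_eqI:
  assumes "u \<in> Hom (nil_op n) p q" "v \<in> Hom (nil_op n) p q"
    "\<And>i. i \<in> {1..q} \<Longrightarrow> act u (cls n q (gen i)) = act v (cls n q (gen i))"
  shows "u = v"
  by (rule nil_op_eqI[OF assms(1,2)])
    (rule nil_hom_eqI[OF act_hom[OF assms(1)] act_hom[OF assms(2)] nil_group_group assms(3)])

lemma nil_op_gen_exists:
  assumes "\<And>i. i \<in> {1..q} \<Longrightarrow> y i \<in> carrier (nil_group n p)"
  obtains u where "u \<in> Hom (nil_op n) p q" "\<And>i. i \<in> {1..q} \<Longrightarrow> act u (cls n q (gen i)) = y i"
proof -
  obtain g where g: "g \<in> hom (nil_group n q) (nil_group n p)"
    "\<And>i. i \<in> {1..q} \<Longrightarrow> g (cls n q (gen i)) = y i"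
    by (rule nil_hom_exists[of q y n p]) (use assms in auto)
  let ?u = "(q, p, restrict g (carrier (nil_group n q)))"
  have "restrict g (carrier (nil_group n q)) \<in> hom (nil_group n q) (nil_group n p)"
    by (rule restrict_hom[OF nil_group_group g(1)])
  hence "?u \<in> Hom (nil_op n) p q" by (simp add: Hom_nil_op act_def)
  moreover have "act ?u (cls n q (gen i)) = y i" if "i \<in> {1..q}" for i
    using g(2) that gen_closed by (auto simp: act_def carrier_nil_group)
  ultimately show ?thesis by (rule that)
qed

section \<open>Operations as elements of free nilpotent groups\<close>

lemma el_closed: "w \<in> Hom (nil_op n) p 1 \<Longrightarrow> el n w \<in> carrier (nil_group n p)"
  unfolding el_def by (rule act_closed[OF _ zgen_closed])

lemma el_inj:
  assumes "v \<in> Hom (nil_op n) p 1" "w \<in> Hom (nil_op n) p 1" "el n v = el n w" shows "v = w"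
  by (rule nil_op_gen_eqI[OF assms(1,2)]) (use assms(3) in \<open>auto simp: el_def zgen_def\<close>)

lemma el_surj:
  assumes "x \<in> carrier (nil_group n p)" obtains w where "w \<in> Hom (nil_op n) p 1" "el n w = x"
  by (rule nil_op_gen_exists[of 1 "\<lambda>_. x" n p]) (use assms in \<open>auto simp: el_def zgen_def\<close>)

lemma el_comp:
  assumes "u \<in> Hom (nil_op n) p q" "w \<in> Hom (nil_op n) q 1"
  shows "el n (w \<cdot>\<^bsub>nil_op n\<^esub> u) = act u (el n w)"
  unfolding el_def by (rule act_comp[OF assms zgen_closed])

lemma el_pr_comp:
  assumes "u \<in> Hom (nil_op n) p q" "k < q"
  shows "el n (pr n q k \<cdot>\<^bsub>nil_op n\<^esub> u) = act u (cls n q (gen (Suc k)))"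
  using el_comp[OF assms(1) pr_Hom[OF assms(2)]] el_pr[OF assms(2)] by simp

text \<open>Composition with projection k is evaluation at generator \<open>Suc k\<close>, so the
  projections are jointly monic because the generators generate.\<close>

lemma nil_op_joint_monic:
  assumes "u \<in> Hom (nil_op n) p q" "v \<in> Hom (nil_op n) p q"
    "\<And>k. k < q \<Longrightarrow> pr n q k \<cdot>\<^bsub>nil_op n\<^esub> u = pr n q k \<cdot>\<^bsub>nil_op n\<^esub> v"
  shows "u = v"
proof (rule nil_op_gen_eqI[OF assms(1,2)])
  fix i assume "i \<in> {1..q}"
  then obtain k where "i = Suc k" "k < q" by (cases i) auto
  thus "act u (cls n q (gen i)) = act v (cls n q (gen i))"
    using assms(3) el_pr_comp[OF assms(1)] el_pr_comp[OF assms(2)] by metis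
qed

section \<open>Finite products in the theory\<close>

definition tup :: "enat \<Rightarrow> nat \<Rightarrow> nat \<Rightarrow> (nat \<Rightarrow> nil_arr) \<Rightarrow> nil_arr" where
  "tup n p q w = (THE u. u \<in> Hom (nil_op n) p q \<and> (\<forall>k<q. pr n q k \<cdot>\<^bsub>nil_op n\<^esub> u = w k))"

lemma tup:
  assumes "\<And>k. k < q \<Longrightarrow> w k \<in> Hom (nil_op n) p 1"
  shows tup_Hom: "tup n p q w \<in> Hom (nil_op n) p q"
    and pr_tup: "\<And>k. k < q \<Longrightarrow> pr n q k \<cdot>\<^bsub>nil_op n\<^esub> tup n p q w = w k"
proof -
  obtain u where u: "u \<in> Hom (nil_op n) p q"
    "\<And>i. i \<in> {1..q} \<Longrightarrow> act u (cls n q (gen i)) = el n (w (i - 1))"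
    by (rule nil_op_gen_exists[of q "\<lambda>i. el n (w (i - 1))" n p]) (use assms in \<open>auto intro!: el_closed\<close>)
  have "pr n q k \<cdot>\<^bsub>nil_op n\<^esub> u = w k" if k: "k < q" for k
  proof (rule el_inj[OF _ assms[OF k]])
    show "pr n q k \<cdot>\<^bsub>nil_op n\<^esub> u \<in> Hom (nil_op n) p 1"
      using nil_op.Comp_Hom[OF u(1) pr_Hom[OF k]] .
    show "el n (pr n q k \<cdot>\<^bsub>nil_op n\<^esub> u) = el n (w k)" using el_pr_comp[OF u(1) k] u(2) k by simp
  qed
  hence "\<exists>!u. u \<in> Hom (nil_op n) p q \<and> (\<forall>k<q. pr n q k \<cdot>\<^bsub>nil_op n\<^esub> u = w k)"
    using u(1) nil_op_joint_monic by metis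
  from theI'[OF this] show "tup n p q w \<in> Hom (nil_op n) p q"
    "\<And>k. k < q \<Longrightarrow> pr n q k \<cdot>\<^bsub>nil_op n\<^esub> tup n p q w = w k"
    unfolding tup_def by auto
qed

lemma nil_pr1_Hom: "nil_pr1 n p q \<in> Hom (nil_op n) (p + q) p"
  and nil_pr2_Hom: "nil_pr2 n p q \<in> Hom (nil_op n) (p + q) q"
  by (simp_all add: nil_pr1_def nil_pr2_def nil_shift_Hom)

lemma pr_nil_pr1:
  assumes "k < p" shows "pr n p k \<cdot>\<^bsub>nil_op n\<^esub> nil_pr1 n p q = pr n (p + q) k"
proof (rule el_inj)
  show "el n (pr n p k \<cdot>\<^bsub>nil_op n\<^esub> nil_pr1 n p q) = el n (pr n (p + q) k)"
    unfolding el_pr_comp[OF nil_pr1_Hom assms]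
    using assms by (simp add: nil_pr1_def nil_shift_gen el_pr)
qed (use assms nil_op.Comp_Hom[OF nil_pr1_Hom pr_Hom[OF assms]] pr_Hom in auto)

lemma pr_nil_pr2:
  assumes "k < q" shows "pr n q k \<cdot>\<^bsub>nil_op n\<^esub> nil_pr2 n p q = pr n (p + q) (p + k)"
proof (rule el_inj)
  show "el n (pr n q k \<cdot>\<^bsub>nil_op n\<^esub> nil_pr2 n p q) = el n (pr n (p + q) (p + k))"
    unfolding el_pr_comp[OF nil_pr2_Hom assms]
    using assms by (simp add: nil_pr2_def nil_shift_gen el_pr)
qed (use assms nil_op.Comp_Hom[OF nil_pr2_Hom pr_Hom[OF assms]] pr_Hom in auto)

lemma pr_1_0: "pr n 1 0 = Ident (nil_op n) 1"
proof (rule el_inj)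
  show "el n (pr n 1 0) = el n (Ident (nil_op n) 1)"
    using zgen_closed[of n] by (subst el_pr) (auto simp: el_def Ident_nil_op act_def zgen_def One_nat_def)
qed (use pr_Hom[of 0 1] nil_op.Ident_Hom[of 1] in auto)

section \<open>The zero object and the zero maps of the theory\<close>

lemma nil_op_terminal: "u \<in> Hom (nil_op n) p 0 \<Longrightarrow> v \<in> Hom (nil_op n) p 0 \<Longrightarrow> u = v"
  by (rule nil_op_joint_monic) auto

lemma carrier_nil_group_0: "carrier (nil_group n 0) = {\<one>\<^bsub>nil_group n 0\<^esub>}"
proof -
  have "carrier (free_group 0) = {\<one>\<^bsub>free_group 0\<^esub>}"
    by (auto simp: mem_carrier_free_group one_free_group)
  thus ?thesis using hom_one[OF cls_hom free_group_group nil_group_group] by (simp add: carrier_nil_group)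
qed

text \<open>A map out of 0 is a homomorphism into the trivial group. Together with
  \<open>nil_op_terminal\<close> this makes 0 a zero object.\<close>

lemma nil_op_initial:
  assumes "u \<in> Hom (nil_op n) 0 p" "v \<in> Hom (nil_op n) 0 p" shows "u = v"
  by (rule nil_op_eqI[OF assms])
    (use act_closed[OF assms(1)] act_closed[OF assms(2)] carrier_nil_group_0 in auto)

abbreviation nz :: "enat \<Rightarrow> nat \<Rightarrow> nat \<Rightarrow> nil_arr" where "nz n \<equiv> zero_map (nil_op n) 0"

lemma nz_eq:
  assumes "u \<in> Hom (nil_op n) p 0" "v \<in> Hom (nil_op n) 0 q"
  shows "nz n p q = v \<cdot>\<^bsub>nil_op n\<^esub> u"
  unfolding zero_map_def using assms nil_op_terminal nil_op_initial by (intro the_equality) metis+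

lemma nz_factors:
  obtains u v where "u \<in> Hom (nil_op n) p 0" "v \<in> Hom (nil_op n) 0 q" "nz n p q = v \<cdot>\<^bsub>nil_op n\<^esub> u"
proof -
  obtain u where "u \<in> Hom (nil_op n) p 0" using tup_Hom[of 0 undefined n p] by auto
  moreover obtain v where "v \<in> Hom (nil_op n) 0 q"
    by (rule nil_op_gen_exists[of q "\<lambda>_. \<one>\<^bsub>nil_group n 0\<^esub>"]) (auto simp: carrier_nil_group_0)
  ultimately show ?thesis using nz_eq that by blast
qed

lemma nz_Hom: "nz n p q \<in> Hom (nil_op n) p q"
  using nz_factors nil_op.Comp_Hom by metis

lemma comp_nz:
  assumes "w \<in> Hom (nil_op n) q r" shows "w \<cdot>\<^bsub>nil_op n\<^esub> nz n p q = nz n p r"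
proof -
  obtain u v where uv: "u \<in> Hom (nil_op n) p 0" "v \<in> Hom (nil_op n) 0 q" "nz n p q = v \<cdot>\<^bsub>nil_op n\<^esub> u"
    by (rule nz_factors)
  show ?thesis using nz_eq[OF uv(1) nil_op.Comp_Hom[OF uv(2) assms]]
    by (simp add: uv(3) nil_op.Comp_assoc[OF uv(1,2) assms])
qed

lemma nz_comp:
  assumes "w \<in> Hom (nil_op n) p q" shows "nz n q r \<cdot>\<^bsub>nil_op n\<^esub> w = nz n p r"
proof -
  obtain u v where uv: "u \<in> Hom (nil_op n) q 0" "v \<in> Hom (nil_op n) 0 r" "nz n q r = v \<cdot>\<^bsub>nil_op n\<^esub> u"
    by (rule nz_factors)
  show ?thesis using nz_eq[OF nil_op.Comp_Hom[OF assms uv(1)] uv(2)]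
    by (simp add: uv(3) nil_op.Comp_assoc[OF assms uv(1,2)])
qed

lemma el_nz: "el n (nz n p 1) = \<one>\<^bsub>nil_group n p\<^esub>"
proof -
  obtain u v where uv: "u \<in> Hom (nil_op n) p 0" "v \<in> Hom (nil_op n) 0 1" "nz n p 1 = v \<cdot>\<^bsub>nil_op n\<^esub> u"
    by (rule nz_factors)
  have "el n v = \<one>\<^bsub>nil_group n 0\<^esub>" using el_closed[OF uv(2)] carrier_nil_group_0 by auto
  thus ?thesis using el_comp[OF uv(1,2)] uv(3) hom_one[OF act_hom[OF uv(1)] nil_group_group nil_group_group]
    by simp
qed

section \<open>The multiplication and induction over operations\<close>

definition mu :: "enat \<Rightarrow> nil_arr" where
  "mu n = (THE w. w \<in> Hom (nil_op n) 2 1 \<and>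
     el n w = cls n 2 (gen 1) \<otimes>\<^bsub>nil_group n 2\<^esub> cls n 2 (gen 2))"

lemma mu: shows mu_Hom: "mu n \<in> Hom (nil_op n) 2 1"
  and el_mu: "el n (mu n) = cls n 2 (gen 1) \<otimes>\<^bsub>nil_group n 2\<^esub> cls n 2 (gen 2)"
proof -
  have "cls n 2 (gen 1) \<in> carrier (nil_group n 2)" "cls n 2 (gen 2) \<in> carrier (nil_group n 2)"
    using gen_closed[of 1 2] gen_closed[of 2 2] by (auto simp: carrier_nil_group)
  hence "cls n 2 (gen 1) \<otimes>\<^bsub>nil_group n 2\<^esub> cls n 2 (gen 2) \<in> carrier (nil_group n 2)"
    by (rule monoid.m_closed[OF group.is_monoid[OF nil_group_group]])
  then obtain w where "w \<in> Hom (nil_op n) 2 1"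
    "el n w = cls n 2 (gen 1) \<otimes>\<^bsub>nil_group n 2\<^esub> cls n 2 (gen 2)"
    by (rule el_surj)
  hence "\<exists>!w. w \<in> Hom (nil_op n) 2 1 \<and> el n w = cls n 2 (gen 1) \<otimes>\<^bsub>nil_group n 2\<^esub> cls n 2 (gen 2)"
    using el_inj by metis
  from theI'[OF this] show "mu n \<in> Hom (nil_op n) 2 1"
    "el n (mu n) = cls n 2 (gen 1) \<otimes>\<^bsub>nil_group n 2\<^esub> cls n 2 (gen 2)"
    by (simp_all add: mu_def)
qed

lemma el_mu_comp:
  assumes "u \<in> Hom (nil_op n) p 2"
  shows "el n (mu n \<cdot>\<^bsub>nil_op n\<^esub> u)
    = el n (pr n 2 0 \<cdot>\<^bsub>nil_op n\<^esub> u) \<otimes>\<^bsub>nil_group n p\<^esub> el n (pr n 2 1 \<cdot>\<^bsub>nil_op n\<^esub> u)"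
proof -
  have "cls n 2 (gen 1) \<in> carrier (nil_group n 2)" "cls n 2 (gen 2) \<in> carrier (nil_group n 2)"
    using gen_closed[of 1 2] gen_closed[of 2 2] by (auto simp: carrier_nil_group)
  thus ?thesis unfolding el_comp[OF assms mu_Hom] el_mu
    using hom_mult[OF act_hom[OF assms]] el_pr_comp[OF assms] by (simp add: numeral_2_eq_2 One_nat_def)
qed

text \<open>The inverse case speaks of a pair whose product is zero instead of an inverse: a
  property that is additive along \<open>mu\<close> then passes from the first component to the
  second by cancellation.\<close>

lemma nil_op_induct [consumes 1, case_names zero pr mult inv]:
  assumes w: "w \<in> Hom (nil_op n) p 1"
    and "P (nz n p 1)" and "\<And>k. k < p \<Longrightarrow> P (pr n p k)"
    and mult: "\<And>u. u \<in> Hom (nil_op n) p 2 \<Longrightarrow> P (pr n 2 0 \<cdot>\<^bsub>nil_op n\<^esub> u) \<Longrightarrow> P (pr n 2 1 \<cdot>\<^bsub>nil_op n\<^esub> u)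
      \<Longrightarrow> P (mu n \<cdot>\<^bsub>nil_op n\<^esub> u)"
    and inv: "\<And>u. u \<in> Hom (nil_op n) p 2 \<Longrightarrow> mu n \<cdot>\<^bsub>nil_op n\<^esub> u = nz n p 1
      \<Longrightarrow> P (pr n 2 0 \<cdot>\<^bsub>nil_op n\<^esub> u) \<Longrightarrow> P (pr n 2 1 \<cdot>\<^bsub>nil_op n\<^esub> u)"
  shows "P w"
proof -
  interpret N: group "nil_group n p" by (rule nil_group_group)
  have pair: "\<exists>u. u \<in> Hom (nil_op n) p 2 \<and> pr n 2 0 \<cdot>\<^bsub>nil_op n\<^esub> u = a \<and> pr n 2 1 \<cdot>\<^bsub>nil_op n\<^esub> u = b"
    if "a \<in> Hom (nil_op n) p 1" "b \<in> Hom (nil_op n) p 1" for a b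
  proof -
    have w: "(if k = 0 then a else b) \<in> Hom (nil_op n) p 1" for k :: nat using that by simp
    show ?thesis
      using tup_Hom[of 2 "\<lambda>k. if k = 0 then a else b" n p, OF w]
        pr_tup[of 2 "\<lambda>k. if k = 0 then a else b" n p, OF w, of 0]
        pr_tup[of 2 "\<lambda>k. if k = 0 then a else b" n p, OF w, of 1]
      by (intro exI[of _ "tup n p 2 (\<lambda>k. if k = 0 then a else b)"]) simp
  qed
  have "\<forall>w. w \<in> Hom (nil_op n) p 1 \<and> el n w = x \<longrightarrow> P w" if "x \<in> carrier (nil_group n p)" for x
    using that
  proof (induction rule: nil_group_induct)
    case one
    thus ?case using el_nz[of n p] el_inj nz_Hom assms(2) by metis
  next
    case (gen i)
    then obtain k where "i = Suc k" "k < p" by (cases i) auto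
    thus ?case using el_pr[of k p n] el_inj pr_Hom assms(3) by metis
  next
    case (mult x y)
    obtain a b where ab: "a \<in> Hom (nil_op n) p 1" "el n a = x" "b \<in> Hom (nil_op n) p 1" "el n b = y"
      using mult(1,2) el_surj by metis
    then obtain u where u: "u \<in> Hom (nil_op n) p 2" "pr n 2 0 \<cdot>\<^bsub>nil_op n\<^esub> u = a" "pr n 2 1 \<cdot>\<^bsub>nil_op n\<^esub> u = b"
      using pair by metis
    have "P (mu n \<cdot>\<^bsub>nil_op n\<^esub> u)" using assms(4)[OF u(1)] u ab mult by simp
    moreover have "el n (mu n \<cdot>\<^bsub>nil_op n\<^esub> u) = x \<otimes>\<^bsub>nil_group n p\<^esub> y"
      using el_mu_comp[OF u(1)] u ab by simp
    ultimately show ?case using el_inj nil_op.Comp_Hom[OF u(1) mu_Hom] by metis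
  next
    case (inv x)
    obtain a b where ab: "a \<in> Hom (nil_op n) p 1" "el n a = x"
      "b \<in> Hom (nil_op n) p 1" "el n b = inv\<^bsub>nil_group n p\<^esub> x"
      using inv(1) el_surj N.inv_closed by metis
    then obtain u where u: "u \<in> Hom (nil_op n) p 2" "pr n 2 0 \<cdot>\<^bsub>nil_op n\<^esub> u = a" "pr n 2 1 \<cdot>\<^bsub>nil_op n\<^esub> u = b"
      using pair by metis
    have "el n (mu n \<cdot>\<^bsub>nil_op n\<^esub> u) = el n (nz n p 1)"
      using el_mu_comp[OF u(1)] u ab inv(1) el_nz by simp
    hence "mu n \<cdot>\<^bsub>nil_op n\<^esub> u = nz n p 1" using el_inj nil_op.Comp_Hom[OF u(1) mu_Hom] nz_Hom by metis
    hence "P b" using assms(5)[OF u(1)] u ab inv by simp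
    thus ?case using el_inj ab by metis
  qed
  thus ?thesis using w el_closed by blast
qed

section \<open>The endomorphisms of the object 1 are the integers\<close>

definition zpow :: "enat \<Rightarrow> int \<Rightarrow> nil_arr" where
  "zpow n e = (THE w. w \<in> Hom (nil_op n) 1 1 \<and> el n w = zgen n [^]\<^bsub>nil_group n 1\<^esub> e)"

lemma zpow: shows zpow_Hom: "zpow n e \<in> Hom (nil_op n) 1 1"
  and el_zpow: "el n (zpow n e) = zgen n [^]\<^bsub>nil_group n 1\<^esub> e"
proof -
  interpret N: group "nil_group n 1" by (rule nil_group_group)
  have "zgen n [^]\<^bsub>nil_group n 1\<^esub> e \<in> carrier (nil_group n 1)" using zgen_closed by blast
  then obtain w where "w \<in> Hom (nil_op n) 1 1" "el n w = zgen n [^]\<^bsub>nil_group n 1\<^esub> e"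
    by (rule el_surj)
  hence "\<exists>!w. w \<in> Hom (nil_op n) 1 1 \<and> el n w = zgen n [^]\<^bsub>nil_group n 1\<^esub> e"
    using el_inj by metis
  from theI'[OF this] show "zpow n e \<in> Hom (nil_op n) 1 1" "el n (zpow n e) = zgen n [^]\<^bsub>nil_group n 1\<^esub> e"
    by (simp_all add: zpow_def)
qed

lemma zpow_bij:
  assumes "1 \<le> n" shows "bij_betw (zpow n) UNIV (Hom (nil_op n) 1 1)"
proof (rule bij_betw_imageI)
  note b = zgen_pow_bij[OF assms, unfolded bij_betw_def]
  show "inj (zpow n)"
    by (rule injI) (use el_zpow b in \<open>metis injD\<close>)
  show "range (zpow n) = Hom (nil_op n) 1 1"
  proof (intro equalityI subsetI)
    fix w assume w: "w \<in> Hom (nil_op n) 1 1"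
    then obtain e where "el n w = zgen n [^]\<^bsub>nil_group n 1\<^esub> (e::int)" using b el_closed[OF w] by blast
    thus "w \<in> range (zpow n)" using el_inj[OF w zpow_Hom] el_zpow by (metis rangeI)
  qed (use zpow_Hom in auto)
qed

lemma zpow_0: "zpow n 0 = nz n 1 1"
  by (rule el_inj[OF zpow_Hom nz_Hom])
    (simp only: el_zpow el_nz int_pow_0)

lemma zpow_1: "zpow n 1 = Ident (nil_op n) 1"
proof (rule el_inj[OF zpow_Hom nil_op.Ident_Hom])
  show "el n (zpow n 1) = el n (Ident (nil_op n) 1)"
    unfolding el_zpow group.int_pow_1[OF nil_group_group zgen_closed]
    using zgen_closed[of n] by (simp add: el_def Ident_nil_op act_def)
qed simp

lemma mu_zpow:
  assumes "u \<in> Hom (nil_op n) 1 2" "pr n 2 0 \<cdot>\<^bsub>nil_op n\<^esub> u = zpow n e" "pr n 2 1 \<cdot>\<^bsub>nil_op n\<^esub> u = zpow n f"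
  shows "mu n \<cdot>\<^bsub>nil_op n\<^esub> u = zpow n (e + f)"
proof (rule el_inj[OF _ zpow_Hom])
  show "mu n \<cdot>\<^bsub>nil_op n\<^esub> u \<in> Hom (nil_op n) 1 1" using nil_op.Comp_Hom[OF assms(1) mu_Hom] .
  show "el n (mu n \<cdot>\<^bsub>nil_op n\<^esub> u) = el n (zpow n (e + f))"
    unfolding el_mu_comp[OF assms(1)] assms(2,3) el_zpow
    by (rule group.int_pow_mult[OF nil_group_group zgen_closed, symmetric])
qed

lemma mu_nz_left:
  assumes "u \<in> Hom (nil_op n) p 2" "pr n 2 0 \<cdot>\<^bsub>nil_op n\<^esub> u = nz n p 1"
  shows "mu n \<cdot>\<^bsub>nil_op n\<^esub> u = pr n 2 1 \<cdot>\<^bsub>nil_op n\<^esub> u"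
proof (rule el_inj)
  interpret N: group "nil_group n p" by (rule nil_group_group)
  show w: "pr n 2 1 \<cdot>\<^bsub>nil_op n\<^esub> u \<in> Hom (nil_op n) p 1" "mu n \<cdot>\<^bsub>nil_op n\<^esub> u \<in> Hom (nil_op n) p 1"
    using nil_op.Comp_Hom[OF assms(1) mu_Hom] nil_op.Comp_Hom[OF assms(1) pr_Hom] by auto
  show "el n (mu n \<cdot>\<^bsub>nil_op n\<^esub> u) = el n (pr n 2 1 \<cdot>\<^bsub>nil_op n\<^esub> u)"
    unfolding el_mu_comp[OF assms(1)] assms(2) using el_closed[OF w(1)] el_nz[of n p] by simp
qed

lemma mu_nz_right:
  assumes "u \<in> Hom (nil_op n) p 2" "pr n 2 1 \<cdot>\<^bsub>nil_op n\<^esub> u = nz n p 1"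
  shows "mu n \<cdot>\<^bsub>nil_op n\<^esub> u = pr n 2 0 \<cdot>\<^bsub>nil_op n\<^esub> u"
proof (rule el_inj)
  interpret N: group "nil_group n p" by (rule nil_group_group)
  show w: "pr n 2 0 \<cdot>\<^bsub>nil_op n\<^esub> u \<in> Hom (nil_op n) p 1" "mu n \<cdot>\<^bsub>nil_op n\<^esub> u \<in> Hom (nil_op n) p 1"
    using nil_op.Comp_Hom[OF assms(1) mu_Hom] nil_op.Comp_Hom[OF assms(1) pr_Hom] by auto
  show "el n (mu n \<cdot>\<^bsub>nil_op n\<^esub> u) = el n (pr n 2 0 \<cdot>\<^bsub>nil_op n\<^esub> u)"
    unfolding el_mu_comp[OF assms(1)] assms(2) using el_closed[OF w(1)] el_nz[of n p] by simp
qed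

text \<open>Here \<open>u\<close> and \<open>v'\<close> are the inner pairs of the two bracketings,
  \<open>v\<close> and \<open>u'\<close> the outer ones. All four have an arbitrary common source
  p.\<close>

lemma mu_assoc:
  assumes "u \<in> Hom (nil_op n) p 2" "v \<in> Hom (nil_op n) p 2" "u' \<in> Hom (nil_op n) p 2" "v' \<in> Hom (nil_op n) p 2"
    and "pr n 2 0 \<cdot>\<^bsub>nil_op n\<^esub> v = mu n \<cdot>\<^bsub>nil_op n\<^esub> u" "pr n 2 1 \<cdot>\<^bsub>nil_op n\<^esub> u' = mu n \<cdot>\<^bsub>nil_op n\<^esub> v'"
    and "pr n 2 0 \<cdot>\<^bsub>nil_op n\<^esub> u' = pr n 2 0 \<cdot>\<^bsub>nil_op n\<^esub> u" "pr n 2 0 \<cdot>\<^bsub>nil_op n\<^esub> v' = pr n 2 1 \<cdot>\<^bsub>nil_op n\<^esub> u"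
    and "pr n 2 1 \<cdot>\<^bsub>nil_op n\<^esub> v' = pr n 2 1 \<cdot>\<^bsub>nil_op n\<^esub> v"
  shows "mu n \<cdot>\<^bsub>nil_op n\<^esub> v = mu n \<cdot>\<^bsub>nil_op n\<^esub> u'"
proof (rule el_inj)
  interpret N: group "nil_group n p" by (rule nil_group_group)
  show "mu n \<cdot>\<^bsub>nil_op n\<^esub> v \<in> Hom (nil_op n) p 1" "mu n \<cdot>\<^bsub>nil_op n\<^esub> u' \<in> Hom (nil_op n) p 1"
    using nil_op.Comp_Hom[OF _ mu_Hom] assms by auto
  have "el n (pr n 2 k \<cdot>\<^bsub>nil_op n\<^esub> w) \<in> carrier (nil_group n p)"
    if "w \<in> Hom (nil_op n) p 2" "k < 2" for w k
    by (rule el_closed[OF nil_op.Comp_Hom[OF that(1) pr_Hom[OF that(2)]]])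
  thus "el n (mu n \<cdot>\<^bsub>nil_op n\<^esub> v) = el n (mu n \<cdot>\<^bsub>nil_op n\<^esub> u')"
    using assms(1-4) by (simp add: el_mu_comp assms(5-9) N.m_assoc)
qed

section \<open>Calculus in track categories\<close>

lemma mem_Hom_iff: "f \<in> Hom C X Y \<longleftrightarrow> f \<in> Arr C \<and> Dom C f = X \<and> Cod C f = Y"
  by (auto simp: Hom_def)

lemma mem_Track_iff: "\<eta> \<in> Track A f g \<longleftrightarrow> \<eta> \<in> Trk A \<and> Src A \<eta> = f \<and> Trg A \<eta> = g"
  by (auto simp: Track_def)

context category
begin

text \<open>Here and below the axioms are restated with conditions on \<open>Dom\<close>,
  \<open>Cod\<close>, \<open>Src\<close> and \<open>Trg\<close> that the simplifier can check
  itself; composites are then normalized by associating to the right and pushing whiskering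
  inwards.\<close>

lemma Ident_simps [simp]:
  assumes "X \<in> Obj C"
  shows "Ident C X \<in> Arr C" "Dom C (Ident C X) = X" "Cod C (Ident C X) = X"
  using Ident_Hom[OF assms] by (auto simp: mem_Hom_iff)

lemma Comp_simps [simp]:
  assumes "f \<in> Arr C" "g \<in> Arr C" "Dom C g = Cod C f"
  shows "g \<cdot> f \<in> Arr C" "Dom C (g \<cdot> f) = Dom C f" "Cod C (g \<cdot> f) = Cod C g"
  using Comp_Hom[of f "Dom C f" "Cod C f" g "Cod C g"] assms by (auto simp: mem_Hom_iff)

lemma Obj_simps [simp]: "f \<in> Arr C \<Longrightarrow> Dom C f \<in> Obj C" "f \<in> Arr C \<Longrightarrow> Cod C f \<in> Obj C"
  by (simp_all add: Dom_Obj Cod_Obj)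

lemma Comp_Ident_simp [simp]: "f \<in> Arr C \<Longrightarrow> Dom C f = X \<Longrightarrow> f \<cdot> Ident C X = f"
  and Ident_Comp_simp [simp]: "f \<in> Arr C \<Longrightarrow> Cod C f = X \<Longrightarrow> Ident C X \<cdot> f = f"
  by (auto intro: Comp_Ident Ident_Comp simp: mem_Hom_iff)

lemma Comp_assoc_simp [simp]:
  "f \<in> Arr C \<Longrightarrow> g \<in> Arr C \<Longrightarrow> h \<in> Arr C \<Longrightarrow> Dom C g = Cod C f \<Longrightarrow> Dom C h = Cod C g
    \<Longrightarrow> (h \<cdot> g) \<cdot> f = h \<cdot> (g \<cdot> f)"
  by (auto intro: Comp_assoc simp: mem_Hom_iff)

end

context track_category
begin

lemma Trk_simps [simp]:
  assumes "\<eta> \<in> Trk A"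
  shows "Src A \<eta> \<in> Arr A" "Trg A \<eta> \<in> Arr A" "Dom A (Trg A \<eta>) = Dom A (Src A \<eta>)"
    "Cod A (Trg A \<eta>) = Cod A (Src A \<eta>)"
  using Src_Arr[OF assms] Trg_Hom[of \<eta> "Dom A (Src A \<eta>)" "Cod A (Src A \<eta>)"] assms
  by (auto simp: HomTrk_def mem_Hom_iff)

lemma IdT_simps [simp]:
  assumes "f \<in> Arr A" shows "IdT A f \<in> Trk A" "Src A (IdT A f) = f" "Trg A (IdT A f) = f"
  using IdT_Track[OF assms] by (auto simp: mem_Track_iff)

lemma VComp_simps [simp]:
  assumes "\<eta> \<in> Trk A" "\<phi> \<in> Trk A" "Src A \<phi> = Trg A \<eta>"
  shows "\<phi> \<box> \<eta> \<in> Trk A" "Src A (\<phi> \<box> \<eta>) = Src A \<eta>" "Trg A (\<phi> \<box> \<eta>) = Trg A \<phi>"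
  using VComp_Track[of \<eta> "Src A \<eta>" "Trg A \<eta>" \<phi> "Trg A \<phi>"] assms by (auto simp: mem_Track_iff)

lemma InvT_simps [simp]:
  assumes "\<eta> \<in> Trk A"
  shows "InvT A \<eta> \<in> Trk A" "Src A (InvT A \<eta>) = Trg A \<eta>" "Trg A (InvT A \<eta>) = Src A \<eta>"
  using InvT_Track[of \<eta> "Src A \<eta>" "Trg A \<eta>"] assms by (auto simp: mem_Track_iff)

lemma VComp_IdT_simp [simp]: "\<eta> \<in> Trk A \<Longrightarrow> Src A \<eta> = f \<Longrightarrow> \<eta> \<box> IdT A f = \<eta>"
  and IdT_VComp_simp [simp]: "\<eta> \<in> Trk A \<Longrightarrow> Trg A \<eta> = f \<Longrightarrow> IdT A f \<box> \<eta> = \<eta>"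
  by (auto intro: VComp_IdT IdT_VComp simp: mem_Track_iff)

lemma VComp_assoc_simp [simp]:
  "\<eta> \<in> Trk A \<Longrightarrow> \<phi> \<in> Trk A \<Longrightarrow> \<psi> \<in> Trk A \<Longrightarrow> Src A \<phi> = Trg A \<eta> \<Longrightarrow> Src A \<psi> = Trg A \<phi>
    \<Longrightarrow> (\<psi> \<box> \<phi>) \<box> \<eta> = \<psi> \<box> (\<phi> \<box> \<eta>)"
  by (auto intro: VComp_assoc simp: mem_Track_iff)

lemma VComp_InvT_simp [simp]: "\<eta> \<in> Trk A \<Longrightarrow> \<eta> \<box> InvT A \<eta> = IdT A (Trg A \<eta>)"
  and InvT_VComp_simp [simp]: "\<eta> \<in> Trk A \<Longrightarrow> InvT A \<eta> \<box> \<eta> = IdT A (Src A \<eta>)"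
  by (auto intro: VComp_InvT InvT_VComp simp: mem_Track_iff)

lemma VComp_InvT_left [simp]:
  assumes "\<eta> \<in> Trk A" "\<theta> \<in> Trk A" "Trg A \<theta> = Trg A \<eta>" shows "\<eta> \<box> (InvT A \<eta> \<box> \<theta>) = \<theta>"
  using assms VComp_assoc_simp[of \<theta> "InvT A \<eta>" \<eta>] by simp

lemma InvT_VComp_left [simp]:
  assumes "\<eta> \<in> Trk A" "\<theta> \<in> Trk A" "Trg A \<theta> = Src A \<eta>" shows "InvT A \<eta> \<box> (\<eta> \<box> \<theta>) = \<theta>"
  using assms VComp_assoc_simp[of \<theta> \<eta> "InvT A \<eta>"] by simp

lemma VComp_right_cancel:
  assumes "\<eta> \<in> Trk A" "\<phi> \<in> Trk A" "\<psi> \<in> Trk A" "Src A \<phi> = Trg A \<eta>" "Src A \<psi> = Trg A \<eta>"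
    "\<phi> \<box> \<eta> = \<psi> \<box> \<eta>"
  shows "\<phi> = \<psi>"
proof -
  have r: "\<chi> = (\<chi> \<box> \<eta>) \<box> InvT A \<eta>" if "\<chi> \<in> Trk A" "Src A \<chi> = Trg A \<eta>" for \<chi>
    using that assms(1) by simp
  show ?thesis using r[OF assms(2,4)] r[OF assms(3,5)] assms(6) by simp
qed

lemma VComp_left_cancel:
  assumes "\<eta> \<in> Trk A" "\<phi> \<in> Trk A" "\<psi> \<in> Trk A" "Trg A \<phi> = Src A \<eta>" "Trg A \<psi> = Src A \<eta>"
    "\<eta> \<box> \<phi> = \<eta> \<box> \<psi>"
  shows "\<phi> = \<psi>"
proof -
  have "\<phi> = InvT A \<eta> \<box> (\<eta> \<box> \<phi>)" by (rule InvT_VComp_left[OF assms(1,2,4), symmetric])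
  also have "\<dots> = InvT A \<eta> \<box> (\<eta> \<box> \<psi>)" by (simp only: assms(6))
  also have "\<dots> = \<psi>" by (rule InvT_VComp_left[OF assms(1,3,5)])
  finally show ?thesis .
qed

lemma InvT_unique:
  assumes "\<eta> \<in> Trk A" "\<phi> \<in> Trk A" "Src A \<phi> = Trg A \<eta>" "\<phi> \<box> \<eta> = IdT A (Src A \<eta>)"
    and "Trg A \<phi> = Src A \<eta>"
  shows "\<phi> = InvT A \<eta>"
  by (rule VComp_right_cancel[of \<eta>]) (use assms in auto)

lemma Post_simps [simp]:
  assumes "\<eta> \<in> Trk A" "g \<in> Arr A" "Dom A g = Cod A (Src A \<eta>)"
  shows "Post A g \<eta> \<in> Trk A" "Src A (Post A g \<eta>) = g \<cdot> Src A \<eta>" "Trg A (Post A g \<eta>) = g \<cdot> Trg A \<eta>"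
  using Post_Track[of "Src A \<eta>" "Dom A (Src A \<eta>)" "Cod A (Src A \<eta>)" g "Cod A g" \<eta> "Trg A \<eta>"] assms
  by (auto simp: mem_Hom_iff mem_Track_iff)

lemma Pre_simps [simp]:
  assumes "\<eta> \<in> Trk A" "h \<in> Arr A" "Cod A h = Dom A (Src A \<eta>)"
  shows "Pre A h \<eta> \<in> Trk A" "Src A (Pre A h \<eta>) = Src A \<eta> \<cdot> h" "Trg A (Pre A h \<eta>) = Trg A \<eta> \<cdot> h"
  using Pre_Track[of h "Dom A h" "Dom A (Src A \<eta>)" "Src A \<eta>" "Cod A (Src A \<eta>)" \<eta> "Trg A \<eta>"] assms
  by (auto simp: mem_Hom_iff mem_Track_iff)

lemma Post_IdT_simp [simp]:
  "f \<in> Arr A \<Longrightarrow> g \<in> Arr A \<Longrightarrow> Dom A g = Cod A f \<Longrightarrow> Post A g (IdT A f) = IdT A (g \<cdot> f)"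
  and Pre_IdT_simp [simp]:
  "f \<in> Arr A \<Longrightarrow> h \<in> Arr A \<Longrightarrow> Cod A h = Dom A f \<Longrightarrow> Pre A h (IdT A f) = IdT A (f \<cdot> h)"
  by (auto intro: Post_IdT Pre_IdT simp: mem_Hom_iff)

lemma Post_VComp_simp [simp]:
  "\<eta> \<in> Trk A \<Longrightarrow> \<phi> \<in> Trk A \<Longrightarrow> Src A \<phi> = Trg A \<eta> \<Longrightarrow> g \<in> Arr A \<Longrightarrow> Dom A g = Cod A (Src A \<eta>)
    \<Longrightarrow> Post A g (\<phi> \<box> \<eta>) = Post A g \<phi> \<box> Post A g \<eta>"
  by (rule Post_VComp[of "Src A \<eta>" "Dom A (Src A \<eta>)" "Cod A (Src A \<eta>)" \<eta> "Trg A \<eta>" \<phi> "Trg A \<phi>" g "Cod A g"])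
    (auto simp: mem_Hom_iff mem_Track_iff)

lemma Pre_VComp_simp [simp]:
  "\<eta> \<in> Trk A \<Longrightarrow> \<phi> \<in> Trk A \<Longrightarrow> Src A \<phi> = Trg A \<eta> \<Longrightarrow> h \<in> Arr A \<Longrightarrow> Cod A h = Dom A (Src A \<eta>)
    \<Longrightarrow> Pre A h (\<phi> \<box> \<eta>) = Pre A h \<phi> \<box> Pre A h \<eta>"
  by (rule Pre_VComp[of h "Dom A h" "Dom A (Src A \<eta>)" "Src A \<eta>" "Cod A (Src A \<eta>)" \<eta> "Trg A \<eta>" \<phi> "Trg A \<phi>"])
    (auto simp: mem_Hom_iff mem_Track_iff)

lemma Post_Ident_simp [simp]: "\<eta> \<in> Trk A \<Longrightarrow> Cod A (Src A \<eta>) = Y \<Longrightarrow> Post A (Ident A Y) \<eta> = \<eta>"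
  and Pre_Ident_simp [simp]: "\<eta> \<in> Trk A \<Longrightarrow> Dom A (Src A \<eta>) = X \<Longrightarrow> Pre A (Ident A X) \<eta> = \<eta>"
  by (auto intro!: Post_Ident Pre_Ident simp: HomTrk_def mem_Hom_iff)

lemma Post_Comp_simp [simp]:
  "\<eta> \<in> Trk A \<Longrightarrow> g \<in> Arr A \<Longrightarrow> g' \<in> Arr A \<Longrightarrow> Dom A g = Cod A (Src A \<eta>) \<Longrightarrow> Dom A g' = Cod A g
    \<Longrightarrow> Post A (g' \<cdot> g) \<eta> = Post A g' (Post A g \<eta>)"
  by (rule Post_Comp[of \<eta> "Dom A (Src A \<eta>)" "Cod A (Src A \<eta>)" g "Cod A g" g' "Cod A g'"])
    (auto simp: mem_Hom_iff HomTrk_def)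

lemma Pre_Comp_simp [simp]:
  "\<eta> \<in> Trk A \<Longrightarrow> h \<in> Arr A \<Longrightarrow> h' \<in> Arr A \<Longrightarrow> Cod A h = Dom A (Src A \<eta>) \<Longrightarrow> Cod A h' = Dom A h
    \<Longrightarrow> Pre A (h \<cdot> h') \<eta> = Pre A h' (Pre A h \<eta>)"
  by (rule Pre_Comp[of h' "Dom A h'" "Dom A h" h "Dom A (Src A \<eta>)" \<eta> "Cod A (Src A \<eta>)"])
    (auto simp: mem_Hom_iff HomTrk_def)

lemma Post_Pre_simp [simp]:
  "\<eta> \<in> Trk A \<Longrightarrow> h \<in> Arr A \<Longrightarrow> g \<in> Arr A \<Longrightarrow> Cod A h = Dom A (Src A \<eta>) \<Longrightarrow> Dom A g = Cod A (Src A \<eta>)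
    \<Longrightarrow> Post A g (Pre A h \<eta>) = Pre A h (Post A g \<eta>)"
  by (rule Post_Pre[of h "Dom A h" "Dom A (Src A \<eta>)" \<eta> "Cod A (Src A \<eta>)" g "Cod A g"])
    (auto simp: mem_Hom_iff HomTrk_def)

lemma interchange_track:
  "\<eta> \<in> Trk A \<Longrightarrow> \<theta> \<in> Trk A \<Longrightarrow> Dom A (Src A \<theta>) = Cod A (Src A \<eta>)
    \<Longrightarrow> Post A (Trg A \<theta>) \<eta> \<box> Pre A (Src A \<eta>) \<theta> = Pre A (Trg A \<eta>) \<theta> \<box> Post A (Src A \<theta>) \<eta>"
  by (rule interchange[of "Src A \<eta>" "Dom A (Src A \<eta>)" "Cod A (Src A \<eta>)" _ _ "Src A \<theta>" "Cod A (Src A \<theta>)"])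
    (auto simp: mem_Hom_iff mem_Track_iff)

text \<open>Whiskering is a functor between hom-groupoids and therefore preserves inverses.\<close>

lemma Post_InvT [simp]:
  assumes "\<eta> \<in> Trk A" "g \<in> Arr A" "Dom A g = Cod A (Src A \<eta>)"
  shows "Post A g (InvT A \<eta>) = InvT A (Post A g \<eta>)"
  by (rule InvT_unique) (use assms in \<open>auto simp flip: Post_VComp_simp\<close>)

lemma Pre_InvT [simp]:
  assumes "\<eta> \<in> Trk A" "h \<in> Arr A" "Cod A h = Dom A (Src A \<eta>)"
  shows "Pre A h (InvT A \<eta>) = InvT A (Pre A h \<eta>)"
  by (rule InvT_unique) (use assms in \<open>auto simp flip: Pre_VComp_simp\<close>)

end

section \<open>The homotopy category\<close>

context track_category
begin

lemma homotopy_class_eq: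
  assumes "\<eta> \<in> Trk A" shows "homotopy_class A (Src A \<eta>) = homotopy_class A (Trg A \<eta>)"
proof -
  have "k \<in> homotopy_class A (Trg A \<theta>)" if "k \<in> homotopy_class A (Src A \<theta>)" "\<theta> \<in> Trk A" for k \<theta>
  proof -
    from that obtain \<kappa> where "\<kappa> \<in> Track A (Src A \<theta>) k" by (auto simp: homotopy_class_def)
    with that have "\<kappa> \<box> InvT A \<theta> \<in> Track A (Trg A \<theta>) k" by (auto simp: mem_Track_iff)
    thus ?thesis by (auto simp: homotopy_class_def)
  qed
  from this[of _ \<eta>] this[of _ "InvT A \<eta>"] show ?thesis using assms by auto
qed

lemma homotopy_class_self: "f \<in> Arr A \<Longrightarrow> f \<in> homotopy_class A f"
  using IdT_Track[of f] by (auto simp: homotopy_class_def)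

lemma homotopy_class_eqD:
  assumes "f \<in> Arr A" "g \<in> Arr A" "homotopy_class A f = homotopy_class A g"
  obtains \<eta> where "\<eta> \<in> Trk A" "Src A \<eta> = f" "Trg A \<eta> = g"
proof -
  have "g \<in> homotopy_class A f" using homotopy_class_self[OF assms(2)] assms(3) by simp
  hence "\<exists>\<eta>. \<eta> \<in> Trk A \<and> Src A \<eta> = f \<and> Trg A \<eta> = g"
    unfolding homotopy_class_def Track_def by blast
  thus ?thesis using that by blast
qed

lemma mem_homotopy_classD:
  assumes "g \<in> homotopy_class A f"
  shows "g \<in> Arr A" "Dom A g = Dom A f" "Cod A g = Cod A f" "homotopy_class A g = homotopy_class A f"
proof -
  from assms obtain \<eta> where "\<eta> \<in> Trk A" "Src A \<eta> = f" "Trg A \<eta> = g"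
    unfolding homotopy_class_def Track_def by blast
  thus "g \<in> Arr A" "Dom A g = Dom A f" "Cod A g = Cod A f" "homotopy_class A g = homotopy_class A f"
    using homotopy_class_eq[of \<eta>] by auto
qed

text \<open>The ends of a class are defined through \<open>the_elem\<close>, so they are first seen
  to be constant on the class.\<close>

lemma Hom_ho: "Hom (ho A) X Y = homotopy_class A ` Hom A X Y"
proof -
  have im: "k ` homotopy_class A f = {k f}"
    if "f \<in> Arr A" "\<And>g. g \<in> homotopy_class A f \<Longrightarrow> k g = k f" for f and k :: "'m \<Rightarrow> 'o"
    using homotopy_class_self[OF that(1)] that(2)
    by (intro equalityI subsetI) (metis imageE singletonI, metis imageI singletonD)
  have d: "Dom A ` homotopy_class A f = {Dom A f}" "Cod A ` homotopy_class A f = {Cod A f}"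
    if "f \<in> Arr A" for f
    by (rule im[OF that], erule mem_homotopy_classD)+
  have "c \<in> Hom (ho A) X Y \<longleftrightarrow> c \<in> homotopy_class A ` Arr A \<and> the_elem (Dom A ` c) = X \<and> the_elem (Cod A ` c) = Y" for c
    by (simp add: Hom_def ho_def)
  thus ?thesis by (auto simp: d mem_Hom_iff)
qed

lemma homotopy_class_Hom: "f \<in> Arr A \<Longrightarrow> homotopy_class A f \<in> Hom (ho A) (Dom A f) (Cod A f)"
  by (auto simp: Hom_ho mem_Hom_iff)

lemma Ident_ho: "Ident (ho A) X = homotopy_class A (Ident A X)"
  by (simp add: ho_def)

text \<open>Composition of classes is a union over all representatives. It collapses to a single
  class because whiskering on both sides connects any two such composites by a track.\<close>

lemma Comp_ho:
  assumes "f \<in> Arr A" "g \<in> Arr A" "Dom A g = Cod A f"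
  shows "homotopy_class A g \<cdot>\<^bsub>ho A\<^esub> homotopy_class A f = homotopy_class A (g \<cdot> f)"
proof -
  have "homotopy_class A (g' \<cdot> f') = homotopy_class A (g \<cdot> f)"
    if "g' \<in> homotopy_class A g" "f' \<in> homotopy_class A f" for g' f'
  proof -
    from that obtain \<eta> \<theta> where "\<eta> \<in> Trk A" "Src A \<eta> = f" "Trg A \<eta> = f'" "\<theta> \<in> Trk A" "Src A \<theta> = g" "Trg A \<theta> = g'"
      unfolding homotopy_class_def Track_def by blast
    thus ?thesis using homotopy_class_eq[of "Post A g' \<eta> \<box> Pre A f \<theta>"] assms by auto
  qed
  moreover have "f \<in> homotopy_class A f" "g \<in> homotopy_class A g"
    using assms homotopy_class_self by auto
  ultimately have "(\<Union>g' \<in> homotopy_class A g. \<Union>f' \<in> homotopy_class A f. homotopy_class A (g' \<cdot> f'))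
      = homotopy_class A (g \<cdot> f)"
    by blast
  thus ?thesis by (simp add: ho_def)
qed

end

section \<open>Torsors of tracks\<close>

context additive_track_category
begin

interpretation ho: additive_category "ho A" HG by (rule ho_additive)

definition D_post where "D_post X g = Dmap (Ident (ho A) X) (homotopy_class A g)"

definition D_pre where "D_pre Y h = Dmap (homotopy_class A h) (Ident (ho A) Y)"

lemma Obj_ho [simp]: "Obj (ho A) = Obj A" by (simp add: ho_def)

lemma D_post_closed [simp]:
  assumes "g \<in> Arr A" "X \<in> Obj A" "a \<in> carrier (D X (Dom A g))" "Cod A g = Z"
  shows "D_post X g a \<in> carrier (D X Z)"
  using Dmap_hom[OF ho.Ident_Hom homotopy_class_Hom[OF assms(1)]] assms
  unfolding D_post_def hom_def by auto

lemma D_pre_closed [simp]: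
  assumes "h \<in> Arr A" "Y \<in> Obj A" "a \<in> carrier (D (Cod A h) Y)" "Dom A h = W"
  shows "D_pre Y h a \<in> carrier (D W Y)"
  using Dmap_hom[OF homotopy_class_Hom[OF assms(1)] ho.Ident_Hom] assms
  unfolding D_pre_def hom_def by auto

lemma D_monoid: "X \<in> Obj A \<Longrightarrow> Y \<in> Obj A \<Longrightarrow> group (D X Y)"
  using D_group comm_group.axioms(2) by blast

lemma D_post_hom:
  assumes "g \<in> Arr A" "X \<in> Obj A"
  shows "group_hom (D X (Dom A g)) (D X (Cod A g)) (D_post X g)"
  using Dmap_hom[OF ho.Ident_Hom homotopy_class_Hom[OF assms(1)], of X] assms
  by (simp add: group_hom_def group_hom_axioms_def D_monoid D_post_def)

lemma D_pre_hom:
  assumes "h \<in> Arr A" "Y \<in> Obj A"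
  shows "group_hom (D (Cod A h) Y) (D (Dom A h) Y) (D_pre Y h)"
  using Dmap_hom[OF homotopy_class_Hom[OF assms(1)] ho.Ident_Hom, of Y] assms
  by (simp add: group_hom_def group_hom_axioms_def D_monoid D_pre_def)

lemma D_post_Ident [simp]:
  "X \<in> Obj A \<Longrightarrow> Y \<in> Obj A \<Longrightarrow> a \<in> carrier (D X Y) \<Longrightarrow> D_post X (Ident A Y) a = a"
  and D_pre_Ident [simp]:
  "X \<in> Obj A \<Longrightarrow> Y \<in> Obj A \<Longrightarrow> a \<in> carrier (D X Y) \<Longrightarrow> D_pre Y (Ident A X) a = a"
  unfolding D_post_def D_pre_def using Dmap_Ident by (simp_all flip: Ident_ho)

lemma D_pre_Comp:
  assumes "h \<in> Arr A" "h' \<in> Arr A" "Dom A h = Cod A h'" "Y \<in> Obj A" "a \<in> carrier (D (Cod A h) Y)"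
  shows "D_pre Y (h \<cdot> h') a = D_pre Y h' (D_pre Y h a)"
  using Dmap_Comp[OF homotopy_class_Hom[OF assms(1)] _ ho.Ident_Hom ho.Ident_Hom, of "homotopy_class A h'" "Dom A h'" Y a]
    assms homotopy_class_Hom[OF assms(2)]
  by (simp add: D_pre_def Comp_ho)

lemma D_post_class: "homotopy_class A g = homotopy_class A g' \<Longrightarrow> D_post X g = D_post X g'"
  and D_pre_class: "homotopy_class A h = homotopy_class A h' \<Longrightarrow> D_pre Y h = D_pre Y h'"
  by (simp_all add: D_post_def D_pre_def)

text \<open>Sums exist only in the homotopy category, so the map \<open>g\<close> is merely required
  to represent the sum of the two classes.\<close>

lemma D_post_add:
  assumes "g \<in> Hom A Y Z" "g1 \<in> Hom A Y Z" "g2 \<in> Hom A Y Z" "X \<in> Obj A" "a \<in> carrier (D X Y)"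
    "homotopy_class A g = homotopy_class A g1 \<otimes>\<^bsub>HG Y Z\<^esub> homotopy_class A g2"
  shows "D_post X g a = D_post X g1 a \<otimes>\<^bsub>D X Z\<^esub> D_post X g2 a"
  unfolding D_post_def assms(6)
  by (rule Dmap_add_right) (use assms homotopy_class_Hom in \<open>auto simp: Hom_ho intro!: ho.Ident_Hom[unfolded Hom_ho]\<close>)

lemma D_pre_add:
  assumes "h \<in> Hom A W X" "h1 \<in> Hom A W X" "h2 \<in> Hom A W X" "Y \<in> Obj A" "a \<in> carrier (D X Y)"
    "homotopy_class A h = homotopy_class A h1 \<otimes>\<^bsub>HG W X\<^esub> homotopy_class A h2"
  shows "D_pre Y h a = D_pre Y h1 a \<otimes>\<^bsub>D W Y\<^esub> D_pre Y h2 a"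
  unfolding D_pre_def assms(6)
  by (rule Dmap_add_left) (use assms homotopy_class_Hom in \<open>auto simp: Hom_ho intro!: ho.Ident_Hom[unfolded Hom_ho]\<close>)

definition D_of where "D_of H = D (Dom A (Src A H)) (Cod A (Src A H))"

text \<open>The right action of the coefficient group on the tracks parallel to \<open>H\<close>. By
  \<open>tor_inj\<close> and \<open>tor_exists\<close> it is simply transitive.\<close>

definition tor where "tor H a = H \<box> \<sigma> (Src A H) a"

lemma \<sigma>_hom:
  assumes "f \<in> Arr A"
  shows "group_hom (D (Dom A f) (Cod A f)) (loop_group A f) (\<sigma> f)"
    "bij_betw (\<sigma> f) (carrier (D (Dom A f) (Cod A f))) (Track A f f)"
proof -
  have i: "\<sigma> f \<in> iso (D (Dom A f) (Cod A f)) (loop_group A f)"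
    using \<sigma>_iso assms by (simp add: mem_Hom_iff)
  show "bij_betw (\<sigma> f) (carrier (D (Dom A f) (Cod A f))) (Track A f f)"
    using i by (simp add: iso_def loop_group_def)
  have "group (loop_group A f)"
  proof (rule groupI)
    fix x assume "x \<in> carrier (loop_group A f)"
    hence "InvT A x \<in> carrier (loop_group A f)" "InvT A x \<otimes>\<^bsub>loop_group A f\<^esub> x = \<one>\<^bsub>loop_group A f\<^esub>"
      by (auto simp: loop_group_def mem_Track_iff)
    thus "\<exists>y\<in>carrier (loop_group A f). y \<otimes>\<^bsub>loop_group A f\<^esub> x = \<one>\<^bsub>loop_group A f\<^esub>" by blast
  qed (use assms in \<open>auto simp: loop_group_def mem_Track_iff\<close>)
  thus "group_hom (D (Dom A f) (Cod A f)) (loop_group A f) (\<sigma> f)"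
    using i assms by (simp add: group_hom_def group_hom_axioms_def D_monoid iso_def)
qed

lemma \<sigma>_simps [simp]:
  assumes "f \<in> Arr A" "a \<in> carrier (D (Dom A f) (Cod A f))"
  shows "\<sigma> f a \<in> Trk A" "Src A (\<sigma> f a) = f" "Trg A (\<sigma> f a) = f"
  using bij_betwE[OF \<sigma>_hom(2)[OF assms(1)]] assms(2) by (auto simp: mem_Track_iff)

context
  fixes H assumes H: "H \<in> Trk A"
begin

lemma tor_simps [simp]:
  assumes "a \<in> carrier (D_of H)"
  shows "tor H a \<in> Trk A" "Src A (tor H a) = Src A H" "Trg A (tor H a) = Trg A H" "D_of (tor H a) = D_of H"
  using H assms by (auto simp: tor_def D_of_def)

lemma tor_one: "tor H \<one>\<^bsub>D_of H\<^esub> = H"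
  using group_hom.hom_one[OF \<sigma>_hom(1), of "Src A H"] H by (simp add: tor_def D_of_def loop_group_def)

lemma tor_tor:
  assumes "a \<in> carrier (D_of H)" "b \<in> carrier (D_of H)"
  shows "tor (tor H a) b = tor H (a \<otimes>\<^bsub>D_of H\<^esub> b)"
proof -
  have "\<sigma> (Src A H) (a \<otimes>\<^bsub>D_of H\<^esub> b) = \<sigma> (Src A H) a \<box> \<sigma> (Src A H) b"
    using group_hom.hom_mult[OF \<sigma>_hom(1), of "Src A H" a b] H assms by (simp add: D_of_def loop_group_def)
  thus ?thesis using H assms by (simp add: tor_def D_of_def)
qed

lemma tor_inj:
  assumes "a \<in> carrier (D_of H)" "b \<in> carrier (D_of H)" "tor H a = tor H b" shows "a = b"
proof -
  have "\<sigma> (Src A H) a = \<sigma> (Src A H) b"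
    by (rule VComp_left_cancel[of H]) (use H assms in \<open>auto simp: tor_def D_of_def\<close>)
  thus ?thesis using \<sigma>_hom(2)[of "Src A H"] H assms by (auto simp: bij_betw_def inj_on_def D_of_def)
qed

lemma tor_exists:
  assumes "K \<in> Trk A" "Src A K = Src A H" "Trg A K = Trg A H"
  obtains a where "a \<in> carrier (D_of H)" "K = tor H a"
proof -
  have "InvT A H \<box> K \<in> Track A (Src A H) (Src A H)" using H assms by (auto simp: mem_Track_iff)
  hence "InvT A H \<box> K \<in> \<sigma> (Src A H) ` carrier (D_of H)"
    using bij_betw_imp_surj_on[OF \<sigma>_hom(2)[of "Src A H"]] H by (simp add: D_of_def)
  then obtain a where a: "a \<in> carrier (D_of H)" "InvT A H \<box> K = \<sigma> (Src A H) a" by blast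
  have "K = H \<box> (InvT A H \<box> K)" using H assms by simp
  hence "K = tor H a" by (simp only: tor_def a(2))
  with a(1) show ?thesis by (rule that)
qed

lemma VComp_tor:
  assumes "K \<in> Trk A" "Src A K = Trg A H" "a \<in> carrier (D_of H)"
  shows "K \<box> tor H a = tor (K \<box> H) a"
  using H assms by (simp add: tor_def D_of_def)

text \<open>The coefficient sits on the later track here; the commutation of \<sigma> with tracks
  moves it past \<open>H\<close> to the source.\<close>

lemma tor_VComp:
  assumes "K \<in> Trk A" "Src A K = Trg A H" "a \<in> carrier (D_of H)"
  shows "tor K a \<box> H = tor (K \<box> H) a"
proof -
  have "\<sigma> (Trg A H) a \<box> H = H \<box> \<sigma> (Src A H) a"
    using \<sigma>_VComp[of "Src A H" "Dom A (Src A H)" "Cod A (Src A H)" H "Trg A H" a] H assms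
    by (simp add: mem_Hom_iff mem_Track_iff D_of_def)
  thus ?thesis using H assms by (simp add: tor_def D_of_def)
qed

text \<open>Whiskering is equivariant with respect to the induced homomorphism of
  coefficients.\<close>

lemma Post_tor:
  assumes "g \<in> Arr A" "Dom A g = Cod A (Src A H)" "a \<in> carrier (D_of H)"
  shows "Post A g (tor H a) = tor (Post A g H) (D_post (Dom A (Src A H)) g a)"
proof -
  have "Post A g (\<sigma> (Src A H) a) = \<sigma> (g \<cdot> Src A H) (D_post (Dom A (Src A H)) g a)"
    unfolding D_post_def by (rule \<sigma>_Post[of _ _ "Cod A (Src A H)" _ "Cod A g"])
      (use H assms in \<open>auto simp: mem_Hom_iff D_of_def\<close>)
  thus ?thesis using H assms by (simp add: tor_def D_of_def)
qed

lemma Pre_tor: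
  assumes "h \<in> Arr A" "Cod A h = Dom A (Src A H)" "a \<in> carrier (D_of H)"
  shows "Pre A h (tor H a) = tor (Pre A h H) (D_pre (Cod A (Src A H)) h a)"
proof -
  have "Pre A h (\<sigma> (Src A H) a) = \<sigma> (Src A H \<cdot> h) (D_pre (Cod A (Src A H)) h a)"
    unfolding D_pre_def by (rule \<sigma>_Pre[of _ "Dom A h" "Dom A (Src A H)"])
      (use H assms in \<open>auto simp: mem_Hom_iff D_of_def\<close>)
  thus ?thesis using H assms by (simp add: tor_def D_of_def)
qed

end

end

lemma ex1_eqD: "\<exists>!x. P x \<Longrightarrow> P a \<Longrightarrow> P b \<Longrightarrow> a = b"
  by blast

section \<open>Strict products\<close>

locale track_products = track_category A for A :: "('o, 'm, 't, 'z) track_cat_prod_scheme" (structure) +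
  assumes strict_prods: "strict_products A" and zero_obj: "strict_zero_object A (Zero A)"
begin

context
  fixes X Y assumes XY: "X \<in> Obj A" "Y \<in> Obj A"
begin

lemma Prod_simps [simp]:
  "Prod A X Y \<in> Obj A" "Pr1 A X Y \<in> Arr A" "Dom A (Pr1 A X Y) = Prod A X Y" "Cod A (Pr1 A X Y) = X"
  "Pr2 A X Y \<in> Arr A" "Dom A (Pr2 A X Y) = Prod A X Y" "Cod A (Pr2 A X Y) = Y"
  using strict_prods XY unfolding strict_products_def mem_Hom_iff by blast+

lemma prod_bij:
  assumes "Z \<in> Obj A"
  shows "bij_betw (\<lambda>u. (Pr1 A X Y \<cdot> u, Pr2 A X Y \<cdot> u)) (Hom A Z (Prod A X Y)) (Hom A Z X \<times> Hom A Z Y)"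
    "bij_betw (\<lambda>\<theta>. (Post A (Pr1 A X Y) \<theta>, Post A (Pr2 A X Y) \<theta>))
      (HomTrk A Z (Prod A X Y)) (HomTrk A Z X \<times> HomTrk A Z Y)"
  using strict_prods XY assms unfolding strict_products_def by blast+

lemma prod_eqI:
  assumes "u \<in> Hom A Z (Prod A X Y)" "v \<in> Hom A Z (Prod A X Y)"
    "Pr1 A X Y \<cdot> u = Pr1 A X Y \<cdot> v" "Pr2 A X Y \<cdot> u = Pr2 A X Y \<cdot> v"
  shows "u = v"
proof -
  have "Z \<in> Obj A" using assms(1) by (auto simp: mem_Hom_iff)
  from inj_onD[OF bij_betw_imp_inj_on[OF prod_bij(1)[OF this]] _ assms(1,2)] assms(3,4) show ?thesis by simp
qed

lemma prod_trk_eqI: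
  assumes "u \<in> HomTrk A Z (Prod A X Y)" "v \<in> HomTrk A Z (Prod A X Y)"
    "Post A (Pr1 A X Y) u = Post A (Pr1 A X Y) v" "Post A (Pr2 A X Y) u = Post A (Pr2 A X Y) v"
  shows "u = v"
proof -
  have "Z \<in> Obj A" using assms(1) by (auto simp: mem_Hom_iff HomTrk_def)
  from inj_onD[OF bij_betw_imp_inj_on[OF prod_bij(2)[OF this]] _ assms(1,2)] assms(3,4) show ?thesis by simp
qed

lemma pairA:
  assumes "f \<in> Hom A Z X" "g \<in> Hom A Z Y"
  shows "pairA A f g \<in> Hom A Z (Prod A X Y)" "Pr1 A X Y \<cdot> pairA A f g = f" "Pr2 A X Y \<cdot> pairA A f g = g"
proof -
  have Z: "Z \<in> Obj A" using assms(1) by (auto simp: mem_Hom_iff)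
  have "(f, g) \<in> (\<lambda>u. (Pr1 A X Y \<cdot> u, Pr2 A X Y \<cdot> u)) ` Hom A Z (Prod A X Y)"
    using bij_betw_imp_surj_on[OF prod_bij(1)[OF Z]] assms by simp
  then obtain u where u: "u \<in> Hom A Z (Prod A X Y)" "Pr1 A X Y \<cdot> u = f" "Pr2 A X Y \<cdot> u = g" by auto
  hence "\<exists>!u. u \<in> Hom A Z (Prod A X Y) \<and> Pr1 A X Y \<cdot> u = f \<and> Pr2 A X Y \<cdot> u = g"
    using prod_eqI by metis
  from theI'[OF this] assms show "pairA A f g \<in> Hom A Z (Prod A X Y)"
    "Pr1 A X Y \<cdot> pairA A f g = f" "Pr2 A X Y \<cdot> pairA A f g = g"
    by (simp_all add: pairA_def mem_Hom_iff)
qed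

lemma pairT:
  assumes "f \<in> HomTrk A Z X" "g \<in> HomTrk A Z Y"
  shows "pairT A f g \<in> HomTrk A Z (Prod A X Y)"
    "Post A (Pr1 A X Y) (pairT A f g) = f" "Post A (Pr2 A X Y) (pairT A f g) = g"
proof -
  have Z: "Z \<in> Obj A" using assms(1) by (auto simp: mem_Hom_iff HomTrk_def)
  have "(f, g) \<in> (\<lambda>u. (Post A (Pr1 A X Y) u, Post A (Pr2 A X Y) u)) ` HomTrk A Z (Prod A X Y)"
    using bij_betw_imp_surj_on[OF prod_bij(2)[OF Z]] assms by simp
  then obtain u where u: "u \<in> HomTrk A Z (Prod A X Y)" "Post A (Pr1 A X Y) u = f" "Post A (Pr2 A X Y) u = g"
    by auto
  hence "\<exists>!u. u \<in> HomTrk A Z (Prod A X Y) \<and> Post A (Pr1 A X Y) u = f \<and> Post A (Pr2 A X Y) u = g"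
    using prod_trk_eqI by metis
  from theI'[OF this] assms show "pairT A f g \<in> HomTrk A Z (Prod A X Y)"
    "Post A (Pr1 A X Y) (pairT A f g) = f" "Post A (Pr2 A X Y) (pairT A f g) = g"
    by (simp_all add: pairT_def mem_Hom_iff HomTrk_def)
qed

lemma zero_unique:
  shows "\<exists>!f. f \<in> Hom A X (Zero A)" "\<exists>!f. f \<in> Hom A (Zero A) X"
    "\<exists>!\<eta>. \<eta> \<in> HomTrk A X (Zero A)" "\<exists>!\<eta>. \<eta> \<in> HomTrk A (Zero A) X"
proof -
  have *: "(\<exists>!f. f \<in> Hom A X (Zero A)) \<and> (\<exists>!\<eta>. \<eta> \<in> HomTrk A X (Zero A)) \<and>
    (\<exists>!f. f \<in> Hom A (Zero A) X) \<and> (\<exists>!\<eta>. \<eta> \<in> HomTrk A (Zero A) X)"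
    using zero_obj unfolding strict_zero_object_def by (elim conjE) (rule bspec[OF _ XY(1)])
  show "\<exists>!f. f \<in> Hom A X (Zero A)" by (rule conjunct1[OF *])
  show "\<exists>!\<eta>. \<eta> \<in> HomTrk A X (Zero A)" by (rule conjunct1[OF conjunct2[OF *]])
  show "\<exists>!f. f \<in> Hom A (Zero A) X" by (rule conjunct1[OF conjunct2[OF conjunct2[OF *]]])
  show "\<exists>!\<eta>. \<eta> \<in> HomTrk A (Zero A) X" by (rule conjunct2[OF conjunct2[OF conjunct2[OF *]]])
qed

end

lemma Zero_Obj [simp]: "Zero A \<in> Obj A" using zero_obj by (simp add: strict_zero_object_def)

abbreviation "zA \<equiv> zero_map A (Zero A)"

lemma zA_eq:
  assumes "u \<in> Hom A X (Zero A)" "v \<in> Hom A (Zero A) Y" shows "zA X Y = v \<cdot> u"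
proof -
  have XY: "X \<in> Obj A" "Y \<in> Obj A" using assms by (auto simp: mem_Hom_iff)
  have u: "u' = u" if "u' \<in> Hom A X (Zero A)" for u'
    by (rule ex1_eqD[OF zero_unique(1)[OF XY] that assms(1)])
  have v: "v' = v" if "v' \<in> Hom A (Zero A) Y" for v'
    by (rule ex1_eqD[OF zero_unique(2)[OF XY(2,1)] that assms(2)])
  show ?thesis unfolding zero_map_def
  proof (rule the_equality)
    fix f assume "\<exists>u\<in>Hom A X (Zero A). \<exists>v\<in>Hom A (Zero A) Y. f = v \<cdot> u"
    then obtain u' v' where "u' \<in> Hom A X (Zero A)" "v' \<in> Hom A (Zero A) Y" "f = v' \<cdot> u'" by blast
    thus "f = v \<cdot> u" using u[of u'] v[of v'] by simp
  qed (use assms in blast)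
qed

lemma zA_factors:
  assumes "X \<in> Obj A" "Y \<in> Obj A"
  obtains u v where "u \<in> Hom A X (Zero A)" "v \<in> Hom A (Zero A) Y" "zA X Y = v \<cdot> u"
proof -
  obtain u where "u \<in> Hom A X (Zero A)" using zero_unique(1)[OF assms(1,1)] by (elim ex1E)
  moreover obtain v where "v \<in> Hom A (Zero A) Y" using zero_unique(2)[OF assms(2,2)] by (elim ex1E)
  ultimately show ?thesis using zA_eq that by blast
qed

lemma zA_simps [simp]:
  assumes "X \<in> Obj A" "Y \<in> Obj A"
  shows "zA X Y \<in> Arr A" "Dom A (zA X Y) = X" "Cod A (zA X Y) = Y"
proof -
  obtain u v where "u \<in> Hom A X (Zero A)" "v \<in> Hom A (Zero A) Y" "zA X Y = v \<cdot> u"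
    by (rule zA_factors[OF assms])
  thus "zA X Y \<in> Arr A" "Dom A (zA X Y) = X" "Cod A (zA X Y) = Y" by (simp_all add: mem_Hom_iff)
qed

lemma Comp_zA [simp]:
  assumes "f \<in> Arr A" "Dom A f = Y" "X \<in> Obj A" shows "f \<cdot> zA X Y = zA X (Cod A f)"
proof -
  obtain u v where uv: "u \<in> Hom A X (Zero A)" "v \<in> Hom A (Zero A) Y" "zA X Y = v \<cdot> u"
    by (rule zA_factors[OF assms(3), of Y]) (use assms in auto)
  hence "zA X (Cod A f) = (f \<cdot> v) \<cdot> u" using assms by (intro zA_eq) (auto simp: mem_Hom_iff)
  thus ?thesis using uv assms by (simp add: mem_Hom_iff)
qed

lemma zA_Comp [simp]:
  assumes "f \<in> Arr A" "Cod A f = Y" "Z \<in> Obj A" shows "zA Y Z \<cdot> f = zA (Dom A f) Z"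
proof -
  obtain u v where uv: "u \<in> Hom A Y (Zero A)" "v \<in> Hom A (Zero A) Z" "zA Y Z = v \<cdot> u"
    by (rule zA_factors[OF _ assms(3), of Y]) (use assms in auto)
  hence "zA (Dom A f) Z = v \<cdot> (u \<cdot> f)" using assms by (intro zA_eq) (auto simp: mem_Hom_iff)
  thus ?thesis using uv assms by (simp add: mem_Hom_iff)
qed

end

section \<open>Product preserving pseudofunctors\<close>

locale pp_fun = track_products A + pp_pseudofunctor n A \<phi>
  for A :: "('o, 'm, 't, 'z) track_cat_prod_scheme" (structure) and n :: enat
    and \<phi> :: "(nat, nil_arr, 'o, 'm, 't) pseudofun"
begin

lemma PObj_simp [simp]: "PObj \<phi> p \<in> Obj A"
  using PObj_Obj by simp

lemma PArr_simps [simp]: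
  assumes "w \<in> Arr (nil_op n)"
  shows "PArr \<phi> w \<in> Arr A" "Dom A (PArr \<phi> w) = PObj \<phi> (Dom (nil_op n) w)"
    "Cod A (PArr \<phi> w) = PObj \<phi> (Cod (nil_op n) w)"
  using PArr_Hom[of w "Dom (nil_op n) w" "Cod (nil_op n) w"] assms by (auto simp: mem_Hom_iff)

lemma PComp_simps [simp]:
  assumes "g \<in> Arr (nil_op n)" "w \<in> Arr (nil_op n)" "Dom (nil_op n) g = Cod (nil_op n) w"
  shows "PComp \<phi> g w \<in> Trk A" "Src A (PComp \<phi> g w) = PArr \<phi> g \<cdot> PArr \<phi> w"
    "Trg A (PComp \<phi> g w) = PArr \<phi> (g \<cdot>\<^bsub>nil_op n\<^esub> w)"
  using PComp_Track[of w "Dom (nil_op n) w" "Cod (nil_op n) w" g "Cod (nil_op n) g"] assms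
  by (auto simp: mem_Hom_iff mem_Track_iff)

lemma PComp_assoc_arr:
  assumes "h \<in> Arr (nil_op n)" "g \<in> Arr (nil_op n)" "f \<in> Arr (nil_op n)"
    "Dom (nil_op n) g = Cod (nil_op n) h" "Dom (nil_op n) f = Cod (nil_op n) g"
  shows "PComp \<phi> f (g \<cdot>\<^bsub>nil_op n\<^esub> h) \<box> Post A (PArr \<phi> f) (PComp \<phi> g h)
    = PComp \<phi> (f \<cdot>\<^bsub>nil_op n\<^esub> g) h \<box> Pre A (PArr \<phi> h) (PComp \<phi> f g)"
  by (rule PComp_assoc[of h "Dom (nil_op n) h" "Cod (nil_op n) h" g "Cod (nil_op n) g" f "Cod (nil_op n) f"])
    (use assms in \<open>auto simp: mem_Hom_iff\<close>)

lemma PArr_Ident [simp]: "PArr \<phi> (Ident (nil_op n) p) = Ident A (PObj \<phi> p)"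
  by (rule pp_Ident)

lemma PComp_Ident_left:
  assumes "w \<in> Hom (nil_op n) p q" shows "PComp \<phi> (Ident (nil_op n) q) w = IdT A (PArr \<phi> w)"
  using Ident_PComp[OF assms] assms pp_PUnit by (simp add: mem_Hom_iff)

lemma PComp_Ident_right:
  assumes "w \<in> Hom (nil_op n) p q" shows "PComp \<phi> w (Ident (nil_op n) p) = IdT A (PArr \<phi> w)"
  using PComp_Ident[OF assms] assms pp_PUnit by (simp add: mem_Hom_iff)

lemma pr1_simps [simp]:
  "nil_pr1 n p q \<in> Arr (nil_op n)" "Dom (nil_op n) (nil_pr1 n p q) = p + q" "Cod (nil_op n) (nil_pr1 n p q) = p"
  "nil_pr2 n p q \<in> Arr (nil_op n)" "Dom (nil_op n) (nil_pr2 n p q) = p + q" "Cod (nil_op n) (nil_pr2 n p q) = q"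
  using nil_pr1_Hom[of n p q] nil_pr2_Hom[of n p q] by (auto simp: mem_Hom_iff)

lemma pr_simps [simp]:
  "k < p \<Longrightarrow> pr n p k \<in> Arr (nil_op n)" "k < p \<Longrightarrow> Dom (nil_op n) (pr n p k) = p"
  "k < p \<Longrightarrow> Cod (nil_op n) (pr n p k) = 1"
  using pr_Hom[of k p n] by (auto simp: mem_Hom_iff)

lemma pi_map:
  "pi_map n A \<phi> p q \<in> Hom A (PObj \<phi> (p + q)) (Prod A (PObj \<phi> p) (PObj \<phi> q))"
  "Pr1 A (PObj \<phi> p) (PObj \<phi> q) \<cdot> pi_map n A \<phi> p q = PArr \<phi> (nil_pr1 n p q)"
  "Pr2 A (PObj \<phi> p) (PObj \<phi> q) \<cdot> pi_map n A \<phi> p q = PArr \<phi> (nil_pr2 n p q)"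
  unfolding pi_map_def by (rule pairA; simp add: mem_Hom_iff)+

lemma pi_simps [simp]:
  "pi_map n A \<phi> p q \<in> Arr A" "Dom A (pi_map n A \<phi> p q) = PObj \<phi> (p + q)"
  "Cod A (pi_map n A \<phi> p q) = Prod A (PObj \<phi> p) (PObj \<phi> q)"
  using pi_map(1)[of p q] by (auto simp: mem_Hom_iff)

text \<open>Through this inverse of \<open>pi_map\<close> the universal property of the chosen
  strict product, for maps and for tracks, passes to the value of \<phi> at p + q.\<close>

lemma pi_inverse:
  obtains g where "g \<in> Hom A (Prod A (PObj \<phi> p) (PObj \<phi> q)) (PObj \<phi> (p + q))"
    "g \<cdot> pi_map n A \<phi> p q = Ident A (PObj \<phi> (p + q))"
    "PArr \<phi> (nil_pr1 n p q) \<cdot> g = Pr1 A (PObj \<phi> p) (PObj \<phi> q)"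
    "PArr \<phi> (nil_pr2 n p q) \<cdot> g = Pr2 A (PObj \<phi> p) (PObj \<phi> q)"
proof -
  obtain g where g: "g \<in> Hom A (Prod A (PObj \<phi> p) (PObj \<phi> q)) (PObj \<phi> (p + q))"
    "g \<cdot> pi_map n A \<phi> p q = Ident A (PObj \<phi> (p + q))"
    "pi_map n A \<phi> p q \<cdot> g = Ident A (Prod A (PObj \<phi> p) (PObj \<phi> q))"
    using pp_pi_iso[of p q] unfolding is_isomorphism_def by auto
  have "PArr \<phi> (nil_pr1 n p q) \<cdot> g = Pr1 A (PObj \<phi> p) (PObj \<phi> q) \<cdot> (pi_map n A \<phi> p q \<cdot> g)"
    using g(1) unfolding pi_map(2)[symmetric] by (intro Comp_assoc_simp) (auto simp: mem_Hom_iff)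
  moreover have "PArr \<phi> (nil_pr2 n p q) \<cdot> g = Pr2 A (PObj \<phi> p) (PObj \<phi> q) \<cdot> (pi_map n A \<phi> p q \<cdot> g)"
    using g(1) unfolding pi_map(3)[symmetric] by (intro Comp_assoc_simp) (auto simp: mem_Hom_iff)
  ultimately show ?thesis using g by (intro that[of g]) auto
qed

lemma pi_Comp:
  assumes "u \<in> Arr A" "Cod A u = PObj \<phi> (p + q)"
  shows "Pr1 A (PObj \<phi> p) (PObj \<phi> q) \<cdot> (pi_map n A \<phi> p q \<cdot> u) = PArr \<phi> (nil_pr1 n p q) \<cdot> u"
    "Pr2 A (PObj \<phi> p) (PObj \<phi> q) \<cdot> (pi_map n A \<phi> p q \<cdot> u) = PArr \<phi> (nil_pr2 n p q) \<cdot> u"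
  unfolding pi_map(2,3)[symmetric] using assms by simp_all

lemma pi_Post:
  assumes "u \<in> Trk A" "Cod A (Src A u) = PObj \<phi> (p + q)"
  shows "Post A (Pr1 A (PObj \<phi> p) (PObj \<phi> q)) (Post A (pi_map n A \<phi> p q) u) = Post A (PArr \<phi> (nil_pr1 n p q)) u"
    "Post A (Pr2 A (PObj \<phi> p) (PObj \<phi> q)) (Post A (pi_map n A \<phi> p q) u) = Post A (PArr \<phi> (nil_pr2 n p q)) u"
  unfolding pi_map(2,3)[symmetric] using assms by simp_all

lemma pr_pair_eqI:
  assumes "u \<in> Hom A Z (PObj \<phi> (p + q))" "v \<in> Hom A Z (PObj \<phi> (p + q))"
    "PArr \<phi> (nil_pr1 n p q) \<cdot> u = PArr \<phi> (nil_pr1 n p q) \<cdot> v"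
    "PArr \<phi> (nil_pr2 n p q) \<cdot> u = PArr \<phi> (nil_pr2 n p q) \<cdot> v"
  shows "u = v"
proof -
  obtain g where g: "g \<in> Hom A (Prod A (PObj \<phi> p) (PObj \<phi> q)) (PObj \<phi> (p + q))"
    "g \<cdot> pi_map n A \<phi> p q = Ident A (PObj \<phi> (p + q))" by (rule pi_inverse)
  have "pi_map n A \<phi> p q \<cdot> u = pi_map n A \<phi> p q \<cdot> v"
    by (rule prod_eqI[of "PObj \<phi> p" "PObj \<phi> q" _ Z]) (use assms in \<open>auto simp: mem_Hom_iff pi_Comp\<close>)
  hence "(g \<cdot> pi_map n A \<phi> p q) \<cdot> u = (g \<cdot> pi_map n A \<phi> p q) \<cdot> v"
    using g(1) assms(1,2) by (simp add: mem_Hom_iff)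
  thus ?thesis using g(2) assms(1,2) by (simp add: mem_Hom_iff)
qed

lemma pr_pair_trk_eqI:
  assumes "u \<in> HomTrk A Z (PObj \<phi> (p + q))" "v \<in> HomTrk A Z (PObj \<phi> (p + q))"
    "Post A (PArr \<phi> (nil_pr1 n p q)) u = Post A (PArr \<phi> (nil_pr1 n p q)) v"
    "Post A (PArr \<phi> (nil_pr2 n p q)) u = Post A (PArr \<phi> (nil_pr2 n p q)) v"
  shows "u = v"
proof -
  obtain g where g: "g \<in> Hom A (Prod A (PObj \<phi> p) (PObj \<phi> q)) (PObj \<phi> (p + q))"
    "g \<cdot> pi_map n A \<phi> p q = Ident A (PObj \<phi> (p + q))" by (rule pi_inverse)
  have e: "Post A (pi_map n A \<phi> p q) u = Post A (pi_map n A \<phi> p q) v"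
    by (rule prod_trk_eqI[of "PObj \<phi> p" "PObj \<phi> q" _ Z]) (use assms in \<open>auto simp: mem_Hom_iff HomTrk_def pi_Post\<close>)
  have r: "w = Post A g (Post A (pi_map n A \<phi> p q) w)" if "w \<in> HomTrk A Z (PObj \<phi> (p + q))" for w
  proof -
    have "w = Post A (g \<cdot> pi_map n A \<phi> p q) w" using g that by (simp add: mem_Hom_iff HomTrk_def)
    also have "\<dots> = Post A g (Post A (pi_map n A \<phi> p q) w)"
      using g(1) that by (intro Post_Comp_simp) (auto simp: mem_Hom_iff HomTrk_def)
    finally show ?thesis .
  qed
  show ?thesis using r[OF assms(1)] r[OF assms(2)] e by simp
qed

lemma pr_pair_exists:
  assumes "a \<in> Hom A Z (PObj \<phi> p)" "b \<in> Hom A Z (PObj \<phi> q)"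
  obtains u where "u \<in> Hom A Z (PObj \<phi> (p + q))"
    "PArr \<phi> (nil_pr1 n p q) \<cdot> u = a" "PArr \<phi> (nil_pr2 n p q) \<cdot> u = b"
proof -
  obtain g where g: "g \<in> Hom A (Prod A (PObj \<phi> p) (PObj \<phi> q)) (PObj \<phi> (p + q))"
    "PArr \<phi> (nil_pr1 n p q) \<cdot> g = Pr1 A (PObj \<phi> p) (PObj \<phi> q)"
    "PArr \<phi> (nil_pr2 n p q) \<cdot> g = Pr2 A (PObj \<phi> p) (PObj \<phi> q)" by (rule pi_inverse)
  let ?h = "pairA A a b"
  note h = pairA[OF _ _ assms, simplified]
  have "PArr \<phi> (nil_pr1 n p q) \<cdot> (g \<cdot> ?h) = (PArr \<phi> (nil_pr1 n p q) \<cdot> g) \<cdot> ?h"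
    "PArr \<phi> (nil_pr2 n p q) \<cdot> (g \<cdot> ?h) = (PArr \<phi> (nil_pr2 n p q) \<cdot> g) \<cdot> ?h"
    using g(1) h(1) by (simp_all add: mem_Hom_iff)
  thus ?thesis using g h by (intro that[of "g \<cdot> ?h"]) (auto simp: mem_Hom_iff)
qed

lemma pr_pair_trk_exists:
  assumes "a \<in> HomTrk A Z (PObj \<phi> p)" "b \<in> HomTrk A Z (PObj \<phi> q)"
  obtains u where "u \<in> HomTrk A Z (PObj \<phi> (p + q))"
    "Post A (PArr \<phi> (nil_pr1 n p q)) u = a" "Post A (PArr \<phi> (nil_pr2 n p q)) u = b"
proof -
  obtain g where g: "g \<in> Hom A (Prod A (PObj \<phi> p) (PObj \<phi> q)) (PObj \<phi> (p + q))"
    "PArr \<phi> (nil_pr1 n p q) \<cdot> g = Pr1 A (PObj \<phi> p) (PObj \<phi> q)"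
    "PArr \<phi> (nil_pr2 n p q) \<cdot> g = Pr2 A (PObj \<phi> p) (PObj \<phi> q)" by (rule pi_inverse)
  let ?h = "pairT A a b"
  note h = pairT[OF _ _ assms, simplified]
  have "Post A (PArr \<phi> (nil_pr1 n p q)) (Post A g ?h) = Post A (PArr \<phi> (nil_pr1 n p q) \<cdot> g) ?h"
    using g(1) h(1) by (intro Post_Comp_simp[symmetric]) (auto simp: mem_Hom_iff HomTrk_def)
  moreover have "Post A (PArr \<phi> (nil_pr2 n p q)) (Post A g ?h) = Post A (PArr \<phi> (nil_pr2 n p q) \<cdot> g) ?h"
    using g(1) h(1) by (intro Post_Comp_simp[symmetric]) (auto simp: mem_Hom_iff HomTrk_def)
  ultimately show ?thesis using g h by (intro that[of "Post A g ?h"]) (auto simp: mem_Hom_iff HomTrk_def)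
qed

text \<open>\<phi> is strictly functorial on composites whose last factor is \<open>s\<close>. The
  second equation follows from the first by comparing targets and is carried along for
  rewriting.\<close>

definition strict_left :: "nil_arr \<Rightarrow> bool" where
  "strict_left s \<longleftrightarrow> s \<in> Arr (nil_op n) \<and> (\<forall>g \<in> Arr (nil_op n). Cod (nil_op n) g = Dom (nil_op n) s \<longrightarrow>
     PComp \<phi> s g = IdT A (PArr \<phi> s \<cdot> PArr \<phi> g) \<and> PArr \<phi> (s \<cdot>\<^bsub>nil_op n\<^esub> g) = PArr \<phi> s \<cdot> PArr \<phi> g)"

lemma strict_leftI:
  assumes "s \<in> Arr (nil_op n)"
    "\<And>g. g \<in> Arr (nil_op n) \<Longrightarrow> Cod (nil_op n) g = Dom (nil_op n) s \<Longrightarrow> PComp \<phi> s g = IdT A (PArr \<phi> s \<cdot> PArr \<phi> g)"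
  shows "strict_left s"
proof -
  have "PArr \<phi> (s \<cdot>\<^bsub>nil_op n\<^esub> g) = PArr \<phi> s \<cdot> PArr \<phi> g" 
    if g: "g \<in> Arr (nil_op n)" "Cod (nil_op n) g = Dom (nil_op n) s" for g
  proof -
    have "Trg A (PComp \<phi> s g) = PArr \<phi> (s \<cdot>\<^bsub>nil_op n\<^esub> g)" using g assms(1) by (intro PComp_simps) auto
    moreover have "Trg A (IdT A (PArr \<phi> s \<cdot> PArr \<phi> g)) = PArr \<phi> s \<cdot> PArr \<phi> g"
      using g assms(1) by (intro IdT_simps) auto
    ultimately show ?thesis using assms(2)[OF g] by simp
  qed
  thus ?thesis using assms by (auto simp: strict_left_def)
qed

text \<open>Strictness comes from the product condition on \<open>PComp\<close> at the identity of \<open>p + q\<close>, whose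
  coherence track is an identity.\<close>

lemma strict_left_pr1: "strict_left (nil_pr1 n p q)" and strict_left_pr2: "strict_left (nil_pr2 n p q)"
proof -
  have *: "PComp \<phi> (nil_pr1 n p q) g = IdT A (PArr \<phi> (nil_pr1 n p q) \<cdot> PArr \<phi> g) \<and>
    PComp \<phi> (nil_pr2 n p q) g = IdT A (PArr \<phi> (nil_pr2 n p q) \<cdot> PArr \<phi> g)"
    if g: "g \<in> Arr (nil_op n)" "Cod (nil_op n) g = p + q" for g
  proof -
    let ?t = "Dom (nil_op n) g"
    have gH: "g \<in> Hom (nil_op n) ?t (p + q)" using g by (simp add: mem_Hom_iff)
    have e: "Post A (pi_map n A \<phi> p q) (IdT A (PArr \<phi> g))
        = pairT A (PComp \<phi> (nil_pr1 n p q) g) (PComp \<phi> (nil_pr2 n p q) g)"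
      using pp_PComp[OF gH nil_op.Ident_Hom[of "p + q"]] PComp_Ident_left[OF gH] by simp
    have "PComp \<phi> (nil_pr1 n p q) g \<in> HomTrk A (PObj \<phi> ?t) (PObj \<phi> p)"
      "PComp \<phi> (nil_pr2 n p q) g \<in> HomTrk A (PObj \<phi> ?t) (PObj \<phi> q)"
      using g by (auto simp: HomTrk_def mem_Hom_iff)
    from pairT(2,3)[OF _ _ this, simplified, folded e] g show ?thesis by (simp add: pi_Comp)
  qed
  show "strict_left (nil_pr1 n p q)" "strict_left (nil_pr2 n p q)"
    by (rule strict_leftI; simp add: *)+
qed

text \<open>In the associativity coherence for \<open>s\<close>, \<open>t\<close> and
  \<open>g\<close> three of the four tracks are identities, hence so is the fourth.\<close>

lemma strict_left_comp:
  assumes "strict_left s" "strict_left t" "Cod (nil_op n) t = Dom (nil_op n) s"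
  shows "strict_left (s \<cdot>\<^bsub>nil_op n\<^esub> t)"
proof (rule strict_leftI)
  have s: "s \<in> Arr (nil_op n)" "t \<in> Arr (nil_op n)" using assms by (auto simp: strict_left_def)
  show "s \<cdot>\<^bsub>nil_op n\<^esub> t \<in> Arr (nil_op n)" using s assms by simp
  fix g assume g: "g \<in> Arr (nil_op n)" "Cod (nil_op n) g = Dom (nil_op n) (s \<cdot>\<^bsub>nil_op n\<^esub> t)"
  have st: "PComp \<phi> s t = IdT A (PArr \<phi> s \<cdot> PArr \<phi> t)" "PArr \<phi> (s \<cdot>\<^bsub>nil_op n\<^esub> t) = PArr \<phi> s \<cdot> PArr \<phi> t"
    using assms s by (auto simp: strict_left_def)
  have tg: "PComp \<phi> t g = IdT A (PArr \<phi> t \<cdot> PArr \<phi> g)" "PArr \<phi> (t \<cdot>\<^bsub>nil_op n\<^esub> g) = PArr \<phi> t \<cdot> PArr \<phi> g"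
    using assms g s by (auto simp: strict_left_def)
  have sg: "PComp \<phi> s (t \<cdot>\<^bsub>nil_op n\<^esub> g) = IdT A (PArr \<phi> s \<cdot> PArr \<phi> (t \<cdot>\<^bsub>nil_op n\<^esub> g))"
    using assms(1) g s assms(3) by (simp add: strict_left_def)
  have g': "Cod (nil_op n) g = Dom (nil_op n) t" using g s assms(3) by simp
  have "PComp \<phi> (s \<cdot>\<^bsub>nil_op n\<^esub> t) g = PComp \<phi> (s \<cdot>\<^bsub>nil_op n\<^esub> t) g \<box> Pre A (PArr \<phi> g) (PComp \<phi> s t)"
    unfolding st(1) using s g(1) g' assms(3) by (simp add: st(2))
  also have "\<dots> = PComp \<phi> s (t \<cdot>\<^bsub>nil_op n\<^esub> g) \<box> Post A (PArr \<phi> s) (PComp \<phi> t g)"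
    by (rule PComp_assoc_arr[symmetric]) (use s g(1) g' assms(3) in auto)
  also have "\<dots> = IdT A (PArr \<phi> (s \<cdot>\<^bsub>nil_op n\<^esub> t) \<cdot> PArr \<phi> g)"
    unfolding sg tg(1) using s g(1) g' assms(3) by (simp add: st(2) tg(2))
  finally show "PComp \<phi> (s \<cdot>\<^bsub>nil_op n\<^esub> t) g = IdT A (PArr \<phi> (s \<cdot>\<^bsub>nil_op n\<^esub> t) \<cdot> PArr \<phi> g)" .
qed

lemma pr_Suc: "k < p \<Longrightarrow> pr n (Suc p) k = pr n p k \<cdot>\<^bsub>nil_op n\<^esub> nil_pr1 n p 1"
  and pr_Suc_self: "pr n (Suc p) p = nil_pr2 n p 1"
proof -
  show "k < p \<Longrightarrow> pr n (Suc p) k = pr n p k \<cdot>\<^bsub>nil_op n\<^esub> nil_pr1 n p 1"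
    using pr_nil_pr1[of k p n 1] by (simp add: Suc_eq_plus1)
  show "pr n (Suc p) p = nil_pr2 n p 1"
    using pr_nil_pr2[of 0 1 n p] pr_1_0[of n] by (simp add: Suc_eq_plus1)
qed

text \<open>A projection to one coordinate is a composite of binary projections.\<close>

lemma strict_left_pr: "k < p \<Longrightarrow> strict_left (pr n p k)"
proof (induction p)
  case (Suc p)
  show ?case
  proof (cases "k = p")
    case True thus ?thesis by (simp add: pr_Suc_self strict_left_pr2)
  next
    case False
    with Suc have "k < p" by simp
    thus ?thesis unfolding pr_Suc[OF \<open>k < p\<close>]
      by (intro strict_left_comp strict_left_pr1 Suc.IH) auto
  qed
qed simp

lemma strict_left_simps:
  assumes "strict_left s" "g \<in> Arr (nil_op n)" "Cod (nil_op n) g = Dom (nil_op n) s"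
  shows "PComp \<phi> s g = IdT A (PArr \<phi> s \<cdot> PArr \<phi> g)" "PArr \<phi> (s \<cdot>\<^bsub>nil_op n\<^esub> g) = PArr \<phi> s \<cdot> PArr \<phi> g"
  using assms by (auto simp: strict_left_def)

lemma PArr_pr_Suc:
  "k < p \<Longrightarrow> PArr \<phi> (pr n (Suc p) k) = PArr \<phi> (pr n p k) \<cdot> PArr \<phi> (nil_pr1 n p 1)"
  by (simp add: pr_Suc strict_left_simps strict_left_pr)

lemma PArr_pr1:
  assumes "k < p" shows "PArr \<phi> (pr n (p + q) k) = PArr \<phi> (pr n p k) \<cdot> PArr \<phi> (nil_pr1 n p q)"
  using strict_left_simps(2)[OF strict_left_pr[OF assms], of "nil_pr1 n p q"] assms pr_nil_pr1[OF assms] by simp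

lemma PArr_pr2:
  assumes "k < q" shows "PArr \<phi> (pr n (p + q) (p + k)) = PArr \<phi> (pr n q k) \<cdot> PArr \<phi> (nil_pr2 n p q)"
  using strict_left_simps(2)[OF strict_left_pr[OF assms], of "nil_pr2 n p q"] assms pr_nil_pr2[OF assms] by simp

text \<open>\<phi> p is a strict p-fold product of copies of \<phi> 1: the last factor is split off
  by the binary case, and the empty product is the zero object. The next three lemmas complete this
  universal property for maps and tracks.\<close>

lemma joint_eqI:
  assumes "u \<in> Hom A Z (PObj \<phi> p)" "v \<in> Hom A Z (PObj \<phi> p)"
    "\<And>k. k < p \<Longrightarrow> PArr \<phi> (pr n p k) \<cdot> u = PArr \<phi> (pr n p k) \<cdot> v"
  shows "u = v"
  using assms
proof (induction p arbitrary: u v)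
  case 0
  hence Z: "Z \<in> Obj A" by (auto simp: mem_Hom_iff)
  show ?case by (rule ex1_eqD[OF zero_unique(1)[OF Z Z]]) (use 0 in \<open>simp_all add: pp_Zero\<close>)
next
  case (Suc p)
  note uv = Suc.prems(1,2)[unfolded Suc_eq_plus1]
  have "PArr \<phi> (nil_pr1 n p 1) \<cdot> u = PArr \<phi> (nil_pr1 n p 1) \<cdot> v"
  proof (rule Suc.IH)
    fix k assume k: "k < p"
    show "PArr \<phi> (pr n p k) \<cdot> (PArr \<phi> (nil_pr1 n p 1) \<cdot> u) = PArr \<phi> (pr n p k) \<cdot> (PArr \<phi> (nil_pr1 n p 1) \<cdot> v)"
      using Suc.prems(3)[of k] k uv by (simp add: PArr_pr_Suc mem_Hom_iff)
  qed (use uv in \<open>auto simp: mem_Hom_iff\<close>)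
  moreover have "PArr \<phi> (nil_pr2 n p 1) \<cdot> u = PArr \<phi> (nil_pr2 n p 1) \<cdot> v"
    using Suc.prems(3)[of p] by (simp add: pr_Suc_self)
  ultimately show ?case using uv pr_pair_eqI by blast
qed

lemma joint_trk_eqI:
  assumes "u \<in> HomTrk A Z (PObj \<phi> p)" "v \<in> HomTrk A Z (PObj \<phi> p)"
    "\<And>k. k < p \<Longrightarrow> Post A (PArr \<phi> (pr n p k)) u = Post A (PArr \<phi> (pr n p k)) v"
  shows "u = v"
  using assms
proof (induction p arbitrary: u v)
  case 0
  hence Z: "Z \<in> Obj A" by (auto simp: mem_Hom_iff HomTrk_def)
  show ?case by (rule ex1_eqD[OF zero_unique(3)[OF Z Z]]) (use 0 in \<open>simp_all add: pp_Zero\<close>)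
next
  case (Suc p)
  note uv = Suc.prems(1,2)[unfolded Suc_eq_plus1]
  have "Post A (PArr \<phi> (nil_pr1 n p 1)) u = Post A (PArr \<phi> (nil_pr1 n p 1)) v"
  proof (rule Suc.IH)
    fix k assume k: "k < p"
    show "Post A (PArr \<phi> (pr n p k)) (Post A (PArr \<phi> (nil_pr1 n p 1)) u) =
      Post A (PArr \<phi> (pr n p k)) (Post A (PArr \<phi> (nil_pr1 n p 1)) v)"
      using Suc.prems(3)[of k] k uv by (simp add: PArr_pr_Suc mem_Hom_iff HomTrk_def)
  qed (use uv in \<open>auto simp: mem_Hom_iff HomTrk_def\<close>)
  moreover have "Post A (PArr \<phi> (nil_pr2 n p 1)) u = Post A (PArr \<phi> (nil_pr2 n p 1)) v"
    using Suc.prems(3)[of p] by (simp add: pr_Suc_self)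
  ultimately show ?case using uv pr_pair_trk_eqI by blast
qed

lemma joint_exists:
  assumes "Z \<in> Obj A" "\<And>k. k < p \<Longrightarrow> a k \<in> Hom A Z (PObj \<phi> 1)"
  shows "\<exists>u \<in> Hom A Z (PObj \<phi> p). \<forall>k<p. PArr \<phi> (pr n p k) \<cdot> u = a k"
  using assms(2)
proof (induction p)
  case 0
  show ?case using zero_unique(1)[OF assms(1,1)] by (auto simp: pp_Zero)
next
  case (Suc p)
  then obtain u where u: "u \<in> Hom A Z (PObj \<phi> p)" "\<forall>k<p. PArr \<phi> (pr n p k) \<cdot> u = a k" by force
  obtain v where v: "v \<in> Hom A Z (PObj \<phi> (p + 1))"
    "PArr \<phi> (nil_pr1 n p 1) \<cdot> v = u" "PArr \<phi> (nil_pr2 n p 1) \<cdot> v = a p"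
    by (rule pr_pair_exists[OF u(1) Suc.prems[of p]]) auto
  have "PArr \<phi> (pr n (Suc p) k) \<cdot> v = a k" if "k < Suc p" for k
  proof (cases "k = p")
    case True thus ?thesis using v(3) by (simp add: pr_Suc_self)
  next
    case False
    with that u(2) v show ?thesis by (simp add: PArr_pr_Suc mem_Hom_iff)
  qed
  thus ?case using v(1) by (intro bexI[of _ v]) (simp_all add: Suc_eq_plus1)
qed

lemma joint_trk_exists:
  assumes "Z \<in> Obj A" "\<And>k. k < p \<Longrightarrow> a k \<in> HomTrk A Z (PObj \<phi> 1)"
  shows "\<exists>u \<in> HomTrk A Z (PObj \<phi> p). \<forall>k<p. Post A (PArr \<phi> (pr n p k)) u = a k"
  using assms(2)
proof (induction p)
  case 0
  show ?case using zero_unique(3)[OF assms(1,1)] by (auto simp: pp_Zero)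
next
  case (Suc p)
  then obtain u where u: "u \<in> HomTrk A Z (PObj \<phi> p)" "\<forall>k<p. Post A (PArr \<phi> (pr n p k)) u = a k" by force
  obtain v where v: "v \<in> HomTrk A Z (PObj \<phi> (p + 1))"
    "Post A (PArr \<phi> (nil_pr1 n p 1)) v = u" "Post A (PArr \<phi> (nil_pr2 n p 1)) v = a p"
    by (rule pr_pair_trk_exists[OF u(1) Suc.prems[of p]]) auto
  have "Post A (PArr \<phi> (pr n (Suc p) k)) v = a k" if "k < Suc p" for k
  proof (cases "k = p")
    case True thus ?thesis using v(3) by (simp add: pr_Suc_self)
  next
    case False
    with that u(2) v show ?thesis by (simp add: PArr_pr_Suc mem_Hom_iff HomTrk_def)
  qed
  thus ?case using v(1) by (intro bexI[of _ v]) (simp_all add: Suc_eq_plus1)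
qed

lemma nz_simps [simp]:
  "nz n p q \<in> Arr (nil_op n)" "Dom (nil_op n) (nz n p q) = p" "Cod (nil_op n) (nz n p q) = q"
  using nz_Hom[of n p q] by (auto simp: mem_Hom_iff)

lemma PArr_nz [simp]: "PArr \<phi> (nz n p q) = zA (PObj \<phi> p) (PObj \<phi> q)"
  by (rule pp_zero_map)

end

section \<open>Additivity\<close>

context additive_track_category
begin

interpretation ho: additive_category "ho A" HG by (rule ho_additive)

definition hc where "hc = homotopy_class A"

lemma HG_group: "X \<in> Obj A \<Longrightarrow> Y \<in> Obj A \<Longrightarrow> comm_group (HG X Y)"
  using ho.HG_group by simp

lemma HG_carrier: "X \<in> Obj A \<Longrightarrow> Y \<in> Obj A \<Longrightarrow> carrier (HG X Y) = hc ` Hom A X Y"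
  using ho.HG_carrier by (simp add: Hom_ho hc_def)

lemma hc_closed [simp]:
  "f \<in> Arr A \<Longrightarrow> Dom A f = X \<Longrightarrow> Cod A f = Y \<Longrightarrow> hc f \<in> carrier (HG X Y)"
  by (auto simp: HG_carrier mem_Hom_iff)

lemma hc_Comp_add_right:
  assumes "f \<in> Hom A X Y" "f1 \<in> Hom A X Y" "f2 \<in> Hom A X Y" "g \<in> Hom A Y Z"
    "hc f = hc f1 \<otimes>\<^bsub>HG X Y\<^esub> hc f2"
  shows "hc (g \<cdot> f) = hc (g \<cdot> f1) \<otimes>\<^bsub>HG X Z\<^esub> hc (g \<cdot> f2)"
proof -
  have h: "homotopy_class A f1 \<in> Hom (ho A) X Y" "homotopy_class A f2 \<in> Hom (ho A) X Y"
    "homotopy_class A g \<in> Hom (ho A) Y Z" using assms by (auto simp: Hom_ho)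
  from ho.Comp_add_right[OF h] assms show ?thesis
    by (simp add: hc_def Comp_ho mem_Hom_iff flip: assms(5)[unfolded hc_def])
qed

lemma hc_Comp_add_left:
  assumes "f \<in> Hom A X Y" "g \<in> Hom A Y Z" "g1 \<in> Hom A Y Z" "g2 \<in> Hom A Y Z"
    "hc g = hc g1 \<otimes>\<^bsub>HG Y Z\<^esub> hc g2"
  shows "hc (g \<cdot> f) = hc (g1 \<cdot> f) \<otimes>\<^bsub>HG X Z\<^esub> hc (g2 \<cdot> f)"
proof -
  have h: "homotopy_class A f \<in> Hom (ho A) X Y" "homotopy_class A g1 \<in> Hom (ho A) Y Z"
    "homotopy_class A g2 \<in> Hom (ho A) Y Z" using assms by (auto simp: Hom_ho)
  from ho.Comp_add_left[OF h] assms show ?thesis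
    by (simp add: hc_def Comp_ho mem_Hom_iff flip: assms(5)[unfolded hc_def])
qed

lemma hc_Comp_cong:
  assumes "hc f = hc f'" "hc g = hc g'" "f \<in> Arr A" "g \<in> Arr A" "f' \<in> Arr A" "g' \<in> Arr A"
    "Dom A g = Cod A f" "Dom A g' = Cod A f'"
  shows "hc (g \<cdot> f) = hc (g' \<cdot> f')"
proof -
  have "hc (g \<cdot> f) = homotopy_class A g \<cdot>\<^bsub>ho A\<^esub> homotopy_class A f"
    unfolding hc_def by (rule Comp_ho[symmetric]) (use assms in auto)
  also have "\<dots> = hc (g' \<cdot> f')"
    unfolding assms(1,2)[unfolded hc_def] unfolding hc_def by (rule Comp_ho) (use assms in auto)
  finally show ?thesis .
qed

lemma hc_trk: "\<eta> \<in> Trk A \<Longrightarrow> hc (Src A \<eta>) = hc (Trg A \<eta>)"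
  unfolding hc_def by (rule homotopy_class_eq)

end

locale additive_track_products = track_products A + additive_track_category A HG D Dmap \<sigma>
  for A :: "('o, 'm, 't, 'z) track_cat_prod_scheme" (structure)
    and HG :: "'o \<Rightarrow> 'o \<Rightarrow> 'm set monoid"
    and D :: "'o \<Rightarrow> 'o \<Rightarrow> 'd monoid"
    and Dmap :: "'m set \<Rightarrow> 'm set \<Rightarrow> 'd \<Rightarrow> 'd"
    and \<sigma> :: "'m \<Rightarrow> 'd \<Rightarrow> 't"
begin

lemma group_idem_one: "comm_group G \<Longrightarrow> x \<in> carrier G \<Longrightarrow> x = x \<otimes>\<^bsub>G\<^esub> x \<Longrightarrow> x = \<one>\<^bsub>G\<^esub>"
proof -
  assume "comm_group G" "x \<in> carrier G" "x = x \<otimes>\<^bsub>G\<^esub> x"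
  then interpret comm_group G by simp
  show ?thesis using \<open>x \<in> carrier G\<close> \<open>x = x \<otimes>\<^bsub>G\<^esub> x\<close> l_cancel_one' by metis
qed

text \<open>Maps out of the zero object form a one-element group, so the class there is idempotent;
  precomposition carries this to every zero map, and an idempotent element of a group is
  neutral.\<close>

lemma hc_zA:
  assumes "X \<in> Obj A" "Y \<in> Obj A" shows "hc (zA X Y) = \<one>\<^bsub>HG X Y\<^esub>"
proof -
  interpret G: comm_group "HG (Zero A) Y" using HG_group assms by simp
  have "Hom A (Zero A) Y = {zA (Zero A) Y}"
    using ex1_eqD[OF zero_unique(2)[OF assms(2,2)]] assms by (auto simp: mem_Hom_iff)
  hence c: "carrier (HG (Zero A) Y) = {hc (zA (Zero A) Y)}" using assms by (simp add: HG_carrier)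
  have 1: "hc (zA (Zero A) Y) = hc (zA (Zero A) Y) \<otimes>\<^bsub>HG (Zero A) Y\<^esub> hc (zA (Zero A) Y)"
    using G.m_closed c by (metis singletonD singletonI)
  have "hc (zA (Zero A) Y \<cdot> zA X (Zero A)) = hc (zA (Zero A) Y \<cdot> zA X (Zero A)) \<otimes>\<^bsub>HG X Y\<^esub> hc (zA (Zero A) Y \<cdot> zA X (Zero A))"
    by (rule hc_Comp_add_left[OF _ _ _ _ 1]) (use assms in \<open>auto simp: mem_Hom_iff\<close>)
  hence "hc (zA X Y) = hc (zA X Y) \<otimes>\<^bsub>HG X Y\<^esub> hc (zA X Y)" using assms by simp
  thus ?thesis using assms by (intro group_idem_one HG_group) simp_all
qed

lemma hc_zA_add: 
  assumes "X \<in> Obj A" "Y \<in> Obj A" shows "hc (zA X Y) = hc (zA X Y) \<otimes>\<^bsub>HG X Y\<^esub> hc (zA X Y)"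
proof -
  interpret comm_group "HG X Y" by (rule HG_group[OF assms])
  show ?thesis unfolding hc_zA[OF assms] by simp
qed

lemma D_pre_zA:
  assumes "X \<in> Obj A" "Y \<in> Obj A" "W \<in> Obj A" "a \<in> carrier (D X Y)"
  shows "D_pre Y (zA W X) a = \<one>\<^bsub>D W Y\<^esub>"
proof (rule group_idem_one)
  show "D_pre Y (zA W X) a = D_pre Y (zA W X) a \<otimes>\<^bsub>D W Y\<^esub> D_pre Y (zA W X) a"
    by (rule D_pre_add) (use assms hc_zA_add[of W X, unfolded hc_def] in \<open>auto simp: mem_Hom_iff\<close>)
qed (use assms D_group in auto)

end

section \<open>Injections into the products of the theory\<close>

lemma nil_pair:
  assumes "a \<in> Hom (nil_op n) r p" "b \<in> Hom (nil_op n) r q"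
  obtains u where "u \<in> Hom (nil_op n) r (p + q)"
    "nil_pr1 n p q \<cdot>\<^bsub>nil_op n\<^esub> u = a" "nil_pr2 n p q \<cdot>\<^bsub>nil_op n\<^esub> u = b"
proof -
  let ?w = "\<lambda>k. if k < p then pr n p k \<cdot>\<^bsub>nil_op n\<^esub> a else pr n q (k - p) \<cdot>\<^bsub>nil_op n\<^esub> b"
  have w: "?w k \<in> Hom (nil_op n) r 1" if "k < p + q" for k
    using that nil_op.Comp_Hom[OF assms(1) pr_Hom[of k p n]]
      nil_op.Comp_Hom[OF assms(2) pr_Hom[of "k - p" q n]] by auto
  define u where "u = tup n r (p + q) ?w"
  have u: "u \<in> Hom (nil_op n) r (p + q)" and pu: "\<And>k. k < p + q \<Longrightarrow> pr n (p + q) k \<cdot>\<^bsub>nil_op n\<^esub> u = ?w k"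
    unfolding u_def using tup_Hom[of "p + q" ?w n r] pr_tup[of "p + q" ?w n r] w by blast+
  have "nil_pr1 n p q \<cdot>\<^bsub>nil_op n\<^esub> u = a"
  proof (rule nil_op_joint_monic[OF nil_op.Comp_Hom[OF u nil_pr1_Hom] assms(1)])
    fix k assume k: "k < p"
    show "pr n p k \<cdot>\<^bsub>nil_op n\<^esub> (nil_pr1 n p q \<cdot>\<^bsub>nil_op n\<^esub> u) = pr n p k \<cdot>\<^bsub>nil_op n\<^esub> a"
      using nil_op.Comp_assoc[OF u nil_pr1_Hom pr_Hom[OF k]] pu[of k] k by (simp add: pr_nil_pr1)
  qed
  moreover have "nil_pr2 n p q \<cdot>\<^bsub>nil_op n\<^esub> u = b"
  proof (rule nil_op_joint_monic[OF nil_op.Comp_Hom[OF u nil_pr2_Hom] assms(2)])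
    fix k assume k: "k < q"
    show "pr n q k \<cdot>\<^bsub>nil_op n\<^esub> (nil_pr2 n p q \<cdot>\<^bsub>nil_op n\<^esub> u) = pr n q k \<cdot>\<^bsub>nil_op n\<^esub> b"
      using nil_op.Comp_assoc[OF u nil_pr2_Hom pr_Hom[OF k]] pu[of "p + k"] k by (simp add: pr_nil_pr2)
  qed
  ultimately show ?thesis using u that by blast
qed

text \<open>The injection of 1 as coordinate k, counted from 0, of the p-fold product; the zero maps
  supply the other coordinates.\<close>

definition ninj :: "enat \<Rightarrow> nat \<Rightarrow> nat \<Rightarrow> nil_arr" where
  "ninj n p k = tup n 1 p (\<lambda>j. if j = k then Ident (nil_op n) 1 else nz n 1 1)"

lemma ninj_Hom: "ninj n p k \<in> Hom (nil_op n) 1 p"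
  and pr_ninj: "j < p \<Longrightarrow> pr n p j \<cdot>\<^bsub>nil_op n\<^esub> ninj n p k = (if j = k then Ident (nil_op n) 1 else nz n 1 1)"
proof -
  have w: "(if j = k then Ident (nil_op n) 1 else nz n 1 1) \<in> Hom (nil_op n) 1 1" for j
    using nz_Hom nil_op.Ident_Hom by auto
  show "ninj n p k \<in> Hom (nil_op n) 1 p" unfolding ninj_def by (rule tup_Hom) (rule w)
  show "j < p \<Longrightarrow> pr n p j \<cdot>\<^bsub>nil_op n\<^esub> ninj n p k = (if j = k then Ident (nil_op n) 1 else nz n 1 1)"
    unfolding ninj_def by (rule pr_tup) (rule w)
qed

lemma ninj_simps [simp]:
  "ninj n p k \<in> Arr (nil_op n)" "Dom (nil_op n) (ninj n p k) = 1" "Cod (nil_op n) (ninj n p k) = p"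
  using ninj_Hom[of n p k] by (auto simp: mem_Hom_iff)

lemma nil_pr1_inj:
  assumes "k < p" shows "nil_pr1 n p 1 \<cdot>\<^bsub>nil_op n\<^esub> ninj n (p + 1) k = ninj n p k"
proof (rule nil_op_joint_monic[OF nil_op.Comp_Hom[OF ninj_Hom nil_pr1_Hom] ninj_Hom])
  fix j assume j: "j < p"
  show "pr n p j \<cdot>\<^bsub>nil_op n\<^esub> (nil_pr1 n p 1 \<cdot>\<^bsub>nil_op n\<^esub> ninj n (p + 1) k) = pr n p j \<cdot>\<^bsub>nil_op n\<^esub> ninj n p k"
    using nil_op.Comp_assoc[OF ninj_Hom nil_pr1_Hom pr_Hom[OF j], of n 1 k] j pr_ninj[of j "p + 1" n k]
    by (simp add: pr_nil_pr1 pr_ninj)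
qed

lemma nil_pr2_inj: "nil_pr2 n p 1 \<cdot>\<^bsub>nil_op n\<^esub> ninj n (p + 1) k = (if k = p then Ident (nil_op n) 1 else nz n 1 1)"
proof -
  have "nil_pr2 n p 1 = pr n (p + 1) p"
    using pr_nil_pr2[of 0 1 n p] pr_1_0[of n] nil_op.Ident_Comp[OF nil_pr2_Hom] by simp
  thus ?thesis using pr_ninj[of p "p + 1" n k] by auto
qed

lemma nil_pr1_inj_last: "nil_pr1 n p 1 \<cdot>\<^bsub>nil_op n\<^esub> ninj n (p + 1) p = nz n 1 p"
proof (rule nil_op_joint_monic[OF nil_op.Comp_Hom[OF ninj_Hom nil_pr1_Hom] nz_Hom])
  fix j assume j: "j < p"
  show "pr n p j \<cdot>\<^bsub>nil_op n\<^esub> (nil_pr1 n p 1 \<cdot>\<^bsub>nil_op n\<^esub> ninj n (p + 1) p) = pr n p j \<cdot>\<^bsub>nil_op n\<^esub> nz n 1 p"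
    using nil_op.Comp_assoc[OF ninj_Hom nil_pr1_Hom pr_Hom[OF j], of n 1 p] j pr_ninj[of j "p + 1" n p]
    by (simp add: pr_nil_pr1 comp_nz[OF pr_Hom[OF j]])
qed

locale additive_pp_fun = pp_fun A n \<phi> + additive_track_products A HG D Dmap \<sigma>
  for A (structure) and n \<phi> HG D Dmap \<sigma>
begin

lemma hc_PArr_Comp:
  assumes "g \<in> Arr (nil_op n)" "w \<in> Arr (nil_op n)" "Dom (nil_op n) g = Cod (nil_op n) w"
  shows "hc (PArr \<phi> (g \<cdot>\<^bsub>nil_op n\<^esub> w)) = hc (PArr \<phi> g \<cdot> PArr \<phi> w)"
  using hc_trk[OF PComp_simps(1)[OF assms]] assms by simp

text \<open>Both sides have the same composites with the two projections, which are jointly monic up to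
  homotopy.\<close>

lemma hc_Ident_split:
  assumes i: "i \<in> Hom (nil_op n) p (p + q)" "nil_pr1 n p q \<cdot>\<^bsub>nil_op n\<^esub> i = Ident (nil_op n) p"
    "nil_pr2 n p q \<cdot>\<^bsub>nil_op n\<^esub> i = nz n p q"
    and j: "j \<in> Hom (nil_op n) q (p + q)" "nil_pr1 n p q \<cdot>\<^bsub>nil_op n\<^esub> j = nz n q p"
    "nil_pr2 n p q \<cdot>\<^bsub>nil_op n\<^esub> j = Ident (nil_op n) q"
  shows "hc (Ident A (PObj \<phi> (p + q))) = hc (PArr \<phi> i \<cdot> PArr \<phi> (nil_pr1 n p q))
    \<otimes>\<^bsub>HG (PObj \<phi> (p + q)) (PObj \<phi> (p + q))\<^esub> hc (PArr \<phi> j \<cdot> PArr \<phi> (nil_pr2 n p q))"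
    (is "_ = hc ?s1 \<otimes>\<^bsub>?G\<^esub> hc ?s2")
proof -
  let ?B = "PObj \<phi> (p + q)"
  interpret G: comm_group ?G by (rule HG_group) auto
  interpret G1: comm_group "HG ?B (PObj \<phi> p)" by (rule HG_group) auto
  interpret G2: comm_group "HG ?B (PObj \<phi> q)" by (rule HG_group) auto
  have ij: "i \<in> Arr (nil_op n)" "Dom (nil_op n) i = p" "Cod (nil_op n) i = p + q"
    "j \<in> Arr (nil_op n)" "Dom (nil_op n) j = q" "Cod (nil_op n) j = p + q"
    using i(1) j(1) by (auto simp: mem_Hom_iff)
  have "hc ?s1 \<otimes>\<^bsub>?G\<^esub> hc ?s2 \<in> carrier ?G" using ij by simp
  \<comment> \<open>The sum lives on classes only; \<open>s\<close> is a map representing it, to be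
    compared with the identity.\<close>
  then obtain s where s: "s \<in> Hom A ?B ?B" "hc s = hc ?s1 \<otimes>\<^bsub>?G\<^esub> hc ?s2"
    by (auto simp: HG_carrier)
  have P: "PArr \<phi> (nil_pr1 n p q) \<cdot> PArr \<phi> i = Ident A (PObj \<phi> p)"
    "PArr \<phi> (nil_pr2 n p q) \<cdot> PArr \<phi> i = zA (PObj \<phi> p) (PObj \<phi> q)"
    "PArr \<phi> (nil_pr1 n p q) \<cdot> PArr \<phi> j = zA (PObj \<phi> q) (PObj \<phi> p)"
    "PArr \<phi> (nil_pr2 n p q) \<cdot> PArr \<phi> j = Ident A (PObj \<phi> q)"
    using strict_left_simps(2)[OF strict_left_pr1, of i p q] strict_left_simps(2)[OF strict_left_pr2, of i p q]
      strict_left_simps(2)[OF strict_left_pr1, of j p q] strict_left_simps(2)[OF strict_left_pr2, of j p q]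
      ij i j by simp_all
  have PA: "PArr \<phi> (nil_pr1 n p q) \<cdot> (PArr \<phi> i \<cdot> w) = w" "PArr \<phi> (nil_pr2 n p q) \<cdot> (PArr \<phi> i \<cdot> w) = zA (Dom A w) (PObj \<phi> q)"
    if "w \<in> Arr A" "Cod A w = PObj \<phi> p" for w
    using Comp_assoc_simp[of w "PArr \<phi> i" "PArr \<phi> (nil_pr1 n p q)"]
      Comp_assoc_simp[of w "PArr \<phi> i" "PArr \<phi> (nil_pr2 n p q)"] that ij by (simp_all add: P)
  have PB: "PArr \<phi> (nil_pr2 n p q) \<cdot> (PArr \<phi> j \<cdot> w) = w" "PArr \<phi> (nil_pr1 n p q) \<cdot> (PArr \<phi> j \<cdot> w) = zA (Dom A w) (PObj \<phi> p)"
    if "w \<in> Arr A" "Cod A w = PObj \<phi> q" for w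
    using Comp_assoc_simp[of w "PArr \<phi> j" "PArr \<phi> (nil_pr1 n p q)"]
      Comp_assoc_simp[of w "PArr \<phi> j" "PArr \<phi> (nil_pr2 n p q)"] that ij by (simp_all add: P)
  have "hc (PArr \<phi> (nil_pr1 n p q) \<cdot> s) = hc (PArr \<phi> (nil_pr1 n p q) \<cdot> ?s1)
      \<otimes>\<^bsub>HG ?B (PObj \<phi> p)\<^esub> hc (PArr \<phi> (nil_pr1 n p q) \<cdot> ?s2)"
    by (rule hc_Comp_add_right[OF _ _ _ _ s(2)]) (use ij s(1) in \<open>auto simp: mem_Hom_iff\<close>)
  hence 1: "hc (PArr \<phi> (nil_pr1 n p q) \<cdot> s) = hc (PArr \<phi> (nil_pr1 n p q))"
    using ij by (simp add: PA PB hc_zA)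
  have "hc (PArr \<phi> (nil_pr2 n p q) \<cdot> s) = hc (PArr \<phi> (nil_pr2 n p q) \<cdot> ?s1)
      \<otimes>\<^bsub>HG ?B (PObj \<phi> q)\<^esub> hc (PArr \<phi> (nil_pr2 n p q) \<cdot> ?s2)"
    by (rule hc_Comp_add_right[OF _ _ _ _ s(2)]) (use ij s(1) in \<open>auto simp: mem_Hom_iff\<close>)
  hence 2: "hc (PArr \<phi> (nil_pr2 n p q) \<cdot> s) = hc (PArr \<phi> (nil_pr2 n p q))"
    using ij by (simp add: PA PB hc_zA)
  obtain \<theta>1 where \<theta>1: "\<theta>1 \<in> Trk A" "Src A \<theta>1 = PArr \<phi> (nil_pr1 n p q) \<cdot> s" "Trg A \<theta>1 = PArr \<phi> (nil_pr1 n p q)"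
    by (rule homotopy_class_eqD[OF _ _ 1[unfolded hc_def]]) (use s(1) in \<open>auto simp: mem_Hom_iff\<close>)
  obtain \<theta>2 where \<theta>2: "\<theta>2 \<in> Trk A" "Src A \<theta>2 = PArr \<phi> (nil_pr2 n p q) \<cdot> s" "Trg A \<theta>2 = PArr \<phi> (nil_pr2 n p q)"
    by (rule homotopy_class_eqD[OF _ _ 2[unfolded hc_def]]) (use s(1) in \<open>auto simp: mem_Hom_iff\<close>)
  \<comment> \<open>The homotopies on the two coordinates are combined by the strict product of
    tracks; the ends of the result are then read off coordinatewise.\<close>
  obtain \<theta> where \<theta>: "\<theta> \<in> HomTrk A ?B ?B" "Post A (PArr \<phi> (nil_pr1 n p q)) \<theta> = \<theta>1"
    "Post A (PArr \<phi> (nil_pr2 n p q)) \<theta> = \<theta>2"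
    by (rule pr_pair_trk_exists[of \<theta>1 ?B p \<theta>2 q]) (use \<theta>1 \<theta>2 s(1) in \<open>auto simp: mem_Hom_iff HomTrk_def\<close>)
  have t: "\<theta> \<in> Trk A" "Dom A (Src A \<theta>) = ?B" "Cod A (Src A \<theta>) = ?B" using \<theta>(1) by (auto simp: mem_Hom_iff HomTrk_def)
  have "Src A \<theta> = s"
    by (rule pr_pair_eqI[of _ ?B p q]) (use s(1) t \<theta>1(2) \<theta>2(2) \<theta>(2,3)[symmetric] in \<open>auto simp: mem_Hom_iff\<close>)
  moreover have "Trg A \<theta> = Ident A ?B"
    by (rule pr_pair_eqI[of _ ?B p q]) (use s(1) t \<theta>1(3) \<theta>2(3) \<theta>(2,3)[symmetric] in \<open>auto simp: mem_Hom_iff\<close>)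
  ultimately have "hc s = hc (Ident A ?B)" using hc_trk[OF t(1)] by simp
  thus ?thesis using s(2) by simp
qed

lemma D_pre_split:
  assumes i: "i \<in> Hom (nil_op n) p (p + q)" "nil_pr1 n p q \<cdot>\<^bsub>nil_op n\<^esub> i = Ident (nil_op n) p"
    "nil_pr2 n p q \<cdot>\<^bsub>nil_op n\<^esub> i = nz n p q"
    and j: "j \<in> Hom (nil_op n) q (p + q)" "nil_pr1 n p q \<cdot>\<^bsub>nil_op n\<^esub> j = nz n q p"
    "nil_pr2 n p q \<cdot>\<^bsub>nil_op n\<^esub> j = Ident (nil_op n) q"
    and x: "x \<in> carrier (D (PObj \<phi> (p + q)) Y)" "Y \<in> Obj A"
  shows "x = D_pre Y (PArr \<phi> (nil_pr1 n p q)) (D_pre Y (PArr \<phi> i) x)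
    \<otimes>\<^bsub>D (PObj \<phi> (p + q)) Y\<^esub> D_pre Y (PArr \<phi> (nil_pr2 n p q)) (D_pre Y (PArr \<phi> j) x)"
proof -
  have ij: "i \<in> Arr (nil_op n)" "Dom (nil_op n) i = p" "Cod (nil_op n) i = p + q"
    "j \<in> Arr (nil_op n)" "Dom (nil_op n) j = q" "Cod (nil_op n) j = p + q"
    using i(1) j(1) by (auto simp: mem_Hom_iff)
  have "x = D_pre Y (Ident A (PObj \<phi> (p + q))) x" using x by simp
  also have "\<dots> = D_pre Y (PArr \<phi> i \<cdot> PArr \<phi> (nil_pr1 n p q)) x
    \<otimes>\<^bsub>D (PObj \<phi> (p + q)) Y\<^esub> D_pre Y (PArr \<phi> j \<cdot> PArr \<phi> (nil_pr2 n p q)) x"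
    by (rule D_pre_add[OF _ _ _ x(2,1) hc_Ident_split[OF i j, unfolded hc_def]])
      (use ij in \<open>auto simp: mem_Hom_iff\<close>)
  finally show ?thesis using ij x by (simp add: D_pre_Comp)
qed

lemma nil_injections:
  obtains i j where "i \<in> Hom (nil_op n) p (p + q)" "nil_pr1 n p q \<cdot>\<^bsub>nil_op n\<^esub> i = Ident (nil_op n) p"
    "nil_pr2 n p q \<cdot>\<^bsub>nil_op n\<^esub> i = nz n p q"
    "j \<in> Hom (nil_op n) q (p + q)" "nil_pr1 n p q \<cdot>\<^bsub>nil_op n\<^esub> j = nz n q p"
    "nil_pr2 n p q \<cdot>\<^bsub>nil_op n\<^esub> j = Ident (nil_op n) q"
proof -
  obtain i where "i \<in> Hom (nil_op n) p (p + q)" "nil_pr1 n p q \<cdot>\<^bsub>nil_op n\<^esub> i = Ident (nil_op n) p"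
    "nil_pr2 n p q \<cdot>\<^bsub>nil_op n\<^esub> i = nz n p q"
    by (rule nil_pair[OF nil_op.Ident_Hom[of p n] nz_Hom[of n p q]]) auto
  moreover obtain j where "j \<in> Hom (nil_op n) q (p + q)" "nil_pr1 n p q \<cdot>\<^bsub>nil_op n\<^esub> j = nz n q p"
    "nil_pr2 n p q \<cdot>\<^bsub>nil_op n\<^esub> j = Ident (nil_op n) q"
    by (rule nil_pair[OF nz_Hom[of n q p] nil_op.Ident_Hom[of q n]]) auto
  ultimately show ?thesis by (rule that)
qed

text \<open>By \<open>D_pre_split\<close> an element is rebuilt from its restrictions to the first p
  coordinates and to the last one, which gives an induction on the number of coordinates.\<close>

lemma D_detect:
  assumes "Y \<in> Obj A" "x \<in> carrier (D (PObj \<phi> p) Y)"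
    "\<And>k. k < p \<Longrightarrow> D_pre Y (PArr \<phi> (ninj n p k)) x = \<one>\<^bsub>D (PObj \<phi> 1) Y\<^esub>"
  shows "x = \<one>\<^bsub>D (PObj \<phi> p) Y\<^esub>"
  using assms(2,3)
proof (induction p arbitrary: x)
  case 0
  have Z: "PObj \<phi> 0 = Zero A" by (rule pp_Zero)
  have "Ident A (Zero A) = zA (Zero A) (Zero A)"
    by (rule ex1_eqD[OF zero_unique(1)[of "Zero A" "Zero A"]]) (auto simp: mem_Hom_iff)
  hence "x = D_pre Y (zA (Zero A) (Zero A)) x" using 0 assms(1) Z by (metis D_pre_Ident Zero_Obj)
  thus ?case using D_pre_zA[of "Zero A" Y "Zero A" x] 0 assms(1) Z by simp
next
  case (Suc p)
  note x = Suc.prems(1)[unfolded Suc_eq_plus1]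
  interpret comm_group "D (PObj \<phi> (p + 1)) Y" by (rule D_group) (use assms in auto)
  obtain i j where i: "i \<in> Hom (nil_op n) p (p + 1)" "nil_pr1 n p 1 \<cdot>\<^bsub>nil_op n\<^esub> i = Ident (nil_op n) p"
    "nil_pr2 n p 1 \<cdot>\<^bsub>nil_op n\<^esub> i = nz n p 1"
    and j: "j \<in> Hom (nil_op n) 1 (p + 1)" "nil_pr1 n p 1 \<cdot>\<^bsub>nil_op n\<^esub> j = nz n 1 p"
    "nil_pr2 n p 1 \<cdot>\<^bsub>nil_op n\<^esub> j = Ident (nil_op n) 1" by (rule nil_injections)
  have ij: "i \<in> Arr (nil_op n)" "Dom (nil_op n) i = p" "Cod (nil_op n) i = p + 1"
    "j \<in> Arr (nil_op n)" "Dom (nil_op n) j = 1" "Cod (nil_op n) j = p + 1"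
    using i(1) j(1) by (auto simp: mem_Hom_iff)
  have pr_eq: "a = b" if "a \<in> Hom (nil_op n) 1 (p + 1)" "b \<in> Hom (nil_op n) 1 (p + 1)"
    "nil_pr1 n p 1 \<cdot>\<^bsub>nil_op n\<^esub> a = nil_pr1 n p 1 \<cdot>\<^bsub>nil_op n\<^esub> b"
    "nil_pr2 n p 1 \<cdot>\<^bsub>nil_op n\<^esub> a = nil_pr2 n p 1 \<cdot>\<^bsub>nil_op n\<^esub> b" for a b
  proof (rule nil_op_joint_monic[OF that(1,2)])
    fix k assume "k < p + 1"
    then consider "k < p" | "k = p + 0" by force
    thus "pr n (p + 1) k \<cdot>\<^bsub>nil_op n\<^esub> a = pr n (p + 1) k \<cdot>\<^bsub>nil_op n\<^esub> b"
    proof cases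
      case 1
      show ?thesis unfolding pr_nil_pr1[OF 1, symmetric]
        using nil_op.Comp_assoc[OF that(1) nil_pr1_Hom pr_Hom[OF 1]]
          nil_op.Comp_assoc[OF that(2) nil_pr1_Hom pr_Hom[OF 1]] that(3) by simp
    next
      case 2
      show ?thesis unfolding 2 using pr_Suc_self[of p] that(4) by (simp add: Suc_eq_plus1)
    qed
  qed
  \<comment> \<open>The inclusion \<open>i\<close> of the first p coordinates carries injections to
    injections, so the hypothesis on \<open>x\<close> restricts along \<open>i\<close>.\<close>
  have ik: "i \<cdot>\<^bsub>nil_op n\<^esub> ninj n p k = ninj n (p + 1) k" if k: "k < p" for k
  proof (rule pr_eq[OF nil_op.Comp_Hom[OF ninj_Hom i(1)] ninj_Hom])
    show "nil_pr1 n p 1 \<cdot>\<^bsub>nil_op n\<^esub> (i \<cdot>\<^bsub>nil_op n\<^esub> ninj n p k) = nil_pr1 n p 1 \<cdot>\<^bsub>nil_op n\<^esub> ninj n (p + 1) k"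
      using nil_op.Comp_assoc[OF ninj_Hom i(1) nil_pr1_Hom, of k] i(2) k by (simp add: nil_pr1_inj)
    show "nil_pr2 n p 1 \<cdot>\<^bsub>nil_op n\<^esub> (i \<cdot>\<^bsub>nil_op n\<^esub> ninj n p k) = nil_pr2 n p 1 \<cdot>\<^bsub>nil_op n\<^esub> ninj n (p + 1) k"
      using nil_op.Comp_assoc[OF ninj_Hom i(1) nil_pr2_Hom, of k] i(3) k
      by (simp add: nil_pr2_inj nz_comp[OF ninj_Hom])
  qed
  have jp: "j = ninj n (p + 1) p"
    by (rule pr_eq[OF j(1) ninj_Hom]) (simp_all add: j nil_pr1_inj_last nil_pr2_inj)
  have "D_pre Y (PArr \<phi> i) x = \<one>\<^bsub>D (PObj \<phi> p) Y\<^esub>"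
  proof (rule Suc.IH)
    fix k assume k: "k < p"
    have "D_pre Y (PArr \<phi> (ninj n p k)) (D_pre Y (PArr \<phi> i) x) = D_pre Y (PArr \<phi> i \<cdot> PArr \<phi> (ninj n p k)) x"
      by (rule D_pre_Comp[symmetric]) (use ij assms(1) x in auto)
    \<comment> \<open>\<phi> respects this composite only up to a track, but \<open>D\<close>
      depends only on homotopy classes.\<close>
    also have "\<dots> = D_pre Y (PArr \<phi> (ninj n (p + 1) k)) x"
      by (rule fun_cong[OF D_pre_class]) (use hc_PArr_Comp[of i "ninj n p k"] ij in \<open>simp add: hc_def ik[OF k]\<close>)
    also have "\<dots> = \<one>\<^bsub>D (PObj \<phi> 1) Y\<^esub>" using Suc.prems(2)[of k] k by (simp add: Suc_eq_plus1)
    finally show "D_pre Y (PArr \<phi> (ninj n p k)) (D_pre Y (PArr \<phi> i) x) = \<one>\<^bsub>D (PObj \<phi> 1) Y\<^esub>" .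
  qed (use ij x assms(1) in auto)
  moreover have "D_pre Y (PArr \<phi> j) x = \<one>\<^bsub>D (PObj \<phi> 1) Y\<^esub>"
    using Suc.prems(2)[of p] by (simp add: jp Suc_eq_plus1)
  moreover have "D_pre Y (PArr \<phi> (nil_pr1 n p 1)) \<one>\<^bsub>D (PObj \<phi> p) Y\<^esub> = \<one>\<^bsub>D (PObj \<phi> (p + 1)) Y\<^esub>"
    "D_pre Y (PArr \<phi> (nil_pr2 n p 1)) \<one>\<^bsub>D (PObj \<phi> 1) Y\<^esub> = \<one>\<^bsub>D (PObj \<phi> (p + 1)) Y\<^esub>"
    using group_hom.hom_one[OF D_pre_hom[of "PArr \<phi> (nil_pr1 n p 1)" Y]]
      group_hom.hom_one[OF D_pre_hom[of "PArr \<phi> (nil_pr2 n p 1)" Y]] assms(1) by simp_all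
  ultimately show ?case using D_pre_split[OF i j x assms(1)] by (simp add: Suc_eq_plus1)
qed

text \<open>The element is the sum of the given ones pulled back along the projections. An injection
  followed by a projection to another coordinate is zero and kills that summand.\<close>

lemma D_extend:
  assumes "Y \<in> Obj A" "\<And>k. k < p \<Longrightarrow> b k \<in> carrier (D (PObj \<phi> 1) Y)"
  shows "\<exists>x \<in> carrier (D (PObj \<phi> p) Y). \<forall>k<p. D_pre Y (PArr \<phi> (ninj n p k)) x = b k"
  using assms(2)
proof (induction p)
  case 0
  interpret comm_group "D (PObj \<phi> 0) Y" by (rule D_group) (use assms in auto)
  show ?case by (intro bexI[of _ "\<one>\<^bsub>D (PObj \<phi> 0) Y\<^esub>"]) auto
next
  case (Suc p)
  interpret B: comm_group "D (PObj \<phi> (p + 1)) Y" by (rule D_group) (use assms in auto)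
  interpret O: comm_group "D (PObj \<phi> 1) Y" by (rule D_group) (use assms in auto)
  obtain x where x: "x \<in> carrier (D (PObj \<phi> p) Y)" "\<forall>k<p. D_pre Y (PArr \<phi> (ninj n p k)) x = b k"
    using Suc by force
  have b: "b p \<in> carrier (D (PObj \<phi> 1) Y)" using Suc.prems by simp
  let ?P = "PArr \<phi> (nil_pr1 n p 1)" and ?Q = "PArr \<phi> (nil_pr2 n p 1)"
  let ?y = "D_pre Y ?P x \<otimes>\<^bsub>D (PObj \<phi> (p + 1)) Y\<^esub> D_pre Y ?Q (b p)"
  have yc: "D_pre Y ?P x \<in> carrier (D (PObj \<phi> (p + 1)) Y)" "D_pre Y ?Q (b p) \<in> carrier (D (PObj \<phi> (p + 1)) Y)"
    using assms(1) x(1) b by auto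
  have "D_pre Y (PArr \<phi> (ninj n (p + 1) k)) ?y = b k" if "k < p + 1" for k
  proof -
    let ?J = "PArr \<phi> (ninj n (p + 1) k)"
    have "D_pre Y ?J ?y = D_pre Y ?J (D_pre Y ?P x) \<otimes>\<^bsub>D (PObj \<phi> 1) Y\<^esub> D_pre Y ?J (D_pre Y ?Q (b p))"
      using group_hom.hom_mult[OF D_pre_hom[of ?J Y]] yc assms(1) by simp
    also have "D_pre Y ?J (D_pre Y ?P x) = D_pre Y (?P \<cdot> ?J) x"
      by (rule D_pre_Comp[symmetric]) (use assms(1) x in auto)
    also have "D_pre Y ?J (D_pre Y ?Q (b p)) = D_pre Y (?Q \<cdot> ?J) (b p)"
      by (rule D_pre_Comp[symmetric]) (use assms(1) b in auto)
    also have "?P \<cdot> ?J = PArr \<phi> (nil_pr1 n p 1 \<cdot>\<^bsub>nil_op n\<^esub> ninj n (p + 1) k)"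
      by (rule strict_left_simps(2)[OF strict_left_pr1, symmetric]) auto
    also have "?Q \<cdot> ?J = PArr \<phi> (nil_pr2 n p 1 \<cdot>\<^bsub>nil_op n\<^esub> ninj n (p + 1) k)"
      by (rule strict_left_simps(2)[OF strict_left_pr2, symmetric]) auto
    finally have e: "D_pre Y ?J ?y = D_pre Y (PArr \<phi> (nil_pr1 n p 1 \<cdot>\<^bsub>nil_op n\<^esub> ninj n (p + 1) k)) x
      \<otimes>\<^bsub>D (PObj \<phi> 1) Y\<^esub> D_pre Y (PArr \<phi> (nil_pr2 n p 1 \<cdot>\<^bsub>nil_op n\<^esub> ninj n (p + 1) k)) (b p)" .
    show ?thesis
    proof (cases "k = p")
      case True
      thus ?thesis unfolding e using b assms(1) x(1)
        by (simp add: nil_pr1_inj_last nil_pr2_inj D_pre_zA)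
    next
      case False
      hence "k < p" using that by simp
      thus ?thesis unfolding e using b assms(1) x Suc.prems[of k]
        by (simp add: nil_pr1_inj nil_pr2_inj D_pre_zA)
    qed
  qed
  thus ?case using yc by (intro bexI[of _ ?y]) (simp_all add: Suc_eq_plus1)
qed

text \<open>The Eckmann-Hilton argument: \<open>mu\<close> restricts to the identity along both
  injections, and up to homotopy the identity of \<phi> 2 is the sum of the two projectors.\<close>

lemma hc_mu:
  "hc (PArr \<phi> (mu n)) = hc (PArr \<phi> (pr n 2 0)) \<otimes>\<^bsub>HG (PObj \<phi> 2) (PObj \<phi> 1)\<^esub> hc (PArr \<phi> (pr n 2 1))"
proof -
  have two: "(2::nat) = 1 + 1" by simp
  have p0: "pr n 2 0 = nil_pr1 n 1 1" and p1: "pr n 2 1 = nil_pr2 n 1 1"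
    using pr_nil_pr1[of 0 1 n 1] pr_nil_pr2[of 0 1 n 1] pr_1_0[of n] by simp_all
  obtain i j where i: "i \<in> Hom (nil_op n) 1 (1 + 1)" "nil_pr1 n 1 1 \<cdot>\<^bsub>nil_op n\<^esub> i = Ident (nil_op n) 1"
    "nil_pr2 n 1 1 \<cdot>\<^bsub>nil_op n\<^esub> i = nz n 1 1"
    and j: "j \<in> Hom (nil_op n) 1 (1 + 1)" "nil_pr1 n 1 1 \<cdot>\<^bsub>nil_op n\<^esub> j = nz n 1 1"
    "nil_pr2 n 1 1 \<cdot>\<^bsub>nil_op n\<^esub> j = Ident (nil_op n) 1" by (rule nil_injections)
  have ij: "i \<in> Arr (nil_op n)" "Dom (nil_op n) i = 1" "Cod (nil_op n) i = 2"
    "j \<in> Arr (nil_op n)" "Dom (nil_op n) j = 1" "Cod (nil_op n) j = 2"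
    using i(1) j(1) by (auto simp: mem_Hom_iff)
  have mu: "mu n \<in> Arr (nil_op n)" "Dom (nil_op n) (mu n) = 2" "Cod (nil_op n) (mu n) = 1"
    using mu_Hom[of n] by (auto simp: mem_Hom_iff)
  have i2: "i \<in> Hom (nil_op n) 1 2" and j2: "j \<in> Hom (nil_op n) 1 2" using ij by (auto simp: mem_Hom_iff)
  have mi: "mu n \<cdot>\<^bsub>nil_op n\<^esub> i = Ident (nil_op n) 1"
    using mu_nz_right[OF i2] i(2,3) unfolding p0 p1 by simp
  have mj: "mu n \<cdot>\<^bsub>nil_op n\<^esub> j = Ident (nil_op n) 1"
    using mu_nz_left[OF j2] j(2,3) unfolding p0 p1 by simp
  have "hc (PArr \<phi> (mu n) \<cdot> Ident A (PObj \<phi> 2)) = hc (PArr \<phi> (mu n) \<cdot> (PArr \<phi> i \<cdot> PArr \<phi> (nil_pr1 n 1 1)))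
    \<otimes>\<^bsub>HG (PObj \<phi> 2) (PObj \<phi> 1)\<^esub> hc (PArr \<phi> (mu n) \<cdot> (PArr \<phi> j \<cdot> PArr \<phi> (nil_pr2 n 1 1)))"
    by (rule hc_Comp_add_right[OF _ _ _ _ hc_Ident_split[OF i j, folded two]])
      (use ij mu in \<open>auto simp: mem_Hom_iff\<close>)
  also have "hc (PArr \<phi> (mu n) \<cdot> (PArr \<phi> i \<cdot> PArr \<phi> (nil_pr1 n 1 1))) = hc (PArr \<phi> (pr n 2 0))"
  proof -
    have "hc ((PArr \<phi> (mu n) \<cdot> PArr \<phi> i) \<cdot> PArr \<phi> (nil_pr1 n 1 1)) = hc (Ident A (PObj \<phi> 1) \<cdot> PArr \<phi> (nil_pr1 n 1 1))"
      by (rule hc_Comp_cong[OF refl]) (use hc_PArr_Comp[of "mu n" i] mi ij mu in auto)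
    thus ?thesis using ij mu by (simp add: p0)
  qed
  also have "hc (PArr \<phi> (mu n) \<cdot> (PArr \<phi> j \<cdot> PArr \<phi> (nil_pr2 n 1 1))) = hc (PArr \<phi> (pr n 2 1))"
  proof -
    have "hc ((PArr \<phi> (mu n) \<cdot> PArr \<phi> j) \<cdot> PArr \<phi> (nil_pr2 n 1 1)) = hc (Ident A (PObj \<phi> 1) \<cdot> PArr \<phi> (nil_pr2 n 1 1))"
      by (rule hc_Comp_cong[OF refl]) (use hc_PArr_Comp[of "mu n" j] mj ij mu in auto)
    thus ?thesis using ij mu by (simp add: p1)
  qed
  finally show ?thesis using mu by simp
qed

lemma mu_simps [simp]: "mu n \<in> Arr (nil_op n)" "Dom (nil_op n) (mu n) = 2" "Cod (nil_op n) (mu n) = 1"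
  using mu_Hom[of n] by (auto simp: mem_Hom_iff)

lemma hc_mu_comp:
  assumes "u \<in> Hom (nil_op n) p 2"
  shows "hc (PArr \<phi> (mu n \<cdot>\<^bsub>nil_op n\<^esub> u)) = hc (PArr \<phi> (pr n 2 0 \<cdot>\<^bsub>nil_op n\<^esub> u))
    \<otimes>\<^bsub>HG (PObj \<phi> p) (PObj \<phi> 1)\<^esub> hc (PArr \<phi> (pr n 2 1 \<cdot>\<^bsub>nil_op n\<^esub> u))"
proof -
  have u: "u \<in> Arr (nil_op n)" "Dom (nil_op n) u = p" "Cod (nil_op n) u = 2" using assms by (auto simp: mem_Hom_iff)
  have "hc (PArr \<phi> (mu n) \<cdot> PArr \<phi> u) = hc (PArr \<phi> (pr n 2 0) \<cdot> PArr \<phi> u)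
    \<otimes>\<^bsub>HG (PObj \<phi> p) (PObj \<phi> 1)\<^esub> hc (PArr \<phi> (pr n 2 1) \<cdot> PArr \<phi> u)"
    by (rule hc_Comp_add_left[OF _ _ _ _ hc_mu]) (use u in \<open>auto simp: mem_Hom_iff\<close>)
  thus ?thesis using u by (simp add: hc_PArr_Comp)
qed

text \<open>The effect of \<open>hc_mu\<close> on coefficients: the multiplication adds the two
  coordinates.\<close>

lemma D_post_mu:
  assumes "X \<in> Obj A" "a \<in> carrier (D X (PObj \<phi> 2))"
  shows "D_post X (PArr \<phi> (mu n)) a = D_post X (PArr \<phi> (pr n 2 0)) a
    \<otimes>\<^bsub>D X (PObj \<phi> 1)\<^esub> D_post X (PArr \<phi> (pr n 2 1)) a"
  by (rule D_post_add[OF _ _ _ assms hc_mu[unfolded hc_def]]) (auto simp: mem_Hom_iff)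

text \<open>Detected through tracks: \<open>a\<close> acts on the identity track of a zero map, and
  tracks into the product are determined by their coordinates.\<close>

lemma D_post_joint:
  assumes "X \<in> Obj A" "a \<in> carrier (D X (PObj \<phi> q))"
    "\<And>k. k < q \<Longrightarrow> D_post X (PArr \<phi> (pr n q k)) a = \<one>\<^bsub>D X (PObj \<phi> 1)\<^esub>"
  shows "a = \<one>\<^bsub>D X (PObj \<phi> q)\<^esub>"
proof -
  let ?H = "IdT A (zA X (PObj \<phi> q))"
  have H: "?H \<in> Trk A" "D_of ?H = D X (PObj \<phi> q)" using assms(1) by (auto simp: D_of_def)
  interpret G: comm_group "D X (PObj \<phi> q)" by (rule D_group) (use assms in auto)
  have "tor ?H a = ?H"
  proof (rule joint_trk_eqI)
    fix k assume k: "k < q"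
    let ?K = "IdT A (zA X (PObj \<phi> 1))"
    have "Post A (PArr \<phi> (pr n q k)) (tor ?H a) = tor (Post A (PArr \<phi> (pr n q k)) ?H) (D_post X (PArr \<phi> (pr n q k)) a)"
      using Post_tor[of ?H "PArr \<phi> (pr n q k)" a] H assms k by simp
    also have "\<dots> = tor ?K \<one>\<^bsub>D_of ?K\<^esub>" using assms k by (simp add: D_of_def)
    also have "\<dots> = ?K" by (rule tor_one) (use assms in simp)
    finally show "Post A (PArr \<phi> (pr n q k)) (tor ?H a) = Post A (PArr \<phi> (pr n q k)) ?H" using assms k by simp
  qed (use H assms in \<open>auto simp: HomTrk_def mem_Hom_iff\<close>)
  hence "tor ?H a = tor ?H \<one>\<^bsub>D_of ?H\<^esub>" using tor_one[OF H(1)] by simp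
  thus ?thesis using tor_inj[OF H(1)] H(2) assms(2) by simp
qed

end

section \<open>The obstruction cocycle\<close>

locale pp_pair = additive_track_products A HG D Dmap \<sigma> +
    F: additive_pp_fun A n \<phi> HG D Dmap \<sigma> + G: additive_pp_fun A n \<psi> HG D Dmap \<sigma>
  for A :: "('o, 'm, 't, 'z) track_cat_prod_scheme" (structure)
    and n :: enat and \<phi> \<psi> :: "(nat, nil_arr, 'o, 'm, 't) pseudofun"
    and HG :: "'o \<Rightarrow> 'o \<Rightarrow> 'm set monoid"
    and D :: "'o \<Rightarrow> 'o \<Rightarrow> 'd monoid"
    and Dmap :: "'m set \<Rightarrow> 'm set \<Rightarrow> 'd \<Rightarrow> 'd"
    and \<sigma> :: "'m \<Rightarrow> 'd \<Rightarrow> 't"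
begin

text \<open>The restriction factors through the zero object, where the only track is an
  identity.\<close>

lemma Pre_zA:
  assumes "t \<in> Trk A" "Dom A (Src A t) = X" "W \<in> Obj A"
  shows "Pre A (zA W X) t = IdT A (zA W (Cod A (Src A t)))"
proof -
  have X: "X \<in> Obj A" "Cod A (Src A t) \<in> Obj A" using assms by auto
  have "Pre A (zA (Zero A) X) t = IdT A (zA (Zero A) (Cod A (Src A t)))"
    by (rule ex1_eqD[OF zero_unique(4)[OF X(2,2)]]) (use assms X in \<open>auto simp: HomTrk_def mem_Hom_iff\<close>)
  hence "Pre A (zA W (Zero A)) (Pre A (zA (Zero A) X) t) = IdT A (zA W (Cod A (Src A t)))"
    using assms X by simp
  moreover have "Pre A (zA W (Zero A)) (Pre A (zA (Zero A) X) t) = Pre A (zA (Zero A) X \<cdot> zA W (Zero A)) t"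
    by (rule Pre_Comp_simp[symmetric]) (use assms X in auto)
  moreover have "zA (Zero A) X \<cdot> zA W (Zero A) = zA W X" using assms X by simp
  ultimately show ?thesis by simp
qed

lemma Post_zA:
  assumes "t \<in> Trk A" "Cod A (Src A t) = Y" "Z \<in> Obj A"
  shows "Post A (zA Y Z) t = IdT A (zA (Dom A (Src A t)) Z)"
proof -
  have X: "Y \<in> Obj A" "Dom A (Src A t) \<in> Obj A" using assms by auto
  have "Post A (zA Y (Zero A)) t = IdT A (zA (Dom A (Src A t)) (Zero A))"
    by (rule ex1_eqD[OF zero_unique(3)[OF X(2,2)]]) (use assms X in \<open>auto simp: HomTrk_def mem_Hom_iff\<close>)
  hence "Post A (zA (Zero A) Z) (Post A (zA Y (Zero A)) t) = IdT A (zA (Dom A (Src A t)) Z)"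
    using assms X by simp
  moreover have "Post A (zA (Zero A) Z) (Post A (zA Y (Zero A)) t) = Post A (zA (Zero A) Z \<cdot> zA Y (Zero A)) t"
    by (rule Post_Comp_simp[symmetric]) (use assms X in auto)
  moreover have "zA (Zero A) Z \<cdot> zA Y (Zero A) = zA Y Z" using assms X by simp
  ultimately show ?thesis by simp
qed

text \<open>The difference of the two tracks is an element of \<open>D\<close> with trivial
  restrictions, so \<open>D_detect\<close> applies. The ends must agree beforehand, as injections
  are jointly epic only up to homotopy.\<close>

lemma inj_detect:
  assumes "t \<in> Trk A" "t' \<in> Trk A" "Src A t = Src A t'" "Trg A t = Trg A t'" "Dom A (Src A t) = PObj \<phi> p"
    "\<And>k. k < p \<Longrightarrow> Pre A (PArr \<phi> (ninj n p k)) t = Pre A (PArr \<phi> (ninj n p k)) t'"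
  shows "t = t'"
proof -
  obtain d where d: "d \<in> carrier (D_of t)" "t' = tor t d"
    by (rule tor_exists[OF assms(1,2)]) (use assms in auto)
  let ?Y = "Cod A (Src A t)"
  have D: "D_of t = D (PObj \<phi> p) ?Y" by (simp only: D_of_def assms(5))
  have Y: "?Y \<in> Obj A" using assms(1) by simp
  have "d = \<one>\<^bsub>D (PObj \<phi> p) ?Y\<^esub>"
  proof (rule F.D_detect[OF Y d(1)[unfolded D]])
    fix k assume k: "k < p"
    let ?i = "PArr \<phi> (ninj n p k)"
    interpret comm_group "D (PObj \<phi> 1) ?Y" by (rule D_group) (use Y in auto)
    have T: "Pre A ?i t \<in> Trk A" "D_of (Pre A ?i t) = D (PObj \<phi> 1) ?Y"
      using assms(1,5) by (auto simp: D_of_def)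
    have "tor (Pre A ?i t) (D_pre ?Y ?i d) = Pre A ?i t"
      using Pre_tor[OF assms(1), of ?i d] assms(5) assms(6)[OF k] d by simp
    also have "\<dots> = tor (Pre A ?i t) \<one>\<^bsub>D (PObj \<phi> 1) ?Y\<^esub>" using tor_one[OF T(1)] T(2) by simp
    finally have e: "tor (Pre A ?i t) (D_pre ?Y ?i d) = tor (Pre A ?i t) \<one>\<^bsub>D (PObj \<phi> 1) ?Y\<^esub>" .
    show "D_pre ?Y ?i d = \<one>\<^bsub>D (PObj \<phi> 1) ?Y\<^esub>"
      by (rule tor_inj[OF T(1) _ _ e]) (use d D Y T(2) in auto)
  qed
  thus ?thesis using tor_one[OF assms(1)] d D by simp
qed

text \<open>The p-th power of \<open>f\<close>, as a map between the strict p-fold products.\<close>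

definition lev :: "'m \<Rightarrow> nat \<Rightarrow> 'm" where
  "lev f p = (SOME u. u \<in> Hom A (PObj \<phi> p) (PObj \<psi> p) \<and>
     (\<forall>k<p. PArr \<psi> (pr n p k) \<cdot> u = f \<cdot> PArr \<phi> (pr n p k)))"

context
  fixes f assumes f: "f \<in> Hom A (PObj \<phi> 1) (PObj \<psi> 1)"
begin

lemma f_simps [simp]: "f \<in> Arr A" "Dom A f = PObj \<phi> 1" "Cod A f = PObj \<psi> 1"
  using f by (auto simp: mem_Hom_iff)

lemma lev_some:
  "lev f p \<in> Hom A (PObj \<phi> p) (PObj \<psi> p) \<and>
     (\<forall>k<p. PArr \<psi> (pr n p k) \<cdot> lev f p = f \<cdot> PArr \<phi> (pr n p k))"
proof -
  have "\<exists>u \<in> Hom A (PObj \<phi> p) (PObj \<psi> p). \<forall>k<p. PArr \<psi> (pr n p k) \<cdot> u = f \<cdot> PArr \<phi> (pr n p k)"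
    by (rule G.joint_exists) (auto simp: mem_Hom_iff)
  hence "\<exists>u. u \<in> Hom A (PObj \<phi> p) (PObj \<psi> p) \<and> (\<forall>k<p. PArr \<psi> (pr n p k) \<cdot> u = f \<cdot> PArr \<phi> (pr n p k))"
    by blast
  from someI_ex[OF this] show ?thesis unfolding lev_def .
qed

lemma lev_simps [simp]: "lev f p \<in> Arr A" "Dom A (lev f p) = PObj \<phi> p" "Cod A (lev f p) = PObj \<psi> p"
  using lev_some[of p] by (auto simp: mem_Hom_iff)

lemma lev_pr: "k < p \<Longrightarrow> PArr \<psi> (pr n p k) \<cdot> lev f p = f \<cdot> PArr \<phi> (pr n p k)"
  using lev_some by blast

lemma lev_unique:
  assumes "u \<in> Hom A (PObj \<phi> p) (PObj \<psi> p)"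
    "\<And>k. k < p \<Longrightarrow> PArr \<psi> (pr n p k) \<cdot> u = f \<cdot> PArr \<phi> (pr n p k)"
  shows "u = lev f p"
  by (rule G.joint_eqI[OF assms(1)]) (auto simp: assms(2) lev_pr mem_Hom_iff)

lemma lev_1 [simp]: "lev f 1 = f"
  using lev_pr[of 0 1] by (simp add: pr_1_0)

lemma lev_pr1: "PArr \<psi> (nil_pr1 n p q) \<cdot> lev f (p + q) = lev f p \<cdot> PArr \<phi> (nil_pr1 n p q)"
proof (rule G.joint_eqI)
  fix k assume k: "k < p"
  have "PArr \<psi> (pr n p k) \<cdot> (PArr \<psi> (nil_pr1 n p q) \<cdot> lev f (p + q)) = PArr \<psi> (pr n (p + q) k) \<cdot> lev f (p + q)"
    using k by (simp add: G.PArr_pr1)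
  also have "\<dots> = f \<cdot> PArr \<phi> (pr n (p + q) k)" using k by (simp add: lev_pr)
  also have "\<dots> = (f \<cdot> PArr \<phi> (pr n p k)) \<cdot> PArr \<phi> (nil_pr1 n p q)" using k by (simp add: F.PArr_pr1)
  also have "\<dots> = (PArr \<psi> (pr n p k) \<cdot> lev f p) \<cdot> PArr \<phi> (nil_pr1 n p q)" using k by (simp only: lev_pr)
  also have "\<dots> = PArr \<psi> (pr n p k) \<cdot> (lev f p \<cdot> PArr \<phi> (nil_pr1 n p q))" using k by simp
  finally show "PArr \<psi> (pr n p k) \<cdot> (PArr \<psi> (nil_pr1 n p q) \<cdot> lev f (p + q))
    = PArr \<psi> (pr n p k) \<cdot> (lev f p \<cdot> PArr \<phi> (nil_pr1 n p q))" .
qed (auto simp: mem_Hom_iff)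

lemma lev_pr2: "PArr \<psi> (nil_pr2 n p q) \<cdot> lev f (p + q) = lev f q \<cdot> PArr \<phi> (nil_pr2 n p q)"
proof (rule G.joint_eqI)
  fix k assume k: "k < q"
  have "PArr \<psi> (pr n q k) \<cdot> (PArr \<psi> (nil_pr2 n p q) \<cdot> lev f (p + q)) = PArr \<psi> (pr n (p + q) (p + k)) \<cdot> lev f (p + q)"
    using k by (simp add: G.PArr_pr2)
  also have "\<dots> = f \<cdot> PArr \<phi> (pr n (p + q) (p + k))" using k by (simp add: lev_pr)
  also have "\<dots> = (f \<cdot> PArr \<phi> (pr n q k)) \<cdot> PArr \<phi> (nil_pr2 n p q)" using k by (simp add: F.PArr_pr2)
  also have "\<dots> = (PArr \<psi> (pr n q k) \<cdot> lev f q) \<cdot> PArr \<phi> (nil_pr2 n p q)" using k by (simp only: lev_pr)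
  also have "\<dots> = PArr \<psi> (pr n q k) \<cdot> (lev f q \<cdot> PArr \<phi> (nil_pr2 n p q))" using k by simp
  finally show "PArr \<psi> (pr n q k) \<cdot> (PArr \<psi> (nil_pr2 n p q) \<cdot> lev f (p + q))
    = PArr \<psi> (pr n q k) \<cdot> (lev f q \<cdot> PArr \<phi> (nil_pr2 n p q))" .
qed (auto simp: mem_Hom_iff)

lemma PArr_pr_inj:
  assumes "j < p"
  shows "PArr \<psi> (pr n p j) \<cdot> PArr \<psi> (ninj n p k) = (if j = k then Ident A (PObj \<psi> 1) else zA (PObj \<psi> 1) (PObj \<psi> 1))"
    "PArr \<phi> (pr n p j) \<cdot> PArr \<phi> (ninj n p k) = (if j = k then Ident A (PObj \<phi> 1) else zA (PObj \<phi> 1) (PObj \<phi> 1))"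
  using G.strict_left_simps(2)[OF G.strict_left_pr[OF assms], of "ninj n p k"]
    F.strict_left_simps(2)[OF F.strict_left_pr[OF assms], of "ninj n p k"] assms pr_ninj[OF assms, of n k]
  by (auto split: if_splits)

text \<open>This holds strictly and not only up to homotopy: on both sides coordinate k is
  \<open>f\<close> and the others are zero.\<close>

lemma lev_inj: "lev f p \<cdot> PArr \<phi> (ninj n p k) = PArr \<psi> (ninj n p k) \<cdot> f"
proof (rule G.joint_eqI)
  fix j assume j: "j < p"
  have "PArr \<psi> (pr n p j) \<cdot> (lev f p \<cdot> PArr \<phi> (ninj n p k)) = (PArr \<psi> (pr n p j) \<cdot> lev f p) \<cdot> PArr \<phi> (ninj n p k)"
    using j by simp
  also have "\<dots> = f \<cdot> (PArr \<phi> (pr n p j) \<cdot> PArr \<phi> (ninj n p k))" using j by (simp add: lev_pr)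
  also have "\<dots> = (PArr \<psi> (pr n p j) \<cdot> PArr \<psi> (ninj n p k)) \<cdot> f"
    unfolding PArr_pr_inj[OF j] by auto
  also have "\<dots> = PArr \<psi> (pr n p j) \<cdot> (PArr \<psi> (ninj n p k) \<cdot> f)" using j by simp
  finally show "PArr \<psi> (pr n p j) \<cdot> (lev f p \<cdot> PArr \<phi> (ninj n p k)) = PArr \<psi> (pr n p j) \<cdot> (PArr \<psi> (ninj n p k) \<cdot> f)" .
qed (auto simp: mem_Hom_iff)

text \<open>Both sides are additive along \<open>mu\<close> by \<open>hc_mu_comp\<close> and agree
  on zero and on projections; the inverse case cancels in the group of homotopy classes.\<close>

lemma hc_lev:
  assumes "w \<in> Hom (nil_op n) p 1" shows "hc (f \<cdot> PArr \<phi> w) = hc (PArr \<psi> w \<cdot> lev f p)"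
proof -
  interpret H: comm_group "HG (PObj \<phi> p) (PObj \<psi> 1)" by (rule HG_group) auto
  have add: "hc (f \<cdot> PArr \<phi> (mu n \<cdot>\<^bsub>nil_op n\<^esub> u)) = hc (f \<cdot> PArr \<phi> (pr n 2 0 \<cdot>\<^bsub>nil_op n\<^esub> u))
      \<otimes>\<^bsub>HG (PObj \<phi> p) (PObj \<psi> 1)\<^esub> hc (f \<cdot> PArr \<phi> (pr n 2 1 \<cdot>\<^bsub>nil_op n\<^esub> u))"
    "hc (PArr \<psi> (mu n \<cdot>\<^bsub>nil_op n\<^esub> u) \<cdot> lev f p) = hc (PArr \<psi> (pr n 2 0 \<cdot>\<^bsub>nil_op n\<^esub> u) \<cdot> lev f p)
      \<otimes>\<^bsub>HG (PObj \<phi> p) (PObj \<psi> 1)\<^esub> hc (PArr \<psi> (pr n 2 1 \<cdot>\<^bsub>nil_op n\<^esub> u) \<cdot> lev f p)"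
    if u: "u \<in> Hom (nil_op n) p 2" for u
  proof -
    have "u \<in> Arr (nil_op n)" "Dom (nil_op n) u = p" "Cod (nil_op n) u = 2" using u by (auto simp: mem_Hom_iff)
    thus "hc (f \<cdot> PArr \<phi> (mu n \<cdot>\<^bsub>nil_op n\<^esub> u)) = hc (f \<cdot> PArr \<phi> (pr n 2 0 \<cdot>\<^bsub>nil_op n\<^esub> u))
      \<otimes>\<^bsub>HG (PObj \<phi> p) (PObj \<psi> 1)\<^esub> hc (f \<cdot> PArr \<phi> (pr n 2 1 \<cdot>\<^bsub>nil_op n\<^esub> u))"
      by (intro hc_Comp_add_right[OF _ _ _ _ F.hc_mu_comp[OF u]]) (auto simp: mem_Hom_iff)
    from \<open>u \<in> Arr (nil_op n)\<close> \<open>Dom (nil_op n) u = p\<close> \<open>Cod (nil_op n) u = 2\<close>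
    show "hc (PArr \<psi> (mu n \<cdot>\<^bsub>nil_op n\<^esub> u) \<cdot> lev f p) = hc (PArr \<psi> (pr n 2 0 \<cdot>\<^bsub>nil_op n\<^esub> u) \<cdot> lev f p)
      \<otimes>\<^bsub>HG (PObj \<phi> p) (PObj \<psi> 1)\<^esub> hc (PArr \<psi> (pr n 2 1 \<cdot>\<^bsub>nil_op n\<^esub> u) \<cdot> lev f p)"
      by (intro hc_Comp_add_left[OF _ _ _ _ G.hc_mu_comp[OF u]]) (auto simp: mem_Hom_iff)
  qed
  show ?thesis using assms
  proof (induction rule: nil_op_induct)
    case zero show ?case by simp
  next
    case (pr k) thus ?case by (simp add: lev_pr)
  next
    case (mult u) thus ?case by (simp add: add)
  next
    case (inv u)
    have u: "u \<in> Arr (nil_op n)" "Dom (nil_op n) u = p" "Cod (nil_op n) u = 2" using inv(1) by (auto simp: mem_Hom_iff)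
    have "hc (f \<cdot> PArr \<phi> (pr n 2 0 \<cdot>\<^bsub>nil_op n\<^esub> u)) \<otimes>\<^bsub>HG (PObj \<phi> p) (PObj \<psi> 1)\<^esub> hc (f \<cdot> PArr \<phi> (pr n 2 1 \<cdot>\<^bsub>nil_op n\<^esub> u))
      = hc (f \<cdot> PArr \<phi> (pr n 2 0 \<cdot>\<^bsub>nil_op n\<^esub> u)) \<otimes>\<^bsub>HG (PObj \<phi> p) (PObj \<psi> 1)\<^esub> hc (PArr \<psi> (pr n 2 1 \<cdot>\<^bsub>nil_op n\<^esub> u) \<cdot> lev f p)"
      using add[OF inv(1)] inv(2,3) by simp
    thus ?case by (rule H.Units_l_cancel[THEN iffD1, rotated 3]) (use u H.Units_eq in auto)
  qed
qed

end

text \<open>As a global simplification rule, \<open>f_simps\<close> loops together with \<open>mem_Hom_iff\<close>.\<close>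
declare f_simps [simp del]

end

locale track_family = pp_pair A n \<phi> \<psi> HG D Dmap \<sigma>
  for A (structure) and n \<phi> \<psi> HG D Dmap \<sigma> +
  fixes l a
  assumes l_simps [simp]: "l p \<in> Arr A" "Dom A (l p) = PObj \<phi> p" "Cod A (l p) = PObj \<psi> p"
    and a_simps [simp]: "w \<in> Arr (nil_op n) \<Longrightarrow> a w \<in> Trk A"
      "w \<in> Arr (nil_op n) \<Longrightarrow> Src A (a w) = l (Cod (nil_op n) w) \<cdot> PArr \<phi> w"
      "w \<in> Arr (nil_op n) \<Longrightarrow> Trg A (a w) = PArr \<psi> w \<cdot> l (Dom (nil_op n) w)"
begin

text \<open>\<open>lhs\<close> and \<open>rhs\<close> are the two sides of the composition axiom of
  a pseudo natural transformation, formed from tracks that so far have only the right ends.\<close>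

definition lhs where
  "lhs g w = a (g \<cdot>\<^bsub>nil_op n\<^esub> w) \<box> Post A (l (Cod (nil_op n) g)) (PComp \<phi> g w)"

definition rhs where
  "rhs g w = Pre A (l (Dom (nil_op n) w)) (PComp \<psi> g w) \<box> (Post A (PArr \<psi> g) (a w) \<box> Pre A (PArr \<phi> w) (a g))"

text \<open>The obstruction cocycle c(g, w), in multiplicative notation.\<close>

definition defect where
  "defect g w = (THE c. c \<in> carrier (D (PObj \<phi> (Dom (nil_op n) w)) (PObj \<psi> (Cod (nil_op n) g)))
     \<and> lhs g w = tor (rhs g w) c)"

context
  fixes g w assumes gw [simp]: "g \<in> Arr (nil_op n)" "w \<in> Arr (nil_op n)" "Dom (nil_op n) g = Cod (nil_op n) w"
begin

lemma lhs_simps [simp]: "lhs g w \<in> Trk A"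
  "Src A (lhs g w) = l (Cod (nil_op n) g) \<cdot> (PArr \<phi> g \<cdot> PArr \<phi> w)"
  "Trg A (lhs g w) = PArr \<psi> (g \<cdot>\<^bsub>nil_op n\<^esub> w) \<cdot> l (Dom (nil_op n) w)"
  by (simp_all add: lhs_def)

lemma rhs_simps [simp]: "rhs g w \<in> Trk A"
  "Src A (rhs g w) = l (Cod (nil_op n) g) \<cdot> (PArr \<phi> g \<cdot> PArr \<phi> w)"
  "Trg A (rhs g w) = PArr \<psi> (g \<cdot>\<^bsub>nil_op n\<^esub> w) \<cdot> l (Dom (nil_op n) w)"
  by (simp_all add: rhs_def)

lemma D_of_rhs [simp]: "D_of (rhs g w) = D (PObj \<phi> (Dom (nil_op n) w)) (PObj \<psi> (Cod (nil_op n) g))"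
  by (simp add: D_of_def)

lemma defect: shows defect_closed: "defect g w \<in> carrier (D (PObj \<phi> (Dom (nil_op n) w)) (PObj \<psi> (Cod (nil_op n) g)))"
  and lhs_defect: "lhs g w = tor (rhs g w) (defect g w)"
proof -
  obtain c where "c \<in> carrier (D_of (rhs g w))" "lhs g w = tor (rhs g w) c"
    by (rule tor_exists[of "rhs g w" "lhs g w"]) auto
  hence "\<exists>!c. c \<in> carrier (D (PObj \<phi> (Dom (nil_op n) w)) (PObj \<psi> (Cod (nil_op n) g))) \<and> lhs g w = tor (rhs g w) c"
    using tor_inj[of "rhs g w"] by auto
  from theI'[OF this] show "defect g w \<in> carrier (D (PObj \<phi> (Dom (nil_op n) w)) (PObj \<psi> (Cod (nil_op n) g)))"
    "lhs g w = tor (rhs g w) (defect g w)" unfolding defect_def by auto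
qed

lemma defect_one_iff:
  "defect g w = \<one>\<^bsub>D (PObj \<phi> (Dom (nil_op n) w)) (PObj \<psi> (Cod (nil_op n) g))\<^esub> \<longleftrightarrow> lhs g w = rhs g w"
proof -
  interpret comm_group "D (PObj \<phi> (Dom (nil_op n) w)) (PObj \<psi> (Cod (nil_op n) g))" by (rule D_group) auto
  have one: "tor (rhs g w) \<one>\<^bsub>D (PObj \<phi> (Dom (nil_op n) w)) (PObj \<psi> (Cod (nil_op n) g))\<^esub> = rhs g w"
    using tor_one[of "rhs g w"] by simp
  show ?thesis
  proof
    assume "lhs g w = rhs g w"
    hence "tor (rhs g w) (defect g w) = tor (rhs g w) \<one>\<^bsub>D (PObj \<phi> (Dom (nil_op n) w)) (PObj \<psi> (Cod (nil_op n) g))\<^esub>"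
      using lhs_defect one by simp
    from tor_inj[OF _ _ _ this] defect_closed
    show "defect g w = \<one>\<^bsub>D (PObj \<phi> (Dom (nil_op n) w)) (PObj \<psi> (Cod (nil_op n) g))\<^esub>" by simp
  qed (use lhs_defect one in simp)
qed

end

text \<open>One track at the threefold composite is grouped in two ways. Replacing a left side of
  the axiom by its right side costs a defect; each grouping ends at the same track \<open>?M\<close>
  after paying two of them.\<close>

lemma cocycle:
  assumes [simp]: "u \<in> Arr (nil_op n)" "w \<in> Arr (nil_op n)" "g \<in> Arr (nil_op n)"
    and dom: "Dom (nil_op n) w = Cod (nil_op n) u" "Dom (nil_op n) g = Cod (nil_op n) w"
    and p: "Dom (nil_op n) u = p" and s: "Cod (nil_op n) g = s"
  shows "D_post (PObj \<phi> p) (PArr \<psi> g) (defect w u) \<otimes>\<^bsub>D (PObj \<phi> p) (PObj \<psi> s)\<^esub> defect g (w \<cdot>\<^bsub>nil_op n\<^esub> u)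
    = defect (g \<cdot>\<^bsub>nil_op n\<^esub> w) u \<otimes>\<^bsub>D (PObj \<phi> p) (PObj \<psi> s)\<^esub> D_pre (PObj \<psi> s) (PArr \<phi> u) (defect g w)"
proof -
  note dom [simp] and p [simp] and s [simp]
  interpret DG: comm_group "D (PObj \<phi> p) (PObj \<psi> s)" by (rule D_group) auto
  let ?q = "Cod (nil_op n) u" and ?r = "Cod (nil_op n) w"
  let ?gw = "g \<cdot>\<^bsub>nil_op n\<^esub> w" and ?wu = "w \<cdot>\<^bsub>nil_op n\<^esub> u"
  have assoc: "?gw \<cdot>\<^bsub>nil_op n\<^esub> u = g \<cdot>\<^bsub>nil_op n\<^esub> ?wu" by simp
  let ?X = "Pre A (PArr \<phi> u) (Post A (l s) (PComp \<phi> g w))"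
  let ?X' = "Post A (l s) (Post A (PArr \<phi> g) (PComp \<phi> w u))"
  let ?K = "Pre A (l p) (PComp \<psi> ?gw u) \<box> Post A (PArr \<psi> ?gw) (a u)"
  let ?E = "Pre A (PArr \<phi> u) (Pre A (PArr \<phi> w) (a g))"
  let ?M = "Pre A (l p) (PComp \<psi> g ?wu) \<box> (Post A (PArr \<psi> g) (rhs w u) \<box> ?E)"
  \<comment> \<open>The coherence of \<phi> identifies the two groupings.\<close>
  have E1: "lhs ?gw u \<box> ?X = lhs g ?wu \<box> ?X'"
  proof -
    have "lhs ?gw u \<box> ?X = a (?gw \<cdot>\<^bsub>nil_op n\<^esub> u) \<box> Post A (l s) (PComp \<phi> ?gw u \<box> Pre A (PArr \<phi> u) (PComp \<phi> g w))"
      by (simp add: lhs_def)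
    also have "\<dots> = a (?gw \<cdot>\<^bsub>nil_op n\<^esub> u) \<box> Post A (l s) (PComp \<phi> g ?wu \<box> Post A (PArr \<phi> g) (PComp \<phi> w u))"
      by (subst F.PComp_assoc_arr[of u w g, symmetric]) simp_all
    also have "\<dots> = lhs g ?wu \<box> ?X'" by (simp add: lhs_def)
    finally show ?thesis .
  qed
  have E2: "rhs ?gw u \<box> ?X = ?K \<box> Pre A (PArr \<phi> u) (lhs g w)"
    by (simp add: lhs_def rhs_def)
  \<comment> \<open>The coherence of \<psi>, after interchange has brought its composition tracks
    next to each other.\<close>
  have E3: "?K \<box> Pre A (PArr \<phi> u) (rhs g w) = ?M"
  proof -
    let ?E' = "Pre A (PArr \<phi> u) (Post A (PArr \<psi> g) (a w)) \<box> ?E"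
    have i: "Post A (PArr \<psi> ?gw) (a u) \<box> Pre A (PArr \<phi> u) (Pre A (l ?q) (PComp \<psi> g w))
        = Pre A (l p) (Pre A (PArr \<psi> u) (PComp \<psi> g w)) \<box> Post A (PArr \<psi> g) (Post A (PArr \<psi> w) (a u))"
      using interchange_track[of "a u" "PComp \<psi> g w"] by simp
    have "?K \<box> Pre A (PArr \<phi> u) (rhs g w) = Pre A (l p) (PComp \<psi> ?gw u) \<box>
        ((Post A (PArr \<psi> ?gw) (a u) \<box> Pre A (PArr \<phi> u) (Pre A (l ?q) (PComp \<psi> g w))) \<box> ?E')"
      by (simp add: rhs_def)
    also have "\<dots> = Pre A (l p) (PComp \<psi> ?gw u \<box> Pre A (PArr \<psi> u) (PComp \<psi> g w)) \<box>
        (Post A (PArr \<psi> g) (Post A (PArr \<psi> w) (a u)) \<box> ?E')"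
      unfolding i by simp
    also have "\<dots> = Pre A (l p) (PComp \<psi> g ?wu \<box> Post A (PArr \<psi> g) (PComp \<psi> w u)) \<box>
        (Post A (PArr \<psi> g) (Post A (PArr \<psi> w) (a u)) \<box> ?E')"
      by (subst G.PComp_assoc_arr[of u w g, symmetric]) simp_all
    also have "\<dots> = ?M" by (simp add: rhs_def)
    finally show ?thesis .
  qed
  \<comment> \<open>Only interchange is used here: the track at \<open>g\<close> passes the
    composition track of \<phi> at \<open>w\<close> and \<open>u\<close>.\<close>
  have E4: "rhs g ?wu \<box> ?X' = Pre A (l p) (PComp \<psi> g ?wu) \<box> (Post A (PArr \<psi> g) (lhs w u) \<box> ?E)"
  proof -
    have i: "Pre A (PArr \<phi> ?wu) (a g) \<box> ?X' = Post A (PArr \<psi> g) (Post A (l ?r) (PComp \<phi> w u)) \<box> ?E"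
      using interchange_track[of "PComp \<phi> w u" "a g"] by simp
    have "rhs g ?wu \<box> ?X' = Pre A (l p) (PComp \<psi> g ?wu) \<box> (Post A (PArr \<psi> g) (a ?wu) \<box> (Pre A (PArr \<phi> ?wu) (a g) \<box> ?X'))"
      by (simp add: rhs_def)
    also have "\<dots> = Pre A (l p) (PComp \<psi> g ?wu) \<box> (Post A (PArr \<psi> g) (lhs w u) \<box> ?E)"
      unfolding i by (simp add: lhs_def)
    finally show ?thesis .
  qed
  let ?c1 = "defect ?gw u" and ?c2 = "D_pre (PObj \<psi> s) (PArr \<phi> u) (defect g w)"
    and ?c3 = "defect g ?wu" and ?c4 = "D_post (PObj \<phi> p) (PArr \<psi> g) (defect w u)"
  have cc: "?c1 \<in> carrier (D (PObj \<phi> p) (PObj \<psi> s))" "?c3 \<in> carrier (D (PObj \<phi> p) (PObj \<psi> s))"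
    "defect g w \<in> carrier (D (PObj \<phi> ?q) (PObj \<psi> s))" "defect w u \<in> carrier (D (PObj \<phi> p) (PObj \<psi> ?r))"
    using defect_closed[of ?gw u] defect_closed[of g ?wu] defect_closed[of g w] defect_closed[of w u] by simp_all
  hence cc2: "?c2 \<in> carrier (D (PObj \<phi> p) (PObj \<psi> s))" "?c4 \<in> carrier (D (PObj \<phi> p) (PObj \<psi> s))" by simp_all
  have M: "?M \<in> Trk A" by simp
  have DM: "D_of ?M = D (PObj \<phi> p) (PObj \<psi> s)" by (simp add: D_of_def)
  have "lhs ?gw u \<box> ?X = tor (rhs ?gw u \<box> ?X) ?c1"
    unfolding lhs_defect[of ?gw u, simplified] by (rule tor_VComp) (use cc in \<open>simp_all add: D_of_def\<close>)
  also have "rhs ?gw u \<box> ?X = ?K \<box> tor (Pre A (PArr \<phi> u) (rhs g w)) ?c2"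
    unfolding E2 lhs_defect[of g w, simplified] using Pre_tor[of "rhs g w" "PArr \<phi> u" "defect g w"] cc by simp
  also have "\<dots> = tor (?K \<box> Pre A (PArr \<phi> u) (rhs g w)) ?c2"
    by (rule VComp_tor) (use cc2 in \<open>simp_all add: D_of_def\<close>)
  finally have 1: "lhs ?gw u \<box> ?X = tor ?M (?c2 \<otimes>\<^bsub>D (PObj \<phi> p) (PObj \<psi> s)\<^esub> ?c1)"
    unfolding E3 using tor_tor[OF M, of ?c2 ?c1] DM cc cc2 by simp
  have "lhs g ?wu \<box> ?X' = tor (rhs g ?wu \<box> ?X') ?c3"
    unfolding lhs_defect[of g ?wu, simplified] by (rule tor_VComp) (use cc in \<open>simp_all add: D_of_def\<close>)
  also have "rhs g ?wu \<box> ?X' = Pre A (l p) (PComp \<psi> g ?wu) \<box> (tor (Post A (PArr \<psi> g) (rhs w u)) ?c4 \<box> ?E)"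
    unfolding E4 lhs_defect[of w u, simplified] using Post_tor[of "rhs w u" "PArr \<psi> g" "defect w u"] cc by simp
  also have "\<dots> = Pre A (l p) (PComp \<psi> g ?wu) \<box> tor (Post A (PArr \<psi> g) (rhs w u) \<box> ?E) ?c4"
    by (subst tor_VComp) (use cc2 in \<open>simp_all add: D_of_def\<close>)
  also have "\<dots> = tor ?M ?c4"
    by (rule VComp_tor) (use cc2 in \<open>simp_all add: D_of_def\<close>)
  finally have 2: "lhs g ?wu \<box> ?X' = tor ?M (?c4 \<otimes>\<^bsub>D (PObj \<phi> p) (PObj \<psi> s)\<^esub> ?c3)"
    using tor_tor[OF M, of ?c4 ?c3] DM cc cc2 by simp
  \<comment> \<open>Both products act on the same track \<open>?M\<close> with the same result, so
    simple transitivity equates them.\<close>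
  have "?c2 \<otimes>\<^bsub>D (PObj \<phi> p) (PObj \<psi> s)\<^esub> ?c1 = ?c4 \<otimes>\<^bsub>D (PObj \<phi> p) (PObj \<psi> s)\<^esub> ?c3"
    by (rule tor_inj[OF M]) (use 1 2 E1 DM cc cc2 in simp_all)
  thus ?thesis using cc cc2 DG.m_comm by simp
qed

end

section \<open>Vanishing of the obstruction\<close>

lemma HomD: "f \<in> Hom C X Y \<Longrightarrow> f \<in> Arr C" "f \<in> Hom C X Y \<Longrightarrow> Dom C f = X" "f \<in> Hom C X Y \<Longrightarrow> Cod C f = Y"
  by (simp_all add: Hom_def)

section \<open>Pairs of operations\<close>

definition pairn :: "enat \<Rightarrow> nat \<Rightarrow> nil_arr \<Rightarrow> nil_arr \<Rightarrow> nil_arr" where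
  "pairn n p a b = tup n p 2 (\<lambda>k. if k = 0 then a else b)"

lemma pairn:
  assumes "a \<in> Hom (nil_op n) p 1" "b \<in> Hom (nil_op n) p 1"
  shows pairn_Hom: "pairn n p a b \<in> Hom (nil_op n) p 2"
    and pr_pairn: "pr n 2 0 \<cdot>\<^bsub>nil_op n\<^esub> pairn n p a b = a" "pr n 2 1 \<cdot>\<^bsub>nil_op n\<^esub> pairn n p a b = b"
proof -
  have w: "(if k = 0 then a else b) \<in> Hom (nil_op n) p 1" for k :: nat using assms by simp
  show "pairn n p a b \<in> Hom (nil_op n) p 2" unfolding pairn_def by (rule tup_Hom[OF w])
  show "pr n 2 0 \<cdot>\<^bsub>nil_op n\<^esub> pairn n p a b = a" "pr n 2 1 \<cdot>\<^bsub>nil_op n\<^esub> pairn n p a b = b"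
    unfolding pairn_def using pr_tup[of 2 "\<lambda>k. if k = 0 then a else b" n p, OF w, of 0]
      pr_tup[of 2 "\<lambda>k. if k = 0 then a else b" n p, OF w, of 1] by simp_all
qed

lemma pairn_unique:
  assumes "u \<in> Hom (nil_op n) p 2" "pr n 2 0 \<cdot>\<^bsub>nil_op n\<^esub> u = a" "pr n 2 1 \<cdot>\<^bsub>nil_op n\<^esub> u = b"
  shows "u = pairn n p a b"
proof -
  have ab: "a \<in> Hom (nil_op n) p 1" "b \<in> Hom (nil_op n) p 1"
    using nil_op.Comp_Hom[OF assms(1) pr_Hom[of 0 2 n]] nil_op.Comp_Hom[OF assms(1) pr_Hom[of 1 2 n]] assms(2,3)
    by simp_all
  show ?thesis
  proof (rule nil_op_joint_monic[OF assms(1) pairn_Hom[OF ab]])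
    fix k :: nat assume "k < 2"
    then consider "k = 0" | "k = 1" by linarith
    thus "pr n 2 k \<cdot>\<^bsub>nil_op n\<^esub> u = pr n 2 k \<cdot>\<^bsub>nil_op n\<^esub> pairn n p a b"
      by cases (use pr_pairn[OF ab] assms in simp_all)
  qed
qed

lemma pairn_comp:
  assumes "a \<in> Hom (nil_op n) p 1" "b \<in> Hom (nil_op n) p 1" "u \<in> Hom (nil_op n) r p"
  shows "pairn n p a b \<cdot>\<^bsub>nil_op n\<^esub> u = pairn n r (a \<cdot>\<^bsub>nil_op n\<^esub> u) (b \<cdot>\<^bsub>nil_op n\<^esub> u)"
proof (rule pairn_unique[OF nil_op.Comp_Hom[OF assms(3) pairn_Hom[OF assms(1,2)]]])
  show "pr n 2 0 \<cdot>\<^bsub>nil_op n\<^esub> (pairn n p a b \<cdot>\<^bsub>nil_op n\<^esub> u) = a \<cdot>\<^bsub>nil_op n\<^esub> u"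
    using nil_op.Comp_assoc[OF assms(3) pairn_Hom[OF assms(1,2)] pr_Hom[of 0 2 n]] pr_pairn[OF assms(1,2)] by simp
  show "pr n 2 1 \<cdot>\<^bsub>nil_op n\<^esub> (pairn n p a b \<cdot>\<^bsub>nil_op n\<^esub> u) = b \<cdot>\<^bsub>nil_op n\<^esub> u"
    using nil_op.Comp_assoc[OF assms(3) pairn_Hom[OF assms(1,2)] pr_Hom[of 1 2 n]] pr_pairn[OF assms(1,2)] by simp
qed

lemma ninj_2: "ninj n 2 0 = pairn n 1 (Ident (nil_op n) 1) (nz n 1 1)"
  "ninj n 2 1 = pairn n 1 (nz n 1 1) (Ident (nil_op n) 1)"
  by (rule pairn_unique[OF ninj_Hom]; simp add: pr_ninj)+

lemma mu_pairn_nz: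
  assumes "a \<in> Hom (nil_op n) p 1"
  shows "mu n \<cdot>\<^bsub>nil_op n\<^esub> pairn n p a (nz n p 1) = a" "mu n \<cdot>\<^bsub>nil_op n\<^esub> pairn n p (nz n p 1) a = a"
  using mu_nz_right[OF pairn_Hom[OF assms nz_Hom]] mu_nz_left[OF pairn_Hom[OF nz_Hom assms]]
    pr_pairn[OF assms nz_Hom] pr_pairn[OF nz_Hom assms] by simp_all

lemma mu_ninj: "k < 2 \<Longrightarrow> mu n \<cdot>\<^bsub>nil_op n\<^esub> ninj n 2 k = Ident (nil_op n) 1"
proof -
  assume "k < 2" then consider "k = 0" | "k = 1" by linarith
  thus ?thesis by cases (simp_all add: ninj_2 mu_pairn_nz[OF nil_op.Ident_Hom])
qed

text \<open>The normalizations under which all defects will be seen to vanish: \<open>a_inj\<close>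
  ties the track at an operation to its restrictions along the injections, and \<open>a_mu\<close>
  ties consecutive integers to each other.\<close>

locale normal_family = track_family A n \<phi> \<psi> HG D Dmap \<sigma> l a
  for A (structure) and n \<phi> \<psi> HG D Dmap \<sigma> and l a +
  assumes n1: "1 \<le> n"
    and l_pr: "k < p \<Longrightarrow> PArr \<psi> (pr n p k) \<cdot> l p = l 1 \<cdot> PArr \<phi> (pr n p k)"
    and a_proj: "w \<in> Hom (nil_op n) p q \<Longrightarrow> k < q \<Longrightarrow> Post A (PArr \<psi> (pr n q k)) (a w) = a (pr n q k \<cdot>\<^bsub>nil_op n\<^esub> w)"
    and a_pr: "k < p \<Longrightarrow> a (pr n p k) = IdT A (l 1 \<cdot> PArr \<phi> (pr n p k))"
    and a_nz: "a (nz n p 1) = IdT A (zA (PObj \<phi> p) (PObj \<psi> 1))"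
    and a_inj: "v \<in> Hom (nil_op n) p 1 \<Longrightarrow> k < p \<Longrightarrow> lhs v (ninj n p k) = rhs v (ninj n p k)"
    and a_mu: "lhs (mu n) (pairn n 1 (zpow n e) (Ident (nil_op n) 1)) = rhs (mu n) (pairn n 1 (zpow n e) (Ident (nil_op n) 1))"
begin

abbreviation "unit p r \<equiv> \<one>\<^bsub>D (PObj \<phi> p) (PObj \<psi> r)\<^esub>"
abbreviation tms (infixl "\<oplus>" 65) where "x \<oplus> y \<equiv> x \<otimes>\<^bsub>D (PObj \<phi> 1) (PObj \<psi> 1)\<^esub> y"

lemma DG: "comm_group (D (PObj \<phi> p) (PObj \<psi> r))"
  by (rule D_group) auto

lemma defect_Hom:
  assumes "g \<in> Hom (nil_op n) q r" "w \<in> Hom (nil_op n) p q"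
  shows "defect g w \<in> carrier (D (PObj \<phi> p) (PObj \<psi> r))"
    "defect g w = unit p r \<longleftrightarrow> lhs g w = rhs g w"
  using defect_closed[of g w] defect_one_iff[of g w] assms by (auto simp: mem_Hom_iff)

lemma cocycle_Hom:
  assumes "u \<in> Hom (nil_op n) p q" "w \<in> Hom (nil_op n) q r" "g \<in> Hom (nil_op n) r s"
  shows "D_post (PObj \<phi> p) (PArr \<psi> g) (defect w u) \<otimes>\<^bsub>D (PObj \<phi> p) (PObj \<psi> s)\<^esub> defect g (w \<cdot>\<^bsub>nil_op n\<^esub> u)
    = defect (g \<cdot>\<^bsub>nil_op n\<^esub> w) u \<otimes>\<^bsub>D (PObj \<phi> p) (PObj \<psi> s)\<^esub> D_pre (PObj \<psi> s) (PArr \<phi> u) (defect g w)"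
  by (rule cocycle) (use assms in \<open>simp_all add: mem_Hom_iff\<close>)

lemma D_post_one:
  assumes "g \<in> Hom (nil_op n) q r" shows "D_post (PObj \<phi> p) (PArr \<psi> g) (unit p q) = unit p r"
proof -
  have g: "PArr \<psi> g \<in> Arr A" "Dom A (PArr \<psi> g) = PObj \<psi> q" "Cod A (PArr \<psi> g) = PObj \<psi> r"
    using HomD[OF assms] by simp_all
  show ?thesis using group_hom.hom_one[OF D_post_hom[OF g(1) F.PObj_simp[of p]]] unfolding g .
qed

lemma D_pre_one:
  assumes "u \<in> Hom (nil_op n) p q" shows "D_pre (PObj \<psi> r) (PArr \<phi> u) (unit q r) = unit p r"
proof -
  have u: "PArr \<phi> u \<in> Arr A" "Dom A (PArr \<phi> u) = PObj \<phi> p" "Cod A (PArr \<phi> u) = PObj \<phi> q"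
    using HomD[OF assms] by simp_all
  show ?thesis using group_hom.hom_one[OF D_pre_hom[OF u(1) G.PObj_simp[of r]]] unfolding u .
qed

lemma l_pr_arr: "k < p \<Longrightarrow> PArr \<psi> (pr n p k) \<cdot> (l p \<cdot> x) = l 1 \<cdot> (PArr \<phi> (pr n p k) \<cdot> x)"
  if "x \<in> Arr A" "Cod A x = PObj \<phi> p"
  using Comp_assoc_simp[of x "l p" "PArr \<psi> (pr n p k)"] Comp_assoc_simp[of x "PArr \<phi> (pr n p k)" "l 1"] that
  by (simp add: l_pr)

lemma a_nz_gen: "a (nz n p q) = IdT A (zA (PObj \<phi> p) (PObj \<psi> q))"
proof (rule G.joint_trk_eqI)
  fix k assume k: "k < q"
  show "Post A (PArr \<psi> (pr n q k)) (a (nz n p q)) = Post A (PArr \<psi> (pr n q k)) (IdT A (zA (PObj \<phi> p) (PObj \<psi> q)))"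
    using a_proj[OF nz_Hom k, of p] k by (simp add: comp_nz[OF pr_Hom[OF k]] a_nz)
qed (auto simp: HomTrk_def mem_Hom_iff)

lemma a_Ident: "a (Ident (nil_op n) 1) = IdT A (l 1)"
  using a_pr[of 0 1] by (simp add: pr_1_0)

text \<open>Both pseudofunctors are strict at projections and the track there is an identity, so
  both sides of the axiom reduce to the track at the composite.\<close>

lemma defect_pr:
  assumes "w \<in> Hom (nil_op n) p q" "k < q" shows "defect (pr n q k) w = unit p 1"
proof -
  have w: "w \<in> Arr (nil_op n)" "Dom (nil_op n) w = p" "Cod (nil_op n) w = q" using assms by (auto simp: mem_Hom_iff)
  have "lhs (pr n q k) w = rhs (pr n q k) w"
    using w assms F.strict_left_simps[OF F.strict_left_pr[OF assms(2)], of w]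
      G.strict_left_simps[OF G.strict_left_pr[OF assms(2)], of w]
    by (simp add: lhs_def rhs_def a_pr a_proj[OF assms])
  thus ?thesis using defect_Hom(2)[OF pr_Hom[OF assms(2)] assms(1)] by simp
qed

text \<open>The cocycle identity with a projection as outermost map, two of its terms vanishing by
  \<open>defect_pr\<close>. It reduces defects to operations with one output.\<close>

lemma defect_proj:
  assumes u: "u \<in> Hom (nil_op n) p q" and w: "w \<in> Hom (nil_op n) q r" and k: "k < r"
  shows "D_post (PObj \<phi> p) (PArr \<psi> (pr n r k)) (defect w u) = defect (pr n r k \<cdot>\<^bsub>nil_op n\<^esub> w) u"
proof -
  interpret comm_group "D (PObj \<phi> p) (PObj \<psi> 1)" by (rule DG)
  have "D_post (PObj \<phi> p) (PArr \<psi> (pr n r k)) (defect w u) \<in> carrier (D (PObj \<phi> p) (PObj \<psi> 1))"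
    using defect_Hom(1)[OF w u] k by simp
  moreover have "defect (pr n r k \<cdot>\<^bsub>nil_op n\<^esub> w) u \<in> carrier (D (PObj \<phi> p) (PObj \<psi> 1))"
    using defect_Hom(1)[OF nil_op.Comp_Hom[OF w pr_Hom[OF k]] u] .
  ultimately show ?thesis
    using cocycle_Hom[OF u w pr_Hom[OF k]] defect_pr[OF nil_op.Comp_Hom[OF u w] k] defect_pr[OF w k] D_pre_one[OF u]
    by simp
qed

lemma defect_nz_right:
  assumes "g \<in> Hom (nil_op n) q r" shows "defect g (nz n p q) = unit p r"
proof -
  have g: "g \<in> Arr (nil_op n)" "Dom (nil_op n) g = q" "Cod (nil_op n) g = r" using assms by (auto simp: mem_Hom_iff)
  have "lhs g (nz n p q) = rhs g (nz n p q)"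
    using g by (simp add: lhs_def rhs_def comp_nz[OF assms] a_nz_gen Pre_zA F.pp_PComp_zero[OF assms] G.pp_PComp_zero[OF assms])
  thus ?thesis using defect_Hom(2)[OF assms nz_Hom] by simp
qed

lemma defect_nz_left:
  assumes "w \<in> Hom (nil_op n) p q" shows "defect (nz n q r) w = unit p r"
proof -
  have w: "w \<in> Arr (nil_op n)" "Dom (nil_op n) w = p" "Cod (nil_op n) w = q" using assms by (auto simp: mem_Hom_iff)
  have "lhs (nz n q r) w = rhs (nz n q r) w"
    using w by (simp add: lhs_def rhs_def nz_comp[OF assms] a_nz_gen Post_zA F.pp_zero_PComp[OF assms] G.pp_zero_PComp[OF assms])
  thus ?thesis using defect_Hom(2)[OF nz_Hom assms] by simp
qed

lemma defect_joint:
  assumes u: "u \<in> Hom (nil_op n) p q" and w: "w \<in> Hom (nil_op n) q r"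
    and "\<And>k. k < r \<Longrightarrow> defect (pr n r k \<cdot>\<^bsub>nil_op n\<^esub> w) u = unit p 1"
  shows "defect w u = unit p r"
  by (rule G.D_post_joint) (use defect_Hom(1)[OF w u] defect_proj[OF u w] assms(3) in auto)

lemma defect_ninj:
  assumes w: "w \<in> Hom (nil_op n) p q" and k: "k < p" shows "defect w (ninj n p k) = unit 1 q"
proof (rule defect_joint[OF ninj_Hom w])
  fix j assume j: "j < q"
  note v = nil_op.Comp_Hom[OF w pr_Hom[OF j]]
  show "defect (pr n q j \<cdot>\<^bsub>nil_op n\<^esub> w) (ninj n p k) = unit 1 1"
    using defect_Hom(2)[OF v ninj_Hom] a_inj[OF v k] by simp
qed

text \<open>In the cocycle identity at an injection i, \<open>defect_ninj\<close> removes two terms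
  and leaves that c(g, w) restricts along i to c(g, w i). Hence c(g, -) is tested on maps out of
  1.\<close>

lemma defect_by_inj:
  assumes w: "w \<in> Hom (nil_op n) p q" and g: "g \<in> Hom (nil_op n) q r"
    and "\<And>k. k < p \<Longrightarrow> defect g (w \<cdot>\<^bsub>nil_op n\<^esub> ninj n p k) = unit 1 r"
  shows "defect g w = unit p r"
proof (rule F.D_detect)
  fix k assume k: "k < p"
  interpret comm_group "D (PObj \<phi> 1) (PObj \<psi> r)" by (rule DG)
  have "D_pre (PObj \<psi> r) (PArr \<phi> (ninj n p k)) (defect g w) \<in> carrier (D (PObj \<phi> 1) (PObj \<psi> r))"
    using defect_Hom(1)[OF g w] by simp
  thus "D_pre (PObj \<psi> r) (PArr \<phi> (ninj n p k)) (defect g w) = unit 1 r"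
    using cocycle_Hom[OF ninj_Hom w g, of k] assms(3)[OF k] defect_ninj[OF w k] D_post_one[OF g]
      defect_ninj[OF nil_op.Comp_Hom[OF w g] k] by simp
qed (use defect_Hom(1)[OF g w] in auto)

lemma D_post_mu_defect:
  assumes u: "u \<in> Hom (nil_op n) q 2" and e: "e \<in> Hom (nil_op n) p q"
  shows "D_post (PObj \<phi> p) (PArr \<psi> (mu n)) (defect u e)
    = defect (pr n 2 0 \<cdot>\<^bsub>nil_op n\<^esub> u) e \<otimes>\<^bsub>D (PObj \<phi> p) (PObj \<psi> 1)\<^esub> defect (pr n 2 1 \<cdot>\<^bsub>nil_op n\<^esub> u) e"
  using G.D_post_mu[OF _ defect_Hom(1)[OF u e]] defect_proj[OF e u] by simp

section \<open>The defect of the multiplication at pairs of integers\<close>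

abbreviation zz where "zz e f \<equiv> pairn n 1 (zpow n e) (zpow n f)"

lemma zz_Hom: "zz e f \<in> Hom (nil_op n) 1 2" by (rule pairn_Hom[OF zpow_Hom zpow_Hom])

lemma mu_zz: "mu n \<cdot>\<^bsub>nil_op n\<^esub> zz e f = zpow n (e + f)"
  by (rule mu_zpow[OF zz_Hom]) (rule pr_pairn[OF zpow_Hom zpow_Hom])+

text \<open>By \<open>M_cocycle\<close> this is an ordinary 2-cocycle on the group of
  integers.\<close>

definition M where "M e f = defect (mu n) (zz e f)"

lemma M_closed: "M e f \<in> carrier (D (PObj \<phi> 1) (PObj \<psi> 1))"
  unfolding M_def by (rule defect_Hom(1)[OF mu_Hom zz_Hom])

lemma M_1: "M e 1 = unit 1 1"
  unfolding M_def using defect_Hom(2)[OF mu_Hom zz_Hom, of e 1] a_mu[of e] by (simp add: zpow_1)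

text \<open>These pairs are the two injections of 1 into 2 and the zero map.\<close>

lemma defect_mu_units:
  assumes "x = Ident (nil_op n) 1 \<and> y = nz n 1 1 \<or> x = nz n 1 1 \<and> y = Ident (nil_op n) 1 \<or> x = nz n 1 1 \<and> y = nz n 1 1"
  shows "defect (mu n) (pairn n 1 x y) = unit 1 1"
proof -
  have z: "pairn n 1 (nz n 1 1) (nz n 1 1) = nz n 1 2"
    by (rule pairn_unique[symmetric, OF nz_Hom]) (rule comp_nz[OF pr_Hom]; simp)+
  show ?thesis using assms defect_ninj[OF mu_Hom, of 0] defect_ninj[OF mu_Hom, of 1] defect_nz_right[OF mu_Hom, of 1]
    by (auto simp: ninj_2 z)
qed

text \<open>Associativity of the multiplication, expressed by two maps from the threefold to the twofold
  product that have zero defect with it.\<close>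

lemma M_cocycle: "M e f \<oplus> M (e + f) g = M f g \<oplus> M e (f + g)"
proof -
  interpret comm_group "D (PObj \<phi> 1) (PObj \<psi> 1)" by (rule DG)
  let ?I = "Ident (nil_op n) 1" and ?N = "nz n 1 1"
  define q0 q1 q2 where q: "q0 = pr n 3 0" "q1 = pr n 3 1" "q2 = pr n 3 2"
  have qH: "q0 \<in> Hom (nil_op n) 3 1" "q1 \<in> Hom (nil_op n) 3 1" "q2 \<in> Hom (nil_op n) 3 1"
    unfolding q by (simp_all add: pr_Hom)
  define P Q where "P = pairn n 3 q0 q1" and "Q = pairn n 3 q1 q2"
  have PQ: "P \<in> Hom (nil_op n) 3 2" "Q \<in> Hom (nil_op n) 3 2"
    unfolding P_def Q_def using pairn_Hom qH by blast+
  note mP = nil_op.Comp_Hom[OF PQ(1) mu_Hom] and mQ = nil_op.Comp_Hom[OF PQ(2) mu_Hom]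
  \<comment> \<open>With variables x, y, z these are the pairs (xy, z) and (x, yz), both with
    product xyz.\<close>
  define R S where "R = pairn n 3 (mu n \<cdot>\<^bsub>nil_op n\<^esub> P) q2" and "S = pairn n 3 q0 (mu n \<cdot>\<^bsub>nil_op n\<^esub> Q)"
  have RS: "R \<in> Hom (nil_op n) 3 2" "S \<in> Hom (nil_op n) 3 2"
    unfolding R_def S_def using pairn_Hom[OF mP qH(3)] pairn_Hom[OF qH(1) mQ] by blast+
  have prR: "pr n 2 0 \<cdot>\<^bsub>nil_op n\<^esub> R = mu n \<cdot>\<^bsub>nil_op n\<^esub> P" "pr n 2 1 \<cdot>\<^bsub>nil_op n\<^esub> R = q2"
    unfolding R_def by (rule pr_pairn[OF mP qH(3)])+
  have prS: "pr n 2 0 \<cdot>\<^bsub>nil_op n\<^esub> S = q0" "pr n 2 1 \<cdot>\<^bsub>nil_op n\<^esub> S = mu n \<cdot>\<^bsub>nil_op n\<^esub> Q"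
    unfolding S_def by (rule pr_pairn[OF qH(1) mQ])+
  have prP: "pr n 2 0 \<cdot>\<^bsub>nil_op n\<^esub> P = q0" "pr n 2 1 \<cdot>\<^bsub>nil_op n\<^esub> P = q1"
    unfolding P_def by (rule pr_pairn[OF qH(1,2)])+
  have prQ: "pr n 2 0 \<cdot>\<^bsub>nil_op n\<^esub> Q = q1" "pr n 2 1 \<cdot>\<^bsub>nil_op n\<^esub> Q = q2"
    unfolding Q_def by (rule pr_pairn[OF qH(2,3)])+
  have RS_eq: "mu n \<cdot>\<^bsub>nil_op n\<^esub> R = mu n \<cdot>\<^bsub>nil_op n\<^esub> S"
    by (rule mu_assoc[OF PQ(1) RS(1,2) PQ(2)]) (simp_all only: prP prQ prR prS)
  have I: "?I \<in> Hom (nil_op n) 1 1" by (rule nil_op.Ident_Hom) simp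
  have qi: "q0 \<cdot>\<^bsub>nil_op n\<^esub> ninj n 3 k = (if k = 0 then ?I else ?N)"
    "q1 \<cdot>\<^bsub>nil_op n\<^esub> ninj n 3 k = (if k = 1 then ?I else ?N)"
    "q2 \<cdot>\<^bsub>nil_op n\<^esub> ninj n 3 k = (if k = 2 then ?I else ?N)" for k
    unfolding q using pr_ninj[of _ 3 n k] by (auto split: if_splits)
  have Pi: "P \<cdot>\<^bsub>nil_op n\<^esub> ninj n 3 k = pairn n 1 (q0 \<cdot>\<^bsub>nil_op n\<^esub> ninj n 3 k) (q1 \<cdot>\<^bsub>nil_op n\<^esub> ninj n 3 k)"
    "Q \<cdot>\<^bsub>nil_op n\<^esub> ninj n 3 k = pairn n 1 (q1 \<cdot>\<^bsub>nil_op n\<^esub> ninj n 3 k) (q2 \<cdot>\<^bsub>nil_op n\<^esub> ninj n 3 k)" for k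
    unfolding P_def Q_def by (rule pairn_comp[OF qH(1,2) ninj_Hom] pairn_comp[OF qH(2,3) ninj_Hom])+
  have Ri: "R \<cdot>\<^bsub>nil_op n\<^esub> ninj n 3 k = pairn n 1 (mu n \<cdot>\<^bsub>nil_op n\<^esub> (P \<cdot>\<^bsub>nil_op n\<^esub> ninj n 3 k)) (q2 \<cdot>\<^bsub>nil_op n\<^esub> ninj n 3 k)"
    "S \<cdot>\<^bsub>nil_op n\<^esub> ninj n 3 k = pairn n 1 (q0 \<cdot>\<^bsub>nil_op n\<^esub> ninj n 3 k) (mu n \<cdot>\<^bsub>nil_op n\<^esub> (Q \<cdot>\<^bsub>nil_op n\<^esub> ninj n 3 k))" for k
    unfolding R_def S_def pairn_comp[OF mP qH(3) ninj_Hom] pairn_comp[OF qH(1) mQ ninj_Hom]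
      nil_op.Comp_assoc[OF ninj_Hom PQ(1) mu_Hom] nil_op.Comp_assoc[OF ninj_Hom PQ(2) mu_Hom] by (rule refl)+
  have k3: "k = 0 \<or> k = 1 \<or> k = 2" if "k < 3" for k :: nat using that by linarith
  \<comment> \<open>Along an injection at most one of the three variables survives, so only the
    pairs of \<open>defect_mu_units\<close> occur; the same works for \<open>Q\<close>,
    \<open>R\<close> and \<open>S\<close>.\<close>
  have dP: "defect (mu n) P = unit 3 1"
  proof (rule defect_by_inj[OF PQ(1) mu_Hom])
    fix k :: nat assume "k < 3"
    show "defect (mu n) (P \<cdot>\<^bsub>nil_op n\<^esub> ninj n 3 k) = unit 1 1"
      unfolding Pi using k3[OF \<open>k < 3\<close>] by (intro defect_mu_units) (auto simp: qi)
  qed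
  have dQ: "defect (mu n) Q = unit 3 1"
  proof (rule defect_by_inj[OF PQ(2) mu_Hom])
    fix k :: nat assume "k < 3"
    show "defect (mu n) (Q \<cdot>\<^bsub>nil_op n\<^esub> ninj n 3 k) = unit 1 1"
      unfolding Pi using k3[OF \<open>k < 3\<close>] by (intro defect_mu_units) (auto simp: qi)
  qed
  have dR: "defect (mu n) R = unit 3 1"
  proof (rule defect_by_inj[OF RS(1) mu_Hom])
    fix k :: nat assume "k < 3"
    show "defect (mu n) (R \<cdot>\<^bsub>nil_op n\<^esub> ninj n 3 k) = unit 1 1"
      unfolding Ri Pi using k3[OF \<open>k < 3\<close>]
      by (intro defect_mu_units) (auto simp: qi mu_pairn_nz[OF I] mu_pairn_nz[OF nz_Hom])
  qed
  have dS: "defect (mu n) S = unit 3 1"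
  proof (rule defect_by_inj[OF RS(2) mu_Hom])
    fix k :: nat assume "k < 3"
    show "defect (mu n) (S \<cdot>\<^bsub>nil_op n\<^esub> ninj n 3 k) = unit 1 1"
      unfolding Ri Pi using k3[OF \<open>k < 3\<close>]
      by (intro defect_mu_units) (auto simp: qi mu_pairn_nz[OF I] mu_pairn_nz[OF nz_Hom])
  qed
  \<comment> \<open>Evaluation of the three variables at the integers e, f and g.\<close>
  define v where "v = tup n 1 3 (\<lambda>k. zpow n (if k = 0 then e else if k = 1 then f else g))"
  have v: "v \<in> Hom (nil_op n) 1 3" unfolding v_def by (rule tup_Hom) (rule zpow_Hom)
  have qv: "q0 \<cdot>\<^bsub>nil_op n\<^esub> v = zpow n e" "q1 \<cdot>\<^bsub>nil_op n\<^esub> v = zpow n f" "q2 \<cdot>\<^bsub>nil_op n\<^esub> v = zpow n g"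
    unfolding q v_def by (subst pr_tup[OF zpow_Hom]; simp)+
  have Pv: "P \<cdot>\<^bsub>nil_op n\<^esub> v = zz e f" "Q \<cdot>\<^bsub>nil_op n\<^esub> v = zz f g"
    unfolding P_def Q_def by (simp_all add: pairn_comp[OF qH(1,2) v] pairn_comp[OF qH(2,3) v] qv)
  have Rv: "R \<cdot>\<^bsub>nil_op n\<^esub> v = zz (e + f) g" "S \<cdot>\<^bsub>nil_op n\<^esub> v = zz e (f + g)"
    unfolding R_def S_def using nil_op.Comp_assoc[OF v PQ(1) mu_Hom] nil_op.Comp_assoc[OF v PQ(2) mu_Hom]
    by (simp_all add: pairn_comp[OF mP qH(3) v] pairn_comp[OF qH(1) mQ v] qv Pv mu_zz)
  \<comment> \<open>The coordinates of \<open>P\<close> and \<open>Q\<close> are projections without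
    defect, so the cocycle identity leaves exactly the value of \<open>M\<close> at the inner
    pair.\<close>
  have dv: "defect (mu n \<cdot>\<^bsub>nil_op n\<^esub> P) v = M e f" "defect (mu n \<cdot>\<^bsub>nil_op n\<^esub> Q) v = M f g"
  proof -
    have "defect q0 v = unit 1 1" "defect q1 v = unit 1 1" "defect q2 v = unit 1 1"
      unfolding q using defect_pr[OF v] by simp_all
    hence "D_post (PObj \<phi> 1) (PArr \<psi> (mu n)) (defect P v) = unit 1 1" "D_post (PObj \<phi> 1) (PArr \<psi> (mu n)) (defect Q v) = unit 1 1"
      using D_post_mu_defect[OF PQ(1) v] D_post_mu_defect[OF PQ(2) v] prP prQ by simp_all
    thus "defect (mu n \<cdot>\<^bsub>nil_op n\<^esub> P) v = M e f" "defect (mu n \<cdot>\<^bsub>nil_op n\<^esub> Q) v = M f g"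
      using cocycle_Hom[OF v PQ(1) mu_Hom] cocycle_Hom[OF v PQ(2) mu_Hom] dP dQ D_pre_one[OF v]
        M_closed defect_Hom(1)[OF mP v] defect_Hom(1)[OF mQ v] by (simp_all add: Pv flip: M_def)
  qed
  have "D_post (PObj \<phi> 1) (PArr \<psi> (mu n)) (defect R v) = M e f"
    "D_post (PObj \<phi> 1) (PArr \<psi> (mu n)) (defect S v) = M f g"
    using D_post_mu_defect[OF RS(1) v] D_post_mu_defect[OF RS(2) v] prR prS dv M_closed
      defect_pr[OF v, of 2] defect_pr[OF v, of 0] by (simp_all flip: q)
  hence "M e f \<oplus> M (e + f) g = defect (mu n \<cdot>\<^bsub>nil_op n\<^esub> R) v" "M f g \<oplus> M e (f + g) = defect (mu n \<cdot>\<^bsub>nil_op n\<^esub> S) v"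
    using cocycle_Hom[OF v RS(1) mu_Hom] cocycle_Hom[OF v RS(2) mu_Hom] dR dS D_pre_one[OF v]
      defect_Hom(1)[OF nil_op.Comp_Hom[OF RS(1) mu_Hom] v] defect_Hom(1)[OF nil_op.Comp_Hom[OF RS(2) mu_Hom] v]
    by (simp_all add: Rv flip: M_def)
  thus ?thesis using RS_eq by simp
qed

lemma M_one: "M e f = unit 1 1"
proof -
  interpret comm_group "D (PObj \<phi> 1) (PObj \<psi> 1)" by (rule DG)
  have step: "M e f = M e (f + 1)" for f
    using M_cocycle[of e f 1] M_closed by (simp add: M_1)
  show ?thesis
  proof (induction f rule: int_induct[where k = 1])
    case base show ?case by (rule M_1)
  next
    case (step1 i) thus ?case using step[of i] by simp
  next
    case (step2 i) thus ?case using step[of "i - 1"] by simp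
  qed
qed

text \<open>After restriction along an injection both components are endomorphisms of 1, hence
  integers by \<open>zpow_bij\<close>, and \<open>M_one\<close> applies.\<close>

lemma defect_mu:
  assumes w: "w \<in> Hom (nil_op n) p 2" shows "defect (mu n) w = unit p 1"
proof (rule defect_by_inj[OF w mu_Hom])
  fix k
  let ?u = "w \<cdot>\<^bsub>nil_op n\<^esub> ninj n p k"
  have u: "?u \<in> Hom (nil_op n) 1 2" by (rule nil_op.Comp_Hom[OF ninj_Hom w])
  have "pr n 2 j \<cdot>\<^bsub>nil_op n\<^esub> ?u \<in> range (zpow n)" if "j < 2" for j
    using nil_op.Comp_Hom[OF u pr_Hom[OF that]] zpow_bij[OF n1] by (simp add: bij_betw_def)
  from this[of 0] this[of 1] obtain e f where "pr n 2 0 \<cdot>\<^bsub>nil_op n\<^esub> ?u = zpow n e" "pr n 2 1 \<cdot>\<^bsub>nil_op n\<^esub> ?u = zpow n f"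
    by auto
  hence "?u = zz e f" by (rule pairn_unique[OF u])
  thus "defect (mu n) ?u = unit 1 1" using M_one[of e f] by (simp add: M_def)
qed

text \<open>The cocycle identity with \<open>mu\<close> outermost: two terms vanish by
  \<open>defect_mu\<close>, and pushing forward along \<open>mu\<close> adds the
  coordinates.\<close>

lemma defect_mu_comp:
  assumes u: "u \<in> Hom (nil_op n) q 2" and w: "w \<in> Hom (nil_op n) p q"
  shows "defect (mu n \<cdot>\<^bsub>nil_op n\<^esub> u) w
    = defect (pr n 2 0 \<cdot>\<^bsub>nil_op n\<^esub> u) w \<otimes>\<^bsub>D (PObj \<phi> p) (PObj \<psi> 1)\<^esub> defect (pr n 2 1 \<cdot>\<^bsub>nil_op n\<^esub> u) w"
proof -
  interpret comm_group "D (PObj \<phi> p) (PObj \<psi> 1)" by (rule DG)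
  note pu = nil_op.Comp_Hom[OF u pr_Hom[of 0 2 n]] nil_op.Comp_Hom[OF u pr_Hom[of 1 2 n]]
  show ?thesis
    using cocycle_Hom[OF w u mu_Hom] D_post_mu_defect[OF u w] defect_mu[OF nil_op.Comp_Hom[OF w u]] defect_mu[OF u]
      D_pre_one[OF w] defect_Hom(1)[OF pu(1) w] defect_Hom(1)[OF pu(2) w] defect_Hom(1)[OF nil_op.Comp_Hom[OF u mu_Hom] w]
    by simp
qed

lemma defect_one:
  assumes g: "g \<in> Hom (nil_op n) q r" and w: "w \<in> Hom (nil_op n) p q"
  shows "defect g w = unit p r"
proof (rule defect_joint[OF w g])
  fix k assume k: "k < r"
  interpret comm_group "D (PObj \<phi> p) (PObj \<psi> 1)" by (rule DG)
  show "defect (pr n r k \<cdot>\<^bsub>nil_op n\<^esub> g) w = unit p 1"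
    using nil_op.Comp_Hom[OF g pr_Hom[OF k]]
  proof (induction rule: nil_op_induct)
    case zero show ?case by (rule defect_nz_left[OF w])
  next
    case (pr k) thus ?case by (rule defect_pr[OF w])
  next
    case (mult u) thus ?case using defect_mu_comp[OF mult(1) w] by simp
  next
    case (inv u)
    \<comment> \<open>The product is a zero map and has no defect, so the additive relation leaves
      the defect of the second component alone.\<close>
    show ?case using defect_mu_comp[OF inv(1) w] inv(2,3) defect_nz_left[OF w, of 1]
        defect_Hom(1)[OF nil_op.Comp_Hom[OF inv(1) pr_Hom[of 1 2 n]] w] by simp
  qed
qed

lemma coherent:
  assumes "g \<in> Hom (nil_op n) q r" "w \<in> Hom (nil_op n) p q" shows "lhs g w = rhs g w"
  using defect_one[OF assms] defect_Hom(2)[OF assms] by simp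

end

section \<open>Existence of coherent families\<close>

text \<open>Dependent choice from 0 in both directions. The hypotheses give only existence of a
  neighbour on either side, so the negative half is built separately, with \<open>Q\<close> read
  backwards.\<close>

lemma int_chain:
  fixes P :: "int \<Rightarrow> 'a \<Rightarrow> bool" and Q :: "int \<Rightarrow> 'a \<Rightarrow> 'a \<Rightarrow> bool"
  assumes "P 0 x0" and up: "\<And>e x. P e x \<Longrightarrow> \<exists>y. P (e + 1) y \<and> Q e x y"
    and down: "\<And>e y. P (e + 1) y \<Longrightarrow> \<exists>x. P e x \<and> Q e x y"
  obtains t where "t 0 = x0" "\<And>e. P e (t e)" "\<And>e. Q e (t e) (t (e + 1))"
proof -
  have "\<exists>g. \<forall>i. (P (int i) (g i) \<and> (i = 0 \<longrightarrow> g i = x0)) \<and> Q (int i) (g i) (g (Suc i))"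
  proof (rule dependent_nat_choice)
    fix x i assume "P (int i) x \<and> (i = 0 \<longrightarrow> x = x0)"
    then obtain y where "P (int i + 1) y" "Q (int i) x y" using up by blast
    thus "\<exists>y. (P (int (Suc i)) y \<and> (Suc i = 0 \<longrightarrow> y = x0)) \<and> Q (int i) x y" by (auto simp: add.commute)
  qed (use assms(1) in auto)
  then obtain g where g: "g 0 = x0" "\<And>i. P (int i) (g i)" "\<And>i. Q (int i) (g i) (g (Suc i))" by blast
  have "\<exists>h. \<forall>i. (P (- int i) (h i) \<and> (i = 0 \<longrightarrow> h i = x0)) \<and> Q (- int (Suc i)) (h (Suc i)) (h i)"
  proof (rule dependent_nat_choice)
    fix x i assume "P (- int i) x \<and> (i = 0 \<longrightarrow> x = x0)"
    thus "\<exists>y. (P (- int (Suc i)) y \<and> (Suc i = 0 \<longrightarrow> y = x0)) \<and> Q (- int (Suc i)) y x"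
      using down[of "- int (Suc i)" x] by simp
  qed (use assms(1) in auto)
  then obtain h where h: "h 0 = x0" "\<And>i. P (- int i) (h i)" "\<And>i. Q (- int (Suc i)) (h (Suc i)) (h i)" by blast
  define t where "t e = (if 0 \<le> e then g (nat e) else h (nat (- e)))" for e
  have "P e (t e) \<and> Q e (t e) (t (e + 1))" for e
  proof (cases "0 \<le> e")
    case True
    then obtain i where "e = int i" using nonneg_int_cases by blast
    thus ?thesis using g(2)[of i] g(3)[of i] by (simp add: t_def nat_add_distrib)
  next
    case False
    then obtain i where i: "e = - int (Suc i)" by (metis int_cases not_less of_nat_0_le_iff)
    have "t e = h (Suc i)" unfolding t_def i by (simp add: nat_add_distrib Suc_eq_plus1 add.commute)
    \<comment> \<open>For \<open>i = 0\<close> the left side is \<open>g 0\<close>, and the two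
      halves share the starting value \<open>x0\<close>.\<close>
    moreover have "t (e + 1) = h i"
      unfolding t_def i using g(1) h(1) by (cases i) (auto simp: nat_add_distrib Suc_eq_plus1 add.commute)
    ultimately show ?thesis using h(2)[of "Suc i"] h(3)[of i] i by simp
  qed
  moreover have "t 0 = x0" using g by (simp add: t_def)
  ultimately show ?thesis using that by blast
qed

locale pp_map = pp_pair A n \<phi> \<psi> HG D Dmap \<sigma>
  for A (structure) and n \<phi> \<psi> HG D Dmap \<sigma> +
  fixes f
  assumes n1: "1 \<le> n" and f: "f \<in> Hom A (PObj \<phi> 1) (PObj \<psi> 1)"
begin

lemmas f_simps' [simp] = HomD[OF f]
lemmas lev_simps' [simp] = lev_simps[OF f]
lemmas lev_1' [simp] = lev_1[OF f]
lemmas lev_inj' = lev_inj[OF f]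

text \<open>\<open>x\<close> is a track at \<open>w\<close> that has no defect with the injections,
  provided \<open>t k\<close> is the track at \<open>w\<close> composed with injection k. The tracks
  at the injections are taken to be identities and therefore do not appear.\<close>

definition is_ext where
  "is_ext w p t x \<longleftrightarrow> x \<in> Trk A \<and> Src A x = f \<cdot> PArr \<phi> w \<and> Trg A x = PArr \<psi> w \<cdot> lev f p \<and>
     (\<forall>k<p. t k \<box> Post A f (PComp \<phi> w (ninj n p k))
       = Pre A f (PComp \<psi> w (ninj n p k)) \<box> Pre A (PArr \<phi> (ninj n p k)) x)"

lemma is_ext_cong: "(\<And>k. k < p \<Longrightarrow> t k = t' k) \<Longrightarrow> is_ext w p t x = is_ext w p t' x"
  by (simp add: is_ext_def)

definition ext where "ext w p t = (THE x. is_ext w p t x)"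

lemma ext_unique:
  assumes w: "w \<in> Hom (nil_op n) p 1" and x: "is_ext w p t x" "is_ext w p t y"
  shows "x = y"
proof (rule inj_detect)
  note w' [simp] = HomD[OF w]
  fix k assume k: "k < p"
  have "Pre A f (PComp \<psi> w (ninj n p k)) \<box> Pre A (PArr \<phi> (ninj n p k)) x
      = Pre A f (PComp \<psi> w (ninj n p k)) \<box> Pre A (PArr \<phi> (ninj n p k)) y"
    using x k by (simp add: is_ext_def)
  thus "Pre A (PArr \<phi> (ninj n p k)) x = Pre A (PArr \<phi> (ninj n p k)) y"
    by (rule VComp_left_cancel[rotated 5]) (use x in \<open>simp_all add: is_ext_def lev_inj'\<close>)
qed (use HomD[OF w] x in \<open>simp_all add: is_ext_def\<close>)

text \<open>A homotopy from \<open>hc_lev\<close> is corrected: its errors along the injections are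
  elements of \<open>D\<close>, and \<open>D_extend\<close> provides one element with exactly these
  restrictions.\<close>

lemma ext_exists:
  assumes w: "w \<in> Hom (nil_op n) p 1"
    and t: "\<And>k. k < p \<Longrightarrow> t k \<in> Track A (f \<cdot> PArr \<phi> (w \<cdot>\<^bsub>nil_op n\<^esub> ninj n p k)) (PArr \<psi> (w \<cdot>\<^bsub>nil_op n\<^esub> ninj n p k) \<cdot> f)"
  shows "is_ext w p t (ext w p t)"
proof -
  note w' [simp] = HomD[OF w]
  obtain x where x: "x \<in> Trk A" "Src A x = f \<cdot> PArr \<phi> w" "Trg A x = PArr \<psi> w \<cdot> lev f p"
    by (rule homotopy_class_eqD[OF _ _ hc_lev[OF f w, unfolded hc_def]]) auto
  let ?L = "\<lambda>k. t k \<box> Post A f (PComp \<phi> w (ninj n p k))"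
  let ?R = "\<lambda>x k. Pre A f (PComp \<psi> w (ninj n p k)) \<box> Pre A (PArr \<phi> (ninj n p k)) x"
  have R: "?R x k \<in> Trk A" "D_of (?R x k) = D (PObj \<phi> 1) (PObj \<psi> 1)" for k
    using x by (simp_all add: lev_inj' D_of_def)
  have "\<exists>b. k < p \<longrightarrow> b \<in> carrier (D (PObj \<phi> 1) (PObj \<psi> 1)) \<and> ?L k = tor (?R x k) b" for k
  proof (cases "k < p")
    case True
    obtain b where "b \<in> carrier (D_of (?R x k))" "?L k = tor (?R x k) b"
      by (rule tor_exists[OF R(1), of "?L k" k]) (use t[OF True] x in \<open>simp_all add: mem_Track_iff lev_inj'\<close>)
    thus ?thesis using R(2) by auto
  qed simp
  then obtain b where b: "\<And>k. k < p \<Longrightarrow> b k \<in> carrier (D (PObj \<phi> 1) (PObj \<psi> 1)) \<and> ?L k = tor (?R x k) (b k)"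
    by metis
  obtain d where d: "d \<in> carrier (D (PObj \<phi> p) (PObj \<psi> 1))"
    "\<And>k. k < p \<Longrightarrow> D_pre (PObj \<psi> 1) (PArr \<phi> (ninj n p k)) d = b k"
    using F.D_extend[of "PObj \<psi> 1" p b] b by auto
  have dx: "d \<in> carrier (D_of x)" using d x by (simp add: D_of_def)
  have "?R (tor x d) k = ?L k" if k: "k < p" for k
  proof -
    have "Pre A (PArr \<phi> (ninj n p k)) (tor x d) = tor (Pre A (PArr \<phi> (ninj n p k)) x) (b k)"
      using Pre_tor[OF x(1), of "PArr \<phi> (ninj n p k)" d] x dx d(2)[OF k] by simp
    hence "?R (tor x d) k = Pre A f (PComp \<psi> w (ninj n p k)) \<box> tor (Pre A (PArr \<phi> (ninj n p k)) x) (b k)"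
      by simp
    also have "\<dots> = tor (?R x k) (b k)"
      by (rule VComp_tor) (use b[OF k] x in \<open>simp_all add: lev_inj' D_of_def\<close>)
    finally show ?thesis using b[OF k] by simp
  qed
  hence ex: "is_ext w p t (tor x d)" using x dx by (simp add: is_ext_def)
  show ?thesis unfolding ext_def
    by (rule theI[of "is_ext w p t", OF ex]) (rule ext_unique[OF w _ ex])
qed

section \<open>Tracks at tuples, coordinate by coordinate\<close>

definition is_tup where
  "is_tup p q w t u \<longleftrightarrow> u \<in> Trk A \<and> Src A u = lev f q \<cdot> PArr \<phi> w \<and> Trg A u = PArr \<psi> w \<cdot> lev f p \<and>
     (\<forall>k<q. Post A (PArr \<psi> (pr n q k)) u = t k)"

definition tupT where "tupT p q w t = (THE u. is_tup p q w t u)"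

lemma PArr_pr_Comp:
  assumes "w \<in> Hom (nil_op n) p q" "k < q"
  shows "PArr \<phi> (pr n q k) \<cdot> PArr \<phi> w = PArr \<phi> (pr n q k \<cdot>\<^bsub>nil_op n\<^esub> w)"
    "PArr \<psi> (pr n q k) \<cdot> PArr \<psi> w = PArr \<psi> (pr n q k \<cdot>\<^bsub>nil_op n\<^esub> w)"
  using F.strict_left_simps(2)[OF F.strict_left_pr[OF assms(2)], of w]
    G.strict_left_simps(2)[OF G.strict_left_pr[OF assms(2)], of w] assms HomD[OF assms(1)] by simp_all

lemma lev_pr_Comp:
  assumes "w \<in> Hom (nil_op n) p q" "k < q"
  shows "PArr \<psi> (pr n q k) \<cdot> (lev f q \<cdot> PArr \<phi> w) = f \<cdot> PArr \<phi> (pr n q k \<cdot>\<^bsub>nil_op n\<^esub> w)"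
proof -
  note w' [simp] = HomD[OF assms(1)]
  have "PArr \<psi> (pr n q k) \<cdot> (lev f q \<cdot> PArr \<phi> w) = (PArr \<psi> (pr n q k) \<cdot> lev f q) \<cdot> PArr \<phi> w"
    using assms(2) by simp
  also have "\<dots> = f \<cdot> PArr \<phi> (pr n q k \<cdot>\<^bsub>nil_op n\<^esub> w)"
    unfolding lev_pr[OF f assms(2)] using assms(2) PArr_pr_Comp(1)[OF assms] by simp
  finally show ?thesis .
qed

lemma PArr_pr_lev:
  assumes "w \<in> Hom (nil_op n) p q" "k < q"
  shows "PArr \<psi> (pr n q k) \<cdot> (PArr \<psi> w \<cdot> lev f p) = PArr \<psi> (pr n q k \<cdot>\<^bsub>nil_op n\<^esub> w) \<cdot> lev f p"
  using HomD[OF assms(1)] assms(2) by (simp flip: PArr_pr_Comp(2)[OF assms])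

lemma tup_unique:
  assumes w: "w \<in> Hom (nil_op n) p q" and x: "is_tup p q w t x" "is_tup p q w t y"
  shows "x = y"
  by (rule G.joint_trk_eqI[of _ "PObj \<phi> p" q])
    (use x HomD[OF w] in \<open>simp_all add: is_tup_def HomTrk_def mem_Hom_iff\<close>)

lemma tupT:
  assumes w: "w \<in> Hom (nil_op n) p q"
    and t: "\<And>k. k < q \<Longrightarrow> t k \<in> Track A (f \<cdot> PArr \<phi> (pr n q k \<cdot>\<^bsub>nil_op n\<^esub> w)) (PArr \<psi> (pr n q k \<cdot>\<^bsub>nil_op n\<^esub> w) \<cdot> lev f p)"
  shows "is_tup p q w t (tupT p q w t)"
proof -
  note w' [simp] = HomD[OF w]
  have "\<exists>u\<in>HomTrk A (PObj \<phi> p) (PObj \<psi> q). \<forall>k<q. Post A (PArr \<psi> (pr n q k)) u = t k"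
    by (rule G.joint_trk_exists) (use t in \<open>auto simp: HomTrk_def mem_Hom_iff mem_Track_iff\<close>)
  then obtain u where u: "u \<in> HomTrk A (PObj \<phi> p) (PObj \<psi> q)" "\<And>k. k < q \<Longrightarrow> Post A (PArr \<psi> (pr n q k)) u = t k"
    by blast
  have u' [simp]: "u \<in> Trk A" "Dom A (Src A u) = PObj \<phi> p" "Cod A (Src A u) = PObj \<psi> q"
    using u(1) by (auto simp: HomTrk_def mem_Hom_iff)
  have "Src A u = lev f q \<cdot> PArr \<phi> w"
  proof (rule G.joint_eqI)
    fix k assume k: "k < q"
    have "PArr \<psi> (pr n q k) \<cdot> Src A u = Src A (t k)" using k by (simp flip: u(2)[OF k])
    thus "PArr \<psi> (pr n q k) \<cdot> Src A u = PArr \<psi> (pr n q k) \<cdot> (lev f q \<cdot> PArr \<phi> w)"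
      using t[OF k] lev_pr_Comp[OF w k] by (simp add: mem_Track_iff)
  qed (auto simp: mem_Hom_iff)
  moreover have "Trg A u = PArr \<psi> w \<cdot> lev f p"
  proof (rule G.joint_eqI)
    fix k assume k: "k < q"
    have "PArr \<psi> (pr n q k) \<cdot> Trg A u = Trg A (t k)" using k by (simp flip: u(2)[OF k])
    thus "PArr \<psi> (pr n q k) \<cdot> Trg A u = PArr \<psi> (pr n q k) \<cdot> (PArr \<psi> w \<cdot> lev f p)"
      using t[OF k] PArr_pr_lev[OF w k] by (simp add: mem_Track_iff)
  qed (auto simp: mem_Hom_iff)
  ultimately have ex: "is_tup p q w t u" using u(2) by (simp add: is_tup_def)
  show ?thesis unfolding tupT_def
    by (rule theI[of "is_tup p q w t", OF ex]) (rule tup_unique[OF w _ ex])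
qed

text \<open>The track at the multiplication. Both composites of \<open>mu\<close> with injections
  are the identity of 1, so identity tracks are prescribed there.\<close>

definition am where "am = ext (mu n) 2 (\<lambda>k. IdT A f)"

lemma am: "is_ext (mu n) 2 (\<lambda>k. IdT A f) am"
  unfolding am_def by (rule ext_exists[OF mu_Hom]) (simp add: mu_ninj mem_Track_iff)

lemma am_simps [simp]: "am \<in> Trk A" "Src A am = f \<cdot> PArr \<phi> (mu n)" "Trg A am = PArr \<psi> (mu n) \<cdot> lev f 2"
  using am by (simp_all add: is_ext_def)

section \<open>Tracks at the integers by recursion\<close>

abbreviation "I \<equiv> Ident (nil_op n) 1"
abbreviation "ze e \<equiv> pairn n 1 (zpow n e) I"

lemma I_Hom: "I \<in> Hom (nil_op n) 1 1" by (rule nil_op.Ident_Hom) simp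

lemma ze_Hom: "ze e \<in> Hom (nil_op n) 1 2"
  by (rule pairn_Hom[OF zpow_Hom I_Hom])

lemmas ze_simps [simp] = HomD[OF ze_Hom]
lemmas zpow_simps [simp] = HomD[OF zpow_Hom]

lemma mu_ze: "mu n \<cdot>\<^bsub>nil_op n\<^esub> ze e = zpow n (e + 1)"
  using mu_zpow[OF ze_Hom, of e e 1] pr_pairn[OF zpow_Hom I_Hom, of e] by (simp add: zpow_1)

text \<open>The track at the pair (e, 1) when \<open>x\<close> is the track at e and the track at 1
  is the identity.\<close>

definition pt where "pt e x = tupT 1 2 (ze e) (\<lambda>k. if k = 0 then x else IdT A f)"

definition Pz where "Pz e x \<longleftrightarrow> x \<in> Trk A \<and> Src A x = f \<cdot> PArr \<phi> (zpow n e) \<and> Trg A x = PArr \<psi> (zpow n e) \<cdot> f"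

lemma pt:
  assumes "Pz e x" shows "is_tup 1 2 (ze e) (\<lambda>k. if k = 0 then x else IdT A f) (pt e x)"
  unfolding pt_def
proof (rule tupT[OF ze_Hom])
  fix k :: nat assume "k < 2"
  then consider "k = 0" | "k = 1" by linarith
  thus "(if k = 0 then x else IdT A f) \<in> Track A (f \<cdot> PArr \<phi> (pr n 2 k \<cdot>\<^bsub>nil_op n\<^esub> ze e)) (PArr \<psi> (pr n 2 k \<cdot>\<^bsub>nil_op n\<^esub> ze e) \<cdot> lev f 1)"
    by cases (use assms pr_pairn[OF zpow_Hom I_Hom] in \<open>simp_all add: Pz_def mem_Track_iff\<close>)
qed

lemma pt_simps:
  assumes "Pz e x"
  shows "pt e x \<in> Trk A" "Src A (pt e x) = lev f 2 \<cdot> PArr \<phi> (ze e)" "Trg A (pt e x) = PArr \<psi> (ze e) \<cdot> f"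
    "Post A (PArr \<psi> (pr n 2 0)) (pt e x) = x" "Post A (PArr \<psi> (pr n 2 1)) (pt e x) = IdT A f"
  using pt[OF assms] by (simp_all add: is_tup_def)

text \<open>The right side of the composition axiom for \<open>mu\<close> and the pair (e, 1), with
  \<open>x\<close> as track at e. The relation \<open>Qz\<close> then says that \<open>y\<close> at
  e + 1 makes the defect vanish.\<close>

definition srhs where
  "srhs e x = Pre A f (PComp \<psi> (mu n) (ze e)) \<box> (Post A (PArr \<psi> (mu n)) (pt e x) \<box> Pre A (PArr \<phi> (ze e)) am)"

lemma srhs_simps:
  assumes "Pz e x"
  shows "srhs e x \<in> Trk A" "Src A (srhs e x) = f \<cdot> (PArr \<phi> (mu n) \<cdot> PArr \<phi> (ze e))"
    "Trg A (srhs e x) = PArr \<psi> (zpow n (e + 1)) \<cdot> f"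
  using pt_simps[OF assms] by (simp_all add: srhs_def mu_ze)

definition Qz where "Qz e x y \<longleftrightarrow> y \<box> Post A f (PComp \<phi> (mu n) (ze e)) = srhs e x"

lemma Qz_up:
  assumes "Pz e x" shows "\<exists>y. Pz (e + 1) y \<and> Qz e x y"
proof -
  let ?y = "srhs e x \<box> InvT A (Post A f (PComp \<phi> (mu n) (ze e)))"
  have "Pz (e + 1) ?y" using srhs_simps[OF assms] by (simp add: Pz_def mu_ze)
  moreover have "Qz e x ?y" using srhs_simps[OF assms] by (simp add: Qz_def mu_ze)
  ultimately show ?thesis by blast
qed

text \<open>Changing \<open>x\<close> by \<open>d\<close> changes the first coordinate of the track
  at (e, 1) by \<open>d\<close> and leaves the second alone; \<open>mu\<close> adds the coordinates,
  so the result changes by \<open>d\<close> as well.\<close>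

lemma Qz_tor:
  assumes x: "Pz e x" and y: "Pz (e + 1) y" and Q: "Qz e x y" and d: "d \<in> carrier (D (PObj \<phi> 1) (PObj \<psi> 1))"
  shows "Qz e (tor x d) (tor y d)"
proof -
  interpret comm_group "D (PObj \<phi> 1) (PObj \<psi> 1)" by (rule D_group) auto
  have dx: "d \<in> carrier (D_of x)" "d \<in> carrier (D_of y)" using x y d by (simp_all add: Pz_def D_of_def)
  have xt: "Pz e (tor x d)" using x dx by (simp add: Pz_def)
  note px [simp] = pt_simps[OF x] and py [simp] = pt_simps[OF xt]
  \<comment> \<open>The change of the track at the pair, still unknown; its two projections are
    computed below.\<close>
  obtain c where c: "c \<in> carrier (D_of (pt e x))" "pt e (tor x d) = tor (pt e x) c"
    by (rule tor_exists[OF px(1) py(1)]) auto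
  have c': "c \<in> carrier (D (PObj \<phi> 1) (PObj \<psi> 2))" using c(1) by (simp add: D_of_def)
  have pc: "Post A (PArr \<psi> g) (pt e (tor x d)) = tor (Post A (PArr \<psi> g) (pt e x)) (D_post (PObj \<phi> 1) (PArr \<psi> g) c)"
    if "g \<in> Hom (nil_op n) 2 1" for g
    unfolding c(2) using Post_tor[OF px(1), of "PArr \<psi> g" c] c(1) HomD[OF that] by simp
  have xTrk: "x \<in> Trk A" using x by (simp add: Pz_def)
  have "tor x d = tor x (D_post (PObj \<phi> 1) (PArr \<psi> (pr n 2 0)) c)"
    using pc[OF pr_Hom[of 0 2 n]] by (simp only: px py)
  hence c0: "D_post (PObj \<phi> 1) (PArr \<psi> (pr n 2 0)) c = d"
    using tor_inj[OF xTrk, of d "D_post (PObj \<phi> 1) (PArr \<psi> (pr n 2 0)) c"] dx c' x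
    by (simp add: Pz_def D_of_def)
  have IT: "IdT A f \<in> Trk A" "D_of (IdT A f) = D (PObj \<phi> 1) (PObj \<psi> 1)" by (simp_all add: D_of_def)
  have "tor (IdT A f) \<one>\<^bsub>D (PObj \<phi> 1) (PObj \<psi> 1)\<^esub> = tor (IdT A f) (D_post (PObj \<phi> 1) (PArr \<psi> (pr n 2 1)) c)"
    using pc[OF pr_Hom[of 1 2 n]] tor_one[OF IT(1)] IT(2) by simp
  hence c1: "D_post (PObj \<phi> 1) (PArr \<psi> (pr n 2 1)) c = \<one>\<^bsub>D (PObj \<phi> 1) (PObj \<psi> 1)\<^esub>"
    using tor_inj[OF IT(1), of "\<one>\<^bsub>D (PObj \<phi> 1) (PObj \<psi> 1)\<^esub>" "D_post (PObj \<phi> 1) (PArr \<psi> (pr n 2 1)) c"] c' IT(2) by simp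
  have cm: "D_post (PObj \<phi> 1) (PArr \<psi> (mu n)) c = d"
    using G.D_post_mu[OF F.PObj_simp c'] c0 c1 d by simp
  have "srhs e (tor x d) = Pre A f (PComp \<psi> (mu n) (ze e)) \<box> (tor (Post A (PArr \<psi> (mu n)) (pt e x)) d \<box> Pre A (PArr \<phi> (ze e)) am)"
    unfolding srhs_def pc[OF mu_Hom] cm ..
  also have "tor (Post A (PArr \<psi> (mu n)) (pt e x)) d \<box> Pre A (PArr \<phi> (ze e)) am
    = tor (Post A (PArr \<psi> (mu n)) (pt e x) \<box> Pre A (PArr \<phi> (ze e)) am) d"
    by (rule tor_VComp) (use d in \<open>simp_all add: D_of_def\<close>)
  also have "Pre A f (PComp \<psi> (mu n) (ze e)) \<box> \<dots> = tor (srhs e x) d"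
    unfolding srhs_def by (rule VComp_tor) (use d in \<open>simp_all add: D_of_def\<close>)
  also have "\<dots> = tor (y \<box> Post A f (PComp \<phi> (mu n) (ze e))) d" using Q by (simp add: Qz_def)
  also have "\<dots> = tor y d \<box> Post A f (PComp \<phi> (mu n) (ze e))"
    by (rule tor_VComp[symmetric]) (use d y in \<open>simp_all add: D_of_def Pz_def mu_ze\<close>)
  finally show ?thesis by (simp add: Qz_def)
qed

text \<open>\<open>x\<close> enters only through a pair, so the relation is not solved for it
  directly. An arbitrary track at e is taken instead, and the error it causes at e + 1 is removed by
  acting with the same element at e.\<close>

lemma Qz_down:
  assumes y: "Pz (e + 1) y" shows "\<exists>x. Pz e x \<and> Qz e x y"
proof -
  obtain x0 where "x0 \<in> Trk A" "Src A x0 = f \<cdot> PArr \<phi> (zpow n e)" "Trg A x0 = PArr \<psi> (zpow n e) \<cdot> lev f 1"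
    by (rule homotopy_class_eqD[OF _ _ hc_lev[OF f zpow_Hom, unfolded hc_def]]) auto
  hence x0: "Pz e x0" by (simp add: Pz_def)
  then obtain y0 where y0: "Pz (e + 1) y0" "Qz e x0 y0" using Qz_up by blast
  obtain d where d: "d \<in> carrier (D_of y0)" "y = tor y0 d"
    by (rule tor_exists[of y0 y]) (use y y0 in \<open>simp_all add: Pz_def\<close>)
  have d': "d \<in> carrier (D (PObj \<phi> 1) (PObj \<psi> 1))" using d y0 by (simp add: Pz_def D_of_def)
  have "Pz e (tor x0 d)" using x0 d' by (simp add: Pz_def D_of_def)
  thus ?thesis using Qz_tor[OF x0 y0 d'] d(2) by blast
qed

text \<open>For e = 0 the pair is the injection with index 1, along which \<open>am\<close> was
  normalized to the identity. The track of the pair is itself an identity, so nothing else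
  contributes.\<close>

lemma Qz_0:
  assumes "Qz 0 (IdT A (zA (PObj \<phi> 1) (PObj \<psi> 1))) y" "Pz 1 y" shows "y = IdT A f"
proof -
  let ?z = "IdT A (zA (PObj \<phi> 1) (PObj \<psi> 1))"
  have P: "Pz 0 ?z" by (simp add: Pz_def zpow_0)
  have ze: "ze 0 = ninj n 2 1" by (simp add: zpow_0 ninj_2)
  have tupid: "is_tup 1 2 (ze 0) (\<lambda>k. if k = 0 then ?z else IdT A f) (IdT A (lev f 2 \<cdot> PArr \<phi> (ze 0)))"
    unfolding is_tup_def
  proof (intro conjI allI impI)
    show "Trg A (IdT A (lev f 2 \<cdot> PArr \<phi> (ze 0))) = PArr \<psi> (ze 0) \<cdot> lev f 1"
      using lev_inj'[of 2 1] by (simp add: ze)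
    fix k :: nat assume k: "k < 2"
    then consider "k = 0" | "k = 1" by linarith
    hence "pr n 2 k \<cdot>\<^bsub>nil_op n\<^esub> ze 0 = (if k = 0 then nz n 1 1 else I)"
      by cases (use pr_pairn[OF zpow_Hom I_Hom, of 0] zpow_0[of n] in simp_all)
    moreover have "Post A (PArr \<psi> (pr n 2 k)) (IdT A (lev f 2 \<cdot> PArr \<phi> (ze 0)))
        = IdT A (f \<cdot> PArr \<phi> (pr n 2 k \<cdot>\<^bsub>nil_op n\<^esub> ze 0))"
      using k by (simp flip: lev_pr_Comp[OF ze_Hom k])
    ultimately show "Post A (PArr \<psi> (pr n 2 k)) (IdT A (lev f 2 \<cdot> PArr \<phi> (ze 0))) = (if k = 0 then ?z else IdT A f)"
      by simp
  qed simp_all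
  have pt0: "pt 0 ?z = IdT A (lev f 2 \<cdot> PArr \<phi> (ze 0))"
    by (rule tup_unique[OF ze_Hom pt[OF P] tupid])
  have l: "PArr \<psi> (mu n) \<cdot> (lev f 2 \<cdot> PArr \<phi> (ninj n 2 1)) = PArr \<psi> (mu n) \<cdot> (PArr \<psi> (ninj n 2 1) \<cdot> f)"
    using lev_inj'[of 2 1] by simp
  have s: "srhs 0 ?z = Pre A f (PComp \<psi> (mu n) (ze 0)) \<box> Pre A (PArr \<phi> (ze 0)) am"
    unfolding srhs_def pt0 by simp
  have "y \<box> Post A f (PComp \<phi> (mu n) (ninj n 2 1)) = IdT A f \<box> Post A f (PComp \<phi> (mu n) (ninj n 2 1))"
    using assms(1)[unfolded Qz_def s] am[unfolded is_ext_def] by (simp add: ze)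
  thus ?thesis
    by (rule VComp_right_cancel[rotated 5]) (use assms(2) in \<open>simp_all add: Pz_def mu_ninj zpow_1\<close>)
qed

lemma zpow_tracks:
  obtains \<tau> where "\<tau> 0 = IdT A (zA (PObj \<phi> 1) (PObj \<psi> 1))" "\<tau> 1 = IdT A f"
    "\<And>e. Pz e (\<tau> e)" "\<And>e. Qz e (\<tau> e) (\<tau> (e + 1))"
proof -
  have P0: "Pz 0 (IdT A (zA (PObj \<phi> 1) (PObj \<psi> 1)))" by (simp add: Pz_def zpow_0)
  obtain \<tau> where t: "\<tau> 0 = IdT A (zA (PObj \<phi> 1) (PObj \<psi> 1))" "\<And>e. Pz e (\<tau> e)" "\<And>e. Qz e (\<tau> e) (\<tau> (e + 1))"
    using int_chain[of Pz, OF P0 Qz_up Qz_down] by blast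
  have "\<tau> 1 = IdT A f" by (rule Qz_0) (use t(1) t(2)[of 1] t(3)[of 0] in simp_all)
  thus ?thesis using t that by blast
qed

text \<open>The tracks come in three layers: integers, operations of p variables by extension along
  the injections, and tuples by coordinates. Most of the work is to see that the layers agree where
  they overlap and respect the normalizations.\<close>

lemma family_exists: "\<exists>a. normal_family A n \<phi> \<psi> HG D Dmap \<sigma> (lev f) a"
proof -
  obtain \<tau> where t: "\<tau> 0 = IdT A (zA (PObj \<phi> 1) (PObj \<psi> 1))" "\<tau> 1 = IdT A f"
    "\<And>e. Pz e (\<tau> e)" "\<And>e. Qz e (\<tau> e) (\<tau> (e + 1))" using zpow_tracks by blast
  \<comment> \<open>An endomorphism of 1 is an integer by \<open>zpow_bij\<close>; \<open>ix\<close>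
    looks up its track.\<close>
  define ix where "ix w = \<tau> (inv_into UNIV (zpow n) w)" for w
  have zinj: "inj (zpow n)" using zpow_bij[OF n1] by (simp add: bij_betw_def)
  have ix: "ix (zpow n e) = \<tau> e" for e unfolding ix_def using zinj by simp
  have ixI: "ix I = IdT A f" using ix[of 1] t(2) by (simp add: zpow_1)
  have ixz: "ix (nz n 1 1) = IdT A (zA (PObj \<phi> 1) (PObj \<psi> 1))" using ix[of 0] t(1) by (simp add: zpow_0)
  have ixT: "ix w \<in> Track A (f \<cdot> PArr \<phi> w) (PArr \<psi> w \<cdot> f)" if w: "w \<in> Hom (nil_op n) 1 1" for w
  proof -
    obtain e where "w = zpow n e" using w zpow_bij[OF n1] by (auto simp: bij_betw_def)
    thus ?thesis using t(3)[of e] ix by (simp add: Pz_def mem_Track_iff)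
  qed
  define b where "b p w = ext w p (\<lambda>k. ix (w \<cdot>\<^bsub>nil_op n\<^esub> ninj n p k))" for p w
  have b: "is_ext w p (\<lambda>k. ix (w \<cdot>\<^bsub>nil_op n\<^esub> ninj n p k)) (b p w)" if w: "w \<in> Hom (nil_op n) p 1" for p w
    unfolding b_def by (rule ext_exists[OF w]) (rule ixT[OF nil_op.Comp_Hom[OF ninj_Hom w]])
  have bT: "b p w \<in> Track A (f \<cdot> PArr \<phi> w) (PArr \<psi> w \<cdot> lev f p)" if w: "w \<in> Hom (nil_op n) p 1" for p w
    using b[OF w] by (simp add: is_ext_def mem_Track_iff)
  \<comment> \<open>With one variable the only injection is the identity, so extension returns the
    integer track.\<close>
  have b1: "b 1 w = ix w" if w: "w \<in> Hom (nil_op n) 1 1" for w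
  proof (rule ext_unique[OF w b[OF w]])
    have "ninj n 1 0 = I"
      using pr_ninj[of 0 1 n 0] pr_1_0[of n] nil_op.Ident_Comp[OF ninj_Hom, of n 1 0] by simp
    thus "is_ext w 1 (\<lambda>k. ix (w \<cdot>\<^bsub>nil_op n\<^esub> ninj n 1 k)) (ix w)"
      using ixT[OF w] HomD[OF w]
      by (simp add: is_ext_def mem_Track_iff F.PComp_Ident_right[OF w] G.PComp_Ident_right[OF w])
  qed
  have bpr: "b p (pr n p j) = IdT A (f \<cdot> PArr \<phi> (pr n p j))" if j: "j < p" for p j
  proof (rule ext_unique[OF pr_Hom[OF j] b[OF pr_Hom[OF j]]])
    have e: "PComp \<phi> (pr n p j) (ninj n p k) = IdT A (PArr \<phi> (pr n p j) \<cdot> PArr \<phi> (ninj n p k))"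
      "PComp \<psi> (pr n p j) (ninj n p k) = IdT A (PArr \<psi> (pr n p j) \<cdot> PArr \<psi> (ninj n p k))" for k
      using F.strict_left_simps(1)[OF F.strict_left_pr[OF j], of "ninj n p k"]
        G.strict_left_simps(1)[OF G.strict_left_pr[OF j], of "ninj n p k"] j by simp_all
    show "is_ext (pr n p j) p (\<lambda>k. ix (pr n p j \<cdot>\<^bsub>nil_op n\<^esub> ninj n p k)) (IdT A (f \<cdot> PArr \<phi> (pr n p j)))"
      using j PArr_pr_inj[OF f j] by (auto simp: is_ext_def e lev_pr[OF f] pr_ninj ixI ixz)
  qed
  have bnz: "b p (nz n p 1) = IdT A (zA (PObj \<phi> p) (PObj \<psi> 1))" for p
  proof (rule ext_unique[OF nz_Hom b[OF nz_Hom]])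
    show "is_ext (nz n p 1) p (\<lambda>k. ix (nz n p 1 \<cdot>\<^bsub>nil_op n\<^esub> ninj n p k)) (IdT A (zA (PObj \<phi> p) (PObj \<psi> 1)))"
      by (simp add: is_ext_def nz_comp[OF ninj_Hom] ixz F.pp_zero_PComp[OF ninj_Hom] G.pp_zero_PComp[OF ninj_Hom])
  qed
  have bmu: "b 2 (mu n) = am"
  proof (rule ext_unique[OF mu_Hom b[OF mu_Hom]])
    show "is_ext (mu n) 2 (\<lambda>k. ix (mu n \<cdot>\<^bsub>nil_op n\<^esub> ninj n 2 k)) am"
      using am is_ext_cong[of 2 "\<lambda>k. ix (mu n \<cdot>\<^bsub>nil_op n\<^esub> ninj n 2 k)" "\<lambda>k. IdT A f" "mu n" am]
      by (simp add: mu_ninj ixI)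
  qed
  define a where "a w = tupT (Dom (nil_op n) w) (Cod (nil_op n) w) w
    (\<lambda>k. b (Dom (nil_op n) w) (pr n (Cod (nil_op n) w) k \<cdot>\<^bsub>nil_op n\<^esub> w))" for w
  have a: "is_tup p q w (\<lambda>k. b p (pr n q k \<cdot>\<^bsub>nil_op n\<^esub> w)) (a w)" if w: "w \<in> Hom (nil_op n) p q" for w p q
    unfolding a_def HomD[OF w] by (rule tupT[OF w]) (rule bT[OF nil_op.Comp_Hom[OF w pr_Hom]])
  have ab: "a w = b p w" if w: "w \<in> Hom (nil_op n) p 1" for w p
  proof (rule tup_unique[OF w a[OF w]])
    show "is_tup p 1 w (\<lambda>k. b p (pr n 1 k \<cdot>\<^bsub>nil_op n\<^esub> w)) (b p w)"
      using bT[OF w] HomD[OF w] by (simp add: is_tup_def mem_Track_iff pr_1_0)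
  qed
  interpret track_family A n \<phi> \<psi> HG D Dmap \<sigma> "lev f" a
  proof
    fix w assume "w \<in> Arr (nil_op n)"
    hence "w \<in> Hom (nil_op n) (Dom (nil_op n) w) (Cod (nil_op n) w)" by (simp add: mem_Hom_iff)
    from a[OF this] show "a w \<in> Trk A" "Src A (a w) = lev f (Cod (nil_op n) w) \<cdot> PArr \<phi> w"
      "Trg A (a w) = PArr \<psi> w \<cdot> lev f (Dom (nil_op n) w)" by (simp_all add: is_tup_def)
  qed simp_all
  \<comment> \<open>The tracks at injections are identities, as \<open>is_ext\<close>
    presupposed.\<close>
  have ai: "a (ninj n p k) = IdT A (lev f p \<cdot> PArr \<phi> (ninj n p k))" for p k
  proof (rule tup_unique[OF ninj_Hom a[OF ninj_Hom]])
    show "is_tup 1 p (ninj n p k) (\<lambda>j. b 1 (pr n p j \<cdot>\<^bsub>nil_op n\<^esub> ninj n p k)) (IdT A (lev f p \<cdot> PArr \<phi> (ninj n p k)))"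
      using lev_inj'[of p k] lev_pr_Comp[OF ninj_Hom, of _ p k] b1[OF I_Hom] b1[OF nz_Hom] ixI ixz
      by (auto simp: is_tup_def pr_ninj)
  qed
  have "normal_family A n \<phi> \<psi> HG D Dmap \<sigma> (lev f) a"
  proof
    show "1 \<le> n" by (rule n1)
    show "PArr \<psi> (pr n p k) \<cdot> lev f p = lev f 1 \<cdot> PArr \<phi> (pr n p k)" if "k < p" for k p
      using lev_pr[OF f that] by simp
    show "Post A (PArr \<psi> (pr n q k)) (a w) = a (pr n q k \<cdot>\<^bsub>nil_op n\<^esub> w)" if "w \<in> Hom (nil_op n) p q" "k < q" for w p q k
      using a[OF that(1)] ab[OF nil_op.Comp_Hom[OF that(1) pr_Hom[OF that(2)]]] that(2) by (simp add: is_tup_def)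
    show "a (pr n p k) = IdT A (lev f 1 \<cdot> PArr \<phi> (pr n p k))" if "k < p" for k p
      using ab[OF pr_Hom[OF that]] bpr[OF that] by simp
    show "a (nz n p 1) = IdT A (zA (PObj \<phi> p) (PObj \<psi> 1))" for p using ab[OF nz_Hom] bnz by simp
    show "lhs v (ninj n p k) = rhs v (ninj n p k)" if v: "v \<in> Hom (nil_op n) p 1" and k: "k < p" for v p k
    proof -
      note vi = nil_op.Comp_Hom[OF ninj_Hom v]
      show ?thesis unfolding lhs_def rhs_def
        using ab[OF v] ab[OF vi] b1[OF vi] b[OF v] k HomD[OF v] lev_inj'[of p k] by (simp add: ai is_ext_def)
    qed
    show "lhs (mu n) (ze e) = rhs (mu n) (ze e)" for e
    proof -
      \<comment> \<open>With this identification the composition axiom at \<open>mu\<close> and (e,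
        1) is literally the relation \<open>Qz\<close> between consecutive integers.\<close>
      have "a (ze e) = pt e (\<tau> e)"
      proof (rule tup_unique[OF ze_Hom a[OF ze_Hom]])
        have "b 1 (pr n 2 k \<cdot>\<^bsub>nil_op n\<^esub> ze e) = (if k = 0 then \<tau> e else IdT A f)" if k: "k < 2" for k
        proof -
          consider "k = 0" | "k = 1" using k by linarith
          thus ?thesis
            by cases (simp_all add: pr_pairn[OF zpow_Hom I_Hom] b1[OF zpow_Hom] b1[OF I_Hom] ix ixI)
        qed
        thus "is_tup 1 2 (ze e) (\<lambda>k. b 1 (pr n 2 k \<cdot>\<^bsub>nil_op n\<^esub> ze e)) (pt e (\<tau> e))"
          using pt[OF t(3)[of e]] by (simp add: is_tup_def)
      qed
      thus ?thesis unfolding lhs_def rhs_def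
        using t(4)[of e] ab[OF mu_Hom] ab[OF zpow_Hom] b1[OF zpow_Hom] ix
        by (simp add: Qz_def srhs_def mu_ze bmu)
    qed
  qed
  thus ?thesis by blast
qed

end

section \<open>Uniqueness of coherent families\<close>

context pp_pair
begin

text \<open>The data of a product preserving transformation between fixed pseudofunctors, with
  \<open>pi_map\<close> replaced by the images of the two projections so that coordinates can be
  used; \<open>pseudonat_iff\<close> translates.\<close>

definition coh where
  "coh l a \<longleftrightarrow> (\<forall>p. l p \<in> Hom A (PObj \<phi> p) (PObj \<psi> p)) \<and>
     (\<forall>w \<in> Arr (nil_op n). a w \<in> Track A (l (Cod (nil_op n) w) \<cdot> PArr \<phi> w) (PArr \<psi> w \<cdot> l (Dom (nil_op n) w))) \<and>
     (\<forall>p q. PArr \<psi> (nil_pr1 n p q) \<cdot> l (p + q) = l p \<cdot> PArr \<phi> (nil_pr1 n p q) \<and>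
            PArr \<psi> (nil_pr2 n p q) \<cdot> l (p + q) = l q \<cdot> PArr \<phi> (nil_pr2 n p q)) \<and>
     (\<forall>p q r. \<forall>w \<in> Hom (nil_op n) r (p + q).
        Post A (PArr \<psi> (nil_pr1 n p q)) (a w) = a (nil_pr1 n p q \<cdot>\<^bsub>nil_op n\<^esub> w) \<and>
        Post A (PArr \<psi> (nil_pr2 n p q)) (a w) = a (nil_pr2 n p q \<cdot>\<^bsub>nil_op n\<^esub> w)) \<and>
     (\<forall>g \<in> Arr (nil_op n). \<forall>w \<in> Arr (nil_op n). Dom (nil_op n) g = Cod (nil_op n) w \<longrightarrow>
        a (g \<cdot>\<^bsub>nil_op n\<^esub> w) \<box> Post A (l (Cod (nil_op n) g)) (PComp \<phi> g w)
        = Pre A (l (Dom (nil_op n) w)) (PComp \<psi> g w) \<box> (Post A (PArr \<psi> g) (a w) \<box> Pre A (PArr \<phi> w) (a g)))"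

context
  fixes l a assumes coh: "coh l a"
begin

lemma coh_l: "l p \<in> Arr A" "Dom A (l p) = PObj \<phi> p" "Cod A (l p) = PObj \<psi> p"
  using coh unfolding coh_def mem_Hom_iff by blast+

lemma coh_a:
  assumes "w \<in> Arr (nil_op n)"
  shows "a w \<in> Trk A" "Src A (a w) = l (Cod (nil_op n) w) \<cdot> PArr \<phi> w" "Trg A (a w) = PArr \<psi> w \<cdot> l (Dom (nil_op n) w)"
  using coh assms unfolding coh_def mem_Track_iff by blast+

lemma coh_l_pr12:
  "PArr \<psi> (nil_pr1 n p q) \<cdot> l (p + q) = l p \<cdot> PArr \<phi> (nil_pr1 n p q)"
  "PArr \<psi> (nil_pr2 n p q) \<cdot> l (p + q) = l q \<cdot> PArr \<phi> (nil_pr2 n p q)"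
  using coh unfolding coh_def by blast+

lemma coh_a_pr12:
  assumes "w \<in> Hom (nil_op n) r (p + q)"
  shows "Post A (PArr \<psi> (nil_pr1 n p q)) (a w) = a (nil_pr1 n p q \<cdot>\<^bsub>nil_op n\<^esub> w)"
    "Post A (PArr \<psi> (nil_pr2 n p q)) (a w) = a (nil_pr2 n p q \<cdot>\<^bsub>nil_op n\<^esub> w)"
  using coh assms unfolding coh_def by blast+

lemma coh_comp:
  assumes "g \<in> Arr (nil_op n)" "w \<in> Arr (nil_op n)" "Dom (nil_op n) g = Cod (nil_op n) w"
  shows "a (g \<cdot>\<^bsub>nil_op n\<^esub> w) \<box> Post A (l (Cod (nil_op n) g)) (PComp \<phi> g w)
    = Pre A (l (Dom (nil_op n) w)) (PComp \<psi> g w) \<box> (Post A (PArr \<psi> g) (a w) \<box> Pre A (PArr \<phi> w) (a g))"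
  using coh assms unfolding coh_def by blast

lemma coh_f: "l 1 \<in> Hom A (PObj \<phi> 1) (PObj \<psi> 1)"
  using coh_l by (simp add: mem_Hom_iff)

lemma coh_l_pr: "k < p \<Longrightarrow> PArr \<psi> (pr n p k) \<cdot> l p = l 1 \<cdot> PArr \<phi> (pr n p k)"
proof (induction p)
  case (Suc p)
  show ?case
  proof (cases "k = p")
    case True
    thus ?thesis using coh_l_pr12(2)[of p 1] F.pr_Suc_self[of p] by (simp add: Suc_eq_plus1)
  next
    case False
    hence k: "k < p" using Suc.prems by simp
    note [simp] = coh_l
    have "PArr \<psi> (pr n (Suc p) k) \<cdot> l (Suc p) = PArr \<psi> (pr n p k) \<cdot> (PArr \<psi> (nil_pr1 n p 1) \<cdot> l (p + 1))"
      using k by (simp add: Suc_eq_plus1 G.PArr_pr1)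
    also have "\<dots> = (PArr \<psi> (pr n p k) \<cdot> l p) \<cdot> PArr \<phi> (nil_pr1 n p 1)"
      unfolding coh_l_pr12 using k by simp
    also have "\<dots> = l 1 \<cdot> PArr \<phi> (pr n (Suc p) k)"
      unfolding Suc.IH[OF k] using k by (simp add: F.PArr_pr_Suc)
    finally show ?thesis .
  qed
qed simp

lemma coh_lev: "l p = lev (l 1) p"
  by (rule lev_unique[OF coh_f]) (simp_all add: mem_Hom_iff coh_l coh_l_pr)

lemma coh_a_pr:
  assumes "w \<in> Hom (nil_op n) p q" "k < q"
  shows "Post A (PArr \<psi> (pr n q k)) (a w) = a (pr n q k \<cdot>\<^bsub>nil_op n\<^esub> w)"
  using assms
proof (induction q arbitrary: w)
  case (Suc q)
  note w = Suc.prems(1)[unfolded Suc_eq_plus1]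
  note [simp] = HomD[OF w] coh_a[OF HomD(1)[OF w]] coh_l
  show ?case
  proof (cases "k = q")
    case True
    thus ?thesis using coh_a_pr12(2)[OF w] F.pr_Suc_self[of q] by simp
  next
    case False
    hence k: "k < q" using Suc.prems by simp
    have "Post A (PArr \<psi> (pr n (Suc q) k)) (a w) = Post A (PArr \<psi> (pr n q k)) (Post A (PArr \<psi> (nil_pr1 n q 1)) (a w))"
      using k by (simp add: G.PArr_pr_Suc)
    also have "\<dots> = a (pr n q k \<cdot>\<^bsub>nil_op n\<^esub> (nil_pr1 n q 1 \<cdot>\<^bsub>nil_op n\<^esub> w))"
      unfolding coh_a_pr12(1)[OF w] by (rule Suc.IH[OF nil_op.Comp_Hom[OF w nil_pr1_Hom] k])
    also have "pr n q k \<cdot>\<^bsub>nil_op n\<^esub> (nil_pr1 n q 1 \<cdot>\<^bsub>nil_op n\<^esub> w) = pr n (Suc q) k \<cdot>\<^bsub>nil_op n\<^esub> w"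
      using nil_op.Comp_assoc[OF w nil_pr1_Hom pr_Hom[OF k]] by (simp add: F.pr_Suc[OF k])
    finally show ?thesis .
  qed
qed simp

text \<open>The composition axiom makes this track idempotent, and an idempotent in a groupoid is an
  identity. The unit axiom in \<open>pseudonat_iff\<close> is obtained from it.\<close>

lemma coh_Ident: "a (Ident (nil_op n) p) = IdT A (l p)"
proof -
  let ?I = "Ident (nil_op n) p"
  note [simp] = coh_l coh_a
  have I: "?I \<in> Hom (nil_op n) p p" by (rule nil_op.Ident_Hom) simp
  have "a ?I = a ?I \<box> a ?I"
    using coh_comp[of ?I ?I] by (simp add: F.PComp_Ident_left[OF I] G.PComp_Ident_left[OF I])
  hence "a ?I \<box> a ?I = IdT A (l p) \<box> a ?I" by simp
  thus ?thesis by (rule VComp_right_cancel[rotated 5]) simp_all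
qed

lemma coh_pr: "k < p \<Longrightarrow> a (pr n p k) = IdT A (l 1 \<cdot> PArr \<phi> (pr n p k))"
  using coh_a_pr[OF nil_op.Ident_Hom[of p n], of k] coh_l by (simp add: coh_Ident coh_l_pr)

end

text \<open>The values of a coherent family on composites are determined by those on the factors, and its
  value on the multiplication by its restrictions along the injections.\<close>

lemma coh_unique:
  assumes c: "coh l a" "coh l' a'" and f: "l 1 = l' 1"
  shows "l = l'" "w \<in> Arr (nil_op n) \<Longrightarrow> a w = a' w"
proof -
  show l: "l = l'" using coh_lev[OF c(1)] coh_lev[OF c(2)] f by (intro ext) metis
  note [simp] = coh_l[OF c(1)] coh_a[OF c(1)] coh_a[OF c(2)[folded l]]
  have step: "a (g \<cdot>\<^bsub>nil_op n\<^esub> v) = a' (g \<cdot>\<^bsub>nil_op n\<^esub> v)"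
    if "g \<in> Arr (nil_op n)" "v \<in> Arr (nil_op n)" "Dom (nil_op n) g = Cod (nil_op n) v" "a g = a' g" "a v = a' v" for g v
    by (rule VComp_right_cancel[of "Post A (l (Cod (nil_op n) g)) (PComp \<phi> g v)"])
      (use coh_comp[OF c(1) that(1-3)] coh_comp[OF c(2) that(1-3), folded l] that in simp_all)
  have joint: "a v = a' v" if v: "v \<in> Hom (nil_op n) p q" and "\<And>k. k < q \<Longrightarrow> a (pr n q k \<cdot>\<^bsub>nil_op n\<^esub> v) = a' (pr n q k \<cdot>\<^bsub>nil_op n\<^esub> v)" for v p q
    by (rule G.joint_trk_eqI[of _ "PObj \<phi> p" q])
      (use that HomD[OF v] in \<open>simp_all add: HomTrk_def mem_Hom_iff coh_a_pr[OF c(1) v] coh_a_pr[OF c(2) v]\<close>)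
  have nz: "a (nz n p q) = a' (nz n p q)" for p q
  proof -
    obtain u v where uv: "u \<in> Hom (nil_op n) p 0" "v \<in> Hom (nil_op n) 0 q" "nz n p q = v \<cdot>\<^bsub>nil_op n\<^esub> u"
      by (rule nz_factors)
    have "a u = a' u" by (rule joint[OF uv(1)]) simp
    \<comment> \<open>The source is the zero object, so there is no injection to check.\<close>
    moreover have "a v = a' v"
      by (rule inj_detect[of _ _ 0]) (simp_all add: HomD[OF uv(2)])
    ultimately show ?thesis unfolding uv(3) by (intro step) (simp_all add: HomD[OF uv(1)] HomD[OF uv(2)])
  qed
  have Ident: "a (Ident (nil_op n) p) = a' (Ident (nil_op n) p)" for p
    using coh_Ident[OF c(1)] coh_Ident[OF c(2)] l by simp
  have inj: "a (ninj n p k) = a' (ninj n p k)" for p k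
    by (rule joint[OF ninj_Hom]) (simp add: pr_ninj nz Ident)
  have mu: "a (mu n) = a' (mu n)"
  proof (rule inj_detect[of _ _ 2])
    fix k :: nat assume k: "k < 2"
    have "Pre A (l 1) (PComp \<psi> (mu n) (ninj n 2 k)) \<box> (Post A (PArr \<psi> (mu n)) (a (ninj n 2 k)) \<box> Pre A (PArr \<phi> (ninj n 2 k)) (a (mu n)))
      = Pre A (l 1) (PComp \<psi> (mu n) (ninj n 2 k)) \<box> (Post A (PArr \<psi> (mu n)) (a (ninj n 2 k)) \<box> Pre A (PArr \<phi> (ninj n 2 k)) (a' (mu n)))"
      using coh_comp[OF c(1), of "mu n" "ninj n 2 k"] coh_comp[OF c(2), of "mu n" "ninj n 2 k", folded l] Ident k
      by (simp add: mu_ninj inj)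
    hence "Post A (PArr \<psi> (mu n)) (a (ninj n 2 k)) \<box> Pre A (PArr \<phi> (ninj n 2 k)) (a (mu n))
      = Post A (PArr \<psi> (mu n)) (a (ninj n 2 k)) \<box> Pre A (PArr \<phi> (ninj n 2 k)) (a' (mu n))"
      by (rule VComp_left_cancel[rotated 5]) simp_all
    thus "Pre A (PArr \<phi> (ninj n 2 k)) (a (mu n)) = Pre A (PArr \<phi> (ninj n 2 k)) (a' (mu n))"
      by (rule VComp_left_cancel[rotated 5]) simp_all
  qed simp_all
  have one: "a v = a' v" if v: "v \<in> Hom (nil_op n) p 1" for v p
    using v
  proof (induction rule: nil_op_induct)
    case zero show ?case by (rule nz)
  next
    case (pr k) thus ?case using coh_pr[OF c(1)] coh_pr[OF c(2)] l by simp
  next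
    case (mult u)
    have "a u = a' u"
    proof (rule joint[OF mult(1)])
      fix k :: nat assume "k < 2"
      then consider "k = 0" | "k = 1" by linarith
      thus "a (pr n 2 k \<cdot>\<^bsub>nil_op n\<^esub> u) = a' (pr n 2 k \<cdot>\<^bsub>nil_op n\<^esub> u)" by cases (use mult in simp_all)
    qed
    thus ?case by (intro step mu) (simp_all add: HomD[OF mult(1)])
  next
    case (inv u)
    note u [simp] = HomD[OF inv(1)]
    interpret DD: comm_group "D (PObj \<phi> p) (PObj \<psi> 1)" by (rule D_group) auto
    \<comment> \<open>The difference \<open>d\<close> of the two families at \<open>u\<close>
      vanishes after the first projection and after \<open>mu\<close>; as \<open>mu\<close> adds
      coordinates it vanishes after the second projection too.\<close>
    obtain d where d: "d \<in> carrier (D_of (a u))" "a' u = tor (a u) d"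
      by (rule tor_exists[of "a u" "a' u"]) simp_all
    have d': "d \<in> carrier (D (PObj \<phi> p) (PObj \<psi> 2))" using d(1) by (simp add: D_of_def)
    have post: "Post A (PArr \<psi> g) (a' u) = tor (Post A (PArr \<psi> g) (a u)) (D_post (PObj \<phi> p) (PArr \<psi> g) d)"
      if "g \<in> Hom (nil_op n) 2 1" for g
      using Post_tor[of "a u" "PArr \<psi> g" d] d HomD[OF that] by simp
    have one: "D_post (PObj \<phi> p) (PArr \<psi> g) d = \<one>\<^bsub>D (PObj \<phi> p) (PObj \<psi> 1)\<^esub>"
      if g: "g \<in> Hom (nil_op n) 2 1" and e: "Post A (PArr \<psi> g) (a u) = Post A (PArr \<psi> g) (a' u)" for g
    proof -
      have T: "Post A (PArr \<psi> g) (a u) \<in> Trk A" "D_of (Post A (PArr \<psi> g) (a u)) = D (PObj \<phi> p) (PObj \<psi> 1)"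
        using HomD[OF g] by (simp_all add: D_of_def)
      have "tor (Post A (PArr \<psi> g) (a u)) (D_post (PObj \<phi> p) (PArr \<psi> g) d)
        = tor (Post A (PArr \<psi> g) (a u)) \<one>\<^bsub>D (PObj \<phi> p) (PObj \<psi> 1)\<^esub>"
        using post[OF g] e tor_one[OF T(1)] T(2) by simp
      thus ?thesis by (rule tor_inj[OF T(1), rotated 2]) (use d' HomD[OF g] T(2) in simp_all)
    qed
    have 0: "D_post (PObj \<phi> p) (PArr \<psi> (pr n 2 0)) d = \<one>\<^bsub>D (PObj \<phi> p) (PObj \<psi> 1)\<^esub>"
      by (rule one[OF pr_Hom]) (use inv(3) in \<open>simp_all add: coh_a_pr[OF c(1) inv(1)] coh_a_pr[OF c(2) inv(1)]\<close>)
    \<comment> \<open>The composite of \<open>mu\<close> and \<open>u\<close> is a zero map, where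
      the families agree, and so they do at \<open>mu\<close>; cancelling all known tracks in the
      composition axiom isolates this equation.\<close>
    have "Post A (PArr \<psi> (mu n)) (a u) = Post A (PArr \<psi> (mu n)) (a' u)"
    proof -
      have nz_u: "a (mu n \<cdot>\<^bsub>nil_op n\<^esub> u) = a' (mu n \<cdot>\<^bsub>nil_op n\<^esub> u)" using inv(2) nz by simp
      have "Pre A (l p) (PComp \<psi> (mu n) u) \<box> (Post A (PArr \<psi> (mu n)) (a u) \<box> Pre A (PArr \<phi> u) (a (mu n)))
        = Pre A (l p) (PComp \<psi> (mu n) u) \<box> (Post A (PArr \<psi> (mu n)) (a' u) \<box> Pre A (PArr \<phi> u) (a (mu n)))"
        using coh_comp[OF c(1), of "mu n" u] coh_comp[OF c(2), of "mu n" u, folded l] nz_u mu by simp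
      hence "Post A (PArr \<psi> (mu n)) (a u) \<box> Pre A (PArr \<phi> u) (a (mu n))
        = Post A (PArr \<psi> (mu n)) (a' u) \<box> Pre A (PArr \<phi> u) (a (mu n))"
        by (rule VComp_left_cancel[rotated 5]) simp_all
      thus ?thesis by (rule VComp_right_cancel[rotated 5]) simp_all
    qed
    from one[OF mu_Hom this] have m: "D_post (PObj \<phi> p) (PArr \<psi> (mu n)) d = \<one>\<^bsub>D (PObj \<phi> p) (PObj \<psi> 1)\<^esub>" .
    have dc: "D_post (PObj \<phi> p) (PArr \<psi> (pr n 2 1)) d \<in> carrier (D (PObj \<phi> p) (PObj \<psi> 1))" using d' by simp
    have 1: "D_post (PObj \<phi> p) (PArr \<psi> (pr n 2 1)) d = \<one>\<^bsub>D (PObj \<phi> p) (PObj \<psi> 1)\<^esub>"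
      using G.D_post_mu[OF F.PObj_simp d'] 0 m dc by simp
    have T: "Post A (PArr \<psi> (pr n 2 1)) (a u) \<in> Trk A" "D_of (Post A (PArr \<psi> (pr n 2 1)) (a u)) = D (PObj \<phi> p) (PObj \<psi> 1)"
      by (simp_all add: D_of_def)
    have "Post A (PArr \<psi> (pr n 2 1)) (a' u) = Post A (PArr \<psi> (pr n 2 1)) (a u)"
      using post[OF pr_Hom[of 1 2 n]] 1 tor_one[OF T(1)] T(2) by simp
    thus ?case using coh_a_pr[OF c(1) inv(1), of 1] coh_a_pr[OF c(2) inv(1), of 1] by simp
  qed
  show "a w = a' w" if w: "w \<in> Arr (nil_op n)"
  proof -
    have wH: "w \<in> Hom (nil_op n) (Dom (nil_op n) w) (Cod (nil_op n) w)" using w by (simp add: mem_Hom_iff)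
    show ?thesis by (rule joint[OF wH]) (rule one[OF nil_op.Comp_Hom[OF wH pr_Hom]])
  qed
qed

text \<open>A normal family satisfies the projection conditions for single coordinates; here they
  are regrouped into the binary ones.\<close>

lemma coh_exists:
  assumes f: "f \<in> Hom A (PObj \<phi> 1) (PObj \<psi> 1)" and n1: "1 \<le> n"
  shows "\<exists>a. coh (lev f) a"
proof -
  interpret M: pp_map A n \<phi> \<psi> HG D Dmap \<sigma> f by unfold_locales (use f n1 in auto)
  obtain a where "normal_family A n \<phi> \<psi> HG D Dmap \<sigma> (lev f) a" using M.family_exists by blast
  then interpret N: normal_family A n \<phi> \<psi> HG D Dmap \<sigma> "lev f" a .
  have "coh (lev f) a" unfolding coh_def
  proof (intro conjI allI ballI impI)
    show "lev f p \<in> Hom A (PObj \<phi> p) (PObj \<psi> p)" for p by (simp add: mem_Hom_iff)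
    show "a w \<in> Track A (lev f (Cod (nil_op n) w) \<cdot> PArr \<phi> w) (PArr \<psi> w \<cdot> lev f (Dom (nil_op n) w))"
      if "w \<in> Arr (nil_op n)" for w using that by (simp add: mem_Track_iff)
    fix p q
    show "PArr \<psi> (nil_pr1 n p q) \<cdot> lev f (p + q) = lev f p \<cdot> PArr \<phi> (nil_pr1 n p q)" by (rule lev_pr1[OF f])
    show "PArr \<psi> (nil_pr2 n p q) \<cdot> lev f (p + q) = lev f q \<cdot> PArr \<phi> (nil_pr2 n p q)" by (rule lev_pr2[OF f])
    fix r w assume w: "w \<in> Hom (nil_op n) r (p + q)"
    note w' [simp] = HomD[OF w]
    show "Post A (PArr \<psi> (nil_pr1 n p q)) (a w) = a (nil_pr1 n p q \<cdot>\<^bsub>nil_op n\<^esub> w)"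
    proof (rule G.joint_trk_eqI)
      fix k assume k: "k < p"
      have "Post A (PArr \<psi> (pr n p k)) (Post A (PArr \<psi> (nil_pr1 n p q)) (a w)) = Post A (PArr \<psi> (pr n (p + q) k)) (a w)"
        using k by (simp add: G.PArr_pr1)
      also have "\<dots> = a (pr n (p + q) k \<cdot>\<^bsub>nil_op n\<^esub> w)" by (rule N.a_proj[OF w]) (use k in simp)
      also have "pr n (p + q) k \<cdot>\<^bsub>nil_op n\<^esub> w = pr n p k \<cdot>\<^bsub>nil_op n\<^esub> (nil_pr1 n p q \<cdot>\<^bsub>nil_op n\<^esub> w)"
        using nil_op.Comp_assoc[OF w nil_pr1_Hom pr_Hom[OF k]] by (simp add: pr_nil_pr1[OF k])
      also have "a \<dots> = Post A (PArr \<psi> (pr n p k)) (a (nil_pr1 n p q \<cdot>\<^bsub>nil_op n\<^esub> w))"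
        by (rule N.a_proj[OF nil_op.Comp_Hom[OF w nil_pr1_Hom] k, symmetric])
      finally show "Post A (PArr \<psi> (pr n p k)) (Post A (PArr \<psi> (nil_pr1 n p q)) (a w))
        = Post A (PArr \<psi> (pr n p k)) (a (nil_pr1 n p q \<cdot>\<^bsub>nil_op n\<^esub> w))" .
    qed (auto simp: HomTrk_def mem_Hom_iff)
    show "Post A (PArr \<psi> (nil_pr2 n p q)) (a w) = a (nil_pr2 n p q \<cdot>\<^bsub>nil_op n\<^esub> w)"
    proof (rule G.joint_trk_eqI)
      fix k assume k: "k < q"
      have "Post A (PArr \<psi> (pr n q k)) (Post A (PArr \<psi> (nil_pr2 n p q)) (a w)) = Post A (PArr \<psi> (pr n (p + q) (p + k))) (a w)"
        using k by (simp add: G.PArr_pr2)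
      also have "\<dots> = a (pr n (p + q) (p + k) \<cdot>\<^bsub>nil_op n\<^esub> w)" by (rule N.a_proj[OF w]) (use k in simp)
      also have "pr n (p + q) (p + k) \<cdot>\<^bsub>nil_op n\<^esub> w = pr n q k \<cdot>\<^bsub>nil_op n\<^esub> (nil_pr2 n p q \<cdot>\<^bsub>nil_op n\<^esub> w)"
        using nil_op.Comp_assoc[OF w nil_pr2_Hom pr_Hom[OF k]] by (simp add: pr_nil_pr2[OF k])
      also have "a \<dots> = Post A (PArr \<psi> (pr n q k)) (a (nil_pr2 n p q \<cdot>\<^bsub>nil_op n\<^esub> w))"
        by (rule N.a_proj[OF nil_op.Comp_Hom[OF w nil_pr2_Hom] k, symmetric])
      finally show "Post A (PArr \<psi> (pr n q k)) (Post A (PArr \<psi> (nil_pr2 n p q)) (a w))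
        = Post A (PArr \<psi> (pr n q k)) (a (nil_pr2 n p q \<cdot>\<^bsub>nil_op n\<^esub> w))" .
    qed (auto simp: HomTrk_def mem_Hom_iff)
  next
    fix g w assume gw: "g \<in> Arr (nil_op n)" "w \<in> Arr (nil_op n)" "Dom (nil_op n) g = Cod (nil_op n) w"
    show "a (g \<cdot>\<^bsub>nil_op n\<^esub> w) \<box> Post A (lev f (Cod (nil_op n) g)) (PComp \<phi> g w)
      = Pre A (lev f (Dom (nil_op n) w)) (PComp \<psi> g w) \<box> (Post A (PArr \<psi> g) (a w) \<box> Pre A (PArr \<phi> w) (a g))"
      using N.coherent[of g "Cod (nil_op n) w" "Cod (nil_op n) g" w "Dom (nil_op n) w"] gw
      by (simp add: mem_Hom_iff N.lhs_def N.rhs_def)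
  qed
  thus ?thesis by blast
qed

end

section \<open>Pseudo natural transformations and homotopies\<close>

context pp_pair
begin

text \<open>Maps into a strict product are compared on the two factors, where \<open>pi_map\<close>
  becomes the images of the projections of the theory. The next two lemmas do the same for
  tracks.\<close>

lemma pi_lev_iff:
  assumes l: "\<And>p. l p \<in> Hom A (PObj \<phi> p) (PObj \<psi> p)"
  shows "pi_map n A \<psi> p q \<cdot> l (p + q) = prodA A (l p) (l q) \<cdot> pi_map n A \<phi> p q
    \<longleftrightarrow> PArr \<psi> (nil_pr1 n p q) \<cdot> l (p + q) = l p \<cdot> PArr \<phi> (nil_pr1 n p q) \<and>
       PArr \<psi> (nil_pr2 n p q) \<cdot> l (p + q) = l q \<cdot> PArr \<phi> (nil_pr2 n p q)" (is "?u = ?v \<longleftrightarrow> _")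
proof -
  note [simp] = HomD[OF l]
  let ?X = "PObj \<phi> p" and ?Y = "PObj \<phi> q" and ?X' = "PObj \<psi> p" and ?Y' = "PObj \<psi> q"
  have "prodA A (l p) (l q) = pairA A (l p \<cdot> Pr1 A ?X ?Y) (l q \<cdot> Pr2 A ?X ?Y)" by (simp add: prodA_def)
  moreover note pairA[of ?X' ?Y' "l p \<cdot> Pr1 A ?X ?Y" "Prod A ?X ?Y" "l q \<cdot> Pr2 A ?X ?Y"]
  ultimately have P: "prodA A (l p) (l q) \<in> Hom A (Prod A ?X ?Y) (Prod A ?X' ?Y')"
    "Pr1 A ?X' ?Y' \<cdot> prodA A (l p) (l q) = l p \<cdot> Pr1 A ?X ?Y"
    "Pr2 A ?X' ?Y' \<cdot> prodA A (l p) (l q) = l q \<cdot> Pr2 A ?X ?Y"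
    by (simp_all add: mem_Hom_iff)
  note [simp] = HomD[OF P(1)]
  have v: "Pr1 A ?X' ?Y' \<cdot> ?v = l p \<cdot> PArr \<phi> (nil_pr1 n p q)" "Pr2 A ?X' ?Y' \<cdot> ?v = l q \<cdot> PArr \<phi> (nil_pr2 n p q)"
  proof -
    have "Pr1 A ?X' ?Y' \<cdot> ?v = (Pr1 A ?X' ?Y' \<cdot> prodA A (l p) (l q)) \<cdot> pi_map n A \<phi> p q"
      "Pr2 A ?X' ?Y' \<cdot> ?v = (Pr2 A ?X' ?Y' \<cdot> prodA A (l p) (l q)) \<cdot> pi_map n A \<phi> p q"
      by (rule Comp_assoc_simp[symmetric]; simp)+
    thus "Pr1 A ?X' ?Y' \<cdot> ?v = l p \<cdot> PArr \<phi> (nil_pr1 n p q)" "Pr2 A ?X' ?Y' \<cdot> ?v = l q \<cdot> PArr \<phi> (nil_pr2 n p q)"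
      unfolding P(2,3) by (simp_all add: F.pi_map)
  qed
  have u: "Pr1 A ?X' ?Y' \<cdot> ?u = PArr \<psi> (nil_pr1 n p q) \<cdot> l (p + q)" "Pr2 A ?X' ?Y' \<cdot> ?u = PArr \<psi> (nil_pr2 n p q) \<cdot> l (p + q)"
    by (rule G.pi_Comp; simp)+
  show ?thesis
  proof
    assume "?u = ?v" thus "PArr \<psi> (nil_pr1 n p q) \<cdot> l (p + q) = l p \<cdot> PArr \<phi> (nil_pr1 n p q) \<and>
       PArr \<psi> (nil_pr2 n p q) \<cdot> l (p + q) = l q \<cdot> PArr \<phi> (nil_pr2 n p q)" using u v by simp
  next
    assume e: "PArr \<psi> (nil_pr1 n p q) \<cdot> l (p + q) = l p \<cdot> PArr \<phi> (nil_pr1 n p q) \<and>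
       PArr \<psi> (nil_pr2 n p q) \<cdot> l (p + q) = l q \<cdot> PArr \<phi> (nil_pr2 n p q)"
    show "?u = ?v"
      by (rule prod_eqI[of ?X' ?Y' _ "PObj \<phi> (p + q)"]) (use u v e in \<open>simp_all add: mem_Hom_iff\<close>)
  qed
qed

lemma pi_trk_iff:
  assumes t: "t \<in> HomTrk A Z (PObj \<psi> (p + q))" and b: "b \<in> HomTrk A Z (PObj \<psi> p)" "c \<in> HomTrk A Z (PObj \<psi> q)"
  shows "Post A (pi_map n A \<psi> p q) t = pairT A b c \<longleftrightarrow>
    Post A (PArr \<psi> (nil_pr1 n p q)) t = b \<and> Post A (PArr \<psi> (nil_pr2 n p q)) t = c"
proof -
  have t' [simp]: "t \<in> Trk A" "Dom A (Src A t) = Z" "Cod A (Src A t) = PObj \<psi> (p + q)"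
    using t by (simp_all add: HomTrk_def mem_Hom_iff)
  note P = pairT[OF G.PObj_simp G.PObj_simp b]
  show ?thesis
  proof
    assume "Post A (pi_map n A \<psi> p q) t = pairT A b c"
    thus "Post A (PArr \<psi> (nil_pr1 n p q)) t = b \<and> Post A (PArr \<psi> (nil_pr2 n p q)) t = c"
      using G.pi_Post[of t p q] P(2,3) by simp
  next
    assume "Post A (PArr \<psi> (nil_pr1 n p q)) t = b \<and> Post A (PArr \<psi> (nil_pr2 n p q)) t = c"
    thus "Post A (pi_map n A \<psi> p q) t = pairT A b c"
      by (intro prod_trk_eqI[OF _ _ _ P(1)])
        (simp_all add: G.pi_Post P(2,3), simp_all add: HomTrk_def mem_Hom_iff)
  qed
qed

lemma pi_hom_iff:
  assumes H: "\<And>p. H p \<in> HomTrk A (PObj \<phi> p) (PObj \<psi> p)"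
  shows "Post A (pi_map n A \<psi> p q) (H (p + q)) = Pre A (pi_map n A \<phi> p q) (prodT A (H p) (H q))
    \<longleftrightarrow> Post A (PArr \<psi> (nil_pr1 n p q)) (H (p + q)) = Pre A (PArr \<phi> (nil_pr1 n p q)) (H p) \<and>
       Post A (PArr \<psi> (nil_pr2 n p q)) (H (p + q)) = Pre A (PArr \<phi> (nil_pr2 n p q)) (H q)" (is "?u = ?v \<longleftrightarrow> _")
proof -
  have H' [simp]: "H p \<in> Trk A" "Dom A (Src A (H p)) = PObj \<phi> p" "Cod A (Src A (H p)) = PObj \<psi> p" for p
    using H[of p] by (simp_all add: HomTrk_def mem_Hom_iff)
  let ?X = "PObj \<phi> p" and ?Y = "PObj \<phi> q" and ?X' = "PObj \<psi> p" and ?Y' = "PObj \<psi> q"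
  have "prodT A (H p) (H q) = pairT A (Pre A (Pr1 A ?X ?Y) (H p)) (Pre A (Pr2 A ?X ?Y) (H q))"
    by (simp add: prodT_def Let_def)
  moreover note pairT[of ?X' ?Y' "Pre A (Pr1 A ?X ?Y) (H p)" "Prod A ?X ?Y" "Pre A (Pr2 A ?X ?Y) (H q)"]
  ultimately have P: "prodT A (H p) (H q) \<in> HomTrk A (Prod A ?X ?Y) (Prod A ?X' ?Y')"
    "Post A (Pr1 A ?X' ?Y') (prodT A (H p) (H q)) = Pre A (Pr1 A ?X ?Y) (H p)"
    "Post A (Pr2 A ?X' ?Y') (prodT A (H p) (H q)) = Pre A (Pr2 A ?X ?Y) (H q)"
    by (simp_all add: mem_Hom_iff HomTrk_def)
  have P' [simp]: "prodT A (H p) (H q) \<in> Trk A" "Dom A (Src A (prodT A (H p) (H q))) = Prod A ?X ?Y"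
    "Cod A (Src A (prodT A (H p) (H q))) = Prod A ?X' ?Y'"
    using P(1) by (simp_all add: HomTrk_def mem_Hom_iff)
  have pre: "Pre A (pi_map n A \<phi> p q) (Pre A (Pr1 A ?X ?Y) t) = Pre A (PArr \<phi> (nil_pr1 n p q)) t"
    if "t \<in> Trk A" "Dom A (Src A t) = ?X" for t
    using Pre_Comp_simp[of t "Pr1 A ?X ?Y" "pi_map n A \<phi> p q"] that by (simp add: F.pi_map)
  have pre': "Pre A (pi_map n A \<phi> p q) (Pre A (Pr2 A ?X ?Y) t) = Pre A (PArr \<phi> (nil_pr2 n p q)) t"
    if "t \<in> Trk A" "Dom A (Src A t) = ?Y" for t
    using Pre_Comp_simp[of t "Pr2 A ?X ?Y" "pi_map n A \<phi> p q"] that by (simp add: F.pi_map)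
  have v: "Post A (Pr1 A ?X' ?Y') ?v = Pre A (PArr \<phi> (nil_pr1 n p q)) (H p)"
    "Post A (Pr2 A ?X' ?Y') ?v = Pre A (PArr \<phi> (nil_pr2 n p q)) (H q)"
    by (simp_all add: P(2,3) pre pre')
  have u: "Post A (Pr1 A ?X' ?Y') ?u = Post A (PArr \<psi> (nil_pr1 n p q)) (H (p + q))"
    "Post A (Pr2 A ?X' ?Y') ?u = Post A (PArr \<psi> (nil_pr2 n p q)) (H (p + q))"
    by (rule G.pi_Post; simp)+
  show ?thesis
  proof
    assume "?u = ?v"
    thus "Post A (PArr \<psi> (nil_pr1 n p q)) (H (p + q)) = Pre A (PArr \<phi> (nil_pr1 n p q)) (H p) \<and>
       Post A (PArr \<psi> (nil_pr2 n p q)) (H (p + q)) = Pre A (PArr \<phi> (nil_pr2 n p q)) (H q)" using u v by simp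
  next
    assume e: "Post A (PArr \<psi> (nil_pr1 n p q)) (H (p + q)) = Pre A (PArr \<phi> (nil_pr1 n p q)) (H p) \<and>
       Post A (PArr \<psi> (nil_pr2 n p q)) (H (p + q)) = Pre A (PArr \<phi> (nil_pr2 n p q)) (H q)"
    show "?u = ?v"
    proof (rule prod_trk_eqI[of ?X' ?Y' _ "PObj \<phi> (p + q)"])
      show "Post A (Pr1 A ?X' ?Y') ?u = Post A (Pr1 A ?X' ?Y') ?v" using u v e by simp
      show "Post A (Pr2 A ?X' ?Y') ?u = Post A (Pr2 A ?X' ?Y') ?v" using u v e by simp
    qed (simp_all add: mem_Hom_iff HomTrk_def)
  qed
qed

lemma PUnit_eq: "PUnit \<phi> p = IdT A (Ident A (PObj \<phi> p))" "PUnit \<psi> p = IdT A (Ident A (PObj \<psi> p))"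
  by (rule F.pp_PUnit G.pp_PUnit)+

text \<open>Reduces transformations to coherent families, for which existence and uniqueness are
  established.\<close>

lemma pseudonat_iff:
  assumes d: "NDom \<alpha> = \<phi>" "NCod \<alpha> = \<psi>"
  shows "pp_pseudonat n A \<alpha> \<longleftrightarrow> coh (NObj \<alpha>) (NArr \<alpha>) \<and> NArr \<alpha> \<in> extensional (Arr (nil_op n))"
proof
  assume "pp_pseudonat n A \<alpha>"
  hence nat: "pseudo_natural (nil_op n) A \<alpha>"
    and pi: "\<And>p q. pi_map n A \<psi> p q \<cdot> NObj \<alpha> (p + q) = prodA A (NObj \<alpha> p) (NObj \<alpha> q) \<cdot> pi_map n A \<phi> p q"
    and piT: "\<And>p q r u. u \<in> Hom (nil_op n) r (p + q) \<Longrightarrow> Post A (pi_map n A \<psi> p q) (NArr \<alpha> u)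
        = pairT A (NArr \<alpha> (nil_pr1 n p q \<cdot>\<^bsub>nil_op n\<^esub> u)) (NArr \<alpha> (nil_pr2 n p q \<cdot>\<^bsub>nil_op n\<^esub> u))"
    unfolding pp_pseudonat_def d by blast+
  interpret N: pseudo_natural "nil_op n" A \<alpha> \<phi> \<psi>
    using nat unfolding d by simp_all
  have l: "NObj \<alpha> p \<in> Hom A (PObj \<phi> p) (PObj \<psi> p)" for p using N.NObj_Hom by simp
  note [simp] = HomD[OF l]
  have a: "NArr \<alpha> w \<in> Track A (NObj \<alpha> (Cod (nil_op n) w) \<cdot> PArr \<phi> w) (PArr \<psi> w \<cdot> NObj \<alpha> (Dom (nil_op n) w))"
    if "w \<in> Arr (nil_op n)" for w
    by (rule N.NArr_Track) (use that in \<open>simp add: mem_Hom_iff\<close>)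
  have a' [simp]: "NArr \<alpha> w \<in> Trk A" "Src A (NArr \<alpha> w) = NObj \<alpha> (Cod (nil_op n) w) \<cdot> PArr \<phi> w"
    "Trg A (NArr \<alpha> w) = PArr \<psi> w \<cdot> NObj \<alpha> (Dom (nil_op n) w)" if "w \<in> Arr (nil_op n)" for w
    using a[OF that] by (simp_all add: mem_Track_iff)
  show "coh (NObj \<alpha>) (NArr \<alpha>) \<and> NArr \<alpha> \<in> extensional (Arr (nil_op n))"
  proof
    show "coh (NObj \<alpha>) (NArr \<alpha>)" unfolding coh_def
    proof (intro conjI allI ballI impI)
      fix p q
      show "PArr \<psi> (nil_pr1 n p q) \<cdot> NObj \<alpha> (p + q) = NObj \<alpha> p \<cdot> PArr \<phi> (nil_pr1 n p q)"
        "PArr \<psi> (nil_pr2 n p q) \<cdot> NObj \<alpha> (p + q) = NObj \<alpha> q \<cdot> PArr \<phi> (nil_pr2 n p q)"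
        using pi_lev_iff[of "NObj \<alpha>", OF l] pi by blast+
      fix r w assume w: "w \<in> Hom (nil_op n) r (p + q)"
      have "NArr \<alpha> w \<in> HomTrk A (PObj \<phi> r) (PObj \<psi> (p + q))"
        "NArr \<alpha> (nil_pr1 n p q \<cdot>\<^bsub>nil_op n\<^esub> w) \<in> HomTrk A (PObj \<phi> r) (PObj \<psi> p)"
        "NArr \<alpha> (nil_pr2 n p q \<cdot>\<^bsub>nil_op n\<^esub> w) \<in> HomTrk A (PObj \<phi> r) (PObj \<psi> q)"
        using HomD[OF w] by (simp_all add: HomTrk_def mem_Hom_iff)
      from pi_trk_iff[OF this] piT[OF w]
      show "Post A (PArr \<psi> (nil_pr1 n p q)) (NArr \<alpha> w) = NArr \<alpha> (nil_pr1 n p q \<cdot>\<^bsub>nil_op n\<^esub> w)"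
        "Post A (PArr \<psi> (nil_pr2 n p q)) (NArr \<alpha> w) = NArr \<alpha> (nil_pr2 n p q \<cdot>\<^bsub>nil_op n\<^esub> w)" by blast+
    next
      fix g w assume gw: "g \<in> Arr (nil_op n)" "w \<in> Arr (nil_op n)" "Dom (nil_op n) g = Cod (nil_op n) w"
      show "NArr \<alpha> (g \<cdot>\<^bsub>nil_op n\<^esub> w) \<box> Post A (NObj \<alpha> (Cod (nil_op n) g)) (PComp \<phi> g w)
        = Pre A (NObj \<alpha> (Dom (nil_op n) w)) (PComp \<psi> g w) \<box> (Post A (PArr \<psi> g) (NArr \<alpha> w) \<box> Pre A (PArr \<phi> w) (NArr \<alpha> g))"
        using N.NArr_Comp[of w "Dom (nil_op n) w" "Cod (nil_op n) w" g "Cod (nil_op n) g"] gw by (simp add: mem_Hom_iff)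
    qed (use l a in auto)
    show "NArr \<alpha> \<in> extensional (Arr (nil_op n))" by (rule N.N_ext)
  qed
next
  assume c: "coh (NObj \<alpha>) (NArr \<alpha>) \<and> NArr \<alpha> \<in> extensional (Arr (nil_op n))"
  note [simp] = coh_l[OF c[THEN conjunct1]] coh_a[OF c[THEN conjunct1]]
  have l: "NObj \<alpha> p \<in> Hom A (PObj \<phi> p) (PObj \<psi> p)" for p by (simp add: mem_Hom_iff)
  have nat: "pseudo_natural (nil_op n) A \<alpha>"
  proof (rule pseudo_natural.intro, unfold d)
    show "pseudofunctor (nil_op n) A \<phi>" "pseudofunctor (nil_op n) A \<psi>" by unfold_locales
    show "NObj \<alpha> \<in> extensional (Obj (nil_op n))" by simp
    show "NArr \<alpha> \<in> extensional (Arr (nil_op n))" using c by blast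
    fix X show "NObj \<alpha> X \<in> Hom A (PObj \<phi> X) (PObj \<psi> X)" by (rule l)
    show "Pre A (NObj \<alpha> X) (PUnit \<psi> X) \<box> NArr \<alpha> (Ident (nil_op n) X) = Post A (NObj \<alpha> X) (PUnit \<phi> X)"
      by (simp add: PUnit_eq coh_Ident[OF c[THEN conjunct1]])
  next
    fix w X Y assume w: "w \<in> Hom (nil_op n) X Y"
    show "NArr \<alpha> w \<in> Track A (NObj \<alpha> Y \<cdot> PArr \<phi> w) (PArr \<psi> w \<cdot> NObj \<alpha> X)"
      using HomD[OF w] by (simp add: mem_Track_iff)
    fix g Z assume g: "g \<in> Hom (nil_op n) Y Z"
    show "NArr \<alpha> (g \<cdot>\<^bsub>nil_op n\<^esub> w) \<box> Post A (NObj \<alpha> Z) (PComp \<phi> g w)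
      = Pre A (NObj \<alpha> X) (PComp \<psi> g w) \<box> Post A (PArr \<psi> g) (NArr \<alpha> w) \<box> Pre A (PArr \<phi> w) (NArr \<alpha> g)"
      using coh_comp[OF c[THEN conjunct1], of g w] HomD[OF w] HomD[OF g] by simp
  qed
  show "pp_pseudonat n A \<alpha>" unfolding pp_pseudonat_def d
  proof (intro conjI allI ballI nat)
    show "pp_pseudofunctor n A \<phi>" "pp_pseudofunctor n A \<psi>" by unfold_locales
    fix p q
    show "pi_map n A \<psi> p q \<cdot> NObj \<alpha> (p + q) = prodA A (NObj \<alpha> p) (NObj \<alpha> q) \<cdot> pi_map n A \<phi> p q"
      using pi_lev_iff[of "NObj \<alpha>", OF l] coh_l_pr12[OF c[THEN conjunct1]] by blast
    fix r w assume w: "w \<in> Hom (nil_op n) r (p + q)"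
    have "NArr \<alpha> w \<in> HomTrk A (PObj \<phi> r) (PObj \<psi> (p + q))"
      "NArr \<alpha> (nil_pr1 n p q \<cdot>\<^bsub>nil_op n\<^esub> w) \<in> HomTrk A (PObj \<phi> r) (PObj \<psi> p)"
      "NArr \<alpha> (nil_pr2 n p q \<cdot>\<^bsub>nil_op n\<^esub> w) \<in> HomTrk A (PObj \<phi> r) (PObj \<psi> q)"
      using HomD[OF w] by (simp_all add: HomTrk_def mem_Hom_iff)
    from pi_trk_iff[OF this] coh_a_pr12[OF c[THEN conjunct1] w]
    show "Post A (pi_map n A \<psi> p q) (NArr \<alpha> w)
        = pairT A (NArr \<alpha> (nil_pr1 n p q \<cdot>\<^bsub>nil_op n\<^esub> w)) (NArr \<alpha> (nil_pr2 n p q \<cdot>\<^bsub>nil_op n\<^esub> w))" by blast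
  qed
qed

text \<open>The counterpart of \<open>coh\<close> for homotopies, again with the projections in
  place of \<open>pi_map\<close>.\<close>

definition hcoh where
  "hcoh l a l' a' H \<longleftrightarrow> (\<forall>p. H p \<in> Track A (l p) (l' p)) \<and>
     (\<forall>w \<in> Arr (nil_op n). a' w = Post A (PArr \<psi> w) (H (Dom (nil_op n) w)) \<box>
        (a w \<box> Pre A (PArr \<phi> w) (InvT A (H (Cod (nil_op n) w))))) \<and>
     (\<forall>p q. Post A (PArr \<psi> (nil_pr1 n p q)) (H (p + q)) = Pre A (PArr \<phi> (nil_pr1 n p q)) (H p) \<and>
            Post A (PArr \<psi> (nil_pr2 n p q)) (H (p + q)) = Pre A (PArr \<phi> (nil_pr2 n p q)) (H q))"

context
  fixes l a l' a' assumes c: "coh l a" "coh l' a'"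
begin

lemma hcoh_pr:
  assumes H: "hcoh l a l' a' H" and k: "k < p"
  shows "Post A (PArr \<psi> (pr n p k)) (H p) = Pre A (PArr \<phi> (pr n p k)) (H 1)"
proof -
  note [simp] = coh_l[OF c(1)] coh_l[OF c(2)]
  have H' [simp]: "H p \<in> Trk A" "Src A (H p) = l p" "Trg A (H p) = l' p" for p
    using H by (simp_all add: hcoh_def mem_Track_iff)
  have pr12: "Post A (PArr \<psi> (nil_pr1 n p q)) (H (p + q)) = Pre A (PArr \<phi> (nil_pr1 n p q)) (H p)"
    "Post A (PArr \<psi> (nil_pr2 n p q)) (H (p + q)) = Pre A (PArr \<phi> (nil_pr2 n p q)) (H q)" for p q
    using H by (simp_all add: hcoh_def)
  show ?thesis using k
  proof (induction p)
    case (Suc p)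
    show ?case
    proof (cases "k = p")
      case True
      thus ?thesis using pr12(2)[of p 1] F.pr_Suc_self[of p] by (simp add: Suc_eq_plus1)
    next
      case False
      hence k: "k < p" using Suc.prems by simp
      have "Post A (PArr \<psi> (pr n (Suc p) k)) (H (Suc p)) = Post A (PArr \<psi> (pr n p k)) (Post A (PArr \<psi> (nil_pr1 n p 1)) (H (p + 1)))"
        using k by (simp add: Suc_eq_plus1 G.PArr_pr1)
      also have "\<dots> = Pre A (PArr \<phi> (nil_pr1 n p 1)) (Post A (PArr \<psi> (pr n p k)) (H p))"
        unfolding pr12 using k by simp
      also have "\<dots> = Pre A (PArr \<phi> (pr n (Suc p) k)) (H 1)"
        unfolding Suc.IH[OF k] using k by (simp add: F.PArr_pr_Suc)
      finally show ?thesis .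
    qed
  qed simp
qed

lemma hcoh_unique:
  assumes H: "hcoh l a l' a' H"
    and K: "K \<in> HomTrk A (PObj \<phi> p) (PObj \<psi> p)"
      "\<And>k. k < p \<Longrightarrow> Post A (PArr \<psi> (pr n p k)) K = Pre A (PArr \<phi> (pr n p k)) (H 1)"
  shows "H p = K"
  by (rule G.joint_trk_eqI[OF _ K(1)])
    (use H coh_l[OF c(1)] hcoh_pr[OF H] K(2) in \<open>simp_all add: hcoh_def mem_Track_iff HomTrk_def mem_Hom_iff\<close>)

text \<open>\<open>H\<close> is the levelwise power of \<open>h\<close>. Ends and product conditions
  are checked on coordinates; naturality is obtained for all operations at once.\<close>

lemma hcoh_exists:
  assumes h: "h \<in> Track A (l 1) (l' 1)"
  obtains H where "hcoh l a l' a' H" "H 1 = h"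
proof -
  note [simp] = coh_l[OF c(1)] coh_l[OF c(2)] coh_a[OF c(1)] coh_a[OF c(2)]
  have h' [simp]: "h \<in> Trk A" "Src A h = l 1" "Trg A h = l' 1" using h by (simp_all add: mem_Track_iff)
  have "\<exists>u \<in> HomTrk A (PObj \<phi> p) (PObj \<psi> p). \<forall>k<p. Post A (PArr \<psi> (pr n p k)) u = Pre A (PArr \<phi> (pr n p k)) h" for p
    by (rule G.joint_trk_exists) (simp_all add: HomTrk_def mem_Hom_iff)
  then obtain H where H: "\<And>p. H p \<in> HomTrk A (PObj \<phi> p) (PObj \<psi> p)"
    "\<And>p k. k < p \<Longrightarrow> Post A (PArr \<psi> (pr n p k)) (H p) = Pre A (PArr \<phi> (pr n p k)) h" by metis
  have H' [simp]: "H p \<in> Trk A" "Dom A (Src A (H p)) = PObj \<phi> p" "Cod A (Src A (H p)) = PObj \<psi> p" for p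
    using H(1)[of p] by (simp_all add: HomTrk_def mem_Hom_iff)
  have S [simp]: "Src A (H p) = l p" for p
  proof (rule G.joint_eqI)
    fix k assume k: "k < p"
    have "PArr \<psi> (pr n p k) \<cdot> Src A (H p) = Src A (Pre A (PArr \<phi> (pr n p k)) h)" using k by (simp flip: H(2)[OF k])
    thus "PArr \<psi> (pr n p k) \<cdot> Src A (H p) = PArr \<psi> (pr n p k) \<cdot> l p" using coh_l_pr[OF c(1) k] k by simp
  qed (simp_all add: mem_Hom_iff)
  have T [simp]: "Trg A (H p) = l' p" for p
  proof (rule G.joint_eqI)
    fix k assume k: "k < p"
    have "PArr \<psi> (pr n p k) \<cdot> Trg A (H p) = Trg A (Pre A (PArr \<phi> (pr n p k)) h)" using k by (simp flip: H(2)[OF k])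
    thus "PArr \<psi> (pr n p k) \<cdot> Trg A (H p) = PArr \<psi> (pr n p k) \<cdot> l' p" using coh_l_pr[OF c(2) k] k by simp
  qed (simp_all add: mem_Hom_iff)
  have H1: "H 1 = h" using H(2)[of 0 1] by (simp add: pr_1_0)
  have pr1: "Post A (PArr \<psi> (nil_pr1 n p q)) (H (p + q)) = Pre A (PArr \<phi> (nil_pr1 n p q)) (H p)" for p q
  proof (rule G.joint_trk_eqI[of _ "PObj \<phi> (p + q)" p])
    fix k assume k: "k < p"
    have "Post A (PArr \<psi> (pr n p k)) (Post A (PArr \<psi> (nil_pr1 n p q)) (H (p + q))) = Post A (PArr \<psi> (pr n (p + q) k)) (H (p + q))"
      using k by (simp add: G.PArr_pr1)
    also have "\<dots> = Pre A (PArr \<phi> (nil_pr1 n p q)) (Post A (PArr \<psi> (pr n p k)) (H p))"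
      using k by (simp add: H(2) F.PArr_pr1)
    also have "\<dots> = Post A (PArr \<psi> (pr n p k)) (Pre A (PArr \<phi> (nil_pr1 n p q)) (H p))" using k by simp
    finally show "Post A (PArr \<psi> (pr n p k)) (Post A (PArr \<psi> (nil_pr1 n p q)) (H (p + q)))
      = Post A (PArr \<psi> (pr n p k)) (Pre A (PArr \<phi> (nil_pr1 n p q)) (H p))" .
  qed (simp_all add: HomTrk_def mem_Hom_iff)
  have pr2: "Post A (PArr \<psi> (nil_pr2 n p q)) (H (p + q)) = Pre A (PArr \<phi> (nil_pr2 n p q)) (H q)" for p q
  proof (rule G.joint_trk_eqI[of _ "PObj \<phi> (p + q)" q])
    fix k assume k: "k < q"
    have "Post A (PArr \<psi> (pr n q k)) (Post A (PArr \<psi> (nil_pr2 n p q)) (H (p + q))) = Post A (PArr \<psi> (pr n (p + q) (p + k))) (H (p + q))"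
      using k by (simp add: G.PArr_pr2)
    also have "\<dots> = Pre A (PArr \<phi> (nil_pr2 n p q)) (Post A (PArr \<psi> (pr n q k)) (H q))"
      using k by (simp add: H(2) F.PArr_pr2)
    also have "\<dots> = Post A (PArr \<psi> (pr n q k)) (Pre A (PArr \<phi> (nil_pr2 n p q)) (H q))" using k by simp
    finally show "Post A (PArr \<psi> (pr n q k)) (Post A (PArr \<psi> (nil_pr2 n p q)) (H (p + q)))
      = Post A (PArr \<psi> (pr n q k)) (Pre A (PArr \<phi> (nil_pr2 n p q)) (H q))" .
  qed (simp_all add: HomTrk_def mem_Hom_iff)
  text \<open>The conjugate of \<open>a\<close> by \<open>H\<close> is again coherent, hence equal to \<open>a'\<close> by uniqueness.\<close>
  define b where "b w = Post A (PArr \<psi> w) (H (Dom (nil_op n) w)) \<box>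
    (a w \<box> Pre A (PArr \<phi> w) (InvT A (H (Cod (nil_op n) w))))" for w
  have "coh l' b" unfolding coh_def
  proof (intro conjI allI ballI impI)
    show "l' p \<in> Hom A (PObj \<phi> p) (PObj \<psi> p)" for p by (simp add: mem_Hom_iff)
    show "b w \<in> Track A (l' (Cod (nil_op n) w) \<cdot> PArr \<phi> w) (PArr \<psi> w \<cdot> l' (Dom (nil_op n) w))"
      if "w \<in> Arr (nil_op n)" for w using that by (simp add: b_def mem_Track_iff)
    fix p q
    show "PArr \<psi> (nil_pr1 n p q) \<cdot> l' (p + q) = l' p \<cdot> PArr \<phi> (nil_pr1 n p q)"
      "PArr \<psi> (nil_pr2 n p q) \<cdot> l' (p + q) = l' q \<cdot> PArr \<phi> (nil_pr2 n p q)"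
      by (rule coh_l_pr12[OF c(2)])+
    fix r w assume w: "w \<in> Hom (nil_op n) r (p + q)"
    note [simp] = HomD[OF w]
    have e1: "Post A (PArr \<psi> (nil_pr1 n p q) \<cdot> PArr \<psi> w) t = Post A (PArr \<psi> (nil_pr1 n p q \<cdot>\<^bsub>nil_op n\<^esub> w)) t"
      "Pre A (PArr \<phi> (nil_pr1 n p q) \<cdot> PArr \<phi> w) t = Pre A (PArr \<phi> (nil_pr1 n p q \<cdot>\<^bsub>nil_op n\<^esub> w)) t" for t
      using F.strict_left_simps(2)[OF F.strict_left_pr1, of w p q] G.strict_left_simps(2)[OF G.strict_left_pr1, of w p q] by simp_all
    have e2: "Post A (PArr \<psi> (nil_pr2 n p q) \<cdot> PArr \<psi> w) t = Post A (PArr \<psi> (nil_pr2 n p q \<cdot>\<^bsub>nil_op n\<^esub> w)) t"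
      "Pre A (PArr \<phi> (nil_pr2 n p q) \<cdot> PArr \<phi> w) t = Pre A (PArr \<phi> (nil_pr2 n p q \<cdot>\<^bsub>nil_op n\<^esub> w)) t" for t
      using F.strict_left_simps(2)[OF F.strict_left_pr2, of w p q] G.strict_left_simps(2)[OF G.strict_left_pr2, of w p q] by simp_all
    show "Post A (PArr \<psi> (nil_pr1 n p q)) (b w) = b (nil_pr1 n p q \<cdot>\<^bsub>nil_op n\<^esub> w)"
      using e1(1)[of "H r"] e1(2)[of "H p"] coh_l_pr12[OF c(1)] by (simp add: b_def pr1 coh_a_pr12[OF c(1) w])
    show "Post A (PArr \<psi> (nil_pr2 n p q)) (b w) = b (nil_pr2 n p q \<cdot>\<^bsub>nil_op n\<^esub> w)"
      using e2(1)[of "H r"] e2(2)[of "H q"] coh_l_pr12[OF c(1)] by (simp add: b_def pr2 coh_a_pr12[OF c(1) w])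
  next
    fix g w assume gw [simp]: "g \<in> Arr (nil_op n)" "w \<in> Arr (nil_op n)" "Dom (nil_op n) g = Cod (nil_op n) w"
    let ?p = "Dom (nil_op n) w" and ?q = "Cod (nil_op n) w" and ?r = "Cod (nil_op n) g" and ?gw = "g \<cdot>\<^bsub>nil_op n\<^esub> w"
    let ?J = "Pre A (PArr \<phi> w) (Pre A (PArr \<phi> g) (InvT A (H ?r)))"
    let ?P = "Post A (PArr \<psi> g) (a w) \<box> Pre A (PArr \<phi> w) (a g)"
    \<comment> \<open>Interchange moves the composition tracks of \<psi> past the homotopy at the
      source; \<open>i2\<close> does it for \<phi> and the inverse homotopy at the target.\<close>
    have i1: "Post A (PArr \<psi> ?gw) (H ?p) \<box> Pre A (l ?p) (PComp \<psi> g w)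
        = Pre A (l' ?p) (PComp \<psi> g w) \<box> Post A (PArr \<psi> g) (Post A (PArr \<psi> w) (H ?p))"
      using interchange_track[of "H ?p" "PComp \<psi> g w"] by simp
    have i2: "Post A (l ?r) (PComp \<phi> g w) \<box> ?J
        = Pre A (PArr \<phi> ?gw) (InvT A (H ?r)) \<box> Post A (l' ?r) (PComp \<phi> g w)"
      using interchange_track[of "PComp \<phi> g w" "InvT A (H ?r)"] by simp
    have "b ?gw \<box> Post A (l' ?r) (PComp \<phi> g w) = Post A (PArr \<psi> ?gw) (H ?p) \<box>
        (a ?gw \<box> (Pre A (PArr \<phi> ?gw) (InvT A (H ?r)) \<box> Post A (l' ?r) (PComp \<phi> g w)))"
      by (simp add: b_def)
    also have "\<dots> = Post A (PArr \<psi> ?gw) (H ?p) \<box> ((a ?gw \<box> Post A (l ?r) (PComp \<phi> g w)) \<box> ?J)"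
      unfolding i2[symmetric] by simp
    also have "\<dots> = (Post A (PArr \<psi> ?gw) (H ?p) \<box> Pre A (l ?p) (PComp \<psi> g w)) \<box> (?P \<box> ?J)"
      unfolding coh_comp[OF c(1) gw] by simp
    also have "\<dots> = Pre A (l' ?p) (PComp \<psi> g w) \<box> (Post A (PArr \<psi> g) (b w) \<box> Pre A (PArr \<phi> w) (b g))"
      unfolding i1 by (simp add: b_def)
    finally show "b ?gw \<box> Post A (l' ?r) (PComp \<phi> g w)
      = Pre A (l' ?p) (PComp \<psi> g w) \<box> (Post A (PArr \<psi> g) (b w) \<box> Pre A (PArr \<phi> w) (b g))" .
  qed
  hence "a' w = b w" if "w \<in> Arr (nil_op n)" for w using coh_unique(2)[of l' a' l' b w] c(2) that by blast
  hence "hcoh l a l' a' H" by (simp add: hcoh_def mem_Track_iff pr1 pr2 b_def)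
  thus ?thesis using H1 that by blast
qed

end

lemma homotopy_iff:
  assumes s: "pp_pseudonat n A (HSrc H)" "pp_pseudonat n A (HTrg H)"
    and d: "NDom (HSrc H) = \<phi>" "NCod (HSrc H) = \<psi>" "NDom (HTrg H) = \<phi>" "NCod (HTrg H) = \<psi>"
  shows "pp_homotopy n A H \<longleftrightarrow> hcoh (NObj (HSrc H)) (NArr (HSrc H)) (NObj (HTrg H)) (NArr (HTrg H)) (HObj H)"
proof -
  have c: "coh (NObj (HSrc H)) (NArr (HSrc H))" "coh (NObj (HTrg H)) (NArr (HTrg H))"
    using pseudonat_iff[OF d(1,2)] pseudonat_iff[OF d(3,4)] s by blast+
  note [simp] = coh_l[OF c(1)] coh_l[OF c(2)] coh_a[OF c(1)] coh_a[OF c(2)]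
  have nat: "pseudo_natural (nil_op n) A (HSrc H)" "pseudo_natural (nil_op n) A (HTrg H)"
    using s by (simp_all add: pp_pseudonat_def)
  show ?thesis
  proof
    assume H: "pp_homotopy n A H"
    have "pseudo_homotopy (nil_op n) A H" using H by (simp add: pp_homotopy_def)
    then interpret K: pseudo_homotopy "nil_op n" A H "HSrc H" "HTrg H" \<phi> \<psi> unfolding d by simp_all
    have T: "HObj H p \<in> Track A (NObj (HSrc H) p) (NObj (HTrg H) p)" for p using K.HObj_Track by simp
    hence T' [simp]: "HObj H p \<in> Trk A" "Src A (HObj H p) = NObj (HSrc H) p" "Trg A (HObj H p) = NObj (HTrg H) p" for p
      by (simp_all add: mem_Track_iff)
    have HT: "HObj H p \<in> HomTrk A (PObj \<phi> p) (PObj \<psi> p)" for p by (simp add: HomTrk_def mem_Hom_iff)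
    show "hcoh (NObj (HSrc H)) (NArr (HSrc H)) (NObj (HTrg H)) (NArr (HTrg H)) (HObj H)"
      unfolding hcoh_def
    proof (intro conjI allI ballI)
      fix w assume w: "w \<in> Arr (nil_op n)"
      show "NArr (HTrg H) w = Post A (PArr \<psi> w) (HObj H (Dom (nil_op n) w)) \<box>
        (NArr (HSrc H) w \<box> Pre A (PArr \<phi> w) (InvT A (HObj H (Cod (nil_op n) w))))"
        using K.HObj_natural[of w "Dom (nil_op n) w" "Cod (nil_op n) w"] w by (simp add: mem_Hom_iff)
    next
      fix p q
      have "Post A (pi_map n A \<psi> p q) (HObj H (p + q)) = Pre A (pi_map n A \<phi> p q) (prodT A (HObj H p) (HObj H q))"
        using H unfolding pp_homotopy_def d by blast
      thus "Post A (PArr \<psi> (nil_pr1 n p q)) (HObj H (p + q)) = Pre A (PArr \<phi> (nil_pr1 n p q)) (HObj H p)"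
        "Post A (PArr \<psi> (nil_pr2 n p q)) (HObj H (p + q)) = Pre A (PArr \<phi> (nil_pr2 n p q)) (HObj H q)"
        using pi_hom_iff[of "HObj H", OF HT] by blast+
    qed (rule T)
  next
    assume h: "hcoh (NObj (HSrc H)) (NArr (HSrc H)) (NObj (HTrg H)) (NArr (HTrg H)) (HObj H)"
    have T: "HObj H p \<in> Track A (NObj (HSrc H) p) (NObj (HTrg H) p)" for p using h unfolding hcoh_def by blast
    hence T' [simp]: "HObj H p \<in> Trk A" "Src A (HObj H p) = NObj (HSrc H) p" "Trg A (HObj H p) = NObj (HTrg H) p" for p
      by (simp_all add: mem_Track_iff)
    have HT: "HObj H p \<in> HomTrk A (PObj \<phi> p) (PObj \<psi> p)" for p by (simp add: HomTrk_def mem_Hom_iff)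
    have "pseudo_homotopy (nil_op n) A H"
    proof (rule pseudo_homotopy.intro, unfold d)
      fix w X Y assume w: "w \<in> Hom (nil_op n) X Y"
      have "NArr (HTrg H) w = Post A (PArr \<psi> w) (HObj H (Dom (nil_op n) w)) \<box>
        (NArr (HSrc H) w \<box> Pre A (PArr \<phi> w) (InvT A (HObj H (Cod (nil_op n) w))))"
        using h HomD[OF w] unfolding hcoh_def by blast
      thus "NArr (HTrg H) w = Post A (PArr \<psi> w) (HObj H X) \<box> NArr (HSrc H) w \<box> Pre A (PArr \<phi> w) (InvT A (HObj H Y))"
        using HomD[OF w] by simp
    qed (use nat T in simp_all)
    thus "pp_homotopy n A H" unfolding pp_homotopy_def d
      using s pi_hom_iff[of "HObj H", OF HT] h[unfolded hcoh_def] by blast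
  qed
qed

end

section \<open>Evaluation is an equivalence\<close>

locale pseudo_setting = additive_track_products A HG D Dmap \<sigma>
  for A :: "('o, 'm, 't) track_cat_prod" (structure)
    and HG :: "'o \<Rightarrow> 'o \<Rightarrow> 'm set monoid"
    and D :: "'o \<Rightarrow> 'o \<Rightarrow> 'd monoid"
    and Dmap :: "'m set \<Rightarrow> 'm set \<Rightarrow> 'd \<Rightarrow> 'd"
    and \<sigma> :: "'m \<Rightarrow> 'd \<Rightarrow> 't" +
  fixes n :: enat
  assumes n1: "1 \<le> n"
begin

abbreviation "B \<equiv> PseudoPi n A"

lemma pp_pairI:
  assumes "pp_pseudofunctor n A \<phi>" "pp_pseudofunctor n A \<psi>"
  shows "pp_pair A n \<phi> \<psi> HG D Dmap \<sigma>"
  by (intro pp_pair.intro additive_pp_fun.intro pp_fun.intro assms) unfold_locales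

lemma Pi_simps:
  "Obj B = {\<phi>. pp_pseudofunctor n A \<phi>}" "Arr B = {\<alpha>. pp_pseudonat n A \<alpha>}" "Trk B = {H. pp_homotopy n A H}"
  by (simp_all add: PseudoPi_def Let_def)

text \<open>All operations of \<open>B\<close> act componentwise, so that \<open>nat_eqI\<close> and
  \<open>hot_eqI\<close> turn its laws into laws of \<open>A\<close> at the component 1.\<close>

lemma Pi_ops [simp]:
  "Dom B = NDom" "Cod B = NCod" "Src B = HSrc" "Trg B = HTrg"
  "NDom (Ident B \<phi>) = \<phi>" "NCod (Ident B \<phi>) = \<phi>" "NObj (Ident B \<phi>) p = Ident A (PObj \<phi> p)"
  "NDom (\<beta> \<cdot>\<^bsub>B\<^esub> \<alpha>) = NDom \<alpha>" "NCod (\<beta> \<cdot>\<^bsub>B\<^esub> \<alpha>) = NCod \<beta>" "NObj (\<beta> \<cdot>\<^bsub>B\<^esub> \<alpha>) p = NObj \<beta> p \<cdot> NObj \<alpha> p"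
  "HSrc (IdT B \<alpha>) = \<alpha>" "HTrg (IdT B \<alpha>) = \<alpha>" "HObj (IdT B \<alpha>) p = IdT A (NObj \<alpha> p)"
  "HSrc (K \<box>\<^bsub>B\<^esub> H) = HSrc H" "HTrg (K \<box>\<^bsub>B\<^esub> H) = HTrg K" "HObj (K \<box>\<^bsub>B\<^esub> H) p = HObj K p \<box> HObj H p"
  "HSrc (InvT B H) = HTrg H" "HTrg (InvT B H) = HSrc H" "HObj (InvT B H) p = InvT A (HObj H p)"
  "HSrc (Post B \<beta> H) = \<beta> \<cdot>\<^bsub>B\<^esub> HSrc H" "HTrg (Post B \<beta> H) = \<beta> \<cdot>\<^bsub>B\<^esub> HTrg H"
  "HObj (Post B \<beta> H) p = Post A (NObj \<beta> p) (HObj H p)"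
  "HSrc (Pre B \<beta> H) = HSrc H \<cdot>\<^bsub>B\<^esub> \<beta>" "HTrg (Pre B \<beta> H) = HTrg H \<cdot>\<^bsub>B\<^esub> \<beta>"
  "HObj (Pre B \<beta> H) p = Pre A (NObj \<beta> p) (HObj H p)"
  by (simp_all add: PseudoPi_def Let_def nat_id_def nat_comp_def)

lemma Obj_B: "\<phi> \<in> Obj B \<Longrightarrow> pp_pseudofunctor n A \<phi>"
  by (simp add: Pi_simps)

lemma PObj_B [simp]: "\<phi> \<in> Obj B \<Longrightarrow> PObj \<phi> p \<in> Obj A"
  using Obj_B[of \<phi>] pp_pseudofunctor.axioms(1)[of n A \<phi>] pseudofunctor.PObj_Obj[of "nil_op n" A \<phi> p] by simp

lemma NObjD:
  assumes "\<alpha> \<in> Arr B"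
  shows "NDom \<alpha> \<in> Obj B" "NCod \<alpha> \<in> Obj B" "pp_pair.coh A n (NDom \<alpha>) (NCod \<alpha>) (NObj \<alpha>) (NArr \<alpha>)"
    "NArr \<alpha> \<in> extensional (Arr (nil_op n))"
proof -
  have a: "pp_pseudonat n A \<alpha>" using assms by (simp add: Pi_simps)
  thus o: "NDom \<alpha> \<in> Obj B" "NCod \<alpha> \<in> Obj B" by (simp_all add: Pi_simps pp_pseudonat_def)
  interpret pp_pair A n "NDom \<alpha>" "NCod \<alpha>" HG D Dmap \<sigma> by (rule pp_pairI) (use o Obj_B in auto)
  show "coh (NObj \<alpha>) (NArr \<alpha>)" "NArr \<alpha> \<in> extensional (Arr (nil_op n))"
    using pseudonat_iff[OF refl refl] a by blast+
qed

lemma pair_B: "\<phi> \<in> Obj B \<Longrightarrow> \<psi> \<in> Obj B \<Longrightarrow> pp_pair A n \<phi> \<psi> HG D Dmap \<sigma>"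
  using pp_pairI Obj_B by blast

lemma nat_simps [simp]:
  assumes "\<alpha> \<in> Arr B"
  shows "NObj \<alpha> p \<in> Arr A" "Dom A (NObj \<alpha> p) = PObj (NDom \<alpha>) p" "Cod A (NObj \<alpha> p) = PObj (NCod \<alpha>) p"
    "NDom \<alpha> \<in> Obj B" "NCod \<alpha> \<in> Obj B"
  using pp_pair.coh_l[OF pair_B[OF NObjD(1,2)[OF assms]] NObjD(3)[OF assms]] NObjD[OF assms] by auto

lemma nat_pr:
  assumes "\<alpha> \<in> Arr B" "k < p"
  shows "PArr (NCod \<alpha>) (pr n p k) \<cdot> NObj \<alpha> p = NObj \<alpha> 1 \<cdot> PArr (NDom \<alpha>) (pr n p k)"
  by (rule pp_pair.coh_l_pr[OF pair_B[OF NObjD(1,2)[OF assms(1)]] NObjD(3)[OF assms(1)] assms(2)])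

text \<open>Evaluation is faithful on maps, by uniqueness of coherent families.\<close>

lemma nat_eqI:
  assumes "\<alpha> \<in> Arr B" "\<beta> \<in> Arr B" "NDom \<alpha> = NDom \<beta>" "NCod \<alpha> = NCod \<beta>" "NObj \<alpha> 1 = NObj \<beta> 1"
  shows "\<alpha> = \<beta>"
proof -
  note u = pp_pair.coh_unique[OF pair_B[OF NObjD(1,2)[OF assms(1)]] NObjD(3)[OF assms(1)]
      NObjD(3)[OF assms(2), folded assms(3,4)] assms(5)]
  have "NArr \<alpha> = NArr \<beta>"
    by (rule extensionalityI[OF NObjD(4)[OF assms(1)] NObjD(4)[OF assms(2)]]) (rule u(2))
  with u(1) assms(3,4) show ?thesis by simp
qed

text \<open>Evaluation is full on maps. The coherent family is restricted to arrows because
  transformations are extensional.\<close>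

lemma nat_exists:
  assumes "\<phi> \<in> Obj B" "\<psi> \<in> Obj B" "f \<in> Hom A (PObj \<phi> 1) (PObj \<psi> 1)"
  obtains \<alpha> where "\<alpha> \<in> Arr B" "NDom \<alpha> = \<phi>" "NCod \<alpha> = \<psi>" "NObj \<alpha> 1 = f"
proof -
  interpret pp_pair A n \<phi> \<psi> HG D Dmap \<sigma> by (rule pair_B[OF assms(1,2)])
  obtain a where a: "coh (lev f) a" using coh_exists[OF assms(3) n1] by blast
  let ?\<alpha> = "\<lparr>NDom = \<phi>, NCod = \<psi>, NObj = lev f, NArr = restrict a (Arr (nil_op n))\<rparr>"
  have "coh (lev f) (restrict a (Arr (nil_op n)))"
    using a HomD(1) unfolding coh_def by (auto simp: mem_Hom_iff)
  hence "pp_pseudonat n A ?\<alpha>" using pseudonat_iff[of ?\<alpha>] by simp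
  thus ?thesis using lev_1[OF assms(3)] by (intro that[of ?\<alpha>]) (simp_all add: Pi_simps)
qed

lemma Ident_B [simp]:
  assumes "\<phi> \<in> Obj B" shows "Ident B \<phi> \<in> Arr B"
proof -
  interpret pp_pair A n \<phi> \<phi> HG D Dmap \<sigma> by (rule pair_B[OF assms assms])
  have e: "NArr (Ident B \<phi>) = (\<lambda>w\<in>Arr (nil_op n). IdT A (PArr \<phi> w))" "NObj (Ident B \<phi>) = (\<lambda>p. Ident A (PObj \<phi> p))"
    by (simp_all add: PseudoPi_def Let_def nat_id_def restrict_UNIV)
  have "coh (NObj (Ident B \<phi>)) (NArr (Ident B \<phi>))"
    unfolding coh_def e
  proof (intro conjI allI ballI impI)
    fix p q r w assume w: "w \<in> Hom (nil_op n) r (p + q)"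
    note [simp] = HomD[OF w]
    show "Post A (PArr \<phi> (nil_pr1 n p q)) ((\<lambda>w\<in>Arr (nil_op n). IdT A (PArr \<phi> w)) w)
      = (\<lambda>w\<in>Arr (nil_op n). IdT A (PArr \<phi> w)) (nil_pr1 n p q \<cdot>\<^bsub>nil_op n\<^esub> w)"
      using F.strict_left_simps(2)[OF F.strict_left_pr1, of w p q] by simp
    show "Post A (PArr \<phi> (nil_pr2 n p q)) ((\<lambda>w\<in>Arr (nil_op n). IdT A (PArr \<phi> w)) w)
      = (\<lambda>w\<in>Arr (nil_op n). IdT A (PArr \<phi> w)) (nil_pr2 n p q \<cdot>\<^bsub>nil_op n\<^esub> w)"
      using F.strict_left_simps(2)[OF F.strict_left_pr2, of w p q] by simp
  qed (simp_all add: mem_Hom_iff mem_Track_iff)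
  moreover have "NArr (Ident B \<phi>) \<in> extensional (Arr (nil_op n))" by (simp add: e)
  ultimately show ?thesis using pseudonat_iff[of "Ident B \<phi>"] by (simp add: Pi_simps)
qed

text \<open>A lift of the composite at 1 exists, but that does not show that this particular
  composite is a transformation; so its coherence is computed.\<close>

lemma Comp_B [simp]:
  assumes \<alpha>: "\<alpha> \<in> Arr B" and \<beta>: "\<beta> \<in> Arr B" and d: "NDom \<beta> = NCod \<alpha>"
  shows "\<beta> \<cdot>\<^bsub>B\<^esub> \<alpha> \<in> Arr B"
proof -
  define \<phi> \<psi> \<chi> where "\<phi> = NDom \<alpha>" and "\<psi> = NCod \<alpha>" and "\<chi> = NCod \<beta>"
  have o: "\<phi> \<in> Obj B" "\<psi> \<in> Obj B" "\<chi> \<in> Obj B"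
    unfolding \<phi>_def \<psi>_def \<chi>_def using NObjD[OF \<alpha>] NObjD[OF \<beta>] by auto
  interpret P: pp_pair A n \<phi> \<psi> HG D Dmap \<sigma> by (rule pair_B[OF o(1,2)])
  interpret Q: pp_pair A n \<psi> \<chi> HG D Dmap \<sigma> by (rule pair_B[OF o(2,3)])
  interpret R: pp_pair A n \<phi> \<chi> HG D Dmap \<sigma> by (rule pair_B[OF o(1,3)])
  define l a m b where "l = NObj \<alpha>" and "a = NArr \<alpha>" and "m = NObj \<beta>" and "b = NArr \<beta>"
  have c: "P.coh l a" and c': "Q.coh m b"
    using NObjD(3)[OF \<alpha>] NObjD(3)[OF \<beta>] unfolding \<phi>_def \<psi>_def \<chi>_def l_def a_def m_def b_def d by auto
  note [simp] = P.coh_l[OF c] P.coh_a[OF c] Q.coh_l[OF c'] Q.coh_a[OF c']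
  have e: "NObj (\<beta> \<cdot>\<^bsub>B\<^esub> \<alpha>) = (\<lambda>p. m p \<cdot> l p)" "NArr (\<beta> \<cdot>\<^bsub>B\<^esub> \<alpha>) = (\<lambda>w\<in>Arr (nil_op n). Pre A (l (Dom (nil_op n) w)) (b w) \<box> Post A (m (Cod (nil_op n) w)) (a w))"
    by (simp_all add: PseudoPi_def Let_def nat_comp_def l_def a_def m_def b_def restrict_UNIV)
  define s where "s w = Pre A (l (Dom (nil_op n) w)) (b w) \<box> Post A (m (Cod (nil_op n) w)) (a w)" for w
  have e2: "NArr (\<beta> \<cdot>\<^bsub>B\<^esub> \<alpha>) w = s w" if "w \<in> Arr (nil_op n)" for w using that by (simp add: e s_def)
  have l1: "PArr \<chi> (nil_pr1 n p q) \<cdot> m (p + q) = m p \<cdot> PArr \<psi> (nil_pr1 n p q)"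
    "PArr \<chi> (nil_pr2 n p q) \<cdot> m (p + q) = m q \<cdot> PArr \<psi> (nil_pr2 n p q)"
    "PArr \<psi> (nil_pr1 n p q) \<cdot> l (p + q) = l p \<cdot> PArr \<phi> (nil_pr1 n p q)"
    "PArr \<psi> (nil_pr2 n p q) \<cdot> l (p + q) = l q \<cdot> PArr \<phi> (nil_pr2 n p q)" for p q
    by (rule P.coh_l_pr12[OF c] Q.coh_l_pr12[OF c'])+
  have "R.coh (\<lambda>p. m p \<cdot> l p) s" unfolding R.coh_def
  proof (intro conjI allI ballI impI)
    show "m p \<cdot> l p \<in> Hom A (PObj \<phi> p) (PObj \<chi> p)" for p by (simp add: mem_Hom_iff)
    show "s w \<in> Track A ((m (Cod (nil_op n) w) \<cdot> l (Cod (nil_op n) w)) \<cdot> PArr \<phi> w) (PArr \<chi> w \<cdot> (m (Dom (nil_op n) w) \<cdot> l (Dom (nil_op n) w)))"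
      if "w \<in> Arr (nil_op n)" for w using that by (simp add: s_def mem_Track_iff)
    fix p q
    have "PArr \<chi> (nil_pr1 n p q) \<cdot> (m (p + q) \<cdot> l (p + q)) = (PArr \<chi> (nil_pr1 n p q) \<cdot> m (p + q)) \<cdot> l (p + q)" by simp
    also have "\<dots> = m p \<cdot> (PArr \<psi> (nil_pr1 n p q) \<cdot> l (p + q))" unfolding l1(1) by simp
    also have "\<dots> = (m p \<cdot> l p) \<cdot> PArr \<phi> (nil_pr1 n p q)" unfolding l1(3) by simp
    finally show "PArr \<chi> (nil_pr1 n p q) \<cdot> (m (p + q) \<cdot> l (p + q)) = (m p \<cdot> l p) \<cdot> PArr \<phi> (nil_pr1 n p q)" .
    have "PArr \<chi> (nil_pr2 n p q) \<cdot> (m (p + q) \<cdot> l (p + q)) = (PArr \<chi> (nil_pr2 n p q) \<cdot> m (p + q)) \<cdot> l (p + q)" by simp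
    also have "\<dots> = m q \<cdot> (PArr \<psi> (nil_pr2 n p q) \<cdot> l (p + q))" unfolding l1(2) by simp
    also have "\<dots> = (m q \<cdot> l q) \<cdot> PArr \<phi> (nil_pr2 n p q)" unfolding l1(4) by simp
    finally show "PArr \<chi> (nil_pr2 n p q) \<cdot> (m (p + q) \<cdot> l (p + q)) = (m q \<cdot> l q) \<cdot> PArr \<phi> (nil_pr2 n p q)" .
    fix r w assume w: "w \<in> Hom (nil_op n) r (p + q)"
    note [simp] = HomD[OF w]
    have "Post A (PArr \<chi> (nil_pr1 n p q)) (s w)
        = Pre A (l r) (Post A (PArr \<chi> (nil_pr1 n p q)) (b w)) \<box> Post A (PArr \<chi> (nil_pr1 n p q) \<cdot> m (p + q)) (a w)"
      by (simp add: s_def)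
    also have "\<dots> = Pre A (l r) (Post A (PArr \<chi> (nil_pr1 n p q)) (b w)) \<box> Post A (m p) (Post A (PArr \<psi> (nil_pr1 n p q)) (a w))"
      unfolding l1(1) by simp
    also have "\<dots> = s (nil_pr1 n p q \<cdot>\<^bsub>nil_op n\<^esub> w)"
      unfolding P.coh_a_pr12[OF c w] Q.coh_a_pr12[OF c' w] by (simp add: s_def)
    finally show "Post A (PArr \<chi> (nil_pr1 n p q)) (s w) = s (nil_pr1 n p q \<cdot>\<^bsub>nil_op n\<^esub> w)" .
    have "Post A (PArr \<chi> (nil_pr2 n p q)) (s w)
        = Pre A (l r) (Post A (PArr \<chi> (nil_pr2 n p q)) (b w)) \<box> Post A (PArr \<chi> (nil_pr2 n p q) \<cdot> m (p + q)) (a w)"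
      by (simp add: s_def)
    also have "\<dots> = Pre A (l r) (Post A (PArr \<chi> (nil_pr2 n p q)) (b w)) \<box> Post A (m q) (Post A (PArr \<psi> (nil_pr2 n p q)) (a w))"
      unfolding l1(2) by simp
    also have "\<dots> = s (nil_pr2 n p q \<cdot>\<^bsub>nil_op n\<^esub> w)"
      unfolding P.coh_a_pr12[OF c w] Q.coh_a_pr12[OF c' w] by (simp add: s_def)
    finally show "Post A (PArr \<chi> (nil_pr2 n p q)) (s w) = s (nil_pr2 n p q \<cdot>\<^bsub>nil_op n\<^esub> w)" .
  next
    fix g w assume gw [simp]: "g \<in> Arr (nil_op n)" "w \<in> Arr (nil_op n)" "Dom (nil_op n) g = Cod (nil_op n) w"
    let ?p = "Dom (nil_op n) w" and ?q = "Cod (nil_op n) w" and ?r = "Cod (nil_op n) g" and ?gw = "g \<cdot>\<^bsub>nil_op n\<^esub> w"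
    let ?E = "Pre A (PArr \<phi> w) (Post A (m ?r) (a g))"
    \<comment> \<open>The one interchange: the second transformation at \<open>g\<close> passes the
      first one at \<open>w\<close>. The rest is regrouping by the two composition axioms.\<close>
    have i: "Pre A (l ?p) (Pre A (PArr \<psi> w) (b g)) \<box> Post A (m ?r) (Post A (PArr \<psi> g) (a w))
        = Post A (PArr \<chi> g) (Post A (m ?q) (a w)) \<box> Pre A (PArr \<phi> w) (Pre A (l ?q) (b g))"
      using interchange_track[of "a w" "b g"] by simp
    have "s ?gw \<box> Post A (m ?r \<cdot> l ?r) (PComp \<phi> g w)
        = Pre A (l ?p) (b ?gw) \<box> Post A (m ?r) (a ?gw \<box> Post A (l ?r) (PComp \<phi> g w))" by (simp add: s_def)
    also have "\<dots> = Pre A (l ?p) (b ?gw \<box> Post A (m ?r) (PComp \<psi> g w)) \<box> (Post A (m ?r) (Post A (PArr \<psi> g) (a w)) \<box> ?E)"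
      unfolding P.coh_comp[OF c gw] by simp
    also have "\<dots> = Pre A (l ?p) (Pre A (m ?p) (PComp \<chi> g w)) \<box> (Pre A (l ?p) (Post A (PArr \<chi> g) (b w)) \<box>
        ((Pre A (l ?p) (Pre A (PArr \<psi> w) (b g)) \<box> Post A (m ?r) (Post A (PArr \<psi> g) (a w))) \<box> ?E))"
      unfolding Q.coh_comp[OF c' gw] by simp
    also have "\<dots> = Pre A (m ?p \<cdot> l ?p) (PComp \<chi> g w) \<box> (Post A (PArr \<chi> g) (s w) \<box> Pre A (PArr \<phi> w) (s g))"
      unfolding i by (simp add: s_def)
    finally show "s ?gw \<box> Post A (m ?r \<cdot> l ?r) (PComp \<phi> g w)
      = Pre A (m ?p \<cdot> l ?p) (PComp \<chi> g w) \<box> (Post A (PArr \<chi> g) (s w) \<box> Pre A (PArr \<phi> w) (s g))" .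
  qed
  hence "R.coh (NObj (\<beta> \<cdot>\<^bsub>B\<^esub> \<alpha>)) (NArr (\<beta> \<cdot>\<^bsub>B\<^esub> \<alpha>))"
    unfolding R.coh_def e(1) by (auto simp: e2 mem_Hom_iff)
  moreover have "NArr (\<beta> \<cdot>\<^bsub>B\<^esub> \<alpha>) \<in> extensional (Arr (nil_op n))" by (simp add: e)
  ultimately show ?thesis using R.pseudonat_iff[of "\<beta> \<cdot>\<^bsub>B\<^esub> \<alpha>"] by (simp add: Pi_simps \<phi>_def \<chi>_def)
qed

lemma HObjD:
  assumes "H \<in> Trk B"
  shows "HSrc H \<in> Arr B" "HTrg H \<in> Arr B" "NDom (HTrg H) = NDom (HSrc H)" "NCod (HTrg H) = NCod (HSrc H)"
    "pp_pair.hcoh A n (NDom (HSrc H)) (NCod (HSrc H)) (NObj (HSrc H)) (NArr (HSrc H)) (NObj (HTrg H)) (NArr (HTrg H)) (HObj H)"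
proof -
  have h: "pp_homotopy n A H" using assms by (simp add: Pi_simps)
  hence s: "pp_pseudonat n A (HSrc H)" "pp_pseudonat n A (HTrg H)" by (simp_all add: pp_homotopy_def)
  thus a: "HSrc H \<in> Arr B" "HTrg H \<in> Arr B" by (simp_all add: Pi_simps)
  have "pseudo_homotopy (nil_op n) A H" using h by (simp add: pp_homotopy_def)
  thus d: "NDom (HTrg H) = NDom (HSrc H)" "NCod (HTrg H) = NCod (HSrc H)" by (simp_all add: pseudo_homotopy_def)
  show "pp_pair.hcoh A n (NDom (HSrc H)) (NCod (HSrc H)) (NObj (HSrc H)) (NArr (HSrc H)) (NObj (HTrg H)) (NArr (HTrg H)) (HObj H)"
    using pp_pair.homotopy_iff[OF pair_B[OF NObjD(1,2)[OF a(1)]] s refl refl d] h by blast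
qed

lemma hot_simps [simp]:
  assumes "H \<in> Trk B"
  shows "HSrc H \<in> Arr B" "HTrg H \<in> Arr B" "NDom (HTrg H) = NDom (HSrc H)" "NCod (HTrg H) = NCod (HSrc H)"
    "HObj H p \<in> Trk A" "Src A (HObj H p) = NObj (HSrc H) p" "Trg A (HObj H p) = NObj (HTrg H) p"
proof -
  note D = HObjD[OF assms]
  show "HSrc H \<in> Arr B" "HTrg H \<in> Arr B" "NDom (HTrg H) = NDom (HSrc H)" "NCod (HTrg H) = NCod (HSrc H)"
    by (rule D)+
  interpret pp_pair A n "NDom (HSrc H)" "NCod (HSrc H)" HG D Dmap \<sigma> by (rule pair_B) (use D(1) in simp_all)
  show "HObj H p \<in> Trk A" "Src A (HObj H p) = NObj (HSrc H) p" "Trg A (HObj H p) = NObj (HTrg H) p"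
    using D(5) by (simp_all add: hcoh_def mem_Track_iff)
qed

lemma hot_pr:
  assumes "H \<in> Trk B" "k < p"
  shows "Post A (PArr (NCod (HSrc H)) (pr n p k)) (HObj H p) = Pre A (PArr (NDom (HSrc H)) (pr n p k)) (HObj H 1)"
proof -
  note D = HObjD[OF assms(1)]
  show ?thesis
    by (rule pp_pair.hcoh_pr[OF pair_B NObjD(3)[OF D(1)] NObjD(3)[OF D(2), unfolded D(3,4)] D(5) assms(2)])
      (use D(1) in simp_all)
qed

lemma hot_unique:
  assumes "H \<in> Trk B" "K \<in> HomTrk A (PObj (NDom (HSrc H)) p) (PObj (NCod (HSrc H)) p)"
    "\<And>k. k < p \<Longrightarrow> Post A (PArr (NCod (HSrc H)) (pr n p k)) K = Pre A (PArr (NDom (HSrc H)) (pr n p k)) (HObj H 1)"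
  shows "HObj H p = K"
proof -
  note D = HObjD[OF assms(1)]
  show ?thesis
    by (rule pp_pair.hcoh_unique[OF pair_B NObjD(3)[OF D(1)] NObjD(3)[OF D(2), unfolded D(3,4)] D(5) assms(2,3)])
      (use D(1) in simp_all)
qed

lemma hot_eqI:
  assumes "H \<in> Trk B" "K \<in> Trk B" "HSrc H = HSrc K" "HTrg H = HTrg K" "HObj H 1 = HObj K 1"
  shows "H = K"
proof -
  have "HObj H p = HObj K p" for p
    by (rule hot_unique[OF assms(1)]) (use assms(2) hot_pr[OF assms(2)] assms(3,5) in \<open>simp_all add: HomTrk_def mem_Hom_iff\<close>)
  thus ?thesis using assms(3,4) by (simp add: fun_eq_iff)
qed

lemma hot_exists:
  assumes a: "\<alpha> \<in> Arr B" "\<beta> \<in> Arr B" and d: "NDom \<beta> = NDom \<alpha>" "NCod \<beta> = NCod \<alpha>"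
    and h: "h \<in> Track A (NObj \<alpha> 1) (NObj \<beta> 1)"
  obtains H where "H \<in> Trk B" "HSrc H = \<alpha>" "HTrg H = \<beta>" "HObj H 1 = h"
proof -
  interpret pp_pair A n "NDom \<alpha>" "NCod \<alpha>" HG D Dmap \<sigma> by (rule pair_B) (use a in simp_all)
  obtain H where H: "hcoh (NObj \<alpha>) (NArr \<alpha>) (NObj \<beta>) (NArr \<beta>) H" "H 1 = h"
    by (rule hcoh_exists[OF NObjD(3)[OF a(1)] NObjD(3)[OF a(2), unfolded d] h])
  let ?H = "\<lparr>HSrc = \<alpha>, HTrg = \<beta>, HObj = H\<rparr>"
  have "pp_homotopy n A ?H" using homotopy_iff[of ?H] a d H(1) by (simp add: Pi_simps)
  thus ?thesis using H(2) by (intro that[of ?H]) (simp_all add: Pi_simps)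
qed

text \<open>The homotopy lifted from the component at 1 has the same coordinates as \<open>K\<close>
  at every level, so it equals the given family; naturality of \<open>K\<close> follows from
  this.\<close>

lemma hotI:
  assumes a: "\<alpha> \<in> Arr B" "\<beta> \<in> Arr B" and d: "NDom \<beta> = NDom \<alpha>" "NCod \<beta> = NCod \<alpha>"
    and K: "\<And>p. K p \<in> Track A (NObj \<alpha> p) (NObj \<beta> p)"
    "\<And>p k. k < p \<Longrightarrow> Post A (PArr (NCod \<alpha>) (pr n p k)) (K p) = Pre A (PArr (NDom \<alpha>) (pr n p k)) (K 1)"
  shows "\<lparr>HSrc = \<alpha>, HTrg = \<beta>, HObj = K\<rparr> \<in> Trk B"
proof -
  obtain H where H: "H \<in> Trk B" "HSrc H = \<alpha>" "HTrg H = \<beta>" "HObj H 1 = K 1"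
    by (rule hot_exists[OF a d K(1)])
  have "HObj H p = K p" for p
    by (rule hot_unique[OF H(1)]) (use K(1)[of p] K(2)[of _ p] H a in \<open>simp_all add: mem_Track_iff HomTrk_def mem_Hom_iff\<close>)
  hence "H = \<lparr>HSrc = \<alpha>, HTrg = \<beta>, HObj = K\<rparr>" using H by (cases H) (simp add: fun_eq_iff)
  thus ?thesis using H(1) by simp
qed

text \<open>Brings the track operations of \<open>B\<close> into the shape of
  \<open>hotI\<close>.\<close>

lemma hot_mem:
  "H \<in> Trk B \<longleftrightarrow> \<lparr>HSrc = HSrc H, HTrg = HTrg H, HObj = HObj H\<rparr> \<in> Trk B"
  by (cases H) simp

lemma PArr_pr_simps [simp]:
  assumes "\<phi> \<in> Obj B" "k < p"
  shows "PArr \<phi> (pr n p k) \<in> Arr A" "Dom A (PArr \<phi> (pr n p k)) = PObj \<phi> p" "Cod A (PArr \<phi> (pr n p k)) = PObj \<phi> 1"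
proof -
  interpret pp_pair A n \<phi> \<phi> HG D Dmap \<sigma> by (rule pair_B[OF assms(1,1)])
  show "PArr \<phi> (pr n p k) \<in> Arr A" "Dom A (PArr \<phi> (pr n p k)) = PObj \<phi> p" "Cod A (PArr \<phi> (pr n p k)) = PObj \<phi> 1"
    using assms(2) by simp_all
qed

lemma IdT_B [simp]: "\<alpha> \<in> Arr B \<Longrightarrow> IdT B \<alpha> \<in> Trk B"
  unfolding hot_mem[of "IdT B \<alpha>"] by (rule hotI) (simp_all add: mem_Track_iff nat_pr)

lemma VComp_B [simp]:
  assumes "H \<in> Trk B" "K \<in> Trk B" "HSrc K = HTrg H" shows "K \<box>\<^bsub>B\<^esub> H \<in> Trk B"
  unfolding hot_mem[of "K \<box>\<^bsub>B\<^esub> H"]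
proof (rule hotI)
  fix p k :: nat assume k: "k < p"
  show "Post A (PArr (NCod (HSrc (K \<box>\<^bsub>B\<^esub> H))) (pr n p k)) (HObj (K \<box>\<^bsub>B\<^esub> H) p)
    = Pre A (PArr (NDom (HSrc (K \<box>\<^bsub>B\<^esub> H))) (pr n p k)) (HObj (K \<box>\<^bsub>B\<^esub> H) 1)"
    using assms k hot_pr[OF assms(1) k] hot_pr[OF assms(2) k] by simp
qed (use assms hot_simps(3,4)[OF assms(2)] in \<open>simp_all add: mem_Track_iff\<close>)

lemma InvT_B [simp]:
  assumes "H \<in> Trk B" shows "InvT B H \<in> Trk B"
  unfolding hot_mem[of "InvT B H"]
proof (rule hotI)
  fix p k :: nat assume k: "k < p"
  show "Post A (PArr (NCod (HSrc (InvT B H))) (pr n p k)) (HObj (InvT B H) p)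
    = Pre A (PArr (NDom (HSrc (InvT B H))) (pr n p k)) (HObj (InvT B H) 1)"
    using assms k hot_pr[OF assms k] by simp
qed (use assms in \<open>simp_all add: mem_Track_iff\<close>)

lemma Post_B [simp]:
  assumes "H \<in> Trk B" "\<beta> \<in> Arr B" "NDom \<beta> = NCod (HSrc H)" shows "Post B \<beta> H \<in> Trk B"
  unfolding hot_mem[of "Post B \<beta> H"]
proof (rule hotI)
  fix p k :: nat assume k: "k < p"
  have "Post A (PArr (NCod \<beta>) (pr n p k)) (Post A (NObj \<beta> p) (HObj H p))
      = Post A (PArr (NCod \<beta>) (pr n p k) \<cdot> NObj \<beta> p) (HObj H p)"
    using assms k by simp
  also have "\<dots> = Post A (NObj \<beta> 1) (Post A (PArr (NCod (HSrc H)) (pr n p k)) (HObj H p))"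
    unfolding nat_pr[OF assms(2) k] using assms k by simp
  also have "\<dots> = Pre A (PArr (NDom (HSrc H)) (pr n p k)) (Post A (NObj \<beta> 1) (HObj H 1))"
    unfolding hot_pr[OF assms(1) k] using assms k by simp
  finally show "Post A (PArr (NCod (HSrc (Post B \<beta> H))) (pr n p k)) (HObj (Post B \<beta> H) p)
    = Pre A (PArr (NDom (HSrc (Post B \<beta> H))) (pr n p k)) (HObj (Post B \<beta> H) 1)" by simp
qed (use assms in \<open>simp_all add: mem_Track_iff\<close>)

lemma Pre_B [simp]:
  assumes "H \<in> Trk B" "\<beta> \<in> Arr B" "NCod \<beta> = NDom (HSrc H)" shows "Pre B \<beta> H \<in> Trk B"
  unfolding hot_mem[of "Pre B \<beta> H"]
proof (rule hotI)
  fix p k :: nat assume k: "k < p"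
  have "Post A (PArr (NCod (HSrc H)) (pr n p k)) (Pre A (NObj \<beta> p) (HObj H p))
      = Pre A (NObj \<beta> p) (Post A (PArr (NCod (HSrc H)) (pr n p k)) (HObj H p))"
    using assms k by simp
  also have "\<dots> = Pre A (PArr (NCod \<beta>) (pr n p k) \<cdot> NObj \<beta> p) (HObj H 1)"
    unfolding hot_pr[OF assms(1) k] using assms k by simp
  also have "\<dots> = Pre A (PArr (NDom \<beta>) (pr n p k)) (Pre A (NObj \<beta> 1) (HObj H 1))"
    unfolding nat_pr[OF assms(2) k] using assms k by simp
  finally show "Post A (PArr (NCod (HSrc (Pre B \<beta> H))) (pr n p k)) (HObj (Pre B \<beta> H) p)
    = Pre A (PArr (NDom (HSrc (Pre B \<beta> H))) (pr n p k)) (HObj (Pre B \<beta> H) 1)" by simp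
qed (use assms in \<open>simp_all add: mem_Track_iff\<close>)

text \<open>Since evaluation at 1 is faithful, each law is inherited from \<open>A\<close>.\<close>

lemma category_B: "category B"
proof
  fix f W X g Y h Z
  assume "f \<in> Hom B W X" "g \<in> Hom B X Y" "h \<in> Hom B Y Z"
  thus "h \<cdot>\<^bsub>B\<^esub> g \<cdot>\<^bsub>B\<^esub> f = h \<cdot>\<^bsub>B\<^esub> (g \<cdot>\<^bsub>B\<^esub> f)"
    by (intro nat_eqI) (auto simp: mem_Hom_iff)
next
  fix f X Y assume f: "f \<in> Hom B X Y"
  show "f \<cdot>\<^bsub>B\<^esub> Ident B X = f" by (rule nat_eqI) (use f in \<open>auto simp: mem_Hom_iff\<close>)
  show "Ident B Y \<cdot>\<^bsub>B\<^esub> f = f" by (rule nat_eqI) (use f in \<open>auto simp: mem_Hom_iff\<close>)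
qed (auto simp: mem_Hom_iff)

interpretation B: category B by (rule category_B)

lemma track_category_B: "track_category B"
proof
  fix f X Y \<eta> f' g Z \<theta> g'
  assume "f \<in> Hom B X Y" "\<eta> \<in> Track B f f'" "g \<in> Hom B Y Z" "\<theta> \<in> Track B g g'"
  thus "Post B g' \<eta> \<box>\<^bsub>B\<^esub> Pre B f \<theta> = Pre B f' \<theta> \<box>\<^bsub>B\<^esub> Post B g \<eta>"
    using interchange_track[of "HObj \<eta> 1" "HObj \<theta> 1"]
    by (intro hot_eqI) (auto simp: mem_Hom_iff mem_Track_iff)
qed (auto simp: mem_Hom_iff mem_Track_iff HomTrk_def intro!: hot_eqI)

interpretation B: track_category B by (rule track_category_B)

lemma ev_simps:
  "G \<in> Obj B \<Longrightarrow> FObj (ev n A) G = PObj G 1"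
  "\<alpha> \<in> Arr B \<Longrightarrow> FArr (ev n A) \<alpha> = NObj \<alpha> 1"
  "H \<in> Trk B \<Longrightarrow> FTrk (ev n A) H = HObj H 1"
  by (simp_all add: ev_def)

lemma ev_track_functor: "track_functor B A (ev n A)"
proof
  show "FObj (ev n A) \<in> extensional (Obj B)" "FArr (ev n A) \<in> extensional (Arr B)"
    "FTrk (ev n A) \<in> extensional (Trk B)" by (simp_all add: ev_def)
qed (auto simp: mem_Hom_iff mem_Track_iff HomTrk_def ev_simps)

section \<open>The section of evaluation determined by a choice of weak groups\<close>

context
  fixes F :: "'o \<Rightarrow> (nat, nil_arr, 'o, 'm, 't) pseudofun"
  assumes F: "\<And>X. X \<in> Obj A \<Longrightarrow> weak_nil_group n A X (F X)"
begin

lemma F_simps [simp]: "X \<in> Obj A \<Longrightarrow> F X \<in> Obj B" "X \<in> Obj A \<Longrightarrow> PObj (F X) 1 = X"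
  using F by (simp_all add: weak_nil_group_def)

definition liftA where
  "liftA f = (THE \<alpha>. \<alpha> \<in> Arr B \<and> NDom \<alpha> = F (Dom A f) \<and> NCod \<alpha> = F (Cod A f) \<and> NObj \<alpha> 1 = f)"

lemma liftA:
  assumes "f \<in> Arr A"
  shows "liftA f \<in> Arr B" "NDom (liftA f) = F (Dom A f)" "NCod (liftA f) = F (Cod A f)" "NObj (liftA f) 1 = f"
proof -
  obtain \<alpha> where "\<alpha> \<in> Arr B" "NDom \<alpha> = F (Dom A f)" "NCod \<alpha> = F (Cod A f)" "NObj \<alpha> 1 = f"
    by (rule nat_exists[of "F (Dom A f)" "F (Cod A f)" f]) (use assms in \<open>auto simp: mem_Hom_iff\<close>)
  hence "\<exists>!\<alpha>. \<alpha> \<in> Arr B \<and> NDom \<alpha> = F (Dom A f) \<and> NCod \<alpha> = F (Cod A f) \<and> NObj \<alpha> 1 = f"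
    by (intro ex1I[of _ \<alpha>]) (auto intro: nat_eqI)
  from theI'[OF this] show "liftA f \<in> Arr B" "NDom (liftA f) = F (Dom A f)" "NCod (liftA f) = F (Cod A f)"
    "NObj (liftA f) 1 = f" unfolding liftA_def by blast+
qed

lemmas liftA_simps [simp] = liftA

definition liftT where
  "liftT \<eta> = (THE H. H \<in> Trk B \<and> HSrc H = liftA (Src A \<eta>) \<and> HTrg H = liftA (Trg A \<eta>) \<and> HObj H 1 = \<eta>)"

lemma liftT [simp]:
  assumes "\<eta> \<in> Trk A"
  shows "liftT \<eta> \<in> Trk B" "HSrc (liftT \<eta>) = liftA (Src A \<eta>)" "HTrg (liftT \<eta>) = liftA (Trg A \<eta>)" "HObj (liftT \<eta>) 1 = \<eta>"
proof -
  obtain H where "H \<in> Trk B" "HSrc H = liftA (Src A \<eta>)" "HTrg H = liftA (Trg A \<eta>)" "HObj H 1 = \<eta>"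
    by (rule hot_exists[of "liftA (Src A \<eta>)" "liftA (Trg A \<eta>)" \<eta>]) (use assms in \<open>auto simp: mem_Track_iff\<close>)
  hence "\<exists>!H. H \<in> Trk B \<and> HSrc H = liftA (Src A \<eta>) \<and> HTrg H = liftA (Trg A \<eta>) \<and> HObj H 1 = \<eta>"
    by (intro ex1I[of _ H]) (auto intro: hot_eqI)
  from theI'[OF this] show "liftT \<eta> \<in> Trk B" "HSrc (liftT \<eta>) = liftA (Src A \<eta>)"
    "HTrg (liftT \<eta>) = liftA (Trg A \<eta>)" "HObj (liftT \<eta>) 1 = \<eta>" unfolding liftT_def by blast+
qed

definition T where "T = \<lparr>FObj = restrict F (Obj A), FArr = restrict liftA (Arr A), FTrk = restrict liftT (Trk A)\<rparr>"

lemma T_simps [simp]: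
  "X \<in> Obj A \<Longrightarrow> FObj T X = F X" "f \<in> Arr A \<Longrightarrow> FArr T f = liftA f" "\<eta> \<in> Trk A \<Longrightarrow> FTrk T \<eta> = liftT \<eta>"
  by (simp_all add: T_def)

text \<open>In each law both sides have the same ends and the same component at 1, which determines
  them.\<close>

lemma T_track_functor: "track_functor A B T"
proof
  show "FObj T \<in> extensional (Obj A)" "FArr T \<in> extensional (Arr A)" "FTrk T \<in> extensional (Trk A)"
    by (simp_all add: T_def)
qed (auto simp: mem_Hom_iff mem_Track_iff HomTrk_def intro!: hot_eqI nat_eqI)

lemma ev_T: "tfun_comp A (ev n A) T = tfun_id A"
  by (simp add: tfun_comp_def tfun_id_def compose_def ev_simps cong: restrict_cong)

lemma T_extends: "extends_to n A F T"
  by (simp add: extends_to_def T_track_functor ev_T)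

text \<open>The value of such a functor on a map or a track has its ends prescribed by
  \<open>F\<close> and its component at 1 by the section property, hence is the lift.\<close>

lemma extends_unique:
  assumes S: "extends_to n A F S" shows "S = T"
proof -
  interpret S: track_functor A B S using S by (simp add: extends_to_def)
  have o: "FObj S X = F X" if "X \<in> Obj A" for X using S that by (simp add: extends_to_def)
  have e: "tfun_comp A (ev n A) S = tfun_id A" using S by (simp add: extends_to_def)
  have a: "FArr S f \<in> Arr B" "NDom (FArr S f) = F (Dom A f)" "NCod (FArr S f) = F (Cod A f)" "NObj (FArr S f) 1 = f"
    if f: "f \<in> Arr A" for f
  proof -
    have h: "FArr S f \<in> Hom B (FObj S (Dom A f)) (FObj S (Cod A f))" by (rule S.on_Hom) (use f in \<open>simp add: mem_Hom_iff\<close>)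
    thus "FArr S f \<in> Arr B" "NDom (FArr S f) = F (Dom A f)" "NCod (FArr S f) = F (Cod A f)"
      using f o by (simp_all add: mem_Hom_iff)
    have "compose (Arr A) (FArr (ev n A)) (FArr S) f = (\<lambda>f \<in> Arr A. f) f"
      using e by (simp add: tfun_comp_def tfun_id_def)
    thus "NObj (FArr S f) 1 = f" using f h by (simp add: compose_def ev_simps mem_Hom_iff)
  qed
  have A: "FArr S f = FArr T f" if "f \<in> Arr A" for f
    by (rule nat_eqI) (use a[OF that] that in simp_all)
  have T: "FTrk S \<eta> = FTrk T \<eta>" if \<eta>: "\<eta> \<in> Trk A" for \<eta>
  proof (rule hot_eqI)
    have h: "FTrk S \<eta> \<in> Track B (FArr S (Src A \<eta>)) (FArr S (Trg A \<eta>))"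
      by (rule S.on_Track) (use \<eta> in \<open>simp add: mem_Track_iff\<close>)
    thus "FTrk S \<eta> \<in> Trk B" "HSrc (FTrk S \<eta>) = HSrc (FTrk T \<eta>)" "HTrg (FTrk S \<eta>) = HTrg (FTrk T \<eta>)"
      using \<eta> A by (simp_all add: mem_Track_iff)
    have "compose (Trk A) (FTrk (ev n A)) (FTrk S) \<eta> = (\<lambda>f \<in> Trk A. f) \<eta>"
      using e by (simp add: tfun_comp_def tfun_id_def)
    thus "HObj (FTrk S \<eta>) 1 = HObj (FTrk T \<eta>) 1" using \<eta> h by (simp add: compose_def ev_simps mem_Track_iff)
  qed (use \<eta> in simp)
  have "FObj S = FObj T" by (rule extensionalityI[of _ "Obj A"]) (use S.ext o in \<open>simp_all add: T_def\<close>)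
  moreover have "FArr S = FArr T" by (rule extensionalityI[of _ "Arr A"]) (use S.ext A in \<open>simp_all add: T_def\<close>)
  moreover have "FTrk S = FTrk T" by (rule extensionalityI[of _ "Trk A"]) (use S.ext T in \<open>simp_all add: T_def\<close>)
  ultimately show ?thesis by simp
qed

text \<open>\<open>G\<close> and the chosen structure are two weak group structures on one object.
  Its identity lifts in both directions, and the lifts are inverse to each other by
  faithfulness.\<close>

lemma counit_exists:
  assumes "G \<in> Obj B"
  shows "\<exists>\<alpha>. \<alpha> \<in> Arr B \<and> NDom \<alpha> = F (PObj G 1) \<and> NCod \<alpha> = G \<and> NObj \<alpha> 1 = Ident A (PObj G 1) \<and> is_isomorphism B \<alpha>"
proof -
  let ?X = "PObj G 1"
  obtain \<alpha> where \<alpha>: "\<alpha> \<in> Arr B" "NDom \<alpha> = F ?X" "NCod \<alpha> = G" "NObj \<alpha> 1 = Ident A ?X"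
    by (rule nat_exists[of "F ?X" G "Ident A ?X"]) (use assms in \<open>auto simp: mem_Hom_iff\<close>)
  obtain \<beta> where \<beta>: "\<beta> \<in> Arr B" "NDom \<beta> = G" "NCod \<beta> = F ?X" "NObj \<beta> 1 = Ident A ?X"
    by (rule nat_exists[of G "F ?X" "Ident A ?X"]) (use assms in \<open>auto simp: mem_Hom_iff\<close>)
  have "\<beta> \<cdot>\<^bsub>B\<^esub> \<alpha> = Ident B (F ?X)" "\<alpha> \<cdot>\<^bsub>B\<^esub> \<beta> = Ident B G"
    by (rule nat_eqI; use \<alpha> \<beta> assms in simp)+
  hence "is_isomorphism B \<alpha>" using \<alpha> \<beta> by (auto simp: is_isomorphism_def mem_Hom_iff)
  thus ?thesis using \<alpha> by blast
qed

text \<open>One composite is the identity itself. For the other the lifted identities are strictly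
  natural, because both sides of each square have the same component at 1.\<close>

lemma T_equivalence: "two_equivalence A B T (ev n A)"
  unfolding two_equivalence_def
proof (intro conjI T_track_functor ev_track_functor)
  have "is_isomorphism A (Ident A X)" if "X \<in> Obj A" for X
    using that by (auto simp: is_isomorphism_def mem_Hom_iff intro!: bexI[of _ "Ident A X"])
  thus "\<exists>c. two_natural_iso A A (tfun_comp A (ev n A) T) (tfun_id A) c"
    unfolding ev_T by (intro exI[of _ "Ident A"]) (auto simp: two_natural_iso_def tfun_id_def mem_Hom_iff HomTrk_def)
  obtain d where d: "\<And>G. G \<in> Obj B \<Longrightarrow> d G \<in> Arr B \<and> NDom (d G) = F (PObj G 1) \<and> NCod (d G) = G
    \<and> NObj (d G) 1 = Ident A (PObj G 1) \<and> is_isomorphism B (d G)"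
    using counit_exists by metis
  have c: "FObj (tfun_comp B T (ev n A)) G = F (PObj G 1)" if "G \<in> Obj B" for G
    using that by (simp add: tfun_comp_def compose_def ev_simps)
  have c': "FArr (tfun_comp B T (ev n A)) \<alpha> = liftA (NObj \<alpha> 1)" if "\<alpha> \<in> Arr B" for \<alpha>
    using that by (simp add: tfun_comp_def compose_def ev_simps)
  have c'': "FTrk (tfun_comp B T (ev n A)) H = liftT (HObj H 1)" if "H \<in> Trk B" for H
    using that by (simp add: tfun_comp_def compose_def ev_simps)
  have "two_natural_iso B B (tfun_comp B T (ev n A)) (tfun_id B) d"
    unfolding two_natural_iso_def
  proof (intro conjI ballI)
    fix X assume X: "X \<in> Obj B"
    show "d X \<in> Hom B (FObj (tfun_comp B T (ev n A)) X) (FObj (tfun_id B) X)" "is_isomorphism B (d X)"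
      using d[OF X] X c by (simp_all add: tfun_id_def mem_Hom_iff)
    fix Y assume Y: "Y \<in> Obj B"
    show "FArr (tfun_id B) f \<cdot>\<^bsub>B\<^esub> d X = d Y \<cdot>\<^bsub>B\<^esub> FArr (tfun_comp B T (ev n A)) f" if f: "f \<in> Hom B X Y" for f
      by (rule nat_eqI) (use d[OF X] d[OF Y] f in \<open>auto simp: c' tfun_id_def mem_Hom_iff\<close>)
    show "Pre B (d X) (FTrk (tfun_id B) \<eta>) = Post B (d Y) (FTrk (tfun_comp B T (ev n A)) \<eta>)" if \<eta>: "\<eta> \<in> HomTrk B X Y" for \<eta>
    proof -
      have \<eta>' : "\<eta> \<in> Trk B" "NDom (HSrc \<eta>) = X" "NCod (HSrc \<eta>) = Y" using \<eta> by (auto simp: HomTrk_def mem_Hom_iff)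
      \<comment> \<open>Two homotopies can be compared at 1 only when their source and target
        transformations agree; this supplies both ends.\<close>
      have n: "\<alpha> \<cdot>\<^bsub>B\<^esub> d X = d Y \<cdot>\<^bsub>B\<^esub> liftA (NObj \<alpha> 1)" if "\<alpha> \<in> Arr B" "NDom \<alpha> = X" "NCod \<alpha> = Y" for \<alpha>
        by (rule nat_eqI) (use d[OF X] d[OF Y] that in auto)
      show ?thesis
        by (rule hot_eqI) (use d[OF X] d[OF Y] \<eta>' n[of "HSrc \<eta>"] n[of "HTrg \<eta>"] in \<open>auto simp: c'' tfun_id_def\<close>)
    qed
  qed
  thus "\<exists>d. two_natural_iso B B (tfun_comp B T (ev n A)) (tfun_id B) d" by blast
qed

end

end

theorem theorem6p3:
  fixes A :: "('o, 'm, 't) track_cat_prod"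
    and HG :: "'o \<Rightarrow> 'o \<Rightarrow> 'm set monoid"
    and D :: "'o \<Rightarrow> 'o \<Rightarrow> 'd monoid"
    and Dmap :: "'m set \<Rightarrow> 'm set \<Rightarrow> 'd \<Rightarrow> 'd"
    and \<sigma> :: "'m \<Rightarrow> 'd \<Rightarrow> 't"
    and n :: enat
    and F :: "'o \<Rightarrow> (nat, nil_arr, 'o, 'm, 't) pseudofun"
  assumes "additive_track_category A HG D Dmap \<sigma>"
    and "strict_products A"
    and "2 \<le> n"
    and "\<And>X. X \<in> Obj A \<Longrightarrow> weak_nil_group n A X (F X)"
  shows "(\<exists>!T. extends_to n A F T) \<and>
         (\<forall>T. extends_to n A F T \<longrightarrow> two_equivalence A (PseudoPi n A) T (ev n A))"
proof -
  interpret additive_track_category A HG D Dmap \<sigma> by (rule assms(1))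
  have "1 \<le> n" using assms(3) by (rule order_trans[rotated]) (simp add: one_le_numeral)
  then interpret pseudo_setting A HG D Dmap \<sigma> n
    by unfold_locales (use assms(2) zero in auto)
  have T: "extends_to n A F (T F)" by (rule T_extends) (rule assms(4))
  have u: "S = T F" if "extends_to n A F S" for S by (rule extends_unique[OF assms(4) that])
  have e: "two_equivalence A (PseudoPi n A) (T F) (ev n A)" by (rule T_equivalence) (rule assms(4))
  show ?thesis using T u e by blast
qed

end
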